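(* Let $(A,\mathfrak m)$ be a Cohen-Macaulay local ring with $d=\dim A>0$ and $I$ a canonical ideal of $A$. Let $n\ge1$ be an integer, let $Q$ be a parameter ideal of $A$ which satisfies the condition $(\sharp)$ with respect to $I$, and set $J=I+Q$. Suppose that $A$ is an $n$-Goto ring with respect to $Q$. Then the Hilbert function of $A$ with respect to $J$ is given by $$\ell_A(A/J^{\ell+1})=\mathrm e_0(J)\binom{\ell+d}{d}-\big[\mathrm e_0(J)-\ell_A(A/J)+n\big]\binom{\ell+d-1}{d-1}+n\binom{\ell+d-2}{d-2}$$ for all $\ell\ge0$. Hence $\mathrm e_2(J)=n$ if $d\ge2$, and $\mathrm e_i(J)=0$ for all $3\le i\le d$ if $d\ge3$.
   Context: A canonical ideal of $A$ is an ideal $I\ne A$ isomorphic as an $A$-module to the canonical module $\mathrm K_A$. A parameter ideal $Q=(a_1,\ldots,a_d)$ (generated by a system of parameters) satisfies $(\sharp)$ with respect to $I$ if $a_1\in I$ and $Q$ is a reduction of $J=I+Q$, i.e. $J^{r+1}=QJ^r$ for some $r\ge0$. The Hilbert coefficients $\mathrm e_i(J)$ are defined by $\ell_A(A/J^{m+1})=\sum_{i=0}^d(-1)^i\mathrm e_i(J)\binom{m+d-i}{d-i}$ for $m\gg0$. For $d=1$, the symbol $\binom{\ell+d-2}{d-2}=\binom{\ell-1}{-1}$ means $1$ if $\ell=0$ and $0$ if $\ell\ge1$. With $t$ an indeterminate, $\mathcal T=A[Qt]$, the Sally module is $\mathcal S_Q(J)=JA[Jt]/J\mathcal T\cong\bigoplus_{i\ge1}J^{i+1}/JQ^i$,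 graded with $[\mathcal S_Q(J)]_i=J^{i+1}/JQ^i$; $\operatorname{rank}\mathcal S_Q(J)=\ell_{\mathcal T_{\mathfrak p}}([\mathcal S_Q(J)]_{\mathfrak p})$ with $\mathfrak p=\mathfrak m\mathcal T$. $A$ is an $n$-Goto ring with respect to $Q$ if $\mathcal S_Q(J)=\mathcal T[\mathcal S_Q(J)]_1$ and $\operatorname{rank}\mathcal S_Q(J)=n$; equivalently, $J^3=QJ^2$ and $\ell_A(J^2/QJ)=n$. *)

theory Defs
  imports "HOL-Library.Extended_Nat" "HOL-Algebra.Ring_Divisibility" "HOL-Algebra.Ideal_Product"
    "HOL-Algebra.UnivPoly"
begin

section \<open>Modules\<close>

text \<open>Modules are \<open>module\<close> records of HOL-Algebra. The inherited fields \<open>mult\<close> and \<open>one\<close> play no role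
  for a module (the locale \<open>module\<close> ignores them), so they are left \<open>undefined\<close> below.\<close>

definition ring_module :: "('a, 'm) ring_scheme \<Rightarrow> ('a, 'a) module" where
  "ring_module R = \<lparr>carrier = carrier R, mult = mult R, one = one R, zero = zero R, add = add R,
     smult = mult R\<rparr>"

definition quot_module :: "('r, 'b, 'm) module_scheme \<Rightarrow> 'b set \<Rightarrow> ('r, 'b set) module" where
  "quot_module M N = \<lparr>carrier = a_rcosets\<^bsub>M\<^esub> N, mult = undefined, one = undefined, zero = N,
     add = set_add M, smult = (\<lambda>r X. \<Union>x\<in>X. N +>\<^bsub>M\<^esub> (r \<odot>\<^bsub>M\<^esub> x))\<rparr>"

definition submod_span ::
  "('r, 'k) ring_scheme \<Rightarrow> ('r, 'b, 'm) module_scheme \<Rightarrow> 'b set \<Rightarrow> 'b set" where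
  "submod_span R M X = \<Inter>{N. submodule N R M \<and> X \<subseteq> N}"

definition fin_gen :: "('r, 'k) ring_scheme \<Rightarrow> ('r, 'b, 'm) module_scheme \<Rightarrow> bool" where
  "fin_gen R M \<longleftrightarrow> (\<exists>X\<subseteq>carrier M. finite X \<and> submod_span R M X = carrier M)"

definition module_length :: "('r, 'k) ring_scheme \<Rightarrow> ('r, 'b, 'm) module_scheme \<Rightarrow> enat" where
  "module_length R M = Sup {enat n |n. \<exists>N :: nat \<Rightarrow> 'b set.
     (\<forall>i\<le>n. submodule (N i) R M) \<and> (\<forall>i<n. N i \<subset> N (Suc i))}"

definition mod_hom ::
  "('r, 'k) ring_scheme \<Rightarrow> ('r, 'b, 'm) module_scheme \<Rightarrow> ('r, 'c, 'n) module_scheme \<Rightarrow> ('b \<Rightarrow> 'c) set"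
  where
  "mod_hom R M N = {f \<in> carrier M \<rightarrow>\<^sub>E carrier N.
     (\<forall>x\<in>carrier M. \<forall>y\<in>carrier M. f (x \<oplus>\<^bsub>M\<^esub> y) = f x \<oplus>\<^bsub>N\<^esub> f y) \<and>
     (\<forall>r\<in>carrier R. \<forall>x\<in>carrier M. f (r \<odot>\<^bsub>M\<^esub> x) = r \<odot>\<^bsub>N\<^esub> f x)}"

definition mod_isomorphic ::
  "('r, 'k) ring_scheme \<Rightarrow> ('r, 'b, 'm) module_scheme \<Rightarrow> ('r, 'c, 'n) module_scheme \<Rightarrow> bool" where
  "mod_isomorphic R M N \<longleftrightarrow> (\<exists>f\<in>mod_hom R M N. bij_betw f (carrier M) (carrier N))"

definition hom_module ::
  "('r, 'k) ring_scheme \<Rightarrow> ('r, 'b, 'm) module_scheme \<Rightarrow> ('r, 'c, 'n) module_scheme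
     \<Rightarrow> ('r, 'b \<Rightarrow> 'c) module" where
  "hom_module R M N = \<lparr>carrier = mod_hom R M N, mult = undefined, one = undefined,
     zero = (\<lambda>x\<in>carrier M. \<zero>\<^bsub>N\<^esub>), add = (\<lambda>f g. \<lambda>x\<in>carrier M. f x \<oplus>\<^bsub>N\<^esub> g x),
     smult = (\<lambda>r f. \<lambda>x\<in>carrier M. r \<odot>\<^bsub>N\<^esub> f x)\<rparr>"

definition free_module :: "('r, 'k) ring_scheme \<Rightarrow> nat \<Rightarrow> ('r, nat \<Rightarrow> 'r) module" where
  "free_module R n = \<lparr>carrier = {..<n} \<rightarrow>\<^sub>E carrier R, mult = undefined, one = undefined,
     zero = (\<lambda>j\<in>{..<n}. \<zero>\<^bsub>R\<^esub>), add = (\<lambda>v w. \<lambda>j\<in>{..<n}. v j \<oplus>\<^bsub>R\<^esub> w j),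
     smult = (\<lambda>r v. \<lambda>j\<in>{..<n}. r \<otimes>\<^bsub>R\<^esub> v j)\<rparr>"


section \<open>Ext over a Noetherian ring\<close>

text \<open>Over a Noetherian ring every finitely generated module has a resolution by free modules of
  finite rank, so Ext can be computed from such a resolution:
  \<open>\<dots> \<rightarrow> R^(b 2) \<rightarrow> R^(b 1) \<rightarrow> R^(b 0) \<rightarrow> N \<rightarrow> 0\<close>, with \<open>d i : R^(b (i+1)) \<rightarrow> R^(b i)\<close>.\<close>

definition free_resolution ::
  "('r, 'k) ring_scheme \<Rightarrow> ('r, 'b, 'm) module_scheme \<Rightarrow> (nat \<Rightarrow> nat)
     \<Rightarrow> (nat \<Rightarrow> (nat \<Rightarrow> 'r) \<Rightarrow> (nat \<Rightarrow> 'r)) \<Rightarrow> ((nat \<Rightarrow> 'r) \<Rightarrow> 'b) \<Rightarrow> bool" where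
  "free_resolution R N b d \<epsilon> \<longleftrightarrow>
     (let F = (\<lambda>i. free_module R (b i)) in
       \<epsilon> \<in> mod_hom R (F 0) N \<and> (\<forall>i. d i \<in> mod_hom R (F (Suc i)) (F i)) \<and>
       \<epsilon> ` carrier (F 0) = carrier N \<and>
       d 0 ` carrier (F 1) = {v \<in> carrier (F 0). \<epsilon> v = \<zero>\<^bsub>N\<^esub>} \<and>
       (\<forall>i. d (Suc i) ` carrier (F (Suc (Suc i))) =
              {v \<in> carrier (F (Suc i)). d i v = \<zero>\<^bsub>F i\<^esub>}))"

definition ext_of_resolution ::
  "('r, 'k) ring_scheme \<Rightarrow> (nat \<Rightarrow> nat) \<Rightarrow> (nat \<Rightarrow> (nat \<Rightarrow> 'r) \<Rightarrow> (nat \<Rightarrow> 'r))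
     \<Rightarrow> ('r, 'c, 'n) module_scheme \<Rightarrow> nat \<Rightarrow> ('r, ((nat \<Rightarrow> 'r) \<Rightarrow> 'c) set) module" where
  "ext_of_resolution R b d M i =
     (let F = (\<lambda>j. free_module R (b j));
          H = (\<lambda>j. hom_module R (F j) M);
          \<delta> = (\<lambda>j f. compose (carrier (F (Suc j))) f (d j));
          Z = {f \<in> carrier (H i). \<delta> i f = \<zero>\<^bsub>H (Suc i)\<^esub>};
          B = (case i of 0 \<Rightarrow> {\<zero>\<^bsub>H 0\<^esub>} | Suc j \<Rightarrow> \<delta> j ` carrier (H j))
      in quot_module ((H i)\<lparr>carrier := Z\<rparr>) B)"

definition ext_module ::
  "('r, 'k) ring_scheme \<Rightarrow> ('r, 'b, 'm) module_scheme \<Rightarrow> ('r, 'c, 'n) module_scheme \<Rightarrow> nat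
     \<Rightarrow> ('r, ((nat \<Rightarrow> 'r) \<Rightarrow> 'c) set) module" where
  "ext_module R N M i =
     (let (b, d) = (SOME (b, d). \<exists>\<epsilon>. free_resolution R N b d \<epsilon>) in ext_of_resolution R b d M i)"


section \<open>Cohen--Macaulay local rings and canonical modules\<close>

definition krull_dim :: "('a, 'k) ring_scheme \<Rightarrow> enat" where
  "krull_dim R = Sup {enat n |n. \<exists>P :: nat \<Rightarrow> 'a set.
     (\<forall>i\<le>n. primeideal (P i) R) \<and> (\<forall>i<n. P i \<subset> P (Suc i))}"

definition noetherian_local :: "('a, 'k) ring_scheme \<Rightarrow> 'a set \<Rightarrow> bool" where
  "noetherian_local A \<mm> \<longleftrightarrow> cring A \<and> noetherian_ring A \<and> maximalideal \<mm> A \<and>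
     (\<forall>\<nn>. maximalideal \<nn> A \<longrightarrow> \<nn> = \<mm>)"

definition seq_mult ::
  "('a, 'k) ring_scheme \<Rightarrow> ('a, 'b, 'm) module_scheme \<Rightarrow> 'a list \<Rightarrow> 'b set" where
  "seq_mult A M xs = submod_span A M {x \<odot>\<^bsub>M\<^esub> y |x y. x \<in> set xs \<and> y \<in> carrier M}"

text \<open>The first condition says that \<open>xs ! i\<close> is a nonzerodivisor on
  \<open>M / (xs ! 0, \<dots>, xs ! (i - 1)) M\<close>.\<close>

definition regular_seq ::
  "('a, 'k) ring_scheme \<Rightarrow> ('a, 'b, 'm) module_scheme \<Rightarrow> 'a list \<Rightarrow> bool" where
  "regular_seq A M xs \<longleftrightarrow> set xs \<subseteq> carrier A \<and>
     (\<forall>i<length xs. \<forall>y\<in>carrier M.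
        (xs ! i) \<odot>\<^bsub>M\<^esub> y \<in> seq_mult A M (take i xs) \<longrightarrow> y \<in> seq_mult A M (take i xs)) \<and>
     seq_mult A M xs \<noteq> carrier M"

definition depth ::
  "('a, 'k) ring_scheme \<Rightarrow> 'a set \<Rightarrow> ('a, 'b, 'm) module_scheme \<Rightarrow> enat" where
  "depth A \<mm> M = Sup {enat (length xs) |xs. set xs \<subseteq> \<mm> \<and> regular_seq A M xs}"

definition cohen_macaulay_local :: "('a, 'k) ring_scheme \<Rightarrow> 'a set \<Rightarrow> bool" where
  "cohen_macaulay_local A \<mm> \<longleftrightarrow>
     noetherian_local A \<mm> \<and> depth A \<mm> (ring_module A) = krull_dim A"

definition maximal_cm ::
  "('a, 'k) ring_scheme \<Rightarrow> 'a set \<Rightarrow> ('a, 'b, 'm) module_scheme \<Rightarrow> bool" where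
  "maximal_cm A \<mm> M \<longleftrightarrow> module A M \<and> fin_gen A M \<and> depth A \<mm> M = krull_dim A"

text \<open>The type of \<open>M\<close> is the dimension of \<open>Ext\<^sup>t(A/\<mm>, M)\<close> over the residue field, where
  \<open>t = depth M\<close>. This module is killed by \<open>\<mm>\<close>, so its dimension over \<open>A/\<mm>\<close> is its length
  over \<open>A\<close>.\<close>

definition cm_type ::
  "('a, 'k) ring_scheme \<Rightarrow> 'a set \<Rightarrow> ('a, 'b, 'm) module_scheme \<Rightarrow> enat" where
  "cm_type A \<mm> M = module_length A
     (ext_module A (quot_module (ring_module A) \<mm>) M (the_enat (depth A \<mm> M)))"

text \<open>The injective dimension of \<open>M\<close> is the supremum of all \<open>i\<close> with \<open>Ext\<^sup>i(A/\<aa>, M) \<noteq> 0\<close> for some ideal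
  \<open>\<aa>\<close>; by Baer's criterion cyclic modules suffice.\<close>

definition fin_inj_dim :: "('a, 'k) ring_scheme \<Rightarrow> ('a, 'b, 'm) module_scheme \<Rightarrow> bool" where
  "fin_inj_dim A M \<longleftrightarrow> (\<exists>r. \<forall>\<aa> i. ideal \<aa> A \<and> r < i \<longrightarrow>
     (let E = ext_module A (quot_module (ring_module A) \<aa>) M i in carrier E = {\<zero>\<^bsub>E\<^esub>}))"

text \<open>Following Bruns and Herzog, a canonical module is a maximal Cohen--Macaulay module of type one
  and of finite injective dimension.\<close>

definition canonical_module ::
  "('a, 'k) ring_scheme \<Rightarrow> 'a set \<Rightarrow> ('a, 'b, 'm) module_scheme \<Rightarrow> bool" where
  "canonical_module A \<mm> K \<longleftrightarrow> maximal_cm A \<mm> K \<and> cm_type A \<mm> K = 1 \<and> fin_inj_dim A K"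

definition canonical_ideal ::
  "('a, 'k) ring_scheme \<Rightarrow> ('a, 'b, 'm) module_scheme \<Rightarrow> 'a set \<Rightarrow> bool" where
  "canonical_ideal A K I \<longleftrightarrow> ideal I A \<and> I \<noteq> carrier A \<and>
     mod_isomorphic A ((ring_module A)\<lparr>carrier := I\<rparr>) K"


section \<open>Parameter ideals and Hilbert coefficients\<close>

abbreviation ideal_pow :: "('a, 'k) ring_scheme \<Rightarrow> 'a set \<Rightarrow> nat \<Rightarrow> 'a set" where
  "ideal_pow A J n \<equiv> J [^]\<^bsub>ideals_set A\<^esub> n"

definition system_of_parameters :: "('a, 'k) ring_scheme \<Rightarrow> 'a set \<Rightarrow> 'a list \<Rightarrow> bool" where
  "system_of_parameters A \<mm> as \<longleftrightarrow> set as \<subseteq> \<mm> \<and> enat (length as) = krull_dim A \<and>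
     (\<exists>k. ideal_pow A \<mm> k \<subseteq> Idl\<^bsub>A\<^esub> (set as))"

definition parameter_ideal :: "('a, 'k) ring_scheme \<Rightarrow> 'a set \<Rightarrow> 'a set \<Rightarrow> bool" where
  "parameter_ideal A \<mm> Q \<longleftrightarrow> (\<exists>as. system_of_parameters A \<mm> as \<and> Q = Idl\<^bsub>A\<^esub> (set as))"

definition reduction :: "('a, 'k) ring_scheme \<Rightarrow> 'a set \<Rightarrow> 'a set \<Rightarrow> bool" where
  "reduction A Q J \<longleftrightarrow> Q \<subseteq> J \<and>
     (\<exists>r. ideal_pow A J (r + 1) = ideal_prod A Q (ideal_pow A J r))"

definition sharp :: "('a, 'k) ring_scheme \<Rightarrow> 'a set \<Rightarrow> 'a set \<Rightarrow> 'a set \<Rightarrow> bool" where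
  "sharp A \<mm> I Q \<longleftrightarrow>
     (\<exists>as. system_of_parameters A \<mm> as \<and> Q = Idl\<^bsub>A\<^esub> (set as) \<and> as \<noteq> [] \<and> hd as \<in> I) \<and>
     reduction A Q (I <+>\<^bsub>A\<^esub> Q)"

definition quot_length :: "('a, 'k) ring_scheme \<Rightarrow> 'a set \<Rightarrow> enat" where
  "quot_length A J = module_length A (quot_module (ring_module A) J)"

text \<open>\<open>hilbert_coeff A J i\<close> is \<open>e\<^sub>i(J)\<close> for \<open>i \<le> dim A\<close>; the condition \<open>e i = 0\<close> for \<open>i > dim A\<close>
  only serves to make the description definite.\<close>

definition hilbert_coeff :: "('a, 'k) ring_scheme \<Rightarrow> 'a set \<Rightarrow> nat \<Rightarrow> int" where
  "hilbert_coeff A J =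
     (let d = the_enat (krull_dim A) in
       THE e. (\<forall>i>d. e i = 0) \<and>
         (\<exists>m0. \<forall>m\<ge>m0. \<exists>k. quot_length A (ideal_pow A J (m + 1)) = enat k \<and>
           int k = (\<Sum>i\<le>d. (-1) ^ i * e i * int ((m + d - i) choose (d - i)))))"

text \<open>The binomial coefficient \<open>l + d - 2\<close> over \<open>d - 2\<close>, where \<open>l - 1\<close> over \<open>- 1\<close> is \<open>1\<close> for
  \<open>l = 0\<close> and \<open>0\<close> for \<open>l > 0\<close>.\<close>

definition binom_minus2 :: "nat \<Rightarrow> nat \<Rightarrow> nat" where
  "binom_minus2 d l = (if d = 1 then (if l = 0 then 1 else 0) else (l + d - 2) choose (d - 2))"


section \<open>Localization\<close>

definition loc_rel ::
  "('r, 'k) ring_scheme \<Rightarrow> 'r set \<Rightarrow> ('r, 'b, 'm) module_scheme \<Rightarrow> (('b \<times> 'r) \<times> ('b \<times> 'r)) set" where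
  "loc_rel R S M = {((x, s), (y, t)). x \<in> carrier M \<and> y \<in> carrier M \<and> s \<in> S \<and> t \<in> S \<and>
     (\<exists>u\<in>S. u \<odot>\<^bsub>M\<^esub> (t \<odot>\<^bsub>M\<^esub> x) = u \<odot>\<^bsub>M\<^esub> (s \<odot>\<^bsub>M\<^esub> y))}"

definition loc_frac ::
  "('r, 'k) ring_scheme \<Rightarrow> 'r set \<Rightarrow> ('r, 'b, 'm) module_scheme \<Rightarrow> 'b \<Rightarrow> 'r \<Rightarrow> ('b \<times> 'r) set" where
  "loc_frac R S M x s = loc_rel R S M `` {(x, s)}"

definition loc_ring :: "('r, 'k) ring_scheme \<Rightarrow> 'r set \<Rightarrow> ('r \<times> 'r) set ring" where
  "loc_ring R S = (let frac = loc_frac R S (ring_module R) in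
     \<lparr>carrier = (carrier R \<times> S) // loc_rel R S (ring_module R),
      mult = (\<lambda>X Y. \<Union>(a, s)\<in>X. \<Union>(b, t)\<in>Y. frac (a \<otimes>\<^bsub>R\<^esub> b) (s \<otimes>\<^bsub>R\<^esub> t)),
      one = frac \<one>\<^bsub>R\<^esub> \<one>\<^bsub>R\<^esub>,
      zero = frac \<zero>\<^bsub>R\<^esub> \<one>\<^bsub>R\<^esub>,
      add = (\<lambda>X Y. \<Union>(a, s)\<in>X. \<Union>(b, t)\<in>Y.
        frac ((t \<otimes>\<^bsub>R\<^esub> a) \<oplus>\<^bsub>R\<^esub> (s \<otimes>\<^bsub>R\<^esub> b)) (s \<otimes>\<^bsub>R\<^esub> t))\<rparr>)"

definition loc_module ::
  "('r, 'k) ring_scheme \<Rightarrow> 'r set \<Rightarrow> ('r, 'b, 'm) module_scheme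
     \<Rightarrow> (('r \<times> 'r) set, ('b \<times> 'r) set) module" where
  "loc_module R S M = (let frac = loc_frac R S M in
     \<lparr>carrier = (carrier M \<times> S) // loc_rel R S M, mult = undefined, one = undefined,
      zero = frac \<zero>\<^bsub>M\<^esub> \<one>\<^bsub>R\<^esub>,
      add = (\<lambda>X Y. \<Union>(x, s)\<in>X. \<Union>(y, t)\<in>Y.
        frac ((t \<odot>\<^bsub>M\<^esub> x) \<oplus>\<^bsub>M\<^esub> (s \<odot>\<^bsub>M\<^esub> y)) (s \<otimes>\<^bsub>R\<^esub> t)),
      smult = (\<lambda>X Y. \<Union>(a, s)\<in>X. \<Union>(y, t)\<in>Y. frac (a \<odot>\<^bsub>M\<^esub> y) (s \<otimes>\<^bsub>R\<^esub> t))\<rparr>)"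


section \<open>Sally modules and Goto rings\<close>

text \<open>The Rees algebra \<open>A[Jt]\<close> as the subring of \<open>A[t]\<close> of polynomials whose coefficient of \<open>t^i\<close>
  lies in \<open>J^i\<close>.\<close>

definition rees :: "('a, 'k) ring_scheme \<Rightarrow> 'a set \<Rightarrow> ('a, nat \<Rightarrow> 'a) up_ring" where
  "rees A J = (UP A)\<lparr>carrier := {p \<in> carrier (UP A). \<forall>i. coeff (UP A) p i \<in> ideal_pow A J i}\<rparr>"

definition rees_ext :: "('a, 'k) ring_scheme \<Rightarrow> 'a set \<Rightarrow> 'a set \<Rightarrow> (nat \<Rightarrow> 'a) set" where
  "rees_ext A J \<aa> = Idl\<^bsub>rees A J\<^esub> ((\<lambda>a. monom (UP A) a 0) ` \<aa>)"

text \<open>The Sally module \<open>J A[Jt] / J \<T>\<close> with \<open>\<T> = A[Qt]\<close>, a module over \<open>\<T>\<close>.\<close>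

definition sally :: "('a, 'k) ring_scheme \<Rightarrow> 'a set \<Rightarrow> 'a set \<Rightarrow> (nat \<Rightarrow> 'a, (nat \<Rightarrow> 'a) set) module"
  where
  "sally A Q J =
     quot_module ((ring_module (UP A))\<lparr>carrier := rees_ext A J J\<rparr>) (rees_ext A Q J)"

definition sally_component :: "('a, 'k) ring_scheme \<Rightarrow> 'a set \<Rightarrow> 'a set \<Rightarrow> nat \<Rightarrow> (nat \<Rightarrow> 'a) set set"
  where
  "sally_component A Q J i =
     {rees_ext A Q J +>\<^bsub>UP A\<^esub> p |p. p \<in> rees_ext A J J \<and> (\<forall>j. j \<noteq> i \<longrightarrow> coeff (UP A) p j = \<zero>\<^bsub>A\<^esub>)}"

definition sally_rank :: "('a, 'k) ring_scheme \<Rightarrow> 'a set \<Rightarrow> 'a set \<Rightarrow> 'a set \<Rightarrow> enat" where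
  "sally_rank A \<mm> Q J =
     (let T = rees A Q; S = carrier T - rees_ext A Q \<mm>
      in module_length (loc_ring T S) (loc_module T S (sally A Q J)))"

definition goto_ring :: "('a, 'k) ring_scheme \<Rightarrow> 'a set \<Rightarrow> 'a set \<Rightarrow> 'a set \<Rightarrow> nat \<Rightarrow> bool" where
  "goto_ring A \<mm> I Q n \<longleftrightarrow>
     (let J = I <+>\<^bsub>A\<^esub> Q in
       carrier (sally A Q J) = submod_span (rees A Q) (sally A Q J) (sally_component A Q J 1) \<and>
       sally_rank A \<mm> Q J = enat n)"

end

theory Submission
  imports Defs "HOL-Algebra.Subrings"
begin

text \<open>Write \<open>Q = (a, a\<^sub>2, \<dots>, a\<^sub>d)\<close> with \<open>a \<in> I\<close>, where the generators can be chosen to form a sequence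
  \<open>a\<^sub>2, \<dots>, a\<^sub>d, a\<close> regular both on \<open>A\<close> and on \<open>I\<close>. As \<open>I\<close> is a canonical module, \<open>I/QI\<close> has a simple
  socle and the length of \<open>A/Q\<close>, so it is faithful over \<open>A/Q\<close>. With \<open>J\<^sup>3 = QJ\<^sup>2\<close> this forces
  \<open>I\<^sup>2 \<subseteq> Q\<close>, whence \<open>J\<^sup>2 = aB + QJ\<close> for the ideal \<open>B = J\<^sup>2 : a\<close>, which contains \<open>J\<close>. Since \<open>Q\<close> is
  generated by a regular sequence, \<open>J^(l+1) = aQ^(l-1)B + Q^l J\<close>, and multiplication by \<open>a\<close> identifies
  \<open>Q^(l-1)B / Q^(l-1)J\<close> with \<open>J^(l+1) / Q^l J\<close>. Hence a composition series of
  \<open>B/J\<close> yields one of the localized Sally module, so \<open>\<ell>(B/J) = n\<close>, and the Hilbert function follows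
  because the lengths of \<open>Q^l / Q^l \<cc>\<close> are known for every ideal \<open>\<cc> \<supseteq> Q\<close> of finite colength.\<close>

text \<open>The type of \<open>K\<close> is read off Ext of one resolution picked by choice, so
  cohomology is computed with that very resolution, by linear maps on free modules modulo ideals
  \<open>N \<subseteq> M\<close>; dimension shifting along a regular sequence turns type one into a
  simple socle of \<open>I/QI\<close>. Parameters become regular without dimension theory: an
  associated prime of \<open>M/N\<close> containing them all would contain \<open>\<mm>\<close> and
  yield a socle element, which vanishing cohomology forbids. The element \<open>a\<close> comes last
  and stays in \<open>I\<close>: regular modulo the ideal \<open>P\<close> of the other generators,
  it can be cancelled, and lying in \<open>I\<close> it gives \<open>P \<inter> I = PI\<close>. For
  \<open>x, y, u \<in> I\<close> the product \<open>xyu\<close> lies in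
  \<open>QJ\<^sup>2 \<subseteq> aI\<^sup>2 + P\<close>; its part in \<open>P\<close> is also in
  \<open>I\<close>, hence in \<open>PI\<close>, so \<open>xy\<close> kills \<open>I/QI\<close> and
  lies in \<open>Q\<close>. A simple step of a composition series of \<open>B/J\<close> gives a
  subquotient of the Sally module isomorphic to \<open>\<T>/\<mm>\<T>\<close>, of length one at
  \<open>\<mm>\<T>\<close> because \<open>\<T>/\<mm>\<T>\<close> is a domain; this is why the rank
  equals the length of \<open>B/J\<close>.\<close>

no_notation Sum_Type.Plus (infixr \<open><+>\<close> 65)

section \<open>Lengths of chains\<close>

text \<open>Only the family of sets enters, so the same supremum serves module lengths, intervals of
  ideals and saturated submodules, and strictly monotone maps compare them.\<close>

definition chain_length :: "'a set set \<Rightarrow> enat" where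
  "chain_length \<L> = Sup {enat n |n. \<exists>N :: nat \<Rightarrow> 'a set.
     (\<forall>i\<le>n. N i \<in> \<L>) \<and> (\<forall>i<n. N i \<subset> N (Suc i))}"

lemma module_length_eq_chain_length:
  "module_length R M = chain_length {N. submodule N R M}"
  by (simp add: module_length_def chain_length_def)

lemma chain_length_ge:
  assumes "\<forall>i\<le>n. N i \<in> \<L>" "\<forall>i<n. N i \<subset> N (Suc i)"
  shows "enat n \<le> chain_length \<L>"
  unfolding chain_length_def by (rule Sup_upper) (use assms in blast)

lemma chain_length_le:
  assumes "\<And>n N. \<lbrakk>\<forall>i\<le>n. N i \<in> \<L>; \<forall>i<n. N i \<subset> N (Suc i)\<rbrakk> \<Longrightarrow> enat n \<le> k"
  shows "chain_length \<L> \<le> k"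
  unfolding chain_length_def by (rule Sup_least) (use assms in blast)

text \<open>A finite supremum in \<open>enat\<close> is a maximum; nonemptiness excludes
  \<open>Sup {} = 0\<close>, which nothing attains.\<close>

lemma Sup_enat_attained:
  assumes "Sup X = enat n" "X \<noteq> {}"
  shows "enat n \<in> X"
  using assms unfolding Sup_enat_def by (metis Max_in enat.distinct(1))

lemma enat_le_diff:
  fixes a b c :: enat
  assumes "b \<noteq> \<infinity>" "a + b \<le> c"
  shows "a \<le> c - b"
  using assms by (cases a; cases b; cases c) simp_all

lemma enat_diff_le:
  fixes a b c :: enat
  assumes "b \<noteq> \<infinity>" "a \<le> c - b" "b \<le> c"
  shows "a + b \<le> c"
  using assms by (cases a; cases b; cases c) simp_all

lemma chain_length_attained:
  assumes "chain_length \<L> = enat n" "\<L> \<noteq> {}"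
  obtains N where "\<forall>i\<le>n. N i \<in> \<L>" "\<forall>i<n. N i \<subset> N (Suc i)"
proof -
  obtain X where X: "X \<in> \<L>" using assms(2) by blast
  have "enat 0 \<in> {enat n |n. \<exists>N :: nat \<Rightarrow> 'a set. (\<forall>i\<le>n. N i \<in> \<L>) \<and> (\<forall>i<n. N i \<subset> N (Suc i))}"
    using X by (auto intro!: exI[of _ "\<lambda>_. X"])
  with Sup_enat_attained[OF assms(1)[unfolded chain_length_def]] show ?thesis
    using that by blast
qed

text \<open>Used in pairs: one strictly monotone map in each direction proves two lengths equal,
  without a lattice isomorphism.\<close>

lemma chain_length_mono_map:
  assumes "\<And>X. X \<in> \<L> \<Longrightarrow> f X \<in> \<L>'"
    and "\<And>X Y. \<lbrakk>X \<in> \<L>; Y \<in> \<L>; X \<subset> Y\<rbrakk> \<Longrightarrow> f X \<subset> f Y"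
  shows "chain_length \<L> \<le> chain_length \<L>'"
proof (rule chain_length_le)
  fix n N assume N: "\<forall>i\<le>n. N i \<in> \<L>" "\<forall>i<n. N i \<subset> N (Suc i)"
  show "enat n \<le> chain_length \<L>'"
    by (rule chain_length_ge[where N = "\<lambda>i. f (N i)"]) (use N assms in auto)
qed

lemma chain_mono:
  fixes N :: "nat \<Rightarrow> 'a set"
  assumes "\<forall>i<n. N i \<subset> N (Suc i)" "i \<le> j" "j \<le> n"
  shows "N i \<subseteq> N j"
  using assms(2,3)
proof (induction j)
  case (Suc j)
  show ?case
  proof (cases "i = Suc j")
    case False
    then have "N i \<subseteq> N j" using Suc by simp
    moreover have "N j \<subset> N (Suc j)" using Suc.prems assms(1) by simp
    ultimately show ?thesis by blast
  qed simp
qed simp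

section \<open>Arithmetic of ideals\<close>

context cring begin

lemma idl_carr: "\<lbrakk>ideal I R; x \<in> I\<rbrakk> \<Longrightarrow> x \<in> carrier R"
  by (rule ideal.Icarr)

lemma idl_sub: "ideal I R \<Longrightarrow> I \<subseteq> carrier R"
  using idl_carr by blast

lemma idl_zero: "ideal I R \<Longrightarrow> \<zero> \<in> I"
  by (simp add: additive_subgroup.zero_closed ideal.axioms(1))

lemma idl_add: "\<lbrakk>ideal I R; x \<in> I; y \<in> I\<rbrakk> \<Longrightarrow> x \<oplus> y \<in> I"
  by (simp add: additive_subgroup.a_closed ideal.axioms(1))

lemma idl_neg: "\<lbrakk>ideal I R; x \<in> I\<rbrakk> \<Longrightarrow> \<ominus> x \<in> I"
  by (simp add: additive_subgroup.a_inv_closed ideal.axioms(1))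

lemma idl_diff: "\<lbrakk>ideal I R; x \<in> I; y \<in> I\<rbrakk> \<Longrightarrow> x \<ominus> y \<in> I"
  by (simp add: a_minus_def idl_add idl_neg)

lemma idl_lmult: "\<lbrakk>ideal I R; x \<in> I; c \<in> carrier R\<rbrakk> \<Longrightarrow> c \<otimes> x \<in> I"
  by (rule ideal.I_l_closed)

lemma idl_rmult: "\<lbrakk>ideal I R; x \<in> I; c \<in> carrier R\<rbrakk> \<Longrightarrow> x \<otimes> c \<in> I"
  by (rule ideal.I_r_closed)

lemmas idl_intros = idl_zero idl_add idl_neg idl_diff idl_lmult idl_rmult

lemma idl_add_cancel:
  assumes "ideal I R" "x \<oplus> y \<in> I" "y \<in> I" "x \<in> carrier R"
  shows "x \<in> I"
proof -
  have "x \<oplus> y \<ominus> y = x" using assms idl_carr by algebra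
  then show ?thesis using idl_diff[OF assms(1-3)] by simp
qed

lemma idl_diff_cancel:
  assumes "ideal I R" "x \<ominus> y \<in> I" "y \<in> I" "x \<in> carrier R"
  shows "x \<in> I"
  using idl_add_cancel[OF assms(1), of x "\<ominus> y"] assms by (simp add: a_minus_def idl_neg)

lemma idealI':
  assumes "I \<subseteq> carrier R" "\<zero> \<in> I" "\<And>x y. \<lbrakk>x \<in> I; y \<in> I\<rbrakk> \<Longrightarrow> x \<oplus> y \<in> I"
    "\<And>c x. \<lbrakk>c \<in> carrier R; x \<in> I\<rbrakk> \<Longrightarrow> c \<otimes> x \<in> I"
  shows "ideal I R"
proof (rule idealI[OF ring_axioms])
  show "subgroup I (add_monoid R)"
  proof (rule add.subgroupI)
    fix a assume a: "a \<in> I"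
    then have "(\<ominus> \<one>) \<otimes> a \<in> I" using assms(4) by simp
    moreover have "(\<ominus> \<one>) \<otimes> a = \<ominus> a" using a assms(1) by (simp add: l_minus subsetD)
    ultimately show "\<ominus> a \<in> I" by simp
  qed (use assms in auto)
  show "a \<otimes> x \<in> I" if "a \<in> I" "x \<in> carrier R" for a x
    using assms(4)[OF that(2,1)] that assms(1) m_comm by (metis subsetD)
qed (use assms in auto)

lemma idl_sumI: "\<lbrakk>x \<in> I; y \<in> J\<rbrakk> \<Longrightarrow> x \<oplus> y \<in> I <+> J"
  by (auto simp: set_add_def')

lemma idl_sumE:
  assumes "z \<in> I <+> J" obtains x y where "x \<in> I" "y \<in> J" "z = x \<oplus> y"
  using assms by (auto simp: set_add_def')

lemma idl_sum_upper:
  assumes "ideal I R" "ideal J R"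
  shows "I \<subseteq> I <+> J" "J \<subseteq> I <+> J"
proof -
  show "I \<subseteq> I <+> J"
    using idl_sumI[of _ I \<zero> J] idl_carr[OF assms(1)] idl_zero[OF assms(2)] by fastforce
  show "J \<subseteq> I <+> J"
    using idl_sumI[of \<zero> I _ J] idl_carr[OF assms(2)] idl_zero[OF assms(1)] by fastforce
qed

lemma idl_sum_least: "\<lbrakk>ideal L R; I \<subseteq> L; J \<subseteq> L\<rbrakk> \<Longrightarrow> I <+> J \<subseteq> L"
  by (auto elim!: idl_sumE intro!: idl_add)

lemma idl_sum_absorb: "\<lbrakk>ideal I R; ideal J R; J \<subseteq> I\<rbrakk> \<Longrightarrow> I <+> J = I"
  using idl_sum_least idl_sum_upper by (metis subset_antisym subset_refl)

lemma idl_sum_mono: "\<lbrakk>I \<subseteq> I'; J \<subseteq> J'\<rbrakk> \<Longrightarrow> I <+> J \<subseteq> I' <+> J'"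
  by (auto elim!: idl_sumE intro!: idl_sumI)

lemma idl_sum_comm: "\<lbrakk>ideal I R; ideal J R\<rbrakk> \<Longrightarrow> I <+> J = J <+> I"
  by (intro subset_antisym idl_sum_least add_ideals idl_sum_upper)

lemma idl_sum_assoc:
  "\<lbrakk>ideal I R; ideal J R; ideal L R\<rbrakk> \<Longrightarrow> (I <+> J) <+> L = I <+> (J <+> L)"
  using add.set_mult_assoc[of I J L] by (simp add: idl_sub set_add_defs(1))

section \<open>Multiples by an element, colons, products and powers of ideals\<close>

definition elt_mult :: "'a \<Rightarrow> 'a set \<Rightarrow> 'a set" (infixr \<open>\<odot>\<^sub>s\<close> 75) where
  "a \<odot>\<^sub>s I = (\<lambda>x. a \<otimes> x) ` I"

lemma elt_multI: "x \<in> I \<Longrightarrow> a \<otimes> x \<in> a \<odot>\<^sub>s I"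
  by (auto simp: elt_mult_def)

lemma elt_multE:
  assumes "z \<in> a \<odot>\<^sub>s I" obtains x where "x \<in> I" "z = a \<otimes> x"
  using assms by (auto simp: elt_mult_def)

lemma elt_mult_ideal:
  assumes "ideal I R" "a \<in> carrier R"
  shows "ideal (a \<odot>\<^sub>s I) R"
proof (rule idealI')
  show "a \<odot>\<^sub>s I \<subseteq> carrier R" using assms idl_carr by (auto simp: elt_mult_def)
  have "a \<otimes> \<zero> \<in> a \<odot>\<^sub>s I" using assms by (intro elt_multI idl_zero)
  then show "\<zero> \<in> a \<odot>\<^sub>s I" using assms by simp
next
  fix x y assume "x \<in> a \<odot>\<^sub>s I" "y \<in> a \<odot>\<^sub>s I"
  then obtain u v where uv: "u \<in> I" "v \<in> I" "x = a \<otimes> u" "y = a \<otimes> v"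
    by (auto elim!: elt_multE)
  then have "x \<oplus> y = a \<otimes> (u \<oplus> v)" using assms idl_carr by (simp add: r_distr)
  then show "x \<oplus> y \<in> a \<odot>\<^sub>s I" using uv assms by (auto intro!: elt_multI idl_add)
next
  fix c x assume c: "c \<in> carrier R" "x \<in> a \<odot>\<^sub>s I"
  then obtain u where u: "u \<in> I" "x = a \<otimes> u" by (auto elim!: elt_multE)
  then have "c \<otimes> x = a \<otimes> (c \<otimes> u)" using assms c idl_carr by (simp add: m_lcomm)
  then show "c \<otimes> x \<in> a \<odot>\<^sub>s I" using u c assms by (auto intro!: elt_multI idl_lmult)
qed

lemma elt_mult_sub: "\<lbrakk>ideal I R; a \<in> carrier R\<rbrakk> \<Longrightarrow> a \<odot>\<^sub>s I \<subseteq> I"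
  by (auto elim!: elt_multE intro: idl_lmult)

lemma elt_mult_carrier_least: "\<lbrakk>ideal I R; a \<in> I\<rbrakk> \<Longrightarrow> a \<odot>\<^sub>s carrier R \<subseteq> I"
  by (auto elim!: elt_multE intro: idl_rmult)

lemma elt_mult_self: "a \<in> carrier R \<Longrightarrow> a \<in> a \<odot>\<^sub>s carrier R"
  using elt_multI[of \<one> "carrier R" a] by simp

lemma elt_mult_mono: "I \<subseteq> J \<Longrightarrow> a \<odot>\<^sub>s I \<subseteq> a \<odot>\<^sub>s J"
  by (auto simp: elt_mult_def)

lemma Idl_insert:
  assumes "S \<subseteq> carrier R" "a \<in> carrier R"
  shows "Idl (insert a S) = Idl S <+> (a \<odot>\<^sub>s carrier R)"
proof
  have i: "ideal (Idl S) R" "ideal (a \<odot>\<^sub>s carrier R) R"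
    using assms by (auto intro: genideal_ideal elt_mult_ideal oneideal)
  show "Idl (insert a S) \<subseteq> Idl S <+> (a \<odot>\<^sub>s carrier R)"
    using idl_sum_upper[OF i] genideal_self[OF assms(1)] elt_mult_self[OF assms(2)]
    by (intro genideal_minimal add_ideals i) blast
  have j: "ideal (Idl (insert a S)) R" using assms by (auto intro: genideal_ideal)
  show "Idl S <+> (a \<odot>\<^sub>s carrier R) \<subseteq> Idl (insert a S)"
    using genideal_self[of "insert a S"] assms
    by (intro idl_sum_least j genideal_minimal elt_mult_carrier_least) auto
qed

lemma Idl_empty: "Idl {} = {\<zero>}"
proof
  show "Idl {} \<subseteq> {\<zero>}" by (rule genideal_minimal[OF zeroideal]) simp
  show "{\<zero>} \<subseteq> Idl {}" using idl_zero[OF genideal_ideal[of "{}"]] by simp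
qed

definition colon :: "'a set \<Rightarrow> 'a \<Rightarrow> 'a set" where
  "colon N b = {x \<in> carrier R. b \<otimes> x \<in> N}"

lemma colon_ideal:
  assumes "ideal N R" "b \<in> carrier R"
  shows "ideal (colon N b) R"
  by (rule idealI') (use assms in \<open>auto simp: colon_def idl_zero r_distr m_lcomm intro: idl_intros\<close>)

lemma colon_sup: "\<lbrakk>ideal N R; b \<in> carrier R\<rbrakk> \<Longrightarrow> N \<subseteq> colon N b"
  by (auto simp: colon_def intro: idl_intros idl_carr)

lemma prod_in: "\<lbrakk>x \<in> I; y \<in> J\<rbrakk> \<Longrightarrow> x \<otimes> y \<in> I \<cdot> J"
  by (rule ideal_prod.prod)

lemma idl_prod_least:
  assumes "ideal L R" "\<And>x y. \<lbrakk>x \<in> I; y \<in> J\<rbrakk> \<Longrightarrow> x \<otimes> y \<in> L"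
  shows "I \<cdot> J \<subseteq> L"
proof
  fix z assume "z \<in> I \<cdot> J" then show "z \<in> L"
    by (induct) (use assms in \<open>auto intro: idl_add\<close>)
qed

lemma idl_prod_mono:
  assumes "I \<subseteq> I'" "J \<subseteq> J'" shows "I \<cdot> J \<subseteq> I' \<cdot> J'"
proof
  fix z assume "z \<in> I \<cdot> J" then show "z \<in> I' \<cdot> J'"
    by (induct) (use assms in \<open>auto intro: ideal_prod.intros\<close>)
qed

lemma idl_prod_sub: "\<lbrakk>ideal I R; ideal J R\<rbrakk> \<Longrightarrow> I \<cdot> J \<subseteq> I" "\<lbrakk>ideal I R; ideal J R\<rbrakk> \<Longrightarrow> I \<cdot> J \<subseteq> J"
  using ideal_prod_inter by auto

lemma elt_mult_prod:
  assumes "ideal I R" "ideal J R" "a \<in> carrier R"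
  shows "(a \<odot>\<^sub>s I) \<cdot> J = a \<odot>\<^sub>s (I \<cdot> J)"
proof
  show "(a \<odot>\<^sub>s I) \<cdot> J \<subseteq> a \<odot>\<^sub>s (I \<cdot> J)"
  proof (rule idl_prod_least)
    show "ideal (a \<odot>\<^sub>s (I \<cdot> J)) R" using assms by (intro elt_mult_ideal ideal_prod_is_ideal)
    fix x y assume "x \<in> a \<odot>\<^sub>s I" "y \<in> J"
    then show "x \<otimes> y \<in> a \<odot>\<^sub>s (I \<cdot> J)"
      using assms by (auto elim!: elt_multE simp: m_assoc idl_carr intro!: elt_multI prod_in)
  qed
  show "a \<odot>\<^sub>s (I \<cdot> J) \<subseteq> (a \<odot>\<^sub>s I) \<cdot> J"
  proof
    fix z assume "z \<in> a \<odot>\<^sub>s (I \<cdot> J)"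
    then obtain x where x: "x \<in> I \<cdot> J" "z = a \<otimes> x" by (rule elt_multE)
    have "a \<otimes> x \<in> (a \<odot>\<^sub>s I) \<cdot> J"
      using x(1)
    proof induct
      case (prod i j)
      then have "a \<otimes> (i \<otimes> j) = (a \<otimes> i) \<otimes> j" using assms by (simp add: m_assoc idl_carr)
      then show ?case using prod by (auto intro!: prod_in elt_multI)
    next
      case (sum s t)
      then have "s \<in> carrier R" "t \<in> carrier R" using ideal_prod_in_carrier assms by blast+
      then show ?case using sum assms by (auto simp: r_distr intro: ideal_prod.sum)
    qed
    then show "z \<in> (a \<odot>\<^sub>s I) \<cdot> J" using x by simp
  qed
qed

lemma carrier_prod: "ideal I R \<Longrightarrow> carrier R \<cdot> I = I"
  using ideal_prod_one ideal_prod_commute oneideal by metis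

lemma elt_mult_carrier_prod:
  assumes "ideal I R" "a \<in> carrier R"
  shows "(a \<odot>\<^sub>s carrier R) \<cdot> I = a \<odot>\<^sub>s I"
  using elt_mult_prod[OF oneideal assms] carrier_prod[OF assms(1)] by simp

lemma ideals_set_simps [simp]:
  "I \<otimes>\<^bsub>ideals_set R\<^esub> J = I \<cdot> J" "\<one>\<^bsub>ideals_set R\<^esub> = carrier R"
  by (simp_all add: ideals_set_def)

lemma idl_pow_0: "ideal_pow R J 0 = carrier R"
  by (simp add: nat_pow_def ideals_set_def)

lemma idl_pow_Suc: "ideal_pow R J (Suc n) = ideal_pow R J n \<cdot> J"
  by (simp add: nat_pow_def ideals_set_def)

lemma idl_pow_ideal: "ideal J R \<Longrightarrow> ideal (ideal_pow R J n) R"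
  by (induction n) (auto simp: idl_pow_0 idl_pow_Suc oneideal ideal_prod_is_ideal)

lemma idl_pow_1: "ideal J R \<Longrightarrow> ideal_pow R J (Suc 0) = J"
  by (simp add: idl_pow_0 idl_pow_Suc carrier_prod)

lemma idl_pow_add:
  "ideal J R \<Longrightarrow> ideal_pow R J (m + n) = ideal_pow R J m \<cdot> ideal_pow R J n"
  by (induction n) (simp_all add: idl_pow_0 idl_pow_Suc ideal_prod_one idl_pow_ideal ideal_prod_assoc)

lemma idl_pow_antimono: "\<lbrakk>ideal J R; m \<le> n\<rbrakk> \<Longrightarrow> ideal_pow R J n \<subseteq> ideal_pow R J m"
  using idl_pow_add[of J m "n - m"] idl_prod_sub(1) idl_pow_ideal by simp

lemma idl_pow_mono: "I \<subseteq> J \<Longrightarrow> ideal_pow R I n \<subseteq> ideal_pow R J n"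
  by (induction n) (simp_all add: idl_pow_0 idl_prod_mono)

text \<open>A product of \<open>Suc l\<close> elements of \<open>Q\<close> either avoids
  \<open>a\<close> or has a factor \<open>a\<close> that can be pulled out. This recursion stands in
  for monomials in the generators of \<open>Q\<close> in all later inductions.\<close>

lemma idl_pow_sum_principal:
  assumes P: "ideal P R" and a: "a \<in> carrier R" and Q: "Q = P <+> (a \<odot>\<^sub>s carrier R)"
  shows "ideal_pow R Q (Suc l) = ideal_pow R P (Suc l) <+> (a \<odot>\<^sub>s ideal_pow R Q l)"
proof (induction l)
  case 0
  then show ?case using P a Q idl_pow_1 add_ideals elt_mult_ideal oneideal by (simp add: idl_pow_0)
next
  case (Suc l)
  have aA: "ideal (a \<odot>\<^sub>s carrier R) R" using a by (intro elt_mult_ideal oneideal)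
  have iQ: "ideal Q R" unfolding Q by (intro add_ideals P aA)
  have Pw: "ideal (ideal_pow R P n) R" and Qw: "ideal (ideal_pow R Q n) R" for n
    using P iQ by (auto intro: idl_pow_ideal)
  have aw: "ideal (a \<odot>\<^sub>s ideal_pow R Q n) R" for n using a Qw by (intro elt_mult_ideal)
  have "ideal_pow R Q (Suc (Suc l)) = ideal_pow R Q (Suc l) \<cdot> Q" by (simp add: idl_pow_Suc)
  also have "\<dots> = ideal_pow R Q (Suc l) \<cdot> P <+> ideal_pow R Q (Suc l) \<cdot> (a \<odot>\<^sub>s carrier R)"
    by (subst (2) Q) (rule ideal_prod_distr(1)[OF Qw P aA])
  also have "ideal_pow R Q (Suc l) \<cdot> (a \<odot>\<^sub>s carrier R) = a \<odot>\<^sub>s ideal_pow R Q (Suc l)"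
    by (simp only: elt_mult_carrier_prod[OF Qw a] ideal_prod_commute[OF Qw aA])
  also have "ideal_pow R Q (Suc l) \<cdot> P =
      ideal_pow R P (Suc (Suc l)) <+> a \<odot>\<^sub>s (ideal_pow R Q l \<cdot> P)"
    by (simp only: Suc ideal_prod_distr(2)[OF P Pw aw] elt_mult_prod[OF Qw P a] idl_pow_Suc[of P "Suc l"])
  also have "(ideal_pow R P (Suc (Suc l)) <+> a \<odot>\<^sub>s (ideal_pow R Q l \<cdot> P)) <+> a \<odot>\<^sub>s ideal_pow R Q (Suc l) =
     ideal_pow R P (Suc (Suc l)) <+> (a \<odot>\<^sub>s (ideal_pow R Q l \<cdot> P) <+> a \<odot>\<^sub>s ideal_pow R Q (Suc l))"
    by (intro idl_sum_assoc Pw aw elt_mult_ideal a ideal_prod_is_ideal Qw P)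
  \<comment> \<open>The mixed terms disappear because \<open>P \<subseteq> Q\<close>.\<close>
  also have "a \<odot>\<^sub>s (ideal_pow R Q l \<cdot> P) <+> a \<odot>\<^sub>s ideal_pow R Q (Suc l) = a \<odot>\<^sub>s ideal_pow R Q (Suc l)"
  proof -
    have "P \<subseteq> Q" using idl_sum_upper[OF P aA] Q by simp
    then have s: "a \<odot>\<^sub>s (ideal_pow R Q l \<cdot> P) \<subseteq> a \<odot>\<^sub>s ideal_pow R Q (Suc l)"
      by (simp add: elt_mult_mono idl_prod_mono)
    have i: "ideal (a \<odot>\<^sub>s (ideal_pow R Q l \<cdot> P)) R" by (intro elt_mult_ideal a ideal_prod_is_ideal Qw P)
    show ?thesis by (subst idl_sum_comm[OF i aw]) (rule idl_sum_absorb[OF aw i s])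
  qed
  finally show ?case .
qed

end

section \<open>Lengths of subquotients of a ring\<close>

text \<open>The length of \<open>M/N\<close> for ideals \<open>N \<subseteq> M\<close>, read off the
  interval between them; the subquotient itself is never built.\<close>

definition len :: "('a, 'k) ring_scheme \<Rightarrow> 'a set \<Rightarrow> 'a set \<Rightarrow> enat" where
  "len R M N = chain_length {L. ideal L R \<and> N \<subseteq> L \<and> L \<subseteq> M}"

context cring begin

lemma len_mono:
  assumes "N' \<subseteq> N" "M \<subseteq> M'"
  shows "len R M N \<le> len R M' N'"
  unfolding len_def by (rule chain_length_mono_map[where f = id]) (use assms in auto)

text \<open>Put \<open>Y\<close> on top of a longest chain below \<open>X\<close>.\<close>

lemma len_Suc:
  assumes "ideal X R" "ideal Y R" "N \<subseteq> X" "X \<subset> Y"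
  shows "eSuc (len R X N) \<le> len R Y N"
proof (cases "len R X N")
  case (enat n)
  moreover have "{L. ideal L R \<and> N \<subseteq> L \<and> L \<subseteq> X} \<noteq> {}" using assms by blast
  ultimately obtain C where C: "\<forall>i\<le>n. C i \<in> {L. ideal L R \<and> N \<subseteq> L \<and> L \<subseteq> X}"
    "\<forall>i<n. C i \<subset> C (Suc i)"
    unfolding len_def by (rule chain_length_attained)
  have CX: "C i \<subseteq> Y" if "i \<le> n" for i using C that assms(4) by blast
  have "enat (Suc n) \<le> len R Y N"
    unfolding len_def
  proof (rule chain_length_ge[where N = "\<lambda>i. if i \<le> n then C i else Y"])
    show "\<forall>i<Suc n. (if i \<le> n then C i else Y) \<subset> (if Suc i \<le> n then C (Suc i) else Y)"
    proof (intro allI impI)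
      fix i assume "i < Suc n"
      then consider "i < n" | "i = n" by linarith
      then show "(if i \<le> n then C i else Y) \<subset> (if Suc i \<le> n then C (Suc i) else Y)"
      proof cases
        case 2
        have "C n \<subseteq> X" using C by simp
        then show ?thesis using 2 assms(4) by auto
      qed (use C in auto)
    qed
  qed (use C CX assms in auto)
  then show ?thesis using enat by (simp add: eSuc_enat)
next
  case infinity
  then show ?thesis using len_mono[of N N X Y] assms by auto
qed

lemma len_0_iff:
  assumes "ideal M R" "ideal N R" "N \<subseteq> M"
  shows "len R M N = 0 \<longleftrightarrow> M = N"
proof
  show "M = N" if "len R M N = 0"
    using len_Suc[of N M N] assms that by (metis ile0_eq eSuc_ne_0 psubsetI subset_refl)
  have "len R N N \<le> 0"
    unfolding len_def
  proof (rule chain_length_le)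
    fix n C assume C: "\<forall>i\<le>n. C i \<in> {L. ideal L R \<and> N \<subseteq> L \<and> L \<subseteq> N}"
      "\<forall>i<n. C i \<subset> C (Suc i)"
    show "enat n \<le> 0"
    proof (cases n)
      case (Suc m)
      then have "C 0 = N" "C 1 = N" "C 0 \<subset> C (Suc 0)" using C by auto
      then show ?thesis by simp
    qed (simp add: zero_enat_def)
  qed
  then show "len R M N = 0" if "M = N" using that by simp
qed

text \<open>The modular law: sum and intersection with \<open>L\<close> together distinguish
  comparable ideals.\<close>

lemma modular_strict:
  assumes "ideal X R" "ideal Y R" "ideal L R" "X \<subset> Y" "Y \<inter> L \<subseteq> X \<inter> L" "Y <+> L \<subseteq> X <+> L"
  shows False
proof -
  obtain y where y: "y \<in> Y" "y \<notin> X" using assms by auto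
  then have "y \<in> X <+> L" using idl_sum_upper(1)[OF assms(2,3)] assms(6) by blast
  then obtain x l where xl: "x \<in> X" "l \<in> L" "y = x \<oplus> l" by (rule idl_sumE)
  have "l = y \<ominus> x" using xl assms idl_carr by algebra
  then have "l \<in> Y" using idl_diff[OF assms(2) y(1), of x] xl(1) assms(4) by blast
  then have "l \<in> X" using xl assms(5) by blast
  then show False using xl y assms idl_add by blast
qed

text \<open>By the modular law each strict step of a chain from \<open>N\<close> to \<open>M\<close>
  stays strict after adding \<open>L\<close> or after intersecting with \<open>L\<close>, which
  bounds the length from above. From below, every step of a chain above \<open>L\<close> adds one to
  a length that starts at \<open>len R L N\<close>.\<close>

lemma len_add:
  assumes "ideal M R" "ideal L R" "ideal N R" "N \<subseteq> L" "L \<subseteq> M"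
  shows "len R M N = len R M L + len R L N"
proof (rule antisym)
  show "len R M N \<le> len R M L + len R L N"
    unfolding len_def[of R M N]
  proof (rule chain_length_le)
    fix n C assume C: "\<forall>i\<le>n. C i \<in> {L. ideal L R \<and> N \<subseteq> L \<and> L \<subseteq> M}"
      "\<forall>i<n. C i \<subset> C (Suc i)"
    have id: "ideal (C i) R" "N \<subseteq> C i" "C i \<subseteq> M" if "i \<le> n" for i using C that by auto
    have "enat i \<le> len R (C i <+> L) L + len R (C i \<inter> L) N" if "i \<le> n" for i
      using that
    proof (induction i)
      case (Suc i)
      have I: "ideal (C i) R" "ideal (C (Suc i)) R" using id Suc by auto
      have J: "ideal (C i <+> L) R" "ideal (C (Suc i) <+> L) R" "ideal (C i \<inter> L) R"
        "ideal (C (Suc i) \<inter> L) R" using I assms add_ideals i_intersect by auto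
      have S: "C i \<subset> C (Suc i)" using C Suc by simp
      have m: "C i <+> L \<subseteq> C (Suc i) <+> L" "C i \<inter> L \<subseteq> C (Suc i) \<inter> L"
        using S idl_sum_mono[of "C i" "C (Suc i)" L L] by auto
      have sup: "L \<subseteq> C i <+> L" "N \<subseteq> C i \<inter> L"
        using I assms idl_sum_upper id[of i] Suc by auto
      note l1 = len_mono[OF subset_refl m(1), of L] and l2 = len_mono[OF subset_refl m(2), of N]
      have IH: "enat i \<le> len R (C i <+> L) L + len R (C i \<inter> L) N" using Suc by simp
      show ?case
      proof (cases "C (Suc i) <+> L \<subseteq> C i <+> L")
        case True
        then have "C i \<inter> L \<subset> C (Suc i) \<inter> L" using modular_strict[OF I assms(2) S] m by blast
        then have "eSuc (len R (C i \<inter> L) N) \<le> len R (C (Suc i) \<inter> L) N"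
          using len_Suc J sup by blast
        then have "eSuc (len R (C i <+> L) L + len R (C i \<inter> L) N) \<le>
           len R (C (Suc i) <+> L) L + len R (C (Suc i) \<inter> L) N" using l1
          by (metis add_mono iadd_Suc_right)
        then show ?thesis using IH by (metis eSuc_enat eSuc_ile_mono order_trans)
      next
        case False
        then have "C i <+> L \<subset> C (Suc i) <+> L" using m by blast
        then have "eSuc (len R (C i <+> L) L) \<le> len R (C (Suc i) <+> L) L"
          using len_Suc J sup by blast
        then have "eSuc (len R (C i <+> L) L + len R (C i \<inter> L) N) \<le>
           len R (C (Suc i) <+> L) L + len R (C (Suc i) \<inter> L) N" using l2
          by (metis add_mono iadd_Suc)
        then show ?thesis using IH by (metis eSuc_enat eSuc_ile_mono order_trans)
      qed
    qed (simp add: zero_enat_def[symmetric])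
    from this[of n] have "enat n \<le> len R (C n <+> L) L + len R (C n \<inter> L) N" by simp
    also have "\<dots> \<le> len R M L + len R L N"
      using id[of n] assms by (intro add_mono len_mono idl_sum_least) auto
    finally show "enat n \<le> len R M L + len R L N" .
  qed
  show "len R M L + len R L N \<le> len R M N"
  \<comment> \<open>The lower bound is brought into the form \<open>a \<le> c - b\<close> before
    taking the supremum over chains, and subtraction in \<open>enat\<close> can be undone only for
    finite \<open>b\<close>.\<close>
  proof (cases "len R L N = \<infinity>")
    case True
    then show ?thesis using len_mono[of N N L M] assms by simp
  next
    case False
    have "len R M L \<le> len R M N - len R L N"
      unfolding len_def[of R M L]
    proof (rule chain_length_le)
      fix n C assume C: "\<forall>i\<le>n. C i \<in> {X. ideal X R \<and> L \<subseteq> X \<and> X \<subseteq> M}"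
        "\<forall>i<n. C i \<subset> C (Suc i)"
      have "enat i + len R L N \<le> len R (C i) N" if "i \<le> n" for i
        using that
      proof (induction i)
        case 0
        then show ?case using C len_mono[of N N L "C 0"] by (auto simp: zero_enat_def[symmetric])
      next
        case (Suc i)
        have "eSuc (len R (C i) N) \<le> len R (C (Suc i)) N"
        proof (rule len_Suc)
          have "L \<subseteq> C i" using C Suc by simp
          then show "N \<subseteq> C i" using assms by blast
        qed (use C Suc in auto)
        moreover have "eSuc (enat i + len R L N) \<le> eSuc (len R (C i) N)" using Suc by simp
        ultimately have "eSuc (enat i + len R L N) \<le> len R (C (Suc i)) N" by (rule order_trans[rotated])
        then show ?case by (simp add: eSuc_enat[symmetric] iadd_Suc)
      qed
      from this[of n] have "enat n + len R L N \<le> len R (C n) N" by simp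
      also have "\<dots> \<le> len R M N" using C by (intro len_mono) auto
      finally show "enat n \<le> len R M N - len R L N"
        by (rule enat_le_diff[OF False])
    qed
    moreover have "len R L N \<le> len R M N" using len_mono[of N N L M] assms by simp
    ultimately show ?thesis
      by (intro enat_diff_le[OF False])
  qed
qed

text \<open>Multiplication by \<open>a\<close> identifies \<open>X/Y\<close> with \<open>(a X + W)/W\<close>; the case \<open>a = \<one>\<close> is the second
  isomorphism theorem.\<close>

lemma len_mult:
  assumes X: "ideal X R" and W: "ideal W R" and a: "a \<in> carrier R"
  shows "len R ((a \<odot>\<^sub>s X) <+> W) W = len R X (X \<inter> colon W a)"
proof (rule antisym)
  let ?Y = "X \<inter> colon W a"
  show "len R X ?Y \<le> len R ((a \<odot>\<^sub>s X) <+> W) W"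
    unfolding len_def
  proof (rule chain_length_mono_map[where f = "\<lambda>Z. (a \<odot>\<^sub>s Z) <+> W"])
    fix Z assume Z: "Z \<in> {L. ideal L R \<and> ?Y \<subseteq> L \<and> L \<subseteq> X}"
    then have "ideal (a \<odot>\<^sub>s Z) R" using a elt_mult_ideal by simp
    moreover have "(a \<odot>\<^sub>s Z) <+> W \<subseteq> (a \<odot>\<^sub>s X) <+> W"
      using Z by (intro idl_sum_mono elt_mult_mono) auto
    ultimately show "(a \<odot>\<^sub>s Z) <+> W \<in> {L. ideal L R \<and> W \<subseteq> L \<and> L \<subseteq> (a \<odot>\<^sub>s X) <+> W}"
      using W add_ideals idl_sum_upper(2) by simp
    fix Z' assume Z': "Z' \<in> {L. ideal L R \<and> ?Y \<subseteq> L \<and> L \<subseteq> X}" "Z \<subset> Z'"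
    then obtain z where z: "z \<in> Z'" "z \<notin> Z" by blast
    show "(a \<odot>\<^sub>s Z) <+> W \<subset> (a \<odot>\<^sub>s Z') <+> W"
    proof
      show "(a \<odot>\<^sub>s Z) <+> W \<subseteq> (a \<odot>\<^sub>s Z') <+> W"
        using Z' by (intro idl_sum_mono elt_mult_mono) auto
      have "a \<otimes> z \<in> (a \<odot>\<^sub>s Z') <+> W"
        using idl_sum_upper(1)[OF elt_mult_ideal[OF _ a] W, of Z'] elt_multI[OF z(1), of a] Z' by auto
      moreover have "a \<otimes> z \<notin> (a \<odot>\<^sub>s Z) <+> W"
      proof
        assume "a \<otimes> z \<in> (a \<odot>\<^sub>s Z) <+> W"
        then obtain u w where uw: "u \<in> Z" "w \<in> W" "a \<otimes> z = a \<otimes> u \<oplus> w"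
          by (auto elim!: idl_sumE elt_multE)
        have c: "u \<in> carrier R" "z \<in> carrier R" "w \<in> carrier R"
          using uw z Z Z' W idl_carr by blast+
        have "a \<otimes> (z \<ominus> u) = a \<otimes> z \<ominus> a \<otimes> u" using c a by algebra
        also have "\<dots> = w" unfolding uw(3) using c a by algebra
        finally have "a \<otimes> (z \<ominus> u) \<in> W" using uw by simp
        then have "z \<ominus> u \<in> ?Y" using uw z Z Z' c by (auto simp: colon_def intro!: idl_diff[OF X])
        then have "z \<ominus> u \<in> Z" using Z by blast
        then show False using idl_diff_cancel[of Z z u] z uw c Z by blast
      qed
      ultimately show "(a \<odot>\<^sub>s Z) <+> W \<noteq> (a \<odot>\<^sub>s Z') <+> W" by blast
    qed
  qed
  show "len R ((a \<odot>\<^sub>s X) <+> W) W \<le> len R X ?Y"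
    unfolding len_def
  \<comment> \<open>The inverse image of \<open>Z\<close> under multiplication by \<open>a\<close>.
    Strictness holds because every element of \<open>Z'\<close> has the form \<open>a x + w\<close>
    with \<open>w \<in> W\<close> already in \<open>Z\<close>.\<close>
  proof (rule chain_length_mono_map[where f = "\<lambda>Z. X \<inter> colon Z a"])
    fix Z assume Z: "Z \<in> {L. ideal L R \<and> W \<subseteq> L \<and> L \<subseteq> (a \<odot>\<^sub>s X) <+> W}"
    then show "X \<inter> colon Z a \<in> {L. ideal L R \<and> ?Y \<subseteq> L \<and> L \<subseteq> X}"
      using X a colon_ideal i_intersect by (auto simp: colon_def)
    fix Z' assume Z': "Z' \<in> {L. ideal L R \<and> W \<subseteq> L \<and> L \<subseteq> (a \<odot>\<^sub>s X) <+> W}" "Z \<subset> Z'"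
    then obtain z where z: "z \<in> Z'" "z \<notin> Z" by blast
    have "z \<in> (a \<odot>\<^sub>s X) <+> W" using z Z' by blast
    then obtain x w where xw: "x \<in> X" "w \<in> W" "z = a \<otimes> x \<oplus> w"
      by (elim idl_sumE elt_multE) blast
    have c: "x \<in> carrier R" "w \<in> carrier R" using xw X W idl_carr by blast+
    have "a \<otimes> x \<in> Z'" using idl_add_cancel[of Z' "a \<otimes> x" w] xw z Z' c a by blast
    moreover have "a \<otimes> x \<notin> Z" using xw z Z idl_add by blast
    ultimately have "x \<in> X \<inter> colon Z' a" "x \<notin> X \<inter> colon Z a" using xw c by (auto simp: colon_def)
    moreover have "X \<inter> colon Z a \<subseteq> X \<inter> colon Z' a" using Z' by (auto simp: colon_def)
    ultimately show "X \<inter> colon Z a \<subset> X \<inter> colon Z' a" by blast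
  qed
qed

lemma len_sum:
  assumes X: "ideal X R" and W: "ideal W R"
  shows "len R (X <+> W) W = len R X (X \<inter> W)"
proof -
  have "\<one> \<odot>\<^sub>s X = X" "X \<inter> colon W \<one> = X \<inter> W"
    using idl_carr[OF X] by (auto simp: elt_mult_def colon_def image_iff)
  then show ?thesis using len_mult[OF X W one_closed] by simp
qed

end

section \<open>Powers of ideals generated by regular sequences\<close>

context cring begin

definition regular_mod :: "'a set \<Rightarrow> 'a \<Rightarrow> bool" where
  "regular_mod P a \<longleftrightarrow> a \<in> carrier R \<and> (\<forall>x\<in>carrier R. a \<otimes> x \<in> P \<longrightarrow> x \<in> P)"

text \<open>\<open>P\<close> is generated by a weakly regular sequence of length \<open>i\<close>.
  Only the ideal is recorded, since every induction splits off the last generator.\<close>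

inductive regular_ideal :: "nat \<Rightarrow> 'a set \<Rightarrow> bool" where
  regular_ideal_0: "regular_ideal 0 {\<zero>}"
| regular_ideal_Suc: "\<lbrakk>regular_ideal i P; regular_mod P a\<rbrakk> \<Longrightarrow>
     regular_ideal (Suc i) (P <+> (a \<odot>\<^sub>s carrier R))"

lemma regular_modD: "\<lbrakk>regular_mod P a; x \<in> carrier R; a \<otimes> x \<in> P\<rbrakk> \<Longrightarrow> x \<in> P"
  and regular_mod_carrier: "regular_mod P a \<Longrightarrow> a \<in> carrier R"
  by (auto simp: regular_mod_def)

lemma principal_ideal: "a \<in> carrier R \<Longrightarrow> ideal (a \<odot>\<^sub>s carrier R) R"
  by (intro elt_mult_ideal oneideal)

lemma regular_ideal_ideal: "regular_ideal i P \<Longrightarrow> ideal P R"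
  by (induction rule: regular_ideal.induct)
     (auto simp: zeroideal regular_mod_def intro!: add_ideals elt_mult_ideal oneideal)

lemma zero_pow: "ideal_pow R {\<zero>} (Suc l) = {\<zero>}"
  using idl_pow_ideal[OF zeroideal] by (simp add: ideal_prod_zero)

lemma add_principal_pow_prod:
  assumes P: "ideal P R" and a: "a \<in> carrier R" and Q: "Q = P <+> (a \<odot>\<^sub>s carrier R)"
    and c: "ideal \<cc> R"
  shows "ideal_pow R Q (Suc l) \<cdot> \<cc> = (ideal_pow R P (Suc l) \<cdot> \<cc>) <+> (a \<odot>\<^sub>s (ideal_pow R Q l \<cdot> \<cc>))"
proof -
  have iQ: "ideal Q R" unfolding Q by (intro add_ideals P principal_ideal a)
  show ?thesis
    unfolding idl_pow_sum_principal[OF P a Q] elt_mult_prod[OF idl_pow_ideal[OF iQ] c a, symmetric]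
    by (intro ideal_prod_distr(2) c idl_pow_ideal P elt_mult_ideal a iQ)
qed

text \<open>Regularity of \<open>a\<close> modulo \<open>P^l\<close> puts \<open>w\<close> into
  \<open>P^l\<close>, and \<open>a \<in> \<cc>\<close> does the rest. In other words,
  \<open>P^l \<inter> (P^l\<cc> + aR) = P^l\<cc>\<close>.\<close>

lemma pow_prod_absorb:
  assumes P: "ideal P R" and c: "ideal \<cc> R" and "a \<in> \<cc>" "w \<in> carrier R"
    "regular_mod (ideal_pow R P l) a"
    "p \<in> ideal_pow R P l" "q \<in> ideal_pow R P l \<cdot> \<cc>" "p = q \<oplus> a \<otimes> w"
  shows "p \<in> ideal_pow R P l \<cdot> \<cc>"
proof -
  have i: "ideal (ideal_pow R P l) R" "ideal (ideal_pow R P l \<cdot> \<cc>) R"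
    using P c by (auto intro: idl_pow_ideal ideal_prod_is_ideal)
  have car: "p \<in> carrier R" "q \<in> carrier R" "a \<in> carrier R" using assms i idl_carr by blast+
  have q: "q \<in> ideal_pow R P l" using assms(7) idl_prod_sub(1)[OF i(1) c] by blast
  have "a \<otimes> w = p \<ominus> q" using assms(4,8) car by algebra
  then have "w \<in> ideal_pow R P l" using regular_modD[OF assms(5,4)] idl_diff[OF i(1) assms(6) q] by simp
  then have "w \<otimes> a \<in> ideal_pow R P l \<cdot> \<cc>" by (intro prod_in assms)
  then show ?thesis unfolding assms(8) using assms car m_comm i by (auto intro: idl_add)
qed

text \<open>Write \<open>a y = q + a z\<close> by the recursion for \<open>Q^(l+1)\<cc>\<close>.
  Then \<open>a (y - z)\<close> lies in \<open>P^(l+1)\<close>, so \<open>y - z\<close> does too,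
  and \<open>P^(l+1) \<subseteq> Q^l\<cc>\<close> because \<open>P \<subseteq> \<cc>\<close>.
  Together with the obvious converse, \<open>Q^(l+1)\<cc> : a = Q^l\<cc>\<close>.\<close>

lemma mult_pow_prod_cancel:
  assumes P: "ideal P R" and a: "regular_mod (ideal_pow R P (Suc l)) a"
    and Q: "Q = P <+> (a \<odot>\<^sub>s carrier R)"
    and c: "ideal \<cc> R" "Q \<subseteq> \<cc>" and y: "y \<in> carrier R" "a \<otimes> y \<in> ideal_pow R Q (Suc l) \<cdot> \<cc>"
  shows "y \<in> ideal_pow R Q l \<cdot> \<cc>"
proof -
  note a' = regular_mod_carrier[OF a]
  have iQ: "ideal Q R" unfolding Q by (intro add_ideals P principal_ideal a')
  have PQ: "P \<subseteq> Q" unfolding Q by (intro idl_sum_upper P principal_ideal a')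
  obtain q z where qz: "q \<in> ideal_pow R P (Suc l) \<cdot> \<cc>" "z \<in> ideal_pow R Q l \<cdot> \<cc>" "a \<otimes> y = q \<oplus> a \<otimes> z"
    using y(2) unfolding add_principal_pow_prod[OF P a' Q c(1)] by (elim idl_sumE elt_multE) blast
  have i: "ideal (ideal_pow R P (Suc l)) R" "ideal (ideal_pow R Q l \<cdot> \<cc>) R" "ideal (ideal_pow R P (Suc l) \<cdot> \<cc>) R"
    using P iQ c by (auto intro: idl_pow_ideal ideal_prod_is_ideal simp del: nat_pow_Suc)
  have car: "q \<in> carrier R" "z \<in> carrier R" using qz i idl_carr by blast+
  have "a \<otimes> (y \<ominus> z) = a \<otimes> y \<ominus> a \<otimes> z" using y car a' by algebra
  also have "\<dots> = q" unfolding qz(3) using car a' by algebra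
  also have "\<dots> \<in> ideal_pow R P (Suc l)" using qz idl_prod_sub(1)[OF i(1) c(1)] by blast
  finally have "y \<ominus> z \<in> ideal_pow R P (Suc l)" using regular_modD[OF a] y car by simp
  also have "\<dots> \<subseteq> ideal_pow R Q l \<cdot> \<cc>"
    unfolding idl_pow_Suc using PQ c by (intro idl_prod_mono idl_pow_mono) auto
  finally show ?thesis using idl_diff_cancel[OF i(2)] qz y by blast
qed

text \<open>The colon property is an assumption because the two facts are proved together: the
  property for \<open>P\<close> makes a new element regular modulo the powers of \<open>P\<close>,
  and this is needed to pass to \<open>P + bR\<close>. Taking \<open>\<cc> = P\<close>, where
  \<open>P : b = P\<close>, raises the power by one.\<close>

lemma regular_ideal_pow_colon_aux:
  assumes P: "ideal P R"
    and T: "\<And>\<cc> b l x. \<lbrakk>ideal \<cc> R; P \<subseteq> \<cc>; b \<in> carrier R; x \<in> ideal_pow R P l;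
        b \<otimes> x \<in> ideal_pow R P l \<cdot> \<cc>\<rbrakk> \<Longrightarrow> x \<in> ideal_pow R P l \<cdot> colon \<cc> b"
    and b: "regular_mod P b"
  shows "regular_mod (ideal_pow R P l) b"
proof (induction l)
  case 0
  then show ?case using b by (simp add: regular_mod_def)
next
  case (Suc l)
  note b' = regular_mod_carrier[OF b]
  have cP: "colon P b = P" using b P by (auto simp: regular_mod_def colon_def intro: idl_intros idl_carr)
  have "x \<in> ideal_pow R P (Suc l)" if x: "x \<in> carrier R" "b \<otimes> x \<in> ideal_pow R P (Suc l)" for x
  proof -
    have "b \<otimes> x \<in> ideal_pow R P l" using x idl_pow_antimono[OF P, of l "Suc l"] by fastforce
    then have "x \<in> ideal_pow R P l" using regular_modD[OF Suc] x by blast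
    then show ?thesis using T[OF P subset_refl b', of x l] x cP by simp
  qed
  then show ?case using b' by (auto simp: regular_mod_def)
qed

text \<open>\<open>P^l/P^l\<cc>\<close> is a free \<open>R/\<cc>\<close>-module on the monomials of
  degree \<open>l\<close>, and multiplication by \<open>b\<close> acts on each coefficient. The
  proof avoids monomials: the induction on generators treats \<open>p\<close> in
  \<open>x = p + a y\<close>, the one on \<open>l\<close> treats \<open>y\<close>.\<close>

lemma regular_ideal_pow_colon:
  assumes "regular_ideal i P" "ideal \<cc> R" "P \<subseteq> \<cc>" "b \<in> carrier R" "x \<in> ideal_pow R P l"
    "b \<otimes> x \<in> ideal_pow R P l \<cdot> \<cc>"
  shows "x \<in> ideal_pow R P l \<cdot> colon \<cc> b"
  using assms
proof (induction arbitrary: \<cc> b x l rule: regular_ideal.induct)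
  case regular_ideal_0
  have ci: "ideal (colon \<cc> b) R" using regular_ideal_0 by (intro colon_ideal)
  show ?case
  proof (cases l)
    case 0
    then show ?thesis using regular_ideal_0 ci by (simp add: carrier_prod colon_def)
  next
    case (Suc k)
    then have "x = \<zero>" using regular_ideal_0(4) unfolding Suc zero_pow by simp
    then show ?thesis using ci by (auto intro!: idl_zero ideal_prod_is_ideal idl_pow_ideal zeroideal)
  qed
next
  case (regular_ideal_Suc i P a)
  note P = regular_ideal_ideal[OF regular_ideal_Suc.hyps(1)]
  note a = regular_ideal_Suc.hyps(2)
  note a' = regular_mod_carrier[OF a]
  define Q where Q: "Q = P <+> (a \<odot>\<^sub>s carrier R)"
  have iQ: "ideal Q R" unfolding Q by (intro add_ideals P principal_ideal a')
  have PQ: "P \<subseteq> Q" "a \<in> Q"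
    using idl_sum_upper[OF P principal_ideal[OF a']] elt_mult_self[OF a'] Q by auto
  have T: "\<And>\<cc> b l x. \<lbrakk>ideal \<cc> R; P \<subseteq> \<cc>; b \<in> carrier R; x \<in> ideal_pow R P l;
        b \<otimes> x \<in> ideal_pow R P l \<cdot> \<cc>\<rbrakk> \<Longrightarrow> x \<in> ideal_pow R P l \<cdot> colon \<cc> b"
    by (rule regular_ideal_Suc.IH)
  note reg = regular_ideal_pow_colon_aux[OF P T a]
  have "x \<in> ideal_pow R Q l \<cdot> colon \<cc> b"
    if "ideal \<cc> R" "Q \<subseteq> \<cc>" "b \<in> carrier R" "x \<in> ideal_pow R Q l" "b \<otimes> x \<in> ideal_pow R Q l \<cdot> \<cc>" for l x \<cc> b
    using that
  proof (induction l arbitrary: x)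
    case 0
    then show ?case using colon_ideal by (simp add: carrier_prod colon_def)
  next
    case (Suc l)
    note c = Suc.prems(1,2)
    obtain p y where py: "p \<in> ideal_pow R P (Suc l)" "y \<in> ideal_pow R Q l" "x = p \<oplus> a \<otimes> y"
      using Suc.prems(4) unfolding idl_pow_sum_principal[OF P a' Q] by (elim idl_sumE elt_multE) blast
    obtain q z where qz: "q \<in> ideal_pow R P (Suc l) \<cdot> \<cc>" "z \<in> ideal_pow R Q l \<cdot> \<cc>" "b \<otimes> x = q \<oplus> a \<otimes> z"
      using Suc.prems(5) unfolding add_principal_pow_prod[OF P a' Q c(1)] by (elim idl_sumE elt_multE) blast
    have i: "ideal (ideal_pow R P (Suc l)) R" "ideal (ideal_pow R Q l \<cdot> \<cc>) R" "ideal (ideal_pow R P (Suc l) \<cdot> \<cc>) R"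
      "ideal (ideal_pow R Q l) R" "ideal (ideal_pow R Q (Suc l) \<cdot> \<cc>) R"
      using P iQ c by (auto intro: idl_pow_ideal ideal_prod_is_ideal simp del: nat_pow_Suc)
    have car: "p \<in> carrier R" "y \<in> carrier R" "q \<in> carrier R" "z \<in> carrier R" "b \<in> carrier R" "x \<in> carrier R"
      using Suc.prems(3) py qz i a' idl_carr by auto
    have ac: "a \<in> \<cc>" "P \<subseteq> \<cc>" using PQ c by auto
    \<comment> \<open>The part of \<open>b x\<close> without \<open>a\<close> is isolated, so that
      it can be absorbed into \<open>P^(l+1)\<cc>\<close> and treated by the outer induction; what
      remains is \<open>a (b y)\<close>, from which \<open>a\<close> cancels.\<close>
    have eq: "b \<otimes> p = q \<oplus> a \<otimes> (z \<ominus> b \<otimes> y)"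
    proof -
      have "b \<otimes> p = b \<otimes> x \<ominus> a \<otimes> (b \<otimes> y)" unfolding py(3) using car a' by algebra
      also have "\<dots> = q \<oplus> a \<otimes> (z \<ominus> b \<otimes> y)" unfolding qz(3) using car a' by algebra
      finally show ?thesis .
    qed
    have bp: "b \<otimes> p \<in> ideal_pow R P (Suc l) \<cdot> \<cc>"
      by (rule pow_prod_absorb[OF P c(1) ac(1) _ reg _ qz(1) eq]) (use car py i in \<open>auto intro!: idl_lmult\<close>)
    then have p: "p \<in> ideal_pow R P (Suc l) \<cdot> colon \<cc> b" using T[OF c(1) ac(2) Suc.prems(3) py(1)] by simp
    have mono: "ideal_pow R P (Suc l) \<cdot> \<dd> \<subseteq> ideal_pow R Q (Suc l) \<cdot> \<dd>" for \<dd>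
      by (intro idl_prod_mono idl_pow_mono PQ subset_refl)
    have "a \<otimes> (b \<otimes> y) = b \<otimes> x \<ominus> b \<otimes> p" unfolding py(3) using car a' by algebra
    also have "\<dots> \<in> ideal_pow R Q (Suc l) \<cdot> \<cc>" using Suc.prems(5) bp mono i by (blast intro: idl_diff)
    finally have "b \<otimes> y \<in> ideal_pow R Q l \<cdot> \<cc>"
      using mult_pow_prod_cancel[OF P reg Q c] car by simp
    then have "y \<in> ideal_pow R Q l \<cdot> colon \<cc> b" using Suc.IH[OF c Suc.prems(3) py(2)] by simp
    then have "a \<otimes> y \<in> ideal_pow R Q (Suc l) \<cdot> colon \<cc> b"
      unfolding add_principal_pow_prod[OF P a' Q colon_ideal[OF c(1) Suc.prems(3)]]
      using idl_sum_upper(2) elt_multI i colon_ideal[OF c(1) Suc.prems(3)] a'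
      by (meson elt_mult_ideal ideal_prod_is_ideal subsetD)
    moreover have "ideal (ideal_pow R Q (Suc l) \<cdot> colon \<cc> b) R"
      by (intro ideal_prod_is_ideal idl_pow_ideal iQ colon_ideal c Suc.prems(3))
    ultimately show ?case unfolding py(3) using p mono by (blast intro: idl_add)
  qed
  then show ?case using regular_ideal_Suc.prems unfolding Q by blast
qed

lemma regular_mod_pow:
  assumes "regular_ideal i P" "regular_mod P b"
  shows "regular_mod (ideal_pow R P l) b"
  using regular_ideal_pow_colon_aux[OF regular_ideal_ideal[OF assms(1)] _ assms(2)]
    regular_ideal_pow_colon[OF assms(1)] by blast

text \<open>The associated graded ring of \<open>P\<close> modulo \<open>\<pp>\<close> is a
  polynomial ring over the domain \<open>R/\<pp>\<close>, hence a domain. In the induction the parts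
  free of the last generator \<open>a\<close> have a product in \<open>P^(l+k)\<pp>\<close>; one of
  them is therefore negligible, and \<open>a\<close> can be cancelled from the rest.\<close>

lemma regular_ideal_pow_prime:
  assumes "regular_ideal i P" "primeideal \<pp> R" "P \<subseteq> \<pp>" "x \<in> ideal_pow R P l" "y \<in> ideal_pow R P k"
    "x \<otimes> y \<in> ideal_pow R P (l + k) \<cdot> \<pp>"
  shows "x \<in> ideal_pow R P l \<cdot> \<pp> \<or> y \<in> ideal_pow R P k \<cdot> \<pp>"
  using assms
proof (induction arbitrary: x y l k rule: regular_ideal.induct)
  case (regular_ideal_0 x y l k)
  have p: "ideal \<pp> R" using regular_ideal_0(1) primeideal.axioms(1) by blast
  have z: "x \<in> ideal_pow R {\<zero>} l \<cdot> \<pp>" if "x \<in> ideal_pow R {\<zero>} l" "l \<noteq> 0" for x l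
  proof -
    have "x = \<zero>" using that zero_pow[of "l - 1"] by (cases l) auto
    then show ?thesis using p by (auto intro!: idl_zero ideal_prod_is_ideal idl_pow_ideal zeroideal)
  qed
  show ?case
  proof (cases "l = 0 \<and> k = 0")
    case True
    then show ?thesis using regular_ideal_0 p by (auto simp: carrier_prod dest: primeideal.I_prime)
  next
    case False
    then show ?thesis using z regular_ideal_0 by blast
  qed
next
  case (regular_ideal_Suc i P a)
  note rP = regular_ideal_Suc.hyps(1)
  note P = regular_ideal_ideal[OF rP]
  note a = regular_ideal_Suc.hyps(2)
  note a' = regular_mod_carrier[OF a]
  define Q where Q: "Q = P <+> (a \<odot>\<^sub>s carrier R)"
  have rQ: "regular_ideal (Suc i) Q" unfolding Q by (rule regular_ideal.intros(2)[OF rP a])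
  have iQ: "ideal Q R" by (rule regular_ideal_ideal[OF rQ])
  have PQ: "P \<subseteq> Q" "a \<in> Q"
    using idl_sum_upper[OF P principal_ideal[OF a']] elt_mult_self[OF a'] Q by auto
  note reg = regular_mod_pow[OF rP a]
  have p: "ideal \<pp> R" using regular_ideal_Suc(4) primeideal.axioms(1) by blast
  have Qp: "Q \<subseteq> \<pp>" "a \<in> \<pp>" "P \<subseteq> \<pp>" using regular_ideal_Suc.prems(2) PQ unfolding Q by auto
  have colp: "colon \<pp> b = \<pp>" if "b \<in> carrier R" "b \<notin> \<pp>" for b
    using that p primeideal.I_prime[OF regular_ideal_Suc(4)]
    by (auto simp: colon_def intro: idl_intros idl_carr)
  have mono: "ideal_pow R P l \<cdot> \<dd> \<subseteq> ideal_pow R Q l \<cdot> \<dd>" for \<dd> l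
    by (intro idl_prod_mono idl_pow_mono PQ subset_refl)
  have idQ: "ideal (ideal_pow R Q l \<cdot> \<pp>) R" "ideal (ideal_pow R Q l) R" "ideal (ideal_pow R P l) R" for l
    using p iQ P by (auto intro: idl_pow_ideal ideal_prod_is_ideal simp del: nat_pow_Suc)
  \<comment> \<open>If the part of \<open>x\<close> free of \<open>a\<close> is already in
    \<open>P^(l+1)\<pp>\<close>, then \<open>x\<close> may be replaced by \<open>x'\<close>, which
    lowers the total degree by one.\<close>
  have step: "x' \<otimes> y \<in> ideal_pow R Q (l + k) \<cdot> \<pp>"
    if "x \<in> ideal_pow R Q (Suc l)" "y \<in> ideal_pow R Q k" "x \<otimes> y \<in> ideal_pow R Q (Suc l + k) \<cdot> \<pp>"
      "q \<in> ideal_pow R P (Suc l) \<cdot> \<pp>" "x' \<in> ideal_pow R Q l" "x = q \<oplus> a \<otimes> x'" for x y q x' l k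
  proof -
    have car: "x' \<in> carrier R" "y \<in> carrier R" "q \<in> carrier R"
      using that idQ idl_carr ideal_prod_in_carrier[OF idQ(3) p] by blast+
    have "q \<in> ideal_pow R Q (Suc l) \<cdot> \<pp>" using mono that by blast
    then have "y \<otimes> q \<in> ideal_pow R Q k \<cdot> (ideal_pow R Q (Suc l) \<cdot> \<pp>)" using that by (intro prod_in)
    also have "\<dots> = ideal_pow R Q (k + Suc l) \<cdot> \<pp>"
      by (simp only: idl_pow_add[OF iQ, of k "Suc l"] ideal_prod_assoc[OF idQ(2) idQ(2) p])
    finally have yq: "y \<otimes> q \<in> ideal_pow R Q (Suc l + k) \<cdot> \<pp>" by (simp only: add.commute)
    have "a \<otimes> (x' \<otimes> y) = x \<otimes> y \<ominus> y \<otimes> q" unfolding that(6) using car a' by algebra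
    then have "a \<otimes> (x' \<otimes> y) \<in> ideal_pow R Q (Suc (l + k)) \<cdot> \<pp>"
      using idl_diff[OF idQ(1) that(3) yq] by simp
    then show ?thesis using mult_pow_prod_cancel[OF P reg Q p Qp(1), of "x' \<otimes> y" "l + k"] car by blast
  qed
  have lift: "x \<in> ideal_pow R Q (Suc l) \<cdot> \<pp>"
    if "q \<in> ideal_pow R P (Suc l) \<cdot> \<pp>" "x' \<in> ideal_pow R Q l \<cdot> \<pp>" "x = q \<oplus> a \<otimes> x'" for q x x' l
    unfolding add_principal_pow_prod[OF P a' Q p] that(3) using that by (intro idl_sumI elt_multI)
  have "x \<in> ideal_pow R Q l \<cdot> \<pp> \<or> y \<in> ideal_pow R Q k \<cdot> \<pp>"
    if "x \<in> ideal_pow R Q l" "y \<in> ideal_pow R Q k" "x \<otimes> y \<in> ideal_pow R Q (l + k) \<cdot> \<pp>" for x y l k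
    using that
  proof (induction "l + k" arbitrary: l k x y rule: less_induct)
    case less
    have car: "x \<in> carrier R" "y \<in> carrier R" using less.prems idQ idl_carr by blast+
    show ?case
    proof (cases l)
      case 0
      show ?thesis
      \<comment> \<open>In degree zero \<open>x\<close> is a scalar; if it is outside
        \<open>\<pp>\<close>, then \<open>\<pp> : x = \<pp>\<close> and the colon property applies
        to \<open>y\<close>.\<close>
      proof (cases "x \<in> \<pp>")
        case False
        then show ?thesis using regular_ideal_pow_colon[OF rQ p Qp(1) car(1) less.prems(2)] less.prems(3) colp car 0
          by simp
      qed (use 0 p in \<open>simp add: carrier_prod\<close>)
    next
      case (Suc l')
      show ?thesis
      proof (cases k)
        case 0
        show ?thesis
        proof (cases "y \<in> \<pp>")
          case False
          then show ?thesis using regular_ideal_pow_colon[OF rQ p Qp(1) car(2) less.prems(1)] less.prems(3) colp car 0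
            by (simp add: m_comm)
        qed (use 0 p in \<open>simp add: carrier_prod\<close>)
      next
        case k: (Suc k')
        obtain u x' where x: "u \<in> ideal_pow R P (Suc l')" "x' \<in> ideal_pow R Q l'" "x = u \<oplus> a \<otimes> x'"
          using less.prems(1) unfolding Suc idl_pow_sum_principal[OF P a' Q] by (elim idl_sumE elt_multE) blast
        obtain v y' where y: "v \<in> ideal_pow R P (Suc k')" "y' \<in> ideal_pow R Q k'" "y = v \<oplus> a \<otimes> y'"
          using less.prems(2) unfolding k idl_pow_sum_principal[OF P a' Q] by (elim idl_sumE elt_multE) blast
        have lk: "l + k = Suc (Suc l' + k')" using Suc k by simp
        obtain q z where qz: "q \<in> ideal_pow R P (l + k) \<cdot> \<pp>" "z \<in> ideal_pow R Q (Suc l' + k') \<cdot> \<pp>"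
            "x \<otimes> y = q \<oplus> a \<otimes> z"
          using less.prems(3) unfolding lk add_principal_pow_prod[OF P a' Q p] by (elim idl_sumE elt_multE) blast
        have car': "u \<in> carrier R" "v \<in> carrier R" "x' \<in> carrier R" "y' \<in> carrier R" "q \<in> carrier R" "z \<in> carrier R"
          using x y qz idQ idl_carr ideal_prod_in_carrier[OF idQ(3) p] by blast+
        have "u \<otimes> v = x \<otimes> y \<ominus> a \<otimes> (u \<otimes> y' \<oplus> x' \<otimes> v \<oplus> a \<otimes> (x' \<otimes> y'))"
          unfolding x(3) y(3) using car' a' by algebra
        also have "\<dots> = q \<oplus> a \<otimes> (z \<ominus> (u \<otimes> y' \<oplus> x' \<otimes> v \<oplus> a \<otimes> (x' \<otimes> y')))"
          unfolding qz(3) using car' a' by algebra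
        finally have eq: "u \<otimes> v = \<dots>" .
        have uv: "u \<otimes> v \<in> ideal_pow R P (l + k)"
          unfolding idl_pow_add[OF P] Suc k using x y by (intro prod_in)
        have "u \<otimes> v \<in> ideal_pow R P (l + k) \<cdot> \<pp>"
          by (rule pow_prod_absorb[OF P p Qp(2) _ reg uv qz(1) eq]) (use car' a' in simp)
        then have "u \<in> ideal_pow R P l \<cdot> \<pp> \<or> v \<in> ideal_pow R P k \<cdot> \<pp>"
          using regular_ideal_Suc.IH[OF regular_ideal_Suc.prems(1) Qp(3), of u l v k] x y Suc k by blast
        then show ?thesis
        proof
          assume u: "u \<in> ideal_pow R P l \<cdot> \<pp>"
          then have "x' \<otimes> y \<in> ideal_pow R Q (l' + k) \<cdot> \<pp>"
            using step[of x l' y k u x'] less.prems x Suc by blast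
          then have "x' \<in> ideal_pow R Q l' \<cdot> \<pp> \<or> y \<in> ideal_pow R Q k \<cdot> \<pp>"
            using less.hyps[of l' k x' y] x less.prems Suc by simp
          then show ?thesis using lift[OF _ _ x(3)] u Suc by blast
        next
          assume v: "v \<in> ideal_pow R P k \<cdot> \<pp>"
          have "y \<otimes> x \<in> ideal_pow R Q (Suc k' + l) \<cdot> \<pp>"
            using less.prems(3) car k by (simp add: m_comm add.commute del: nat_pow_Suc)
          then have "y' \<otimes> x \<in> ideal_pow R Q (k' + l) \<cdot> \<pp>"
            using step[of y k' x l v y'] less.prems y k v by blast
          then have "y' \<in> ideal_pow R Q k' \<cdot> \<pp> \<or> x \<in> ideal_pow R Q l \<cdot> \<pp>"
            using less.hyps[of k' l y' x] y less.prems k by simp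
          then show ?thesis using lift[OF _ _ y(3)] v k by blast
        qed
      qed
    qed
  qed
  then show ?case using regular_ideal_Suc.prems unfolding Q by blast
qed

text \<open>The binomial counts monomials of degree \<open>l\<close> in \<open>i\<close> variables.
  The ideal \<open>L = aQ^l + Q^(l+1)\<cc>\<close> splits \<open>Q^(l+1)/Q^(l+1)\<cc>\<close> into a
  copy of \<open>Q^l/Q^l\<cc>\<close>, by multiplication by \<open>a\<close>, and
  \<open>P^(l+1)/P^(l+1)\<cc>\<close>, so the counts add by Pascal's rule.\<close>

lemma len_regular_pow:
  assumes "regular_ideal i P" "ideal \<cc> R" "P \<subseteq> \<cc>" "len R (carrier R) \<cc> = enat c"
  shows "len R (ideal_pow R P l) (ideal_pow R P l \<cdot> \<cc>) = enat (c * ((l + i - 1) choose l))"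
  using assms(1,3)
proof (induction arbitrary: l rule: regular_ideal.induct)
  case regular_ideal_0
  show ?case
  \<comment> \<open>For \<open>i = 0\<close> truncated subtraction gives
    \<open>(l - 1) choose l\<close>, which is 1 for \<open>l = 0\<close> and 0 otherwise, as it
    should be.\<close>
  proof (cases l)
    case 0
    then show ?thesis using assms by (simp add: carrier_prod)
  next
    case (Suc k)
    have "{\<zero>} \<cdot> \<cc> = {\<zero>}" using ideal_prod_zero[OF assms(2)] ideal_prod_commute[OF assms(2) zeroideal] by simp
    moreover have "len R {\<zero>} {\<zero>} = 0" using len_0_iff[OF zeroideal zeroideal] by simp
    ultimately show ?thesis unfolding Suc zero_pow by (simp add: zero_enat_def)
  qed
next
  case (regular_ideal_Suc i P a)
  note rP = regular_ideal_Suc.hyps(1)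
  note P = regular_ideal_ideal[OF rP]
  note a = regular_ideal_Suc.hyps(2)
  note a' = regular_mod_carrier[OF a]
  note c = assms(2)
  define Q where Q: "Q = P <+> (a \<odot>\<^sub>s carrier R)"
  have iQ: "ideal Q R" unfolding Q by (intro add_ideals P principal_ideal a')
  have PQ: "P \<subseteq> Q" "a \<in> Q"
    using idl_sum_upper[OF P principal_ideal[OF a']] elt_mult_self[OF a'] Q by auto
  note reg = regular_mod_pow[OF rP a]
  have Qc: "Q \<subseteq> \<cc>" "a \<in> \<cc>" "P \<subseteq> \<cc>" using regular_ideal_Suc.prems PQ unfolding Q by auto
  have "len R (ideal_pow R Q l) (ideal_pow R Q l \<cdot> \<cc>) = enat (c * ((l + i) choose l))" for l
  proof (induction l)
    case 0
    then show ?case using assms by (simp add: carrier_prod)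
  next
    case (Suc l)
    define X where "X = ideal_pow R Q (Suc l)"
    define W where "W = ideal_pow R Q (Suc l) \<cdot> \<cc>"
    define L where "L = (a \<odot>\<^sub>s ideal_pow R Q l) <+> W"
    define Y where "Y = ideal_pow R P (Suc l)"
    have i: "ideal X R" "ideal W R" "ideal (a \<odot>\<^sub>s ideal_pow R Q l) R" "ideal Y R" "ideal (ideal_pow R Q l) R"
      "ideal (Y \<cdot> \<cc>) R" "ideal (a \<odot>\<^sub>s (ideal_pow R Q l \<cdot> \<cc>)) R"
      unfolding X_def W_def Y_def
      by (intro idl_pow_ideal iQ P ideal_prod_is_ideal elt_mult_ideal a' c)+
    have iL: "ideal L R" unfolding L_def by (intro add_ideals i)
    have Xe: "X = Y <+> (a \<odot>\<^sub>s ideal_pow R Q l)" unfolding X_def Y_def by (rule idl_pow_sum_principal[OF P a' Q])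
    have We: "W = (Y \<cdot> \<cc>) <+> (a \<odot>\<^sub>s (ideal_pow R Q l \<cdot> \<cc>))" unfolding W_def Y_def by (rule add_principal_pow_prod[OF P a' Q c])
    have WX: "W \<subseteq> X" unfolding W_def X_def by (intro idl_prod_sub idl_pow_ideal iQ c)
    have WL: "W \<subseteq> L" "a \<odot>\<^sub>s ideal_pow R Q l \<subseteq> L" unfolding L_def using i by (intro idl_sum_upper; simp)+
    have YX: "Y \<subseteq> X" "a \<odot>\<^sub>s ideal_pow R Q l \<subseteq> X" unfolding Xe using i by (intro idl_sum_upper; simp)+
    have LX: "L \<subseteq> X" unfolding L_def by (intro idl_sum_least i WX YX)
    have XL: "Y <+> L = X"
      using YX LX WL Xe by (intro subset_antisym idl_sum_least i) (simp_all add: idl_sum_mono)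
    have 1: "len R L W = len R (ideal_pow R Q l) (ideal_pow R Q l \<cdot> \<cc>)"
    proof -
      have "ideal_pow R Q l \<inter> colon W a = ideal_pow R Q l \<cdot> \<cc>"
      proof
        show "ideal_pow R Q l \<inter> colon W a \<subseteq> ideal_pow R Q l \<cdot> \<cc>"
          using mult_pow_prod_cancel[OF P reg Q c Qc(1)] unfolding W_def by (auto simp: colon_def simp del: nat_pow_Suc)
        have "a \<otimes> x \<in> W" if "x \<in> ideal_pow R Q l \<cdot> \<cc>" for x
          using elt_multI[OF that, of a] idl_sum_upper(2)[OF i(6,7)] unfolding We by blast
        then show "ideal_pow R Q l \<cdot> \<cc> \<subseteq> ideal_pow R Q l \<inter> colon W a"
          using idl_prod_sub(1)[OF i(5) c] idl_carr[OF i(5)] by (auto simp: colon_def)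
      qed
      then show ?thesis unfolding L_def using len_mult[OF i(5,2) a'] by simp
    qed
    have 2: "len R X L = len R Y (Y \<cdot> \<cc>)"
    proof -
      have "Y \<inter> L = Y \<cdot> \<cc>"
      proof
        show "Y \<cdot> \<cc> \<subseteq> Y \<inter> L"
          using idl_prod_sub(1)[OF i(4) c] idl_sum_upper(1)[OF i(6,7)] WL unfolding We by blast
        show "Y \<inter> L \<subseteq> Y \<cdot> \<cc>"
        proof
          fix p assume p: "p \<in> Y \<inter> L"
          then obtain w q z where "w \<in> ideal_pow R Q l" "q \<in> Y \<cdot> \<cc>" "z \<in> ideal_pow R Q l \<cdot> \<cc>" "p = a \<otimes> w \<oplus> (q \<oplus> a \<otimes> z)"
            unfolding L_def We by (elim IntE idl_sumE elt_multE) blast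
          moreover from this have car: "w \<in> carrier R" "q \<in> carrier R" "z \<in> carrier R"
            using i idl_carr ideal_prod_in_carrier[OF i(5) c] by blast+
          ultimately have "p = q \<oplus> a \<otimes> (w \<oplus> z)" "q \<in> Y \<cdot> \<cc>" using a' by algebra+
          then show "p \<in> Y \<cdot> \<cc>"
            using pow_prod_absorb[OF P c Qc(2) _ reg, of "w \<oplus> z" p "Suc l" q] p car unfolding Y_def by blast
        qed
      qed
      then show ?thesis using len_sum[OF i(4) iL] XL by simp
    qed
    have "len R X W = len R X L + len R L W" by (rule len_add[OF i(1) iL i(2) WL(1) LX])
    also have "\<dots> = enat (c * ((Suc l + i - 1) choose Suc l)) + enat (c * ((l + i) choose l))"
      unfolding 1 2 Y_def Suc using regular_ideal_Suc.IH[OF Qc(3), of "Suc l"] by simp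
    also have "\<dots> = enat (c * ((Suc l + i) choose Suc l))" by (simp add: distrib_left)
    finally show ?case unfolding X_def W_def .
  qed
  then show ?case unfolding Q by simp
qed

end

section \<open>Quotient modules\<close>

lemma (in module) submodule_abelian_subgroup:
  assumes "submodule N R M"
  shows "abelian_subgroup N M"
  by (intro abelian_subgroupI3 additive_subgroupI submodule.axioms(1)[OF assms]) unfold_locales

context module begin

lemma submodule_sub: "submodule N R M \<Longrightarrow> N \<subseteq> carrier M"
  using submoduleE(1) .

lemma submodule_carr: "\<lbrakk>submodule N R M; x \<in> N\<rbrakk> \<Longrightarrow> x \<in> carrier M"
  using submoduleE(1) by blast

lemma submodule_zero: "submodule N R M \<Longrightarrow> \<zero>\<^bsub>M\<^esub> \<in> N"
  using abelian_subgroup.axioms(1)[OF submodule_abelian_subgroup] additive_subgroup.zero_closed by blast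

lemma submodule_diff_cancel:
  assumes "submodule N R M" "x \<ominus>\<^bsub>M\<^esub> y \<in> N" "y \<in> N" "x \<in> carrier M"
  shows "x \<in> N"
proof -
  have y: "y \<in> carrier M" using submodule_carr assms by blast
  have "(x \<ominus>\<^bsub>M\<^esub> y) \<oplus>\<^bsub>M\<^esub> y = x"
    unfolding a_minus_def using assms(4) y by (simp add: M.a_assoc M.l_neg)
  then show ?thesis using submoduleE(5)[OF assms(1-3)] by simp
qed

lemma submoduleI':
  assumes "H \<subseteq> carrier M" "\<zero>\<^bsub>M\<^esub> \<in> H" "\<And>a b. \<lbrakk>a \<in> H; b \<in> H\<rbrakk> \<Longrightarrow> a \<oplus>\<^bsub>M\<^esub> b \<in> H"
    "\<And>a x. \<lbrakk>a \<in> carrier R; x \<in> H\<rbrakk> \<Longrightarrow> a \<odot>\<^bsub>M\<^esub> x \<in> H"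
  shows "submodule H R M"
proof (rule submoduleI)
  fix a assume a: "a \<in> H"
  have "(\<ominus> \<one>) \<odot>\<^bsub>M\<^esub> a = \<ominus>\<^bsub>M\<^esub> a" using a assms(1) smult_l_minus[OF R.one_closed] by auto
  then show "\<ominus>\<^bsub>M\<^esub> a \<in> H" using assms(4)[of "\<ominus> \<one>" a] a by simp
qed (use assms in auto)

lemma coset_eq_iff:
  assumes "submodule N R M" "x \<in> carrier M" "y \<in> carrier M"
  shows "N +>\<^bsub>M\<^esub> x = N +>\<^bsub>M\<^esub> y \<longleftrightarrow> x \<ominus>\<^bsub>M\<^esub> y \<in> N"
proof -
  interpret N: abelian_subgroup N M by (rule submodule_abelian_subgroup[OF assms(1)])
  have "N +>\<^bsub>M\<^esub> x = N +>\<^bsub>M\<^esub> y \<longleftrightarrow> x \<in> N +>\<^bsub>M\<^esub> y"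
    using N.a_rcos_self[OF assms(2)] N.a_repr_independence'[OF _ assms(3)] by blast
  then show ?thesis using N.a_rcos_module[OF assms(3,2)] by (simp add: a_minus_def)
qed

lemma coset_self: "\<lbrakk>submodule N R M; x \<in> carrier M\<rbrakk> \<Longrightarrow> x \<in> N +>\<^bsub>M\<^esub> x"
  using abelian_subgroup.a_rcos_self[OF submodule_abelian_subgroup] by blast

lemma mem_coset_iff:
  assumes "submodule N R M" "x \<in> carrier M"
  shows "y \<in> N +>\<^bsub>M\<^esub> x \<longleftrightarrow> y \<in> carrier M \<and> y \<ominus>\<^bsub>M\<^esub> x \<in> N"
proof -
  interpret N: abelian_subgroup N M by (rule submodule_abelian_subgroup[OF assms(1)])
  show ?thesis
  proof (cases "y \<in> carrier M")
    case True
    then show ?thesis using N.a_rcos_module[OF assms(2)] by (simp add: a_minus_def)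
  next
    case False
    then show ?thesis using N.a_elemrcos_carrier[OF assms(2)] by blast
  qed
qed

lemma quot_carrier: "carrier (quot_module M N) = (\<lambda>x. N +>\<^bsub>M\<^esub> x) ` carrier M"
  by (auto simp: quot_module_def A_RCOSETS_def')

lemma quot_zero: "\<zero>\<^bsub>quot_module M N\<^esub> = N"
  by (simp add: quot_module_def)

lemma coset_zero: "submodule N R M \<Longrightarrow> N +>\<^bsub>M\<^esub> \<zero>\<^bsub>M\<^esub> = N"
  using submodule_sub M.a_coset_add_zero by blast

lemma quot_add:
  assumes "submodule N R M" "x \<in> carrier M" "y \<in> carrier M"
  shows "(N +>\<^bsub>M\<^esub> x) \<oplus>\<^bsub>quot_module M N\<^esub> (N +>\<^bsub>M\<^esub> y) = N +>\<^bsub>M\<^esub> (x \<oplus>\<^bsub>M\<^esub> y)"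
  using abelian_subgroup.a_rcos_sum[OF submodule_abelian_subgroup[OF assms(1)] assms(2,3)]
  by (simp add: quot_module_def)

text \<open>The union in the definition of \<open>quot_module\<close> runs over all representatives;
  each contributes the same coset.\<close>

lemma quot_smult:
  assumes N: "submodule N R M" and r: "r \<in> carrier R" and x: "x \<in> carrier M"
  shows "r \<odot>\<^bsub>quot_module M N\<^esub> (N +>\<^bsub>M\<^esub> x) = N +>\<^bsub>M\<^esub> (r \<odot>\<^bsub>M\<^esub> x)"
proof -
  have *: "N +>\<^bsub>M\<^esub> (r \<odot>\<^bsub>M\<^esub> y) = N +>\<^bsub>M\<^esub> (r \<odot>\<^bsub>M\<^esub> x)" if "y \<in> N +>\<^bsub>M\<^esub> x" for y
  proof -
    have y: "y \<in> carrier M" "y \<ominus>\<^bsub>M\<^esub> x \<in> N" using that mem_coset_iff[OF N x] by auto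
    have "r \<odot>\<^bsub>M\<^esub> y \<ominus>\<^bsub>M\<^esub> r \<odot>\<^bsub>M\<^esub> x = r \<odot>\<^bsub>M\<^esub> (y \<ominus>\<^bsub>M\<^esub> x)"
      using r x y by (simp add: a_minus_def smult_r_distr smult_r_minus)
    then show ?thesis using coset_eq_iff[OF N] submoduleE(4)[OF N r y(2)] r x y by simp
  qed
  have "(\<Union>y\<in>N +>\<^bsub>M\<^esub> x. N +>\<^bsub>M\<^esub> (r \<odot>\<^bsub>M\<^esub> y)) = N +>\<^bsub>M\<^esub> (r \<odot>\<^bsub>M\<^esub> x)"
    by (rule SUP_eq_const) (use coset_self[OF N x] in blast, rule *)
  then show ?thesis by (simp add: quot_module_def)
qed

lemma quot_cases:
  assumes "x \<in> carrier (quot_module M N)"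
  obtains u where "u \<in> carrier M" "x = N +>\<^bsub>M\<^esub> u"
  using assms unfolding quot_carrier by blast

lemma coset_closed: "u \<in> carrier M \<Longrightarrow> N +>\<^bsub>M\<^esub> u \<in> carrier (quot_module M N)"
  unfolding quot_carrier by blast

lemma quot_is_module:
  assumes N: "submodule N R M"
  shows "module R (quot_module M N)"
proof (rule moduleI[OF R.is_cring])
  let ?Q = "quot_module M N"
  note qa = quot_add[OF N] and qs = quot_smult[OF N]
  show "abelian_group ?Q"
  proof (rule abelian_groupI)
    fix x assume "x \<in> carrier ?Q"
    then obtain u where u: "u \<in> carrier M" "x = N +>\<^bsub>M\<^esub> u" by (rule quot_cases)
    have "(N +>\<^bsub>M\<^esub> (\<ominus>\<^bsub>M\<^esub> u)) \<oplus>\<^bsub>?Q\<^esub> x = \<zero>\<^bsub>?Q\<^esub>"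
      unfolding u(2) quot_zero using qa[of "\<ominus>\<^bsub>M\<^esub> u" u] u(1) coset_zero[OF N] by (simp add: M.l_neg)
    then show "\<exists>y\<in>carrier ?Q. y \<oplus>\<^bsub>?Q\<^esub> x = \<zero>\<^bsub>?Q\<^esub>"
      using coset_closed[of "\<ominus>\<^bsub>M\<^esub> u" N] u(1) by blast
    have "(N +>\<^bsub>M\<^esub> \<zero>\<^bsub>M\<^esub>) \<oplus>\<^bsub>?Q\<^esub> x = x" unfolding u(2) using qa[OF M.zero_closed u(1)] u(1) by simp
    then show "\<zero>\<^bsub>?Q\<^esub> \<oplus>\<^bsub>?Q\<^esub> x = x" unfolding quot_zero coset_zero[OF N] .
  next
    show "\<zero>\<^bsub>?Q\<^esub> \<in> carrier ?Q"
      using coset_closed[OF M.zero_closed, of N] unfolding quot_zero coset_zero[OF N] .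
  next
    fix x y assume "x \<in> carrier ?Q" "y \<in> carrier ?Q"
    then obtain u v where u: "u \<in> carrier M" "x = N +>\<^bsub>M\<^esub> u" and v: "v \<in> carrier M" "y = N +>\<^bsub>M\<^esub> v"
      by (elim quot_cases)
    show "x \<oplus>\<^bsub>?Q\<^esub> y \<in> carrier ?Q" unfolding u(2) v(2) qa[OF u(1) v(1)] using u v by (intro coset_closed) simp
    show "x \<oplus>\<^bsub>?Q\<^esub> y = y \<oplus>\<^bsub>?Q\<^esub> x"
      unfolding u(2) v(2) qa[OF u(1) v(1)] qa[OF v(1) u(1)] using u v by (simp add: M.a_comm)
    fix z assume "z \<in> carrier ?Q"
    then obtain w where w: "w \<in> carrier M" "z = N +>\<^bsub>M\<^esub> w" by (rule quot_cases)
    show "x \<oplus>\<^bsub>?Q\<^esub> y \<oplus>\<^bsub>?Q\<^esub> z = x \<oplus>\<^bsub>?Q\<^esub> (y \<oplus>\<^bsub>?Q\<^esub> z)"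
      unfolding u(2) v(2) w(2) qa[OF u(1) v(1)] qa[OF v(1) w(1)]
        qa[OF M.a_closed[OF u(1) v(1)] w(1)] qa[OF u(1) M.a_closed[OF v(1) w(1)]]
      using u v w by (simp add: M.a_assoc)
  qed
  fix a x assume a: "a \<in> carrier R" and "x \<in> carrier ?Q"
  then obtain u where u: "u \<in> carrier M" "x = N +>\<^bsub>M\<^esub> u" by (elim quot_cases)
  have au: "a \<odot>\<^bsub>M\<^esub> u \<in> carrier M" using a u by simp
  show "a \<odot>\<^bsub>?Q\<^esub> x \<in> carrier ?Q" unfolding u(2) qs[OF a u(1)] using a u by (intro coset_closed) simp
  {
    fix b assume b: "b \<in> carrier R"
    have bu: "b \<odot>\<^bsub>M\<^esub> u \<in> carrier M" using b u by simp
    show "(a \<oplus> b) \<odot>\<^bsub>?Q\<^esub> x = a \<odot>\<^bsub>?Q\<^esub> x \<oplus>\<^bsub>?Q\<^esub> b \<odot>\<^bsub>?Q\<^esub> x"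
      unfolding u(2) qs[OF a u(1)] qs[OF b u(1)] qs[OF R.a_closed[OF a b] u(1)] qa[OF au bu]
      using a b u by (simp add: smult_l_distr)
    show "(a \<otimes> b) \<odot>\<^bsub>?Q\<^esub> x = a \<odot>\<^bsub>?Q\<^esub> (b \<odot>\<^bsub>?Q\<^esub> x)"
      unfolding u(2) qs[OF b u(1)] qs[OF a bu] qs[OF R.m_closed[OF a b] u(1)]
      using a b u by (simp add: smult_assoc1)
  next
    fix y assume "y \<in> carrier ?Q"
    then obtain v where v: "v \<in> carrier M" "y = N +>\<^bsub>M\<^esub> v" by (rule quot_cases)
    have av: "a \<odot>\<^bsub>M\<^esub> v \<in> carrier M" using a v by simp
    show "a \<odot>\<^bsub>?Q\<^esub> (x \<oplus>\<^bsub>?Q\<^esub> y) = a \<odot>\<^bsub>?Q\<^esub> x \<oplus>\<^bsub>?Q\<^esub> a \<odot>\<^bsub>?Q\<^esub> y"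
      unfolding u(2) v(2) qa[OF u(1) v(1)] qs[OF a u(1)] qs[OF a v(1)] qs[OF a M.a_closed[OF u(1) v(1)]] qa[OF au av]
      using a u v by (simp add: smult_r_distr)
  }
next
  show "\<one> \<odot>\<^bsub>quot_module M N\<^esub> x = x" if "x \<in> carrier (quot_module M N)" for x
  proof -
    obtain u where u: "u \<in> carrier M" "x = N +>\<^bsub>M\<^esub> u" using \<open>x \<in> _\<close> by (rule quot_cases)
    then show ?thesis using quot_smult[OF N R.one_closed u(1)] by simp
  qed
qed

lemma submodule_quotD:
  assumes N: "submodule N R M" and W: "submodule W R (quot_module M N)"
  shows "submodule {x \<in> carrier M. N +>\<^bsub>M\<^esub> x \<in> W} R M" (is "submodule ?L R M") and "N \<subseteq> {x \<in> carrier M. N +>\<^bsub>M\<^esub> x \<in> W}"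
proof -
  interpret Q: module R "quot_module M N" by (rule quot_is_module[OF N])
  show "submodule ?L R M"
  proof (rule submoduleI')
    show "\<zero>\<^bsub>M\<^esub> \<in> ?L" using Q.submodule_zero[OF W] coset_zero[OF N] by (simp add: quot_zero)
    show "a \<oplus>\<^bsub>M\<^esub> b \<in> ?L" if "a \<in> ?L" "b \<in> ?L" for a b
      using that Q.submoduleE(5)[OF W, of "N +>\<^bsub>M\<^esub> a" "N +>\<^bsub>M\<^esub> b"] quot_add[OF N, of a b] by simp
    show "a \<odot>\<^bsub>M\<^esub> x \<in> ?L" if "a \<in> carrier R" "x \<in> ?L" for a x
      using that Q.submoduleE(4)[OF W, of a "N +>\<^bsub>M\<^esub> x"] quot_smult[OF N, of a x] by simp
  qed auto
  have "N +>\<^bsub>M\<^esub> x = N" if "x \<in> N" for x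
    using abelian_subgroup.a_rcos_const[OF submodule_abelian_subgroup[OF N] that] .
  then show "N \<subseteq> ?L" using Q.submodule_zero[OF W] submodule_carr[OF N] by (auto simp: quot_zero)
qed

lemma submodule_quotI:
  assumes N: "submodule N R M" and L: "submodule L R M"
  shows "submodule ((\<lambda>x. N +>\<^bsub>M\<^esub> x) ` L) R (quot_module M N)"
proof -
  interpret Q: module R "quot_module M N" by (rule quot_is_module[OF N])
  note c = submodule_carr[OF L]
  show ?thesis
  proof (rule Q.submoduleI')
    show "\<zero>\<^bsub>quot_module M N\<^esub> \<in> (\<lambda>x. N +>\<^bsub>M\<^esub> x) ` L"
      unfolding quot_zero by (rule image_eqI[where f = "\<lambda>x. N +>\<^bsub>M\<^esub> x", OF coset_zero[OF N, symmetric] submodule_zero[OF L]])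
    show "(\<lambda>x. N +>\<^bsub>M\<^esub> x) ` L \<subseteq> carrier (quot_module M N)" unfolding quot_carrier using c by blast
  next
    fix a b assume "a \<in> (\<lambda>x. N +>\<^bsub>M\<^esub> x) ` L" "b \<in> (\<lambda>x. N +>\<^bsub>M\<^esub> x) ` L"
    then obtain x y where "x \<in> L" "y \<in> L" "a = N +>\<^bsub>M\<^esub> x" "b = N +>\<^bsub>M\<^esub> y" by blast
    then show "a \<oplus>\<^bsub>quot_module M N\<^esub> b \<in> (\<lambda>x. N +>\<^bsub>M\<^esub> x) ` L"
      using quot_add[OF N c c] submoduleE(5)[OF L] by simp
  next
    fix r a assume r: "r \<in> carrier R" and "a \<in> (\<lambda>x. N +>\<^bsub>M\<^esub> x) ` L"
    then obtain x where "x \<in> L" "a = N +>\<^bsub>M\<^esub> x" by blast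
    then show "r \<odot>\<^bsub>quot_module M N\<^esub> a \<in> (\<lambda>x. N +>\<^bsub>M\<^esub> x) ` L"
      using quot_smult[OF N r c] submoduleE(4)[OF L r] by simp
  qed
qed

text \<open>The correspondence theorem, used only as a strictly monotone map in each
  direction.\<close>

lemma length_quot:
  assumes N: "submodule N R M"
  shows "module_length R (quot_module M N) = chain_length {L. submodule L R M \<and> N \<subseteq> L}"
  unfolding module_length_eq_chain_length
proof (rule antisym)
  let ?p = "\<lambda>x. N +>\<^bsub>M\<^esub> x"
  interpret Q: module R "quot_module M N" by (rule quot_is_module[OF N])
  show "chain_length {W. submodule W R (quot_module M N)} \<le> chain_length {L. submodule L R M \<and> N \<subseteq> L}"
  proof (rule chain_length_mono_map[where f = "\<lambda>W. {x \<in> carrier M. ?p x \<in> W}"])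
    fix X Y assume "X \<in> {W. submodule W R (quot_module M N)}" "Y \<in> {W. submodule W R (quot_module M N)}" "X \<subset> Y"
    then obtain y where y: "y \<in> Y" "y \<notin> X" "y \<in> carrier (quot_module M N)" using Q.submodule_carr by blast
    then obtain x where "x \<in> carrier M" "y = ?p x" unfolding quot_carrier by blast
    then have "x \<in> {x \<in> carrier M. ?p x \<in> Y}" "x \<notin> {x \<in> carrier M. ?p x \<in> X}" using y by auto
    moreover have "{x \<in> carrier M. ?p x \<in> X} \<subseteq> {x \<in> carrier M. ?p x \<in> Y}" using \<open>X \<subset> Y\<close> by blast
    ultimately show "{x \<in> carrier M. ?p x \<in> X} \<subset> {x \<in> carrier M. ?p x \<in> Y}" by blast
  qed (use submodule_quotD[OF N] in auto)
  show "chain_length {L. submodule L R M \<and> N \<subseteq> L} \<le> chain_length {W. submodule W R (quot_module M N)}"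
  proof (rule chain_length_mono_map[where f = "\<lambda>L. ?p ` L"])
    fix X Y assume X: "X \<in> {L. submodule L R M \<and> N \<subseteq> L}" and Y: "Y \<in> {L. submodule L R M \<and> N \<subseteq> L}" and "X \<subset> Y"
    then obtain y where y: "y \<in> Y" "y \<notin> X" by blast
    have "?p y \<notin> ?p ` X"
    proof
      assume "?p y \<in> ?p ` X"
      then obtain x where x: "x \<in> X" "?p y = ?p x" by blast
      have "y \<in> carrier M" "x \<in> carrier M" using x y X Y submodule_carr by blast+
      then have "y \<ominus>\<^bsub>M\<^esub> x \<in> X" using x X coset_eq_iff[OF N] by auto
      then show False using submodule_diff_cancel[of X y x] x X y \<open>y \<in> carrier M\<close> by auto
    qed
    then show "?p ` X \<subset> ?p ` Y" using y \<open>X \<subset> Y\<close> by blast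
  qed (use submodule_quotI[OF N] in auto)
qed

end

section \<open>The ring as a module over itself\<close>

context cring begin

lemma ring_module_simps [simp]:
  "carrier (ring_module R) = carrier R" "add (ring_module R) = add R" "zero (ring_module R) = \<zero>"
  "smult (ring_module R) = mult R" "mult (ring_module R) = mult R" "one (ring_module R) = \<one>"
  by (simp_all add: ring_module_def)

lemma a_inv_ring_module: "a_inv (ring_module R) = a_inv R"
  unfolding a_inv_def by (simp add: ring_module_def m_inv_def[abs_def])

lemma minus_ring_module: "x \<ominus>\<^bsub>ring_module R\<^esub> y = x \<ominus> y"
  by (simp add: a_minus_def a_inv_ring_module)

lemma a_r_coset_ring_module: "N +>\<^bsub>ring_module R\<^esub> x = N +> x"
  by (simp add: a_r_coset_def')

lemma ring_module_module: "module R (ring_module R)"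
proof (rule moduleI)
  show "abelian_group (ring_module R)"
    by (rule abelian_groupI) (use l_neg a_inv_closed in \<open>auto simp: a_ac\<close>)
qed (auto simp: l_distr r_distr m_assoc is_cring)

lemma ideal_iff_submodule: "submodule N R (ring_module R) \<longleftrightarrow> ideal N R"
proof
  interpret M: module R "ring_module R" by (rule ring_module_module)
  show "ideal N R" if "submodule N R (ring_module R)"
    by (rule idealI') (use M.submodule_sub[OF that] M.submodule_zero[OF that] M.submoduleE(4,5)[OF that] in auto)
  show "submodule N R (ring_module R)" if "ideal N R"
    by (rule M.submoduleI') (use that in \<open>auto intro: idl_intros idl_carr\<close>)
qed

lemma ideal_module: "ideal I R \<Longrightarrow> module R ((ring_module R)\<lparr>carrier := I\<rparr>)"
  using submodule.submodule_is_module ideal_iff_submodule ring_module_module by blast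

lemma quot_length_eq_len:
  assumes "ideal J R" shows "quot_length R J = len R (carrier R) J"
proof -
  have *: "{L. ideal L R \<and> J \<subseteq> L} = {L. ideal L R \<and> J \<subseteq> L \<and> L \<subseteq> carrier R}" using idl_sub by blast
  have "quot_length R J = chain_length {L. submodule L R (ring_module R) \<and> J \<subseteq> L}"
    unfolding quot_length_def
    by (rule module.length_quot[OF ring_module_module]) (simp add: ideal_iff_submodule assms)
  then show ?thesis unfolding len_def ideal_iff_submodule * .
qed

end

section \<open>Free modules and free resolutions\<close>

text \<open>Membership in \<open>mod_hom\<close> also demands \<open>extensional\<close>; dropping
  this allows composites and differences to be written as plain abstractions, restricted only when a
  \<open>mod_hom\<close> is required.\<close>

definition linear ::
  "('r, 'k) ring_scheme \<Rightarrow> ('r, 'b, 'm) module_scheme \<Rightarrow> ('r, 'c, 'n) module_scheme \<Rightarrow> ('b \<Rightarrow> 'c) \<Rightarrow> bool" where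
  "linear R M N f \<longleftrightarrow> f \<in> carrier M \<rightarrow> carrier N \<and>
     (\<forall>x\<in>carrier M. \<forall>y\<in>carrier M. f (x \<oplus>\<^bsub>M\<^esub> y) = f x \<oplus>\<^bsub>N\<^esub> f y) \<and>
     (\<forall>r\<in>carrier R. \<forall>x\<in>carrier M. f (r \<odot>\<^bsub>M\<^esub> x) = r \<odot>\<^bsub>N\<^esub> f x)"

lemma linearD:
  assumes "linear R M N f"
  shows "x \<in> carrier M \<Longrightarrow> f x \<in> carrier N"
    "\<lbrakk>x \<in> carrier M; y \<in> carrier M\<rbrakk> \<Longrightarrow> f (x \<oplus>\<^bsub>M\<^esub> y) = f x \<oplus>\<^bsub>N\<^esub> f y"
    "\<lbrakk>r \<in> carrier R; x \<in> carrier M\<rbrakk> \<Longrightarrow> f (r \<odot>\<^bsub>M\<^esub> x) = r \<odot>\<^bsub>N\<^esub> f x"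
  using assms by (auto simp: linear_def)

lemma linearI:
  assumes "\<And>x. x \<in> carrier M \<Longrightarrow> f x \<in> carrier N"
    "\<And>x y. \<lbrakk>x \<in> carrier M; y \<in> carrier M\<rbrakk> \<Longrightarrow> f (x \<oplus>\<^bsub>M\<^esub> y) = f x \<oplus>\<^bsub>N\<^esub> f y"
    "\<And>r x. \<lbrakk>r \<in> carrier R; x \<in> carrier M\<rbrakk> \<Longrightarrow> f (r \<odot>\<^bsub>M\<^esub> x) = r \<odot>\<^bsub>N\<^esub> f x"
  shows "linear R M N f"
  using assms by (auto simp: linear_def)

lemma mod_hom_iff: "f \<in> mod_hom R M N \<longleftrightarrow> linear R M N f \<and> f \<in> extensional (carrier M)"
  by (auto simp: mod_hom_def linear_def PiE_def)

lemma linear_zero: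
  assumes "module R M" "module R N" "linear R M N f"
  shows "f \<zero>\<^bsub>M\<^esub> = \<zero>\<^bsub>N\<^esub>"
proof -
  interpret M: module R M by fact
  interpret N: module R N by fact
  have "f (\<zero>\<^bsub>R\<^esub> \<odot>\<^bsub>M\<^esub> \<zero>\<^bsub>M\<^esub>) = \<zero>\<^bsub>R\<^esub> \<odot>\<^bsub>N\<^esub> f \<zero>\<^bsub>M\<^esub>" using linearD(3)[OF assms(3)] by blast
  then show ?thesis using linearD(1)[OF assms(3)] by simp
qed

lemma linear_restrict:
  assumes "module R M" "linear R M N f" shows "restrict f (carrier M) \<in> mod_hom R M N"
proof -
  interpret M: module R M by fact
  show ?thesis unfolding mod_hom_iff by (auto simp: linear_def linearD[OF assms(2)])
qed

lemma linear_compose: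
  assumes "linear R M N f" "linear R N L g" shows "linear R M L (\<lambda>x. g (f x))"
  by (rule linearI) (simp_all add: linearD[OF assms(1)] linearD[OF assms(2)])

lemma linear_image:
  assumes "module R M" "module R N" "linear R M N f"
  shows "submodule (f ` carrier M) R N"
proof -
  interpret M: module R M by fact
  interpret N: module R N by fact
  show ?thesis
  proof (rule N.submoduleI')
    show "\<zero>\<^bsub>N\<^esub> \<in> f ` carrier M" using linear_zero[OF assms] by force
    show "a \<oplus>\<^bsub>N\<^esub> b \<in> f ` carrier M" if "a \<in> f ` carrier M" "b \<in> f ` carrier M" for a b
      using that linearD(2)[OF assms(3), symmetric] by auto
    show "a \<odot>\<^bsub>N\<^esub> b \<in> f ` carrier M" if "a \<in> carrier R" "b \<in> f ` carrier M" for a b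
      using that linearD(3)[OF assms(3), symmetric] by auto
  qed (use linearD[OF assms(3)] in auto)
qed

lemma linear_vimage:
  assumes "module R M" "module R N" "linear R M N f" "submodule L R N"
  shows "submodule {x \<in> carrier M. f x \<in> L} R M"
proof -
  interpret M: module R M by fact
  interpret N: module R N by fact
  show ?thesis
    by (rule M.submoduleI')
      (use linear_zero[OF assms(1-3)] linearD[OF assms(3)] N.submoduleE(4,5)[OF assms(4)] N.submodule_zero[OF assms(4)] in auto)
qed

lemma linear_minus:
  assumes "module R M" "module R N" "linear R M N f" "x \<in> carrier M" "y \<in> carrier M"
  shows "f (x \<ominus>\<^bsub>M\<^esub> y) = f x \<ominus>\<^bsub>N\<^esub> f y"
proof -
  interpret M: module R M by fact
  interpret N: module R N by fact
  have "\<ominus>\<^bsub>M\<^esub> y = (\<ominus>\<^bsub>R\<^esub> \<one>\<^bsub>R\<^esub>) \<odot>\<^bsub>M\<^esub> y" using assms by (simp add: M.smult_l_minus)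
  then have "f (\<ominus>\<^bsub>M\<^esub> y) = (\<ominus>\<^bsub>R\<^esub> \<one>\<^bsub>R\<^esub>) \<odot>\<^bsub>N\<^esub> f y" using assms linearD(3)[OF assms(3)] by simp
  also have "\<dots> = \<ominus>\<^bsub>N\<^esub> f y" using assms linearD(1)[OF assms(3)] by (simp add: N.smult_l_minus)
  finally show ?thesis unfolding a_minus_def using assms linearD(2)[OF assms(3)] by simp
qed

section \<open>Free modules of finite rank and maps out of them\<close>

context cring begin

lemma free_simps [simp]:
  "carrier (free_module R n) = {..<n} \<rightarrow>\<^sub>E carrier R"
  "v \<oplus>\<^bsub>free_module R n\<^esub> w = (\<lambda>j\<in>{..<n}. v j \<oplus> w j)"
  "\<zero>\<^bsub>free_module R n\<^esub> = (\<lambda>j\<in>{..<n}. \<zero>)"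
  "r \<odot>\<^bsub>free_module R n\<^esub> v = (\<lambda>j\<in>{..<n}. r \<otimes> v j)"
  by (simp_all add: free_module_def)

lemma free_module_module: "module R (free_module R n)"
proof (rule moduleI)
  show "abelian_group (free_module R n)"
  proof (rule abelian_groupI)
    fix v assume v: "v \<in> carrier (free_module R n)"
    show "\<exists>w\<in>carrier (free_module R n). w \<oplus>\<^bsub>free_module R n\<^esub> v = \<zero>\<^bsub>free_module R n\<^esub>"
      by (rule bexI[of _ "\<lambda>j\<in>{..<n}. \<ominus> v j"]) (use v in \<open>auto simp: l_neg PiE_iff intro!: restrict_ext\<close>)
  qed (auto simp: PiE_iff a_ac extensional_def intro!: restrict_ext)
qed (auto simp: PiE_iff l_distr r_distr m_assoc is_cring extensional_def fun_eq_iff intro!: restrict_ext)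

definition unit_vec :: "nat \<Rightarrow> nat \<Rightarrow> nat \<Rightarrow> 'a" where
  "unit_vec n j = (\<lambda>i\<in>{..<n}. if i = j then \<one> else \<zero>)"

lemma unit_vec_closed: "unit_vec n j \<in> carrier (free_module R n)"
  by (auto simp: unit_vec_def)

text \<open>Induction on the number of leading coordinates that may be nonzero: the last one is
  cleared with a multiple of its unit vector.\<close>

lemma free_module_span:
  assumes Y: "submodule Y R (free_module R n)" and e: "\<And>j. j < n \<Longrightarrow> unit_vec n j \<in> Y"
  shows "Y = carrier (free_module R n)"
proof
  interpret F: module R "free_module R n" by (rule free_module_module)
  show "Y \<subseteq> carrier (free_module R n)" by (rule F.submodule_sub[OF Y])
  have "v \<in> Y" if "c \<le> n" "v \<in> carrier (free_module R n)" "\<And>j. \<lbrakk>c \<le> j; j < n\<rbrakk> \<Longrightarrow> v j = \<zero>" for c v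
    using that
  proof (induction c arbitrary: v)
    case 0
    then have "v = \<zero>\<^bsub>free_module R n\<^esub>" by (auto simp: PiE_iff extensional_def fun_eq_iff)
    with F.submodule_zero[OF Y] show ?case by (simp only:)
  next
    case (Suc c)
    have vc: "v j \<in> carrier R" if "j < n" for j using Suc.prems(2) that by auto
    have "v(c := \<zero>) \<in> Y"
    proof (rule Suc.IH)
      show "v(c := \<zero>) \<in> carrier (free_module R n)" using Suc.prems by (auto simp: PiE_iff extensional_def)
      show "(v(c := \<zero>)) j = \<zero>" if "c \<le> j" "j < n" for j using Suc.prems(3)[of j] that by auto
    qed (use Suc in simp)
    moreover have "v c \<odot>\<^bsub>free_module R n\<^esub> unit_vec n c \<in> Y"
      using Suc.prems e by (intro F.submoduleE(4)[OF Y] vc) auto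
    ultimately have "v(c := \<zero>) \<oplus>\<^bsub>free_module R n\<^esub> (v c \<odot>\<^bsub>free_module R n\<^esub> unit_vec n c) \<in> Y"
      by (rule F.submoduleE(5)[OF Y])
    also have "v(c := \<zero>) \<oplus>\<^bsub>free_module R n\<^esub> (v c \<odot>\<^bsub>free_module R n\<^esub> unit_vec n c) = v"
      using Suc.prems vc by (auto simp: unit_vec_def fun_eq_iff PiE_iff extensional_def)
    finally show ?case .
  qed
  from this[of n] show "carrier (free_module R n) \<subseteq> Y" by auto
qed

end

context module begin

text \<open>As a function of \<open>v\<close> this is the linear map from the free module that sends
  the \<open>j\<close>-th unit vector to \<open>w j\<close>. The index bound is an argument so that
  proofs can go by induction on it.\<close>

primrec lin_comb :: "(nat \<Rightarrow> 'c) \<Rightarrow> nat \<Rightarrow> (nat \<Rightarrow> 'a) \<Rightarrow> 'c" where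
  "lin_comb w 0 v = \<zero>\<^bsub>M\<^esub>"
| "lin_comb w (Suc c) v = lin_comb w c v \<oplus>\<^bsub>M\<^esub> v c \<odot>\<^bsub>M\<^esub> w c"

lemma lin_comb_closed:
  "\<lbrakk>\<And>j. j < c \<Longrightarrow> w j \<in> carrier M; \<And>j. j < c \<Longrightarrow> v j \<in> carrier R\<rbrakk> \<Longrightarrow> lin_comb w c v \<in> carrier M"
  by (induction c) auto

lemma lin_comb_linear:
  assumes w: "\<And>j. j < n \<Longrightarrow> w j \<in> carrier M"
  shows "linear R (free_module R n) M (lin_comb w n)"
proof (rule linearI)
  fix x y assume xy: "x \<in> carrier (free_module R n)" "y \<in> carrier (free_module R n)"
  have "lin_comb w c (x \<oplus>\<^bsub>free_module R n\<^esub> y) = lin_comb w c x \<oplus>\<^bsub>M\<^esub> lin_comb w c y" if "c \<le> n" for c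
    using that
  proof (induction c)
    case (Suc c)
    have "x c \<in> carrier R" "y c \<in> carrier R" "w c \<in> carrier M" using Suc xy w by (auto simp: PiE_iff)
    moreover have "lin_comb w c x \<in> carrier M" "lin_comb w c y \<in> carrier M"
      using Suc.prems w xy by (auto intro!: lin_comb_closed)
    ultimately show ?case using Suc by (simp add: smult_l_distr M.a_ac)
  qed simp
  then show "lin_comb w n (x \<oplus>\<^bsub>free_module R n\<^esub> y) = lin_comb w n x \<oplus>\<^bsub>M\<^esub> lin_comb w n y" by simp
next
  fix r x assume rx: "r \<in> carrier R" "x \<in> carrier (free_module R n)"
  have "lin_comb w c (r \<odot>\<^bsub>free_module R n\<^esub> x) = r \<odot>\<^bsub>M\<^esub> lin_comb w c x" if "c \<le> n" for c
    using that
  proof (induction c)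
    case (Suc c)
    have "x c \<in> carrier R" "w c \<in> carrier M" using Suc rx w by (auto simp: PiE_iff)
    moreover have "lin_comb w c x \<in> carrier M"
      using Suc.prems w rx by (auto intro!: lin_comb_closed)
    ultimately show ?case using Suc rx(1) by (simp add: smult_r_distr smult_assoc1)
  qed (use rx in simp)
  then show "lin_comb w n (r \<odot>\<^bsub>free_module R n\<^esub> x) = r \<odot>\<^bsub>M\<^esub> lin_comb w n x" by simp
next
  show "lin_comb w n x \<in> carrier M" if "x \<in> carrier (free_module R n)" for x
    using that w by (auto intro!: lin_comb_closed)
qed

lemma lin_comb_unit:
  assumes w: "\<And>j. j < n \<Longrightarrow> w j \<in> carrier M" and j: "j < n"
  shows "lin_comb w n (R.unit_vec n j) = w j"
proof -
  have "lin_comb w c (R.unit_vec n j) = (if j < c then w j else \<zero>\<^bsub>M\<^esub>)" if "c \<le> n" for c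
    using that
  proof (induction c)
    case (Suc c)
    then have "w c \<in> carrier M" "w j \<in> carrier M" using w j by auto
    then show ?case using Suc by (auto simp: R.unit_vec_def less_Suc_eq)
  qed simp
  then show ?thesis using j by simp
qed

text \<open>Projectivity of a free module: preimages are chosen on unit vectors only, and the
  vectors on which \<open>g - h g'\<close> falls into \<open>N\<close> form a submodule.
  \<open>N = 0\<close> gives ordinary lifting; general \<open>N\<close> covers division by a scalar
  modulo an ideal.\<close>

lemma free_module_lift:
  assumes K: "module R K" and N: "submodule N R M"
    and g: "linear R (free_module R n) M g" and h: "linear R K M h"
    and ex: "\<And>v. v \<in> carrier (free_module R n) \<Longrightarrow> \<exists>k\<in>carrier K. g v \<ominus>\<^bsub>M\<^esub> h k \<in> N"
  obtains g' where "linear R (free_module R n) K g'"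
    "\<And>v. v \<in> carrier (free_module R n) \<Longrightarrow> g v \<ominus>\<^bsub>M\<^esub> h (g' v) \<in> N"
proof -
  interpret K: module R K by (rule K)
  interpret F: module R "free_module R n" by (rule R.free_module_module)
  have "\<forall>j. \<exists>k\<in>carrier K. g (R.unit_vec n j) \<ominus>\<^bsub>M\<^esub> h k \<in> N" using ex R.unit_vec_closed by blast
  then obtain w where w: "\<And>j. w j \<in> carrier K" "\<And>j. g (R.unit_vec n j) \<ominus>\<^bsub>M\<^esub> h (w j) \<in> N" by metis
  define g' where "g' = K.lin_comb w n"
  have g': "linear R (free_module R n) K g'" unfolding g'_def by (rule K.lin_comb_linear) (rule w)
  note gc = linearD(1)[OF g] and hc = linearD(1)[OF h] and g'c = linearD(1)[OF g']
  have "linear R (free_module R n) M (\<lambda>v. g v \<ominus>\<^bsub>M\<^esub> h (g' v))"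
  proof (rule linearI)
    fix x y assume xy: "x \<in> carrier (free_module R n)" "y \<in> carrier (free_module R n)"
    note c = gc[OF xy(1)] gc[OF xy(2)] hc[OF g'c[OF xy(1)]] hc[OF g'c[OF xy(2)]]
    show "g (x \<oplus>\<^bsub>free_module R n\<^esub> y) \<ominus>\<^bsub>M\<^esub> h (g' (x \<oplus>\<^bsub>free_module R n\<^esub> y)) =
        (g x \<ominus>\<^bsub>M\<^esub> h (g' x)) \<oplus>\<^bsub>M\<^esub> (g y \<ominus>\<^bsub>M\<^esub> h (g' y))"
      unfolding linearD(2)[OF g xy] linearD(2)[OF g' xy] linearD(2)[OF h g'c[OF xy(1)] g'c[OF xy(2)]] a_minus_def
      using c by (simp add: M.a_ac M.minus_add)
  next
    fix r x assume rx: "r \<in> carrier R" "x \<in> carrier (free_module R n)"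
    note c = gc[OF rx(2)] hc[OF g'c[OF rx(2)]]
    show "g (r \<odot>\<^bsub>free_module R n\<^esub> x) \<ominus>\<^bsub>M\<^esub> h (g' (r \<odot>\<^bsub>free_module R n\<^esub> x)) = r \<odot>\<^bsub>M\<^esub> (g x \<ominus>\<^bsub>M\<^esub> h (g' x))"
      unfolding linearD(3)[OF g rx] linearD(3)[OF g' rx] linearD(3)[OF h rx(1) g'c[OF rx(2)]] a_minus_def
      using c rx(1) by (simp add: smult_r_distr smult_r_minus)
  qed (use gc hc g'c in \<open>auto simp: a_minus_def\<close>)
  from linear_vimage[OF R.free_module_module module_axioms this N]
  have "{v \<in> carrier (free_module R n). g v \<ominus>\<^bsub>M\<^esub> h (g' v) \<in> N} = carrier (free_module R n)"
  proof (rule R.free_module_span)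
    fix j assume "j < n"
    then have "g' (R.unit_vec n j) = w j" unfolding g'_def by (intro K.lin_comb_unit w(1))
    then show "R.unit_vec n j \<in> {v \<in> carrier (free_module R n). g v \<ominus>\<^bsub>M\<^esub> h (g' v) \<in> N}"
      using w R.unit_vec_closed by simp
  qed
  then show ?thesis using that g' by blast
qed

end

section \<open>Finite generation over a Noetherian ring and existence of resolutions\<close>

lemma noetherian_fg:
  assumes "noetherian_ring R" "ideal I R"
  obtains S where "S \<subseteq> carrier R" "finite S" "I = Idl\<^bsub>R\<^esub> S"
  using noetherian_ring.finetely_gen[OF assms] by blast

context cring begin

text \<open>Coordinate by coordinate: among the vectors of \<open>Z\<close> vanishing beyond
  coordinate \<open>c\<close>, the entries at \<open>c\<close> form a finitely generated ideal, and
  subtracting a vector with the same entry from the span of lifted generators moves a vector to the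
  previous stage. Generation by \<open>X\<close> is expressed through the submodules that contain
  \<open>X\<close>.\<close>

lemma free_submodule_fg:
  assumes noeth: "noetherian_ring R" and Z: "submodule Z R (free_module R n)"
  obtains X where "finite X" "X \<subseteq> Z" "\<And>Y. \<lbrakk>submodule Y R (free_module R n); X \<subseteq> Y\<rbrakk> \<Longrightarrow> Z \<subseteq> Y"
proof -
  interpret F: module R "free_module R n" by (rule free_module_module)
  let ?F = "free_module R n"
  note Zc = F.submodule_carr[OF Z]
  define T where "T c = {z \<in> Z. \<forall>j. c \<le> j \<and> j < n \<longrightarrow> z j = \<zero>}" for c
  have "\<exists>X. finite X \<and> X \<subseteq> T c \<and> (\<forall>Y. submodule Y R ?F \<longrightarrow> X \<subseteq> Y \<longrightarrow> T c \<subseteq> Y)" if "c \<le> n" for c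
    using that
  proof (induction c)
    case 0
    have "z = \<zero>\<^bsub>?F\<^esub>" if "z \<in> T 0" for z
      using that Zc[of z] by (auto simp: T_def PiE_iff extensional_def fun_eq_iff)
    then show ?case using F.submodule_zero by (intro exI[of _ "{}"]) blast
  next
    case (Suc c)
    then obtain X where X: "finite X" "X \<subseteq> T c" "\<And>Y. submodule Y R ?F \<Longrightarrow> X \<subseteq> Y \<Longrightarrow> T c \<subseteq> Y" by auto
    have cn: "c < n" using Suc by simp
    have co: "z c \<in> carrier R" if "z \<in> Z" for z using Zc[OF that] cn by auto
    \<comment> \<open>Stated for every submodule \<open>L\<close>: with \<open>L = Z\<close> it
      yields generators, and with \<open>L = Y\<close> it shows that \<open>Y\<close> realizes every
      entry.\<close>
    have I: "ideal {z c |z. z \<in> L \<inter> T (Suc c)} R" if L: "submodule L R ?F" for L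
    proof (rule idealI')
      show "\<zero> \<in> {z c |z. z \<in> L \<inter> T (Suc c)}"
      proof -
        have "\<zero>\<^bsub>?F\<^esub> \<in> L \<inter> T (Suc c)"
          using F.submodule_zero[OF L] F.submodule_zero[OF Z] by (auto simp: T_def)
        moreover have "\<zero> = \<zero>\<^bsub>?F\<^esub> c" using cn by simp
        ultimately show ?thesis by blast
      qed
      fix x y assume "x \<in> {z c |z. z \<in> L \<inter> T (Suc c)}" "y \<in> {z c |z. z \<in> L \<inter> T (Suc c)}"
      then obtain u v where uv: "u \<in> L \<inter> T (Suc c)" "v \<in> L \<inter> T (Suc c)" "x = u c" "y = v c" by blast
      then have "u \<oplus>\<^bsub>?F\<^esub> v \<in> L \<inter> T (Suc c)"
        using F.submoduleE(5)[OF L, of u v] F.submoduleE(5)[OF Z, of u v] by (auto simp: T_def)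
      moreover have "x \<oplus> y = (u \<oplus>\<^bsub>?F\<^esub> v) c" using uv cn by simp
      ultimately show "x \<oplus> y \<in> {z c |z. z \<in> L \<inter> T (Suc c)}" by blast
    next
      fix r x assume r: "r \<in> carrier R" and "x \<in> {z c |z. z \<in> L \<inter> T (Suc c)}"
      then obtain u where u: "u \<in> L \<inter> T (Suc c)" "x = u c" by blast
      then have "r \<odot>\<^bsub>?F\<^esub> u \<in> L \<inter> T (Suc c)"
        using F.submoduleE(4)[OF L r, of u] F.submoduleE(4)[OF Z r, of u] r by (auto simp: T_def)
      moreover have "r \<otimes> x = (r \<odot>\<^bsub>?F\<^esub> u) c" using u cn by simp
      ultimately show "r \<otimes> x \<in> {z c |z. z \<in> L \<inter> T (Suc c)}" by blast
    qed (use co in \<open>auto simp: T_def\<close>)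
    define A where "A = {z c |z. z \<in> T (Suc c)}"
    have TZ: "T (Suc c) = Z \<inter> T (Suc c)" by (auto simp: T_def)
    have "ideal A R" using I[OF Z] TZ unfolding A_def by simp
    then obtain S where S: "S \<subseteq> carrier R" "finite S" "A = Idl S" by (rule noetherian_fg[OF noeth])
    have "S \<subseteq> A" unfolding S(3) by (rule genideal_self[OF S(1)])
    then have "\<forall>s\<in>S. \<exists>z\<in>T (Suc c). z c = s" unfolding A_def by blast
    then obtain g where g: "\<And>s. s \<in> S \<Longrightarrow> g s \<in> T (Suc c)" "\<And>s. s \<in> S \<Longrightarrow> g s c = s" by metis
    have Tm: "T c \<subseteq> T (Suc c)" by (auto simp: T_def)
    show ?case
    proof (intro exI conjI allI impI)
      show "finite (X \<union> g ` S)" using X(1) S(2) by simp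
      show "X \<union> g ` S \<subseteq> T (Suc c)" using X(2) g(1) Tm by blast
      fix Y assume Y: "submodule Y R ?F" "X \<union> g ` S \<subseteq> Y"
      have TY: "T c \<subseteq> Y" using X(3)[OF Y(1)] Y(2) by blast
      have "S \<subseteq> {z c |z. z \<in> Y \<inter> T (Suc c)}"
      proof
        fix s assume "s \<in> S"
        then have "g s \<in> Y \<inter> T (Suc c)" "s = g s c" using g Y(2) by auto
        then show "s \<in> {z c |z. z \<in> Y \<inter> T (Suc c)}" by blast
      qed
      then have AY: "A \<subseteq> {z c |z. z \<in> Y \<inter> T (Suc c)}" unfolding S(3) by (rule genideal_minimal[OF I[OF Y(1)]])
      show "T (Suc c) \<subseteq> Y"
      proof
        fix z assume z: "z \<in> T (Suc c)"
        then have "z c \<in> A" unfolding A_def by blast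
        then obtain y where y: "y \<in> Y" "y \<in> T (Suc c)" "z c = y c" using AY by auto
        have zy: "z \<in> Z" "y \<in> Z" using z y by (auto simp: T_def)
        have my: "(\<ominus> \<one>) \<odot>\<^bsub>?F\<^esub> y \<in> Z" using F.submoduleE(4)[OF Z _ zy(2)] by simp
        have "z \<oplus>\<^bsub>?F\<^esub> ((\<ominus> \<one>) \<odot>\<^bsub>?F\<^esub> y) \<in> Z" by (rule F.submoduleE(5)[OF Z zy(1) my])
        moreover have "(z \<oplus>\<^bsub>?F\<^esub> ((\<ominus> \<one>) \<odot>\<^bsub>?F\<^esub> y)) j = \<zero>" if "c \<le> j" "j < n" for j
        proof (cases "j = c")
          case True
          then show ?thesis using y co[OF zy(2)] cn by (simp add: l_minus r_neg)
        next
          case False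
          then show ?thesis using z y that by (simp add: T_def l_minus)
        qed
        ultimately have "z \<oplus>\<^bsub>?F\<^esub> ((\<ominus> \<one>) \<odot>\<^bsub>?F\<^esub> y) \<in> T c" unfolding T_def by blast
        then have "(z \<oplus>\<^bsub>?F\<^esub> ((\<ominus> \<one>) \<odot>\<^bsub>?F\<^esub> y)) \<oplus>\<^bsub>?F\<^esub> y \<in> Y" using TY y F.submoduleE(5)[OF Y(1)] by blast
        also have "(z \<oplus>\<^bsub>?F\<^esub> ((\<ominus> \<one>) \<odot>\<^bsub>?F\<^esub> y)) \<oplus>\<^bsub>?F\<^esub> y = z"
        proof -
          have "(z j \<oplus> \<ominus> \<one> \<otimes> y j) \<oplus> y j = z j" if "j < n" for j
          proof -
            have "z j \<in> carrier R" "y j \<in> carrier R" using Zc[OF zy(1)] Zc[OF zy(2)] that by auto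
            then show ?thesis by (simp add: l_minus a_assoc l_neg)
          qed
          then show ?thesis using Zc[OF zy(1)] by (auto simp: fun_eq_iff PiE_iff extensional_def)
        qed
        finally show "z \<in> Y" .
      qed
    qed
  qed
  from this[of n] obtain X where "finite X" "X \<subseteq> T n" "\<And>Y. submodule Y R ?F \<Longrightarrow> X \<subseteq> Y \<Longrightarrow> T n \<subseteq> Y" by auto
  moreover have "T n = Z" by (auto simp: T_def)
  ultimately show ?thesis using that by blast
qed

lemma free_submodule_cover:
  assumes noeth: "noetherian_ring R" and Z: "submodule Z R (free_module R n)"
  shows "\<exists>k h. linear R (free_module R k) (free_module R n) h \<and> h ` carrier (free_module R k) = Z"
proof -
  interpret F: module R "free_module R n" by (rule free_module_module)
  obtain X where X: "finite X" "X \<subseteq> Z" "\<And>Y. \<lbrakk>submodule Y R (free_module R n); X \<subseteq> Y\<rbrakk> \<Longrightarrow> Z \<subseteq> Y"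
    using free_submodule_fg[OF assms] by blast
  obtain w where w: "w ` {..<card X} = X"
    using X(1) by (metis bij_betw_imp_surj_on ex_bij_betw_nat_finite atLeast0LessThan)
  then have wZ: "w j \<in> Z" if "j < card X" for j using that X(2) by blast
  then have wc: "w j \<in> carrier (free_module R n)" if "j < card X" for j using that F.submodule_carr[OF Z] by blast
  let ?h = "F.lin_comb w (card X)"
  have h: "linear R (free_module R (card X)) (free_module R n) ?h" by (rule F.lin_comb_linear) (rule wc)
  have u: "?h (unit_vec (card X) j) = w j" if "j < card X" for j by (rule F.lin_comb_unit) (use wc that in auto)
  have "X \<subseteq> ?h ` carrier (free_module R (card X))"
  proof
    fix x assume "x \<in> X"
    then obtain j where j: "j < card X" "x = w j" using w by blast
    have "?h (unit_vec (card X) j) \<in> ?h ` carrier (free_module R (card X))" by (rule imageI[OF unit_vec_closed])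
    then show "x \<in> ?h ` carrier (free_module R (card X))" unfolding u[OF j(1)] j(2) .
  qed
  then have "Z \<subseteq> ?h ` carrier (free_module R (card X))"
    by (rule X(3)[OF linear_image[OF free_module_module free_module_module h]])
  moreover have "{v \<in> carrier (free_module R (card X)). ?h v \<in> Z} = carrier (free_module R (card X))"
    by (rule free_module_span[OF linear_vimage[OF free_module_module free_module_module h Z]])
      (use u wZ unit_vec_closed in \<open>simp del: free_simps\<close>)
  ultimately show ?thesis using h by blast
qed

text \<open>Needed so that the choice in \<open>ext_module\<close> picks an actual
  resolution.\<close>

lemma free_resolution_exists:
  assumes noeth: "noetherian_ring R" and I: "ideal I R"
  shows "\<exists>b d \<epsilon>. free_resolution R (quot_module (ring_module R) I) b d \<epsilon>"
proof -
  let ?F = "free_module R" and ?K = "quot_module (ring_module R) I"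
  interpret RM: module R "ring_module R" by (rule ring_module_module)
  have I': "submodule I R (ring_module R)" using I ideal_iff_submodule by simp
  have mK: "module R ?K" by (rule RM.quot_is_module[OF I'])
  interpret K: module R ?K by (rule mK)
  define \<epsilon> where "\<epsilon> = restrict (\<lambda>v. I +> v 0) (carrier (?F 1))"
  have cos: "I +> x \<in> carrier ?K" if "x \<in> carrier R" for x
    using RM.quot_carrier that by (auto simp: a_r_coset_ring_module)
  have "linear R (?F 1) ?K (\<lambda>v. I +> v 0)"
  proof (rule linearI)
    fix x y assume "x \<in> carrier (?F 1)" "y \<in> carrier (?F 1)"
    then have "x 0 \<in> carrier R" "y 0 \<in> carrier R" by auto
    then show "I +> (x \<oplus>\<^bsub>?F 1\<^esub> y) 0 = (I +> x 0) \<oplus>\<^bsub>?K\<^esub> (I +> y 0)"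
      using RM.quot_add[OF I', of "x 0" "y 0"] by (simp add: a_r_coset_ring_module)
  next
    fix r x assume "r \<in> carrier R" "x \<in> carrier (?F 1)"
    then have "r \<in> carrier R" "x 0 \<in> carrier R" by auto
    then show "I +> (r \<odot>\<^bsub>?F 1\<^esub> x) 0 = r \<odot>\<^bsub>?K\<^esub> (I +> x 0)"
      using RM.quot_smult[OF I', of r "x 0"] by (simp add: a_r_coset_ring_module)
  qed (auto intro!: cos)
  then have \<epsilon>: "\<epsilon> \<in> mod_hom R (?F 1) ?K" unfolding \<epsilon>_def by (rule linear_restrict[OF free_module_module])
  have \<epsilon>_onto: "\<epsilon> ` carrier (?F 1) = carrier ?K"
  proof
    show "\<epsilon> ` carrier (?F 1) \<subseteq> carrier ?K" using \<epsilon> by (auto simp: mod_hom_def simp del: free_simps)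
    show "carrier ?K \<subseteq> \<epsilon> ` carrier (?F 1)"
    proof
      fix y assume "y \<in> carrier ?K"
      then obtain x where x: "x \<in> carrier R" "y = I +> x" using RM.quot_carrier by (auto simp: a_r_coset_ring_module)
      then have v: "(\<lambda>j\<in>{..<1}. x) \<in> carrier (?F 1)" by auto
      then have "\<epsilon> (\<lambda>j\<in>{..<1}. x) = y" unfolding \<epsilon>_def using x by simp
      then show "y \<in> \<epsilon> ` carrier (?F 1)" using v by blast
    qed
  qed
  define Z0 where "Z0 = {v \<in> carrier (?F 1). \<epsilon> v \<in> {\<zero>\<^bsub>?K\<^esub>}}"
  have sub0: "submodule {\<zero>\<^bsub>M\<^esub>} R M" if "module R M" for M :: "('a, 'c, 'd) module_scheme"
  proof -
    interpret M: module R M by (rule that)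
    show ?thesis by (rule M.submoduleI') auto
  qed
  have Z0: "submodule Z0 R (?F 1)" unfolding Z0_def using \<epsilon>
    by (intro linear_vimage[OF free_module_module mK]) (auto simp: mod_hom_iff sub0[OF mK])
  \<comment> \<open>The choice is made on pairs of a rank and a submodule, with the submodule
    condition as a premise, so that one total function can drive the recursion.\<close>
  have "\<forall>nZ. \<exists>kh. submodule (snd nZ) R (?F (fst nZ)) \<longrightarrow>
      linear R (?F (fst kh)) (?F (fst nZ)) (snd kh) \<and> snd kh ` carrier (?F (fst kh)) = snd nZ"
    using free_submodule_cover[OF noeth] by (simp del: free_simps)
  from choice[OF this] obtain f where f: "\<And>nZ. submodule (snd nZ) R (?F (fst nZ)) \<longrightarrow>
      linear R (?F (fst (f nZ))) (?F (fst nZ)) (snd (f nZ)) \<and> snd (f nZ) ` carrier (?F (fst (f nZ))) = snd nZ"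
    by blast
  define k where "k n Z = fst (f (n, Z))" for n Z
  define h where "h n Z = snd (f (n, Z))" for n Z
  have kh: "linear R (?F (k n Z)) (?F n) (h n Z)" "h n Z ` carrier (?F (k n Z)) = Z" if "submodule Z R (?F n)" for n Z
    using f[of "(n, Z)"] that unfolding k_def h_def by (simp_all del: free_simps)
  \<comment> \<open>The state is the rank of the current free module together with the submodule
    that the next differential must cover; the submodule after that is the kernel of this
    differential.\<close>
  define st where "st = rec_nat (1, Z0) (\<lambda>_ (n, Z). (k n Z, {v \<in> carrier (?F (k n Z)). h n Z v \<in> {\<zero>\<^bsub>?F n\<^esub>}}))"
  define b where "b i = fst (st i)" for i
  define Z where "Z i = snd (st i)" for i
  define d where "d i = restrict (h (b i) (Z i)) (carrier (?F (b (Suc i))))" for i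
  have st0: "b 0 = 1" "Z 0 = Z0" by (auto simp: b_def Z_def st_def)
  have stS: "b (Suc i) = k (b i) (Z i)" "Z (Suc i) = {v \<in> carrier (?F (b (Suc i))). h (b i) (Z i) v \<in> {\<zero>\<^bsub>?F (b i)\<^esub>}}" for i
    by (simp_all add: b_def Z_def st_def split_def)
  have Zi: "submodule (Z i) R (?F (b i))" for i
  proof (induction i)
    case 0
    then show ?case using st0 Z0 by simp
  next
    case (Suc i)
    show ?case unfolding stS(2)
      by (rule linear_vimage[OF free_module_module free_module_module _ sub0[OF free_module_module]])
        (use kh(1)[OF Suc] stS(1) in simp)
  qed
  have lin: "linear R (?F (b (Suc i))) (?F (b i)) (h (b i) (Z i))" for i using kh(1)[OF Zi] stS(1) by simp
  have im: "d i ` carrier (?F (b (Suc i))) = Z i" for i using kh(2)[OF Zi] stS(1) unfolding d_def by (simp only: image_restrict_eq)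
  have ZS: "Z (Suc i) = {v \<in> carrier (?F (b (Suc i))). d i v = \<zero>\<^bsub>?F (b i)\<^esub>}" for i
    unfolding stS(2) d_def by auto
  have "d i \<in> mod_hom R (?F (b (Suc i))) (?F (b i))" for i
    unfolding d_def by (rule linear_restrict[OF free_module_module lin])
  then have "free_resolution R ?K b d \<epsilon>"
    unfolding free_resolution_def Let_def
    using \<epsilon> \<epsilon>_onto im[of 0] im ZS st0 unfolding Z0_def by (simp del: free_simps)
  then show ?thesis by blast
qed

end

section \<open>Cohomology of a resolution of the residue field\<close>

context cring begin

text \<open>Weak regularity of the sequence on \<open>M/N\<close>, where \<open>N\<close> grows to
  \<open>N + xM\<close> in place of passing to a quotient module; \<open>add_mults M N xs\<close> is
  the final \<open>N + (xs)M\<close>.\<close>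

fun regular_on :: "'a set \<Rightarrow> 'a set \<Rightarrow> 'a list \<Rightarrow> bool" where
  "regular_on M N [] \<longleftrightarrow> True"
| "regular_on M N (x # xs) \<longleftrightarrow>
     (\<forall>u\<in>M. x \<otimes> u \<in> N \<longrightarrow> u \<in> N) \<and> regular_on M (N <+> (x \<odot>\<^sub>s M)) xs"

fun add_mults :: "'a set \<Rightarrow> 'a set \<Rightarrow> 'a list \<Rightarrow> 'a set" where
  "add_mults M N [] = N"
| "add_mults M N (x # xs) = add_mults M (N <+> (x \<odot>\<^sub>s M)) xs"

lemma add_mult_ideal:
  assumes "ideal M R" "ideal N R" "N \<subseteq> M" "x \<in> carrier R"
  shows "ideal (N <+> (x \<odot>\<^sub>s M)) R" "N <+> (x \<odot>\<^sub>s M) \<subseteq> M" "N \<subseteq> N <+> (x \<odot>\<^sub>s M)"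
    "u \<in> M \<Longrightarrow> x \<otimes> u \<in> N <+> (x \<odot>\<^sub>s M)"
proof -
  have i: "ideal (x \<odot>\<^sub>s M) R" using assms by (intro elt_mult_ideal)
  show "ideal (N <+> (x \<odot>\<^sub>s M)) R" using assms i by (intro add_ideals)
  show "N <+> (x \<odot>\<^sub>s M) \<subseteq> M" using assms by (intro idl_sum_least elt_mult_sub)
  show "N \<subseteq> N <+> (x \<odot>\<^sub>s M)" using idl_sum_upper(1)[OF assms(2) i] .
  show "x \<otimes> u \<in> N <+> (x \<odot>\<^sub>s M)" if "u \<in> M" using idl_sum_upper(2)[OF assms(2) i] elt_multI[OF that] by blast
qed

lemma add_mults_ideal:
  assumes "ideal M R" "ideal N R" "N \<subseteq> M" "set xs \<subseteq> carrier R"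
  shows "ideal (add_mults M N xs) R \<and> add_mults M N xs \<subseteq> M \<and> N \<subseteq> add_mults M N xs"
  using assms
proof (induction xs arbitrary: N)
  case (Cons x xs)
  then have x: "x \<in> carrier R" "set xs \<subseteq> carrier R" by auto
  note a = add_mult_ideal[OF Cons.prems(1-3) x(1)]
  from Cons.IH[OF Cons.prems(1) a(1,2) x(2)] show ?case using a(3) by auto
qed simp

lemma add_mults_mem:
  assumes "ideal M R" "ideal N R" "N \<subseteq> M" "set xs \<subseteq> carrier R" "x \<in> set xs" "u \<in> M"
  shows "x \<otimes> u \<in> add_mults M N xs"
  using assms
proof (induction xs arbitrary: N)
  case (Cons y xs)
  then have y: "y \<in> carrier R" "set xs \<subseteq> carrier R" by auto
  note a = add_mult_ideal[OF Cons.prems(1-3) y(1)]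
  show ?case
  proof (cases "x = y")
    case True
    then show ?thesis using a(4)[OF assms(6)] add_mults_ideal[OF Cons.prems(1) a(1,2) y(2)] by auto
  next
    case False
    then show ?thesis using Cons.IH[OF Cons.prems(1) a(1,2) y(2) _ assms(6)] Cons.prems(5) by simp
  qed
qed simp

lemma add_mults_least:
  assumes "ideal L R" "N \<subseteq> L" "\<And>x u. \<lbrakk>x \<in> set xs; u \<in> M\<rbrakk> \<Longrightarrow> x \<otimes> u \<in> L"
  shows "add_mults M N xs \<subseteq> L"
  using assms
proof (induction xs arbitrary: N)
  case (Cons x xs)
  have "x \<odot>\<^sub>s M \<subseteq> L" using Cons.prems(3) by (auto elim!: elt_multE)
  then have "N <+> (x \<odot>\<^sub>s M) \<subseteq> L" using Cons.prems by (intro idl_sum_least)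
  then show ?case using Cons by simp
qed simp

text \<open>The link to the indexwise form used in \<open>regular_seq\<close>.\<close>

lemma regular_on_iff:
  "regular_on M N xs \<longleftrightarrow> (\<forall>i<length xs. \<forall>u\<in>M. xs ! i \<otimes> u \<in> add_mults M N (take i xs) \<longrightarrow>
     u \<in> add_mults M N (take i xs))"
proof (induction xs arbitrary: N)
  case (Cons x xs)
  show ?case
    by (auto simp: Cons.IH less_Suc_eq_0_disj)
qed simp

end

text \<open>A resolution of \<open>R/\<mm>\<close> in which the augmentation is replaced by a lift
  \<open>\<gamma>\<close> with values in \<open>R\<close>: exactness at \<open>F 0\<close> becomes a
  statement about the preimage of \<open>\<mm>\<close>, and surjectivity the existence of
  \<open>v\<close> with \<open>\<gamma> v\<close> congruent to 1. No cosets of \<open>\<mm>\<close>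
  occur afterwards.\<close>

locale residue_resolution = cring +
  fixes \<mm> :: "'a set" and b :: "nat \<Rightarrow> nat" and d :: "nat \<Rightarrow> (nat \<Rightarrow> 'a) \<Rightarrow> nat \<Rightarrow> 'a"
    and \<gamma> :: "(nat \<Rightarrow> 'a) \<Rightarrow> 'a"
  assumes m: "ideal \<mm> R"
    and \<gamma>: "linear R (free_module R (b 0)) (ring_module R) \<gamma>"
    and d: "linear R (free_module R (b (Suc i))) (free_module R (b i)) (d i)"
    and ex0: "d 0 ` carrier (free_module R (b (Suc 0))) = {v \<in> carrier (free_module R (b 0)). \<gamma> v \<in> \<mm>}"
    and exS: "d (Suc i) ` carrier (free_module R (b (Suc (Suc i)))) =
      {v \<in> carrier (free_module R (b (Suc i))). d i v = \<zero>\<^bsub>free_module R (b i)\<^esub>}"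
    and surj: "\<exists>v\<in>carrier (free_module R (b 0)). \<one> \<ominus> \<gamma> v \<in> \<mm>"
begin

declare free_simps [simp del]

abbreviation F where "F i \<equiv> free_module R (b i)"

lemma Fm: "module R (F i)" by (rule free_module_module)

definition lin :: "nat \<Rightarrow> 'a set \<Rightarrow> ((nat \<Rightarrow> 'a) \<Rightarrow> 'a) \<Rightarrow> bool" where
  "lin j M \<phi> \<longleftrightarrow> linear R (F j) (ring_module R) \<phi> \<and> (\<forall>v\<in>carrier (F j). \<phi> v \<in> M)"

text \<open>A representative of a cocycle with values in \<open>M/N\<close>: maps from a free module
  to \<open>M/N\<close> lift to \<open>M\<close>, so maps into \<open>M\<close> together with
  congruences modulo \<open>N\<close> suffice.\<close>

definition cocycle where
  "cocycle j \<phi> M N \<longleftrightarrow> lin j M \<phi> \<and> (\<forall>v\<in>carrier (F (Suc j)). \<phi> (d j v) \<in> N)"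

text \<open>Nothing maps into degree 0, so there a coboundary is zero modulo
  \<open>N\<close>.\<close>

primrec cobound where
  "cobound 0 \<phi> M N \<longleftrightarrow> (\<forall>v\<in>carrier (F 0). \<phi> v \<in> N)"
| "cobound (Suc i) \<phi> M N \<longleftrightarrow> (\<exists>\<chi>. lin i M \<chi> \<and> (\<forall>v\<in>carrier (F (Suc i)). \<phi> v \<ominus> \<chi> (d i v) \<in> N))"

text \<open>Ext of \<open>R/\<mm>\<close> with values in \<open>M/N\<close> is zero in all degrees
  below \<open>e\<close>.\<close>

definition vanish where
  "vanish e M N \<longleftrightarrow> (\<forall>j<e. \<forall>\<phi>. cocycle j \<phi> M N \<longrightarrow> cobound j \<phi> M N)"

text \<open>Every nonzero class generates Ext in degree \<open>e\<close>; over a residue field this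
  says that its dimension is at most one.\<close>

definition onedim where
  "onedim e M N \<longleftrightarrow> (\<forall>\<phi> \<psi>. cocycle e \<phi> M N \<longrightarrow> cocycle e \<psi> M N \<longrightarrow> \<not> cobound e \<phi> M N \<longrightarrow>
     (\<exists>r\<in>carrier R. cobound e (\<lambda>v. \<psi> v \<ominus> r \<otimes> \<phi> v) M N))"

lemma dc: "v \<in> carrier (F (Suc i)) \<Longrightarrow> d i v \<in> carrier (F i)"
  using linearD(1)[OF d] .

lemma linD:
  assumes "lin j M \<phi>"
  shows "v \<in> carrier (F j) \<Longrightarrow> \<phi> v \<in> M"
    "v \<in> carrier (F j) \<Longrightarrow> \<phi> v \<in> carrier R"
    "\<lbrakk>v \<in> carrier (F j); w \<in> carrier (F j)\<rbrakk> \<Longrightarrow> \<phi> (v \<oplus>\<^bsub>F j\<^esub> w) = \<phi> v \<oplus> \<phi> w"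
    "\<lbrakk>r \<in> carrier R; v \<in> carrier (F j)\<rbrakk> \<Longrightarrow> \<phi> (r \<odot>\<^bsub>F j\<^esub> v) = r \<otimes> \<phi> v"
    "\<phi> \<zero>\<^bsub>F j\<^esub> = \<zero>"
  using assms linearD[of R "F j" "ring_module R" \<phi>] linear_zero[OF Fm ring_module_module, of j \<phi>] unfolding lin_def by auto

lemma linI:
  assumes "\<And>v. v \<in> carrier (F j) \<Longrightarrow> \<phi> v \<in> M" "M \<subseteq> carrier R"
    "\<And>v w. \<lbrakk>v \<in> carrier (F j); w \<in> carrier (F j)\<rbrakk> \<Longrightarrow> \<phi> (v \<oplus>\<^bsub>F j\<^esub> w) = \<phi> v \<oplus> \<phi> w"
    "\<And>r v. \<lbrakk>r \<in> carrier R; v \<in> carrier (F j)\<rbrakk> \<Longrightarrow> \<phi> (r \<odot>\<^bsub>F j\<^esub> v) = r \<otimes> \<phi> v"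
  shows "lin j M \<phi>"
  unfolding lin_def
proof (intro conjI ballI linearI)
  show "\<phi> v \<in> carrier (ring_module R)" if "v \<in> carrier (F j)" for v using assms(1)[OF that] assms(2) by auto
qed (use assms in auto)

lemma lin_diff:
  assumes "ideal M R" "lin j M \<phi>" "lin j M \<psi>"
  shows "lin j M (\<lambda>v. \<phi> v \<ominus> \<psi> v)"
proof (rule linI)
  note c = linD(2)[OF assms(2)] linD(2)[OF assms(3)]
  fix v assume v: "v \<in> carrier (F j)"
  show "\<phi> v \<ominus> \<psi> v \<in> M" using v linD(1)[OF assms(2)] linD(1)[OF assms(3)] assms(1) by (blast intro: idl_diff)
  show "\<phi> (r \<odot>\<^bsub>F j\<^esub> v) \<ominus> \<psi> (r \<odot>\<^bsub>F j\<^esub> v) = r \<otimes> (\<phi> v \<ominus> \<psi> v)" if "r \<in> carrier R" for r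
    unfolding linD(4)[OF assms(2) that v] linD(4)[OF assms(3) that v] using that c[OF v] by algebra
  fix w assume w: "w \<in> carrier (F j)"
  show "\<phi> (v \<oplus>\<^bsub>F j\<^esub> w) \<ominus> \<psi> (v \<oplus>\<^bsub>F j\<^esub> w) = (\<phi> v \<ominus> \<psi> v) \<oplus> (\<phi> w \<ominus> \<psi> w)"
    unfolding linD(3)[OF assms(2) v w] linD(3)[OF assms(3) v w] using c[OF v] c[OF w] by algebra
qed (rule idl_sub[OF assms(1)])

lemma lin_scale:
  assumes "ideal M R" "lin j M \<phi>" "c \<in> carrier R"
  shows "lin j M (\<lambda>v. c \<otimes> \<phi> v)"
proof (rule linI)
  note cl = linD(2)[OF assms(2)]
  fix v assume v: "v \<in> carrier (F j)"
  show "c \<otimes> \<phi> v \<in> M" using v linD(1)[OF assms(2)] assms by (blast intro: idl_lmult)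
  show "c \<otimes> \<phi> (r \<odot>\<^bsub>F j\<^esub> v) = r \<otimes> (c \<otimes> \<phi> v)" if "r \<in> carrier R" for r
    unfolding linD(4)[OF assms(2) that v] by (rule m_lcomm[OF assms(3) that cl[OF v]])
  fix w assume w: "w \<in> carrier (F j)"
  show "c \<otimes> \<phi> (v \<oplus>\<^bsub>F j\<^esub> w) = c \<otimes> \<phi> v \<oplus> c \<otimes> \<phi> w"
    unfolding linD(3)[OF assms(2) v w] using cl[OF v] cl[OF w] assms(3) by (simp add: r_distr)
qed (rule idl_sub[OF assms(1)])

lemma lin_comp:
  assumes "ideal M R" "lin j M \<phi>" "linear R (F i) (F j) s"
  shows "lin i M (\<lambda>v. \<phi> (s v))"
proof (rule linI)
  note sc = linearD(1)[OF assms(3)]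
  fix v assume v: "v \<in> carrier (F i)"
  show "\<phi> (s v) \<in> M" using linD(1)[OF assms(2) sc[OF v]] .
  show "\<phi> (s (r \<odot>\<^bsub>F i\<^esub> v)) = r \<otimes> \<phi> (s v)" if "r \<in> carrier R" for r
    unfolding linearD(3)[OF assms(3) that v] linD(4)[OF assms(2) that sc[OF v]] ..
  fix w assume w: "w \<in> carrier (F i)"
  show "\<phi> (s (v \<oplus>\<^bsub>F i\<^esub> w)) = \<phi> (s v) \<oplus> \<phi> (s w)"
    unfolding linearD(2)[OF assms(3) v w] linD(3)[OF assms(2) sc[OF v] sc[OF w]] ..
qed (rule idl_sub[OF assms(1)])

lemma dd:
  assumes "v \<in> carrier (F (Suc (Suc i)))" shows "d i (d (Suc i) v) = \<zero>\<^bsub>F i\<^esub>"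
  using exS[of i] assms by blast

text \<open>Freeness of \<open>F j\<close> makes the pointwise choice of \<open>k\<close> in
  \<open>\<phi> v = n + x k\<close> linear.\<close>

lemma lift_scalar:
  assumes M: "ideal M R" and N: "ideal N R" "N \<subseteq> M" and x: "x \<in> carrier R" and \<phi>: "lin j M \<phi>"
    and ex: "\<And>v. v \<in> carrier (F j) \<Longrightarrow> \<phi> v \<in> N <+> (x \<odot>\<^sub>s M)"
  obtains \<phi>' where "lin j M \<phi>'" "\<And>v. v \<in> carrier (F j) \<Longrightarrow> \<phi> v \<ominus> x \<otimes> \<phi>' v \<in> N"
proof -
  let ?M = "(ring_module R)\<lparr>carrier := M\<rparr>"
  interpret RM: module R "ring_module R" by (rule ring_module_module)
  have h: "linear R ?M (ring_module R) (\<lambda>u. x \<otimes> u)"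
    by (rule linearI) (use x idl_carr[OF M] in \<open>auto simp: r_distr m_lcomm\<close>)
  have g: "linear R (F j) (ring_module R) \<phi>" using \<phi> unfolding lin_def by blast
  have "\<exists>k\<in>carrier ?M. \<phi> v \<ominus>\<^bsub>ring_module R\<^esub> x \<otimes> k \<in> N" if v: "v \<in> carrier (F j)" for v
  proof -
    obtain n k where nk: "n \<in> N" "k \<in> M" "\<phi> v = n \<oplus> x \<otimes> k" using ex[OF v] by (elim idl_sumE elt_multE) blast
    then have "n \<in> carrier R" "k \<in> carrier R" using idl_carr M N by blast+
    then have "\<phi> v \<ominus> x \<otimes> k = n" unfolding nk(3) using x by algebra
    then show ?thesis using nk(1,2) by (intro bexI[of _ k]) (simp_all add: minus_ring_module)
  qed
  then obtain \<phi>' where p: "linear R (F j) ?M \<phi>'" "\<And>v. v \<in> carrier (F j) \<Longrightarrow> \<phi> v \<ominus>\<^bsub>ring_module R\<^esub> x \<otimes> \<phi>' v \<in> N"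
    using RM.free_module_lift[OF ideal_module[OF M] _ g h, of N] N(1) ideal_iff_submodule by blast
  have "lin j M \<phi>'"
    by (rule linI) (use linearD[OF p(1)] idl_sub[OF M] in auto)
  then show ?thesis using that p(2) by (simp add: minus_ring_module)
qed

lemma lift_free:
  assumes g: "linear R (F i) (F j) g" and h: "linear R (F k) (F j) h"
    and ex: "\<And>v. v \<in> carrier (F i) \<Longrightarrow> g v \<in> h ` carrier (F k)"
  obtains s where "linear R (F i) (F k) s" "\<And>v. v \<in> carrier (F i) \<Longrightarrow> h (s v) = g v"
proof -
  interpret J: module R "F j" by (rule Fm)
  have 0: "submodule {\<zero>\<^bsub>F j\<^esub>} R (F j)" by (rule J.submoduleI') auto
  have "\<exists>u\<in>carrier (F k). g v \<ominus>\<^bsub>F j\<^esub> h u \<in> {\<zero>\<^bsub>F j\<^esub>}" if v: "v \<in> carrier (F i)" for v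
  proof -
    obtain u where "u \<in> carrier (F k)" "g v = h u" using ex[OF v] by blast
    moreover have "g v \<in> carrier (F j)" using linearD(1)[OF g v] .
    ultimately show ?thesis by (intro bexI[of _ u]) (auto simp: a_minus_def J.r_neg)
  qed
  then obtain s where s: "linear R (F i) (F k) s" "\<And>v. v \<in> carrier (F i) \<Longrightarrow> g v \<ominus>\<^bsub>F j\<^esub> h (s v) \<in> {\<zero>\<^bsub>F j\<^esub>}"
    using J.free_module_lift[OF Fm 0 g h] by blast
  have "h (s v) = g v" if "v \<in> carrier (F i)" for v
  proof -
    have "g v \<in> carrier (F j)" "h (s v) \<in> carrier (F j)"
      using that linearD(1)[OF g] linearD(1)[OF h] linearD(1)[OF s(1)] by blast+
    moreover from this have "g v = (g v \<ominus>\<^bsub>F j\<^esub> h (s v)) \<oplus>\<^bsub>F j\<^esub> h (s v)"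
      by (simp add: a_minus_def J.a_assoc J.l_neg)
    ultimately show ?thesis using s(2)[OF that] by simp
  qed
  then show ?thesis using that s(1) by blast
qed

lemma homotopy_start:
  assumes x: "x \<in> \<mm>"
  obtains s where "linear R (F 0) (F (Suc 0)) s" "\<And>v. v \<in> carrier (F 0) \<Longrightarrow> d 0 (s v) = x \<odot>\<^bsub>F 0\<^esub> v"
proof -
  interpret F0: module R "F 0" by (rule Fm)
  have xc: "x \<in> carrier R" using idl_carr[OF m x] .
  have g: "linear R (F 0) (F 0) (\<lambda>v. x \<odot>\<^bsub>F 0\<^esub> v)"
    by (rule linearI) (use xc in \<open>auto simp: F0.smult_r_distr F0.smult_assoc1[symmetric] m_comm\<close>)
  have "x \<odot>\<^bsub>F 0\<^esub> v \<in> d 0 ` carrier (F (Suc 0))" if "v \<in> carrier (F 0)" for v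
  proof -
    have "\<gamma> (x \<odot>\<^bsub>F 0\<^esub> v) = x \<otimes> \<gamma> v" using linearD(3)[OF \<gamma> xc that] by simp
    moreover have "\<gamma> v \<in> carrier R" using linearD(1)[OF \<gamma> that] by simp
    ultimately show ?thesis unfolding ex0 using that xc idl_rmult[OF m x] by simp
  qed
  then show ?thesis using lift_free[OF g d[of 0]] that by blast
qed

text \<open>The defect \<open>x v - s' (d v)\<close> is a cycle, hence a boundary, and lifting it
  defines the next homotopy.\<close>

lemma homotopy_step:
  assumes x: "x \<in> carrier R" and s': "linear R (F j) (F (Suc j)) s'"
    and s'd: "\<And>v. v \<in> carrier (F (Suc j)) \<Longrightarrow> d j (s' (d j v)) = x \<odot>\<^bsub>F j\<^esub> d j v"
  obtains s where "linear R (F (Suc j)) (F (Suc (Suc j))) s"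
    "\<And>v. v \<in> carrier (F (Suc j)) \<Longrightarrow> d (Suc j) (s v) \<oplus>\<^bsub>F (Suc j)\<^esub> s' (d j v) = x \<odot>\<^bsub>F (Suc j)\<^esub> v"
proof -
  interpret FS: module R "F (Suc j)" by (rule Fm)
  interpret Fj: module R "F j" by (rule Fm)
  let ?g = "\<lambda>v. x \<odot>\<^bsub>F (Suc j)\<^esub> v \<ominus>\<^bsub>F (Suc j)\<^esub> s' (d j v)"
  note s'c = linearD(1)[OF s' dc]
  have g: "linear R (F (Suc j)) (F (Suc j)) ?g"
  proof (rule linearI)
    fix v w assume v: "v \<in> carrier (F (Suc j))" and w: "w \<in> carrier (F (Suc j))"
    have "s' (d j (v \<oplus>\<^bsub>F (Suc j)\<^esub> w)) = s' (d j v) \<oplus>\<^bsub>F (Suc j)\<^esub> s' (d j w)"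
      using v w by (simp add: linearD(2)[OF d] linearD(2)[OF s'] dc)
    then show "?g (v \<oplus>\<^bsub>F (Suc j)\<^esub> w) = ?g v \<oplus>\<^bsub>F (Suc j)\<^esub> ?g w"
      using v w s'c[OF v] s'c[OF w] x
      by (simp add: FS.smult_r_distr a_minus_def FS.minus_add FS.a_ac)
  next
    fix r v assume r: "r \<in> carrier R" and v: "v \<in> carrier (F (Suc j))"
    have "s' (d j (r \<odot>\<^bsub>F (Suc j)\<^esub> v)) = r \<odot>\<^bsub>F (Suc j)\<^esub> s' (d j v)"
      using r v by (simp add: linearD(3)[OF d] linearD(3)[OF s'] dc)
    moreover have "x \<odot>\<^bsub>F (Suc j)\<^esub> (r \<odot>\<^bsub>F (Suc j)\<^esub> v) = r \<odot>\<^bsub>F (Suc j)\<^esub> (x \<odot>\<^bsub>F (Suc j)\<^esub> v)"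
      using x r v by (simp add: FS.smult_assoc1[symmetric] m_comm)
    ultimately show "?g (r \<odot>\<^bsub>F (Suc j)\<^esub> v) = r \<odot>\<^bsub>F (Suc j)\<^esub> ?g v"
      using r v s'c[OF v] x
      by (simp add: FS.smult_r_distr FS.smult_r_minus a_minus_def)
  next
    show "?g v \<in> carrier (F (Suc j))" if "v \<in> carrier (F (Suc j))" for v
      using that s'c x by (simp add: a_minus_def)
  qed
  have "?g v \<in> d (Suc j) ` carrier (F (Suc (Suc j)))" if v: "v \<in> carrier (F (Suc j))" for v
  proof -
    have "d j (?g v) = x \<odot>\<^bsub>F j\<^esub> d j v \<ominus>\<^bsub>F j\<^esub> d j (s' (d j v))"
      using linear_minus[OF Fm Fm d, of "x \<odot>\<^bsub>F (Suc j)\<^esub> v" j "s' (d j v)"] linearD(3)[OF d x v] v x s'c[OF v] by simp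
    also have "\<dots> = \<zero>\<^bsub>F j\<^esub>" unfolding s'd[OF v] using x dc[OF v] by (simp add: a_minus_def Fj.r_neg)
    finally show ?thesis unfolding exS using linearD(1)[OF g v] by blast
  qed
  then obtain s where s: "linear R (F (Suc j)) (F (Suc (Suc j))) s"
      "\<And>v. v \<in> carrier (F (Suc j)) \<Longrightarrow> d (Suc j) (s v) = ?g v"
    using lift_free[OF g d[of "Suc j"]] by blast
  have "d (Suc j) (s v) \<oplus>\<^bsub>F (Suc j)\<^esub> s' (d j v) = x \<odot>\<^bsub>F (Suc j)\<^esub> v" if v: "v \<in> carrier (F (Suc j))" for v
    unfolding s(2)[OF v] using v s'c[OF v] x by (simp add: a_minus_def FS.a_assoc FS.l_neg)
  then show ?thesis using that s(1) by blast
qed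

text \<open>Multiplication by an element of \<open>\<mm>\<close> is zero on \<open>R/\<mm>\<close>,
  hence null-homotopic on its resolution. Two consecutive homotopies are asserted together because
  the step builds on the previous one.\<close>

lemma homotopy:
  assumes x: "x \<in> \<mm>"
  shows "\<exists>s s'. linear R (F (Suc j)) (F (Suc (Suc j))) s \<and> linear R (F j) (F (Suc j)) s' \<and>
    (\<forall>v\<in>carrier (F (Suc j)). d (Suc j) (s v) \<oplus>\<^bsub>F (Suc j)\<^esub> s' (d j v) = x \<odot>\<^bsub>F (Suc j)\<^esub> v)"
proof (induction j)
  case 0
  obtain s' where s': "linear R (F 0) (F (Suc 0)) s'" "\<And>v. v \<in> carrier (F 0) \<Longrightarrow> d 0 (s' v) = x \<odot>\<^bsub>F 0\<^esub> v"
    using homotopy_start[OF x] by blast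
  then obtain s where "linear R (F (Suc 0)) (F (Suc (Suc 0))) s"
    "\<And>v. v \<in> carrier (F (Suc 0)) \<Longrightarrow> d (Suc 0) (s v) \<oplus>\<^bsub>F (Suc 0)\<^esub> s' (d 0 v) = x \<odot>\<^bsub>F (Suc 0)\<^esub> v"
    using homotopy_step[OF idl_carr[OF m x] s'(1)] dc by metis
  then show ?case using s' by blast
next
  case (Suc j)
  then obtain s s' where s: "linear R (F (Suc j)) (F (Suc (Suc j))) s" "linear R (F j) (F (Suc j)) s'"
    "\<And>v. v \<in> carrier (F (Suc j)) \<Longrightarrow> d (Suc j) (s v) \<oplus>\<^bsub>F (Suc j)\<^esub> s' (d j v) = x \<odot>\<^bsub>F (Suc j)\<^esub> v" by blast
  interpret FS: module R "F (Suc j)" by (rule Fm)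
  have "d (Suc j) (s (d (Suc j) v)) = x \<odot>\<^bsub>F (Suc j)\<^esub> d (Suc j) v" if v: "v \<in> carrier (F (Suc (Suc j)))" for v
  proof -
    have "s' (d j (d (Suc j) v)) = \<zero>\<^bsub>F (Suc j)\<^esub>" unfolding dd[OF v] by (rule linear_zero[OF Fm Fm s(2)])
    then show ?thesis using s(3)[OF dc[OF v]] dc[OF linearD(1)[OF s(1) dc[OF v]]] by simp
  qed
  then obtain t where "linear R (F (Suc (Suc j))) (F (Suc (Suc (Suc j)))) t"
    "\<And>v. v \<in> carrier (F (Suc (Suc j))) \<Longrightarrow> d (Suc (Suc j)) (t v) \<oplus>\<^bsub>F (Suc (Suc j))\<^esub> s (d (Suc j) v) = x \<odot>\<^bsub>F (Suc (Suc j))\<^esub> v"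
    using homotopy_step[OF idl_carr[OF m x] s(1)] by blast
  then show ?case using s(1) by blast
qed

text \<open>In positive degree \<open>\<chi>\<close> equals some \<open>\<eta> d\<close> modulo
  \<open>N + xM\<close>, and \<open>\<eta> d d = 0\<close>, so after subtracting
  \<open>\<eta> d\<close> the map can be divided by \<open>x\<close> modulo
  \<open>N\<close>.\<close>

lemma cobound_lift:
  assumes M: "ideal M R" and N: "ideal N R" "N \<subseteq> M" and x: "x \<in> carrier R"
    and \<chi>: "lin i M \<chi>" "cobound i \<chi> M (N <+> (x \<odot>\<^sub>s M))"
  obtains \<omega> where "lin i M \<omega>" "\<And>v. v \<in> carrier (F (Suc i)) \<Longrightarrow> \<chi> (d i v) \<ominus> x \<otimes> \<omega> (d i v) \<in> N"
proof (cases i)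
  case 0
  then have "\<chi> v \<in> N <+> (x \<odot>\<^sub>s M)" if "v \<in> carrier (F i)" for v using \<chi>(2) that by simp
  then obtain \<omega> where \<omega>: "lin i M \<omega>" "\<And>v. v \<in> carrier (F i) \<Longrightarrow> \<chi> v \<ominus> x \<otimes> \<omega> v \<in> N"
    using lift_scalar[OF M N x \<chi>(1)] by blast
  show ?thesis by (rule that[OF \<omega>(1) \<omega>(2)[OF dc]])
next
  case (Suc k)
  then obtain \<eta> where \<eta>: "lin k M \<eta>" "\<And>v. v \<in> carrier (F (Suc k)) \<Longrightarrow> \<chi> v \<ominus> \<eta> (d k v) \<in> N <+> (x \<odot>\<^sub>s M)"
    using \<chi>(2) by auto
  have "lin (Suc k) M (\<lambda>v. \<chi> v \<ominus> \<eta> (d k v))"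
    using \<chi>(1) Suc by (intro lin_diff M lin_comp[OF M \<eta>(1) d]) auto
  then obtain \<omega> where \<omega>: "lin (Suc k) M \<omega>" "\<And>v. v \<in> carrier (F (Suc k)) \<Longrightarrow> (\<chi> v \<ominus> \<eta> (d k v)) \<ominus> x \<otimes> \<omega> v \<in> N"
    using lift_scalar[OF M N x] \<eta>(2) by blast
  have "\<chi> (d i v) \<ominus> x \<otimes> \<omega> (d i v) \<in> N" if "v \<in> carrier (F (Suc i))" for v
  proof -
    have v: "v \<in> carrier (F (Suc (Suc k)))" using that Suc by simp
    have "\<eta> (d k (d (Suc k) v)) = \<zero>" unfolding dd[OF v] by (rule linD(5)[OF \<eta>(1)])
    moreover have "\<chi> (d (Suc k) v) \<in> carrier R" using linD(2)[OF \<chi>(1)] dc[OF v] Suc by simp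
    ultimately show ?thesis using \<omega>(2)[OF dc[OF v]] Suc by (simp add: a_minus_def)
  qed
  then show ?thesis using that \<omega>(1) Suc by blast
qed

text \<open>Cohomology is killed by \<open>x \<in> \<mm>\<close>, while \<open>x\<close> is
  injective on \<open>M/N\<close>. Concretely, the homotopy gives \<open>x \<phi> = \<chi> d\<close>
  modulo \<open>N\<close>; by induction \<open>\<chi>\<close> is a coboundary modulo
  \<open>N + xM\<close>, so \<open>x \<phi> = x \<omega> d\<close> modulo \<open>N\<close>, and
  \<open>x\<close> cancels.\<close>

lemma vanish_regular:
  assumes "ideal M R" "ideal N R" "N \<subseteq> M" "set xs \<subseteq> \<mm>" "regular_on M N xs"
  shows "vanish (length xs) M N"
  using assms
proof (induction xs arbitrary: N)
  case Nil
  then show ?case by (simp add: vanish_def)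
next
  case (Cons x xs)
  note M = Cons.prems(1) and N = Cons.prems(2,3)
  have x: "x \<in> \<mm>" "x \<in> carrier R" using Cons.prems(4) idl_carr[OF m] by auto
  note a = add_mult_ideal[OF M N x(2)]
  let ?N = "N <+> (x \<odot>\<^sub>s M)"
  have IH: "vanish (length xs) M ?N" using Cons.IH[OF M a(1,2)] Cons.prems by simp
  have reg: "u \<in> N" if "u \<in> M" "x \<otimes> u \<in> N" for u using Cons.prems(5) that by simp
  show ?case
    unfolding vanish_def
  proof (intro allI impI)
    fix j \<phi> assume j: "j < length (x # xs)" and "cocycle j \<phi> M N"
    then have \<phi>: "lin j M \<phi>" "\<And>v. v \<in> carrier (F (Suc j)) \<Longrightarrow> \<phi> (d j v) \<in> N" by (auto simp: cocycle_def)
    show "cobound j \<phi> M N"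
    proof (cases j)
      case 0
      obtain s where s: "linear R (F 0) (F (Suc 0)) s" "\<And>v. v \<in> carrier (F 0) \<Longrightarrow> d 0 (s v) = x \<odot>\<^bsub>F 0\<^esub> v"
        using homotopy_start[OF x(1)] by blast
      have "\<phi> v \<in> N" if v: "v \<in> carrier (F 0)" for v
      proof -
        have "x \<otimes> \<phi> v = \<phi> (d 0 (s v))" using linD(4)[OF \<phi>(1) x(2)] s(2)[OF v] v 0 by simp
        then show ?thesis using \<phi>(2)[of "s v"] linearD(1)[OF s(1) v] reg linD(1)[OF \<phi>(1)] v 0 by simp
      qed
      then show ?thesis using 0 by simp
    next
      case (Suc i)
      obtain s s' where s: "linear R (F (Suc i)) (F (Suc (Suc i))) s" "linear R (F i) (F (Suc i)) s'"
        "\<And>v. v \<in> carrier (F (Suc i)) \<Longrightarrow> d (Suc i) (s v) \<oplus>\<^bsub>F (Suc i)\<^esub> s' (d i v) = x \<odot>\<^bsub>F (Suc i)\<^esub> v"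
        using homotopy[OF x(1), of i] by blast
      note \<phi>' = \<phi>[unfolded Suc]
      define \<chi> where "\<chi> = (\<lambda>v. \<phi> (s' v))"
      have \<chi>: "lin i M \<chi>" unfolding \<chi>_def by (rule lin_comp[OF M \<phi>'(1) s(2)])
      have key: "x \<otimes> \<phi> v \<ominus> \<chi> (d i v) \<in> N" if v: "v \<in> carrier (F (Suc i))" for v
      proof -
        have c: "d (Suc i) (s v) \<in> carrier (F (Suc i))" "s' (d i v) \<in> carrier (F (Suc i))"
          using dc[OF linearD(1)[OF s(1) v]] linearD(1)[OF s(2) dc[OF v]] by auto
        have "x \<otimes> \<phi> v = \<phi> (d (Suc i) (s v)) \<oplus> \<chi> (d i v)"
          using linD(4)[OF \<phi>'(1) x(2) v] linD(3)[OF \<phi>'(1) c] s(3)[OF v] unfolding \<chi>_def by simp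
        then have "x \<otimes> \<phi> v \<ominus> \<chi> (d i v) = \<phi> (d (Suc i) (s v))"
          using linD(2)[OF \<phi>'(1) c(1)] linD(2)[OF \<chi> dc[OF v]] by (simp add: a_minus_def a_assoc r_neg)
        then show ?thesis using \<phi>'(2)[OF linearD(1)[OF s(1) v]] by simp
      qed
      have "cocycle i \<chi> M ?N" unfolding cocycle_def
      proof (intro conjI ballI \<chi>)
        fix v assume v: "v \<in> carrier (F (Suc i))"
        have c: "\<phi> v \<in> carrier R" "\<chi> (d i v) \<in> carrier R" using linD(2)[OF \<phi>'(1) v] linD(2)[OF \<chi> dc[OF v]] .
        have "x \<otimes> \<phi> v \<in> ?N" using a(4) linD(1)[OF \<phi>'(1) v] by blast
        then have "x \<otimes> \<phi> v \<ominus> (x \<otimes> \<phi> v \<ominus> \<chi> (d i v)) \<in> ?N" using key[OF v] a(1,3) by (blast intro: idl_diff)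
        also have "x \<otimes> \<phi> v \<ominus> (x \<otimes> \<phi> v \<ominus> \<chi> (d i v)) = \<chi> (d i v)" using c x by algebra
        finally show "\<chi> (d i v) \<in> ?N" .
      qed
      then have "cobound i \<chi> M ?N" using IH j Suc unfolding vanish_def by simp
      then obtain \<omega> where \<omega>: "lin i M \<omega>" "\<And>v. v \<in> carrier (F (Suc i)) \<Longrightarrow> \<chi> (d i v) \<ominus> x \<otimes> \<omega> (d i v) \<in> N"
        using cobound_lift[OF M N x(2) \<chi>] by blast
      have "\<phi> v \<ominus> \<omega> (d i v) \<in> N" if v: "v \<in> carrier (F (Suc i))" for v
      proof (rule reg)
        show "\<phi> v \<ominus> \<omega> (d i v) \<in> M" using linD(1)[OF \<phi>'(1) v] linD(1)[OF \<omega>(1) dc[OF v]] M by (blast intro: idl_diff)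
        have c: "\<phi> v \<in> carrier R" "\<chi> (d i v) \<in> carrier R" "\<omega> (d i v) \<in> carrier R"
          using linD(2)[OF \<phi>'(1) v] linD(2)[OF \<chi> dc[OF v]] linD(2)[OF \<omega>(1) dc[OF v]] .
        have "x \<otimes> (\<phi> v \<ominus> \<omega> (d i v)) = (x \<otimes> \<phi> v \<ominus> \<chi> (d i v)) \<oplus> (\<chi> (d i v) \<ominus> x \<otimes> \<omega> (d i v))"
          using c x by algebra
        then show "x \<otimes> (\<phi> v \<ominus> \<omega> (d i v)) \<in> N" using key[OF v] \<omega>(2)[OF v] N by (simp add: idl_add)
      qed
      then show ?thesis using Suc \<omega>(1) by auto
    qed
  qed
qed

text \<open>The connecting map of \<open>0 \<rightarrow> M/N \<rightarrow> M/N \<rightarrow> M/(N +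
  zM) \<rightarrow> 0\<close> on representatives: \<open>\<phi> d\<close> can be divided by
  \<open>z\<close> modulo \<open>N\<close>, and regularity of \<open>z\<close> makes the quotient
  \<open>\<phi>'\<close> a cocycle.\<close>

lemma connecting:
  assumes M: "ideal M R" and N: "ideal N R" "N \<subseteq> M" and z: "z \<in> carrier R"
    and reg: "\<And>u. \<lbrakk>u \<in> M; z \<otimes> u \<in> N\<rbrakk> \<Longrightarrow> u \<in> N"
    and \<phi>: "cocycle j \<phi> M (N <+> (z \<odot>\<^sub>s M))"
  obtains \<phi>' where "cocycle (Suc j) \<phi>' M N" "\<And>v. v \<in> carrier (F (Suc j)) \<Longrightarrow> \<phi> (d j v) \<ominus> z \<otimes> \<phi>' v \<in> N"
proof -
  have l: "lin j M \<phi>" "\<And>v. v \<in> carrier (F (Suc j)) \<Longrightarrow> \<phi> (d j v) \<in> N <+> (z \<odot>\<^sub>s M)" using \<phi> by (auto simp: cocycle_def)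
  obtain \<phi>' where p: "lin (Suc j) M \<phi>'" "\<And>v. v \<in> carrier (F (Suc j)) \<Longrightarrow> \<phi> (d j v) \<ominus> z \<otimes> \<phi>' v \<in> N"
    using lift_scalar[OF M N z lin_comp[OF M l(1) d]] l(2) by blast
  have "\<phi>' (d (Suc j) v) \<in> N" if v: "v \<in> carrier (F (Suc (Suc j)))" for v
  proof (rule reg)
    show "\<phi>' (d (Suc j) v) \<in> M" by (rule linD(1)[OF p(1) dc[OF v]])
    have "\<phi> (d j (d (Suc j) v)) = \<zero>" unfolding dd[OF v] by (rule linD(5)[OF l(1)])
    moreover have c: "\<phi>' (d (Suc j) v) \<in> carrier R" by (rule linD(2)[OF p(1) dc[OF v]])
    ultimately have "\<ominus> (z \<otimes> \<phi>' (d (Suc j) v)) \<in> N" using p(2)[OF dc[OF v]] z by (simp add: a_minus_def)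
    then show "z \<otimes> \<phi>' (d (Suc j) v) \<in> N" using idl_neg[OF N(1)] c z minus_minus by fastforce
  qed
  then show ?thesis using that p by (auto simp: cocycle_def)
qed

text \<open>Injectivity of the connecting map: if \<open>\<phi>' = \<chi> d\<close> modulo
  \<open>N\<close>, then \<open>\<phi> - z \<chi>\<close> is a cocycle modulo \<open>N\<close>, and
  the cohomology of \<open>M/N\<close> in degree \<open>j\<close> is zero.\<close>

lemma connecting_cobound:
  assumes M: "ideal M R" and N: "ideal N R" "N \<subseteq> M" and z: "z \<in> carrier R"
    and \<phi>: "lin j M \<phi>" and \<phi>': "lin (Suc j) M \<phi>'" "cobound (Suc j) \<phi>' M N"
    and eq: "\<And>v. v \<in> carrier (F (Suc j)) \<Longrightarrow> \<phi> (d j v) \<ominus> z \<otimes> \<phi>' v \<in> N"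
    and van: "vanish (Suc j) M N"
  shows "cobound j \<phi> M (N <+> (z \<odot>\<^sub>s M))"
proof -
  note a = add_mult_ideal[OF M N z]
  obtain \<chi> where \<chi>: "lin j M \<chi>" "\<And>v. v \<in> carrier (F (Suc j)) \<Longrightarrow> \<phi>' v \<ominus> \<chi> (d j v) \<in> N"
    using \<phi>'(2) by auto
  let ?p = "\<lambda>v. \<phi> v \<ominus> z \<otimes> \<chi> v"
  have "cocycle j ?p M N" unfolding cocycle_def
  proof (intro conjI ballI)
    show "lin j M ?p" by (intro lin_diff M \<phi> lin_scale \<chi> z)
    fix v assume v: "v \<in> carrier (F (Suc j))"
    have c: "\<phi> (d j v) \<in> carrier R" "\<phi>' v \<in> carrier R" "\<chi> (d j v) \<in> carrier R"
      using linD(2)[OF \<phi> dc[OF v]] linD(2)[OF \<phi>'(1) v] linD(2)[OF \<chi>(1) dc[OF v]] .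
    have "(\<phi> (d j v) \<ominus> z \<otimes> \<phi>' v) \<oplus> z \<otimes> (\<phi>' v \<ominus> \<chi> (d j v)) \<in> N"
      using eq[OF v] \<chi>(2)[OF v] N z by (simp add: idl_add idl_lmult)
    also have "(\<phi> (d j v) \<ominus> z \<otimes> \<phi>' v) \<oplus> z \<otimes> (\<phi>' v \<ominus> \<chi> (d j v)) = \<phi> (d j v) \<ominus> z \<otimes> \<chi> (d j v)" using c z by algebra
    finally show "\<phi> (d j v) \<ominus> z \<otimes> \<chi> (d j v) \<in> N" .
  qed
  then have cb: "cobound j ?p M N" using van unfolding vanish_def by blast
  show ?thesis
  proof (cases j)
    case 0
    have "\<phi> v \<in> N <+> (z \<odot>\<^sub>s M)" if v: "v \<in> carrier (F 0)" for v
    proof -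
      have "?p v \<in> N <+> (z \<odot>\<^sub>s M)" using cb 0 v a(3) by auto
      moreover have "z \<otimes> \<chi> v \<in> N <+> (z \<odot>\<^sub>s M)" using a(4) linD(1)[OF \<chi>(1)] v 0 by blast
      ultimately show ?thesis using idl_diff_cancel[OF a(1)] linD(2)[OF \<phi>] v 0 by blast
    qed
    then show ?thesis using 0 by simp
  next
    case (Suc i)
    then obtain \<omega> where \<omega>: "lin i M \<omega>" "\<And>v. v \<in> carrier (F (Suc i)) \<Longrightarrow> ?p v \<ominus> \<omega> (d i v) \<in> N" using cb by auto
    have "\<phi> v \<ominus> \<omega> (d i v) \<in> N <+> (z \<odot>\<^sub>s M)" if v: "v \<in> carrier (F (Suc i))" for v
    proof -
      have c: "\<phi> v \<in> carrier R" "\<omega> (d i v) \<in> carrier R" "\<chi> v \<in> carrier R"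
        using linD(2)[OF \<phi>] linD(2)[OF \<omega>(1) dc[OF v]] linD(2)[OF \<chi>(1)] v Suc by auto
      have "(?p v \<ominus> \<omega> (d i v)) \<oplus> z \<otimes> \<chi> v \<in> N <+> (z \<odot>\<^sub>s M)"
        using \<omega>(2)[OF v] a(3) a(4)[OF linD(1)[OF \<chi>(1)]] v Suc by (intro idl_add[OF a(1)]) auto
      also have "(?p v \<ominus> \<omega> (d i v)) \<oplus> z \<otimes> \<chi> v = \<phi> v \<ominus> \<omega> (d i v)" using c z by algebra
      finally show ?thesis .
    qed
    then show ?thesis using Suc \<omega>(1) by auto
  qed
qed

text \<open>Ext of \<open>M/(N + zM)\<close> in degree \<open>j\<close> embeds in Ext of
  \<open>M/N\<close> in degree \<open>j + 1\<close>.\<close>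

lemma vanish_step:
  assumes M: "ideal M R" and N: "ideal N R" "N \<subseteq> M" and z: "z \<in> carrier R"
    and reg: "\<And>u. \<lbrakk>u \<in> M; z \<otimes> u \<in> N\<rbrakk> \<Longrightarrow> u \<in> N" and van: "vanish (Suc e) M N"
  shows "vanish e M (N <+> (z \<odot>\<^sub>s M))"
  unfolding vanish_def
proof (intro allI impI)
  fix j \<phi> assume j: "j < e" and \<phi>: "cocycle j \<phi> M (N <+> (z \<odot>\<^sub>s M))"
  obtain \<phi>' where p: "cocycle (Suc j) \<phi>' M N" "\<And>v. v \<in> carrier (F (Suc j)) \<Longrightarrow> \<phi> (d j v) \<ominus> z \<otimes> \<phi>' v \<in> N"
    using connecting[OF M N z reg \<phi>] by blast
  have cb: "cobound (Suc j) \<phi>' M N" using van j p(1) unfolding vanish_def by blast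
  have v: "vanish (Suc j) M N" using van j unfolding vanish_def by auto
  have l: "lin j M \<phi>" "lin (Suc j) M \<phi>'" using \<phi> p(1) by (auto simp: cocycle_def)
  show "cobound j \<phi> M (N <+> (z \<odot>\<^sub>s M))" by (rule connecting_cobound[OF M N z l cb p(2) v])
qed

text \<open>The injective connecting map carries a nonzero class to a nonzero class, and the scalar
  found in the higher degree works in the lower one.\<close>

lemma onedim_step:
  assumes M: "ideal M R" and N: "ideal N R" "N \<subseteq> M" and z: "z \<in> carrier R"
    and reg: "\<And>u. \<lbrakk>u \<in> M; z \<otimes> u \<in> N\<rbrakk> \<Longrightarrow> u \<in> N" and van: "vanish (Suc e) M N"
    and one: "onedim (Suc e) M N"
  shows "onedim e M (N <+> (z \<odot>\<^sub>s M))"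
  unfolding onedim_def
proof (intro allI impI)
  let ?N = "N <+> (z \<odot>\<^sub>s M)"
  fix \<phi> \<psi> assume \<phi>: "cocycle e \<phi> M ?N" "\<not> cobound e \<phi> M ?N" and \<psi>: "cocycle e \<psi> M ?N"
  obtain \<phi>' where p: "cocycle (Suc e) \<phi>' M N" "\<And>v. v \<in> carrier (F (Suc e)) \<Longrightarrow> \<phi> (d e v) \<ominus> z \<otimes> \<phi>' v \<in> N"
    using connecting[OF M N z reg \<phi>(1)] by blast
  obtain \<psi>' where q: "cocycle (Suc e) \<psi>' M N" "\<And>v. v \<in> carrier (F (Suc e)) \<Longrightarrow> \<psi> (d e v) \<ominus> z \<otimes> \<psi>' v \<in> N"
    using connecting[OF M N z reg \<psi>] by blast
  have l: "lin e M \<phi>" "lin (Suc e) M \<phi>'" "lin e M \<psi>" "lin (Suc e) M \<psi>'" using \<phi> \<psi> p(1) q(1) by (auto simp: cocycle_def)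
  have "\<not> cobound (Suc e) \<phi>' M N" using connecting_cobound[OF M N z l(1,2) _ p(2) van] \<phi>(2) by blast
  then obtain r where r: "r \<in> carrier R" "cobound (Suc e) (\<lambda>v. \<psi>' v \<ominus> r \<otimes> \<phi>' v) M N"
    using one p(1) q(1) unfolding onedim_def by blast
  have "cobound e (\<lambda>v. \<psi> v \<ominus> r \<otimes> \<phi> v) M ?N"
  proof (rule connecting_cobound[OF M N z _ _ r(2) _ van])
    show "lin e M (\<lambda>v. \<psi> v \<ominus> r \<otimes> \<phi> v)" "lin (Suc e) M (\<lambda>v. \<psi>' v \<ominus> r \<otimes> \<phi>' v)"
      by (intro lin_diff lin_scale M l r)+
    fix v assume v: "v \<in> carrier (F (Suc e))"
    have c: "\<psi> (d e v) \<in> carrier R" "\<phi> (d e v) \<in> carrier R" "\<psi>' v \<in> carrier R" "\<phi>' v \<in> carrier R"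
      using linD(2)[OF l(3) dc[OF v]] linD(2)[OF l(1) dc[OF v]] linD(2)[OF l(4) v] linD(2)[OF l(2) v] .
    have "(\<psi> (d e v) \<ominus> r \<otimes> \<phi> (d e v)) \<ominus> z \<otimes> (\<psi>' v \<ominus> r \<otimes> \<phi>' v)
       = (\<psi> (d e v) \<ominus> z \<otimes> \<psi>' v) \<ominus> r \<otimes> (\<phi> (d e v) \<ominus> z \<otimes> \<phi>' v)" using c z r by algebra
    also have "\<dots> \<in> N" using p(2)[OF v] q(2)[OF v] N r by (simp add: idl_diff idl_lmult)
    finally show "(\<psi> (d e v) \<ominus> r \<otimes> \<phi> (d e v)) \<ominus> z \<otimes> (\<psi>' v \<ominus> r \<otimes> \<phi>' v) \<in> N" .
  qed
  then show "\<exists>r\<in>carrier R. cobound e (\<lambda>v. \<psi> v \<ominus> r \<otimes> \<phi> v) M ?N" using r by blast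
qed

text \<open>Dimension shifting down to degree 0, where Ext is the socle of
  \<open>M/(N + (xs)M)\<close>.\<close>

lemma onedim_regular:
  assumes "ideal M R" "ideal N R" "N \<subseteq> M" "set xs \<subseteq> \<mm>" "regular_on M N xs" "onedim (length xs) M N"
  shows "onedim 0 M (add_mults M N xs)"
  using assms
proof (induction xs arbitrary: N)
  case (Cons x xs)
  note M = Cons.prems(1) and N = Cons.prems(2,3)
  have x: "x \<in> \<mm>" "x \<in> carrier R" using Cons.prems(4) idl_carr[OF m] by auto
  note a = add_mult_ideal[OF M N x(2)]
  have reg: "u \<in> N" if "u \<in> M" "x \<otimes> u \<in> N" for u using Cons.prems(5) that by simp
  have "vanish (Suc (length xs)) M N" using vanish_regular[OF Cons.prems(1-5)] by simp
  then have "onedim (length xs) M (N <+> (x \<odot>\<^sub>s M))" using onedim_step[OF M N x(2) reg] Cons.prems(6) by simp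
  then show ?case using Cons.IH[OF M a(1,2)] Cons.prems by simp
qed simp

text \<open>An element of the socle is a map from \<open>R/\<mm>\<close>, here composed with the
  augmentation.\<close>

lemma socle_cocycle:
  assumes M: "ideal M R" and u: "u \<in> M" "\<And>c. c \<in> \<mm> \<Longrightarrow> c \<otimes> u \<in> N"
  shows "cocycle 0 (\<lambda>v. \<gamma> v \<otimes> u) M N"
  unfolding cocycle_def
proof (intro conjI ballI)
  have uc: "u \<in> carrier R" using idl_carr[OF M] u by blast
  have gc: "\<gamma> v \<in> carrier R" if "v \<in> carrier (F 0)" for v using linearD(1)[OF \<gamma> that] by simp
  show "lin 0 M (\<lambda>v. \<gamma> v \<otimes> u)"
  proof (rule linI)
    fix v assume v: "v \<in> carrier (F 0)"
    show "\<gamma> v \<otimes> u \<in> M" using M u gc[OF v] by (intro idl_lmult)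
    show "\<gamma> (r \<odot>\<^bsub>F 0\<^esub> v) \<otimes> u = r \<otimes> (\<gamma> v \<otimes> u)" if "r \<in> carrier R" for r
      using linearD(3)[OF \<gamma> that v] gc[OF v] that uc by (simp add: m_assoc)
    fix w assume w: "w \<in> carrier (F 0)"
    show "\<gamma> (v \<oplus>\<^bsub>F 0\<^esub> w) \<otimes> u = \<gamma> v \<otimes> u \<oplus> \<gamma> w \<otimes> u"
      using linearD(2)[OF \<gamma> v w] gc[OF v] gc[OF w] uc by (simp add: l_distr)
  qed (rule idl_sub[OF M])
  show "\<gamma> (d 0 v) \<otimes> u \<in> N" if "v \<in> carrier (F (Suc 0))" for v
    using ex0 that u(2) by blast
qed

text \<open>Since \<open>\<gamma>\<close> takes a value congruent to 1, the cocycle of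
  \<open>u\<close> determines \<open>u\<close> modulo \<open>N\<close>.\<close>

lemma residue_unit_mem:
  assumes N: "ideal N R" and u: "u \<in> carrier R" "\<And>c. c \<in> \<mm> \<Longrightarrow> c \<otimes> u \<in> N"
    and 0: "\<And>v. v \<in> carrier (F 0) \<Longrightarrow> \<gamma> v \<otimes> u \<in> N"
  shows "u \<in> N"
proof -
  obtain v where v: "v \<in> carrier (F 0)" "\<one> \<ominus> \<gamma> v \<in> \<mm>" using surj by blast
  have g: "\<gamma> v \<in> carrier R" using linearD(1)[OF \<gamma> v(1)] by simp
  have "(\<one> \<ominus> \<gamma> v) \<otimes> u \<oplus> \<gamma> v \<otimes> u \<in> N" using u(2)[OF v(2)] 0[OF v(1)] N by (intro idl_add)
  also have "(\<one> \<ominus> \<gamma> v) \<otimes> u \<oplus> \<gamma> v \<otimes> u = u" using g u(1) by algebra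
  finally show ?thesis .
qed

lemma vanish_socle:
  assumes M: "ideal M R" and N: "ideal N R" and van: "vanish (Suc e) M N"
    and u: "u \<in> M" "\<And>c. c \<in> \<mm> \<Longrightarrow> c \<otimes> u \<in> N"
  shows "u \<in> N"
  using van socle_cocycle[OF M u] residue_unit_mem[OF N idl_carr[OF M u(1)] u(2)]
  unfolding vanish_def by (metis cobound.simps(1) zero_less_Suc)

lemma onedim_socle:
  assumes M: "ideal M R" and N: "ideal N R" and one: "onedim 0 M N"
    and u: "u \<in> M" "\<And>c. c \<in> \<mm> \<Longrightarrow> c \<otimes> u \<in> N" "u \<notin> N"
    and w: "w \<in> M" "\<And>c. c \<in> \<mm> \<Longrightarrow> c \<otimes> w \<in> N"
  shows "\<exists>r\<in>carrier R. w \<ominus> r \<otimes> u \<in> N"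
proof -
  have c: "u \<in> carrier R" "w \<in> carrier R" using idl_carr[OF M] u w by auto
  have "\<not> cobound 0 (\<lambda>v. \<gamma> v \<otimes> u) M N" using residue_unit_mem[OF N c(1) u(2)] u(3) by auto
  then obtain r where r: "r \<in> carrier R" "cobound 0 (\<lambda>v. \<gamma> v \<otimes> w \<ominus> r \<otimes> (\<gamma> v \<otimes> u)) M N"
    using one socle_cocycle[OF M u(1,2)] socle_cocycle[OF M w] unfolding onedim_def by blast
  have "w \<ominus> r \<otimes> u \<in> N"
  proof (rule residue_unit_mem[OF N])
    show "w \<ominus> r \<otimes> u \<in> carrier R" using c r by simp
    show "k \<otimes> (w \<ominus> r \<otimes> u) \<in> N" if k: "k \<in> \<mm>" for k
    proof -
      have kc: "k \<in> carrier R" using idl_carr[OF m k] .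
      have "k \<otimes> w \<ominus> r \<otimes> (k \<otimes> u) \<in> N" by (rule idl_diff[OF N w(2)[OF k] idl_lmult[OF N u(2)[OF k] r(1)]])
      also have "k \<otimes> w \<ominus> r \<otimes> (k \<otimes> u) = k \<otimes> (w \<ominus> r \<otimes> u)" using kc c r by algebra
      finally show ?thesis .
    qed
    fix v assume v: "v \<in> carrier (F 0)"
    have g: "\<gamma> v \<in> carrier R" using linearD(1)[OF \<gamma> v] by simp
    have "\<gamma> v \<otimes> (w \<ominus> r \<otimes> u) = \<gamma> v \<otimes> w \<ominus> r \<otimes> (\<gamma> v \<otimes> u)" using g c r by algebra
    then show "\<gamma> v \<otimes> (w \<ominus> r \<otimes> u) \<in> N" using r(2) v by simp
  qed
  then show ?thesis using r by blast
qed

end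

section \<open>Regular sequences from systems of parameters\<close>

context cring begin

text \<open>The ideals of the finite subsets of \<open>T\<close> are directed, so their union is an
  ideal containing \<open>T\<close>.\<close>

lemma Idl_finite_support:
  assumes T: "T \<subseteq> carrier R" and x: "x \<in> Idl T"
  obtains T0 where "finite T0" "T0 \<subseteq> T" "x \<in> Idl T0"
proof -
  let ?U = "\<Union>{Idl T0 |T0. finite T0 \<and> T0 \<subseteq> T}"
  have idT: "ideal (Idl T0) R" if "T0 \<subseteq> T" for T0 using that T by (intro genideal_ideal) auto
  have "ideal ?U R"
  proof (rule idealI')
    show "?U \<subseteq> carrier R" using idT idl_carr by blast
    show "\<zero> \<in> ?U" using idl_zero[OF idT[of "{}"]] by blast
    fix a b assume "a \<in> ?U" "b \<in> ?U"
    then obtain T1 T2 where t: "finite T1" "T1 \<subseteq> T" "a \<in> Idl T1" "finite T2" "T2 \<subseteq> T" "b \<in> Idl T2" by blast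
    have "Idl T1 \<subseteq> Idl (T1 \<union> T2)" "Idl T2 \<subseteq> Idl (T1 \<union> T2)"
      using t T by (intro subset_Idl_subset; blast)+
    then have "a \<oplus> b \<in> Idl (T1 \<union> T2)" using t idT[of "T1 \<union> T2"] by (blast intro: idl_add)
    then show "a \<oplus> b \<in> ?U" using t by (blast intro: finite_UnI)
  next
    show "c \<otimes> a \<in> ?U" if "c \<in> carrier R" "a \<in> ?U" for c a using that idT by (blast intro: idl_lmult)
  qed
  moreover have "T \<subseteq> ?U"
  proof
    fix t assume t: "t \<in> T"
    then have "t \<in> Idl {t}" using T by (intro genideal_self') auto
    then show "t \<in> ?U" using t by blast
  qed
  ultimately have "Idl T \<subseteq> ?U" by (rule genideal_minimal)
  then show ?thesis using x that by blast
qed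

lemma primeideal_ideal: "primeideal P R \<Longrightarrow> ideal P R"
  by (rule primeideal.axioms(1))

text \<open>A product of elements outside \<open>p\<close>, one from each ideal of
  \<open>F\<close>.\<close>

lemma prime_witness:
  assumes p: "primeideal p R" and fin: "finite F" and F: "\<And>q. q \<in> F \<Longrightarrow> ideal q R \<and> \<not> q \<subseteq> p"
  obtains s where "s \<in> carrier R" "s \<notin> p" "\<And>q. q \<in> F \<Longrightarrow> s \<in> q"
proof -
  have "\<exists>s\<in>carrier R. s \<notin> p \<and> (\<forall>q\<in>F. s \<in> q)"
    using fin F
  proof (induction F)
    case empty
    have "\<one> \<notin> p" using ideal.one_imp_carrier[OF primeideal_ideal[OF p]] primeideal.I_notcarr[OF p] by blast
    then show ?case by auto
  next
    case (insert q F)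
    then obtain s where s: "s \<in> carrier R" "s \<notin> p" "\<And>r. r \<in> F \<Longrightarrow> s \<in> r" by auto
    obtain t where t: "t \<in> q" "t \<notin> p" using insert.prems[of q] by blast
    have tc: "t \<in> carrier R" using t insert.prems[of q] idl_carr by blast
    have "s \<otimes> t \<notin> p" using primeideal.I_prime[OF p s(1) tc] s t by blast
    moreover have "s \<otimes> t \<in> r" if "r \<in> insert q F" for r
      using that s t tc insert.prems[of r] idl_lmult idl_rmult by blast
    ultimately show ?case using s tc by blast
  qed
  then show ?thesis using that by blast
qed

text \<open>A coset of \<open>L\<close> has to avoid the primes, because a parameter may only be
  changed by a combination of the later ones. If \<open>y + l\<close> falls into the new prime
  \<open>p\<close>, add \<open>s l'\<close> with \<open>s\<close> in all old primes and neither
  \<open>s\<close> nor \<open>l'\<close> in \<open>p\<close>; incomparability supplies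
  \<open>s\<close>.\<close>

lemma coset_prime_avoidance_incomparable:
  assumes "finite F" "\<And>p. p \<in> F \<Longrightarrow> primeideal p R" "\<And>p q. \<lbrakk>p \<in> F; q \<in> F; p \<subseteq> q\<rbrakk> \<Longrightarrow> p = q"
    "y \<in> carrier R" "ideal L R" "\<And>p. p \<in> F \<Longrightarrow> y \<in> p \<Longrightarrow> \<not> L \<subseteq> p"
  shows "\<exists>l\<in>L. \<forall>p\<in>F. y \<oplus> l \<notin> p"
  using assms(1-3,6)
proof (induction F)
  case empty
  then show ?case using idl_zero[OF assms(5)] by blast
next
  case (insert p F)
  have pp: "primeideal p R" "ideal p R" using insert.prems(1)[of p] primeideal_ideal by auto
  have "\<exists>l\<in>L. \<forall>q\<in>F. y \<oplus> l \<notin> q" by (rule insert.IH) (use insert.prems in blast)+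
  then obtain l where l: "l \<in> L" "\<And>q. q \<in> F \<Longrightarrow> y \<oplus> l \<notin> q" by blast
  have lc: "l \<in> carrier R" using idl_carr[OF assms(5) l(1)] .
  show ?case
  proof (cases "y \<oplus> l \<in> p")
    case False
    then show ?thesis using l by auto
  next
    case True
    have "\<not> L \<subseteq> p"
    proof
      assume "L \<subseteq> p"
      then have "y \<in> p" using idl_add_cancel[OF pp(2) True] l assms(4) by blast
      then show False using insert.prems(3)[of p] \<open>L \<subseteq> p\<close> by blast
    qed
    then obtain l' where l': "l' \<in> L" "l' \<notin> p" by blast
    have l'c: "l' \<in> carrier R" using idl_carr[OF assms(5) l'(1)] .
    have "ideal q R \<and> \<not> q \<subseteq> p" if "q \<in> F" for q
      using that insert.prems(1)[of q] insert.prems(2)[of q p] insert.hyps(2) primeideal_ideal by blast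
    then obtain s where s: "s \<in> carrier R" "s \<notin> p" "\<And>q. q \<in> F \<Longrightarrow> s \<in> q"
      using prime_witness[OF pp(1) insert.hyps(1)] by blast
    have eq: "y \<oplus> (l \<oplus> s \<otimes> l') = s \<otimes> l' \<oplus> (y \<oplus> l)" "y \<oplus> (l \<oplus> s \<otimes> l') = (y \<oplus> l) \<oplus> s \<otimes> l'"
      using assms(4) lc l'c s by algebra+
    have "y \<oplus> (l \<oplus> s \<otimes> l') \<notin> p"
    proof
      assume "y \<oplus> (l \<oplus> s \<otimes> l') \<in> p"
      then have "s \<otimes> l' \<in> p" unfolding eq(1) using idl_add_cancel[OF pp(2) _ True] s l'c by simp
      then show False using primeideal.I_prime[OF pp(1) s(1) l'c] s l' by blast
    qed
    moreover have "y \<oplus> (l \<oplus> s \<otimes> l') \<notin> q" if q: "q \<in> F" for q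
    proof
      have qi: "ideal q R" using insert.prems(1)[of q] q primeideal_ideal by blast
      assume "y \<oplus> (l \<oplus> s \<otimes> l') \<in> q"
      moreover have "s \<otimes> l' \<in> q" using idl_rmult[OF qi s(3)[OF q] l'c] .
      ultimately have "y \<oplus> l \<in> q" unfolding eq(2) using idl_add_cancel[OF qi] assms(4) lc by simp
      then show False using l q by blast
    qed
    moreover have "l \<oplus> s \<otimes> l' \<in> L" using l l' s assms(5) by (blast intro: idl_add idl_lmult)
    ultimately show ?thesis by blast
  qed
qed

text \<open>It is enough to avoid the maximal members of \<open>F\<close>, which are
  incomparable.\<close>

lemma coset_prime_avoidance:
  assumes "finite F" "\<And>p. p \<in> F \<Longrightarrow> primeideal p R"
    "y \<in> carrier R" "ideal L R" "\<And>p. p \<in> F \<Longrightarrow> y \<in> p \<Longrightarrow> \<not> L \<subseteq> p"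
  shows "\<exists>l\<in>L. \<forall>p\<in>F. y \<oplus> l \<notin> p"
proof -
  let ?G = "{p \<in> F. \<forall>q\<in>F. p \<subseteq> q \<longrightarrow> p = q}"
  have "\<exists>l\<in>L. \<forall>p\<in>?G. y \<oplus> l \<notin> p"
    by (rule coset_prime_avoidance_incomparable) (use assms in auto)
  then obtain l where l: "l \<in> L" "\<And>p. p \<in> ?G \<Longrightarrow> y \<oplus> l \<notin> p" by blast
  have "y \<oplus> l \<notin> p" if p: "p \<in> F" for p
  proof -
    obtain q where q: "q \<in> F" "p \<subseteq> q" "\<forall>r\<in>F. q \<subseteq> r \<longrightarrow> q = r"
      using finite_has_maximal2[OF assms(1) p] by blast
    then have "q \<in> ?G" by blast
    then have "y \<oplus> l \<notin> q" by (rule l(2))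
    then show ?thesis using q by blast
  qed
  then show ?thesis using l(1) by blast
qed

text \<open>If \<open>a b\<close> kills \<open>u\<close> modulo \<open>N\<close> and
  \<open>b\<close> does not, then \<open>u b\<close> has at least the annihilator of
  \<open>u\<close>, hence the same one, and \<open>a\<close> lies in it.\<close>

lemma colon_prime_if_maximal:
  assumes M: "ideal M R" and N: "ideal N R" and u: "u \<in> M" "u \<notin> N"
    and max: "\<And>w. \<lbrakk>w \<in> M; w \<notin> N; colon N u \<subseteq> colon N w\<rbrakk> \<Longrightarrow> colon N u = colon N w"
  shows "primeideal (colon N u) R"
proof (rule primeidealI)
  have uc: "u \<in> carrier R" using idl_carr[OF M u(1)] .
  show "ideal (colon N u) R" by (rule colon_ideal[OF N uc])
  show "cring R" by (rule is_cring)
  show "carrier R \<noteq> colon N u"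
  proof
    assume "carrier R = colon N u"
    then have "\<one> \<in> colon N u" by blast
    then show False using u uc by (simp add: colon_def)
  qed
  fix a b assume ab: "a \<in> carrier R" "b \<in> carrier R" "a \<otimes> b \<in> colon N u"
  show "a \<in> colon N u \<or> b \<in> colon N u"
  proof (rule disjCI)
    assume b: "b \<notin> colon N u"
    have w: "u \<otimes> b \<in> M" "u \<otimes> b \<notin> N" using idl_rmult[OF M u(1) ab(2)] b ab by (auto simp: colon_def)
    have "colon N u \<subseteq> colon N (u \<otimes> b)"
    proof
      fix x assume x: "x \<in> colon N u"
      then have xc: "x \<in> carrier R" "u \<otimes> x \<in> N" by (auto simp: colon_def)
      have "(u \<otimes> x) \<otimes> b \<in> N" using idl_rmult[OF N xc(2) ab(2)] .
      also have "(u \<otimes> x) \<otimes> b = (u \<otimes> b) \<otimes> x" using uc ab xc by algebra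
      finally show "x \<in> colon N (u \<otimes> b)" using xc by (simp add: colon_def)
    qed
    then have eq: "colon N u = colon N (u \<otimes> b)" by (rule max[OF w])
    have "u \<otimes> (a \<otimes> b) \<in> N" using ab(3) by (simp add: colon_def)
    also have "u \<otimes> (a \<otimes> b) = (u \<otimes> b) \<otimes> a" using uc ab by algebra
    finally show "a \<in> colon N u" unfolding eq using ab by (simp add: colon_def)
  qed
qed

text \<open>The maximal annihilators of elements of \<open>M/N\<close> are finitely many primes: their witnesses
  generate a submodule, which is finitely generated, and a prime containing the intersection of the
  annihilators of the generators contains one of them.\<close>

lemma finite_associated_primes:
  assumes noeth: "noetherian_ring R" and M: "ideal M R" and N: "ideal N R"
  obtains F where "finite F" "\<And>p. p \<in> F \<Longrightarrow> primeideal p R \<and> (\<exists>u\<in>M. u \<notin> N \<and> p = colon N u)"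
    "\<And>z u. \<lbrakk>z \<in> carrier R; u \<in> M; z \<otimes> u \<in> N; u \<notin> N\<rbrakk> \<Longrightarrow> \<exists>p\<in>F. z \<in> p"
proof -
  define X where "X = {u \<in> M. u \<notin> N \<and> (\<forall>w\<in>M. w \<notin> N \<longrightarrow> colon N u \<subseteq> colon N w \<longrightarrow> colon N u = colon N w)}"
  have XM: "u \<in> M" "u \<notin> N" "u \<in> carrier R" if "u \<in> X" for u using that idl_carr[OF M] by (auto simp: X_def)
  have Xp: "primeideal (colon N u) R" if "u \<in> X" for u
    using that by (intro colon_prime_if_maximal[OF M N]) (auto simp: X_def)
  have ex: "\<exists>w\<in>X. colon N u \<subseteq> colon N w" if u: "u \<in> M" "u \<notin> N" for u
  proof -
    let ?A = "{colon N w |w. w \<in> M \<and> w \<notin> N \<and> colon N u \<subseteq> colon N w}"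
    have "\<exists>P\<in>?A. \<forall>Q\<in>?A. P \<subseteq> Q \<longrightarrow> Q = P"
    proof (rule subset_Zorn_nonempty)
      show "?A \<noteq> {}" using u by blast
      fix C assume C: "C \<noteq> {}" "subset.chain ?A C"
      have "?A \<subseteq> {I. ideal I R}" using colon_ideal[OF N] idl_carr[OF M] by blast
      then have "subset.chain {I. ideal I R} C" using C(2) by (auto simp: subset.chain_def)
      \<comment> \<open>A union of annihilators need not be an annihilator, but over a Noetherian
        ring the union of a nonempty chain of ideals belongs to the chain.\<close>
      then have "\<Union>C \<in> C" using noetherian_ring.ideal_chain_is_trivial[OF noeth C(1)] by blast
      then show "\<Union>C \<in> ?A" using C(2) by (auto simp: subset.chain_def)
    qed
    then obtain P where P: "P \<in> ?A" "\<forall>Q\<in>?A. P \<subseteq> Q \<longrightarrow> Q = P" ..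
    then obtain w where w: "w \<in> M" "w \<notin> N" "colon N u \<subseteq> colon N w" "P = colon N w" by blast
    have "w \<in> X" unfolding X_def
    proof (intro CollectI conjI w ballI impI)
      fix v assume v: "v \<in> M" "v \<notin> N" "colon N w \<subseteq> colon N v"
      then have "colon N v \<in> ?A" using w(3) by blast
      then show "colon N w = colon N v" using P(2) v(3) unfolding w(4) by blast
    qed
    then show ?thesis using w by blast
  qed
  have NX: "N \<union> X \<subseteq> carrier R" using idl_sub[OF N] XM by blast
  obtain S where S: "S \<subseteq> carrier R" "finite S" "Idl (N \<union> X) = Idl S"
    using noetherian_fg[OF noeth genideal_ideal[OF NX]] by blast
  have SX: "S \<subseteq> Idl (N \<union> X)" unfolding S(3) by (rule genideal_self[OF S(1)])
  have "\<exists>T. finite T \<and> T \<subseteq> N \<union> X \<and> s \<in> Idl T" if "s \<in> S" for s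
  proof -
    have "s \<in> Idl (N \<union> X)" using SX that by blast
    then obtain T where "finite T" "T \<subseteq> N \<union> X" "s \<in> Idl T" by (rule Idl_finite_support[OF NX])
    then show ?thesis by blast
  qed
  then have "\<forall>s. \<exists>T. s \<in> S \<longrightarrow> finite T \<and> T \<subseteq> N \<union> X \<and> s \<in> Idl T" by blast
  from choice[OF this] obtain T where T: "\<And>s. s \<in> S \<Longrightarrow> finite (T s) \<and> T s \<subseteq> N \<union> X \<and> s \<in> Idl (T s)" by blast
  define U where "U = (\<Union>s\<in>S. T s) \<inter> X"
  have finU: "finite U" unfolding U_def using S(2) T by blast
  have UX: "U \<subseteq> X" unfolding U_def by blast
  have gen: "X \<subseteq> L" if L: "ideal L R" "N \<subseteq> L" "U \<subseteq> L" for L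
  proof -
    have "S \<subseteq> L"
    proof
      fix s assume s: "s \<in> S"
      have "T s \<subseteq> L" using T[OF s] L s unfolding U_def by blast
      then have "Idl (T s) \<subseteq> L" by (rule genideal_minimal[OF L(1)])
      then show "s \<in> L" using T[OF s] by blast
    qed
    then have "Idl (N \<union> X) \<subseteq> L" unfolding S(3) by (rule genideal_minimal[OF L(1)])
    then show ?thesis using genideal_self[OF NX] by blast
  qed
  let ?F = "colon N ` U"
  have XF: "colon N u \<in> ?F" if u: "u \<in> X" for u
  proof (rule ccontr)
    assume notin: "colon N u \<notin> ?F"
    have "ideal q R \<and> \<not> q \<subseteq> colon N u" if "q \<in> ?F" for q
    proof -
      obtain w where w: "w \<in> U" "q = colon N w" using \<open>q \<in> ?F\<close> by blast
      have wX: "w \<in> X" using w UX by blast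
      have "\<not> colon N w \<subseteq> colon N u"
      proof
        assume "colon N w \<subseteq> colon N u"
        then have "colon N w = colon N u" using wX XM[OF u] unfolding X_def by blast
        then show False using notin w by blast
      qed
      then show ?thesis using w colon_ideal[OF N XM(3)[OF wX]] by blast
    qed
    then obtain s where s: "s \<in> carrier R" "s \<notin> colon N u" "\<And>q. q \<in> ?F \<Longrightarrow> s \<in> q"
      using prime_witness[OF Xp[OF u] finite_imageI[OF finU, of "colon N"]] by metis
    have "X \<subseteq> colon N s"
    proof (rule gen)
      show "ideal (colon N s) R" "N \<subseteq> colon N s" using colon_ideal[OF N s(1)] colon_sup[OF N s(1)] .
      show "U \<subseteq> colon N s"
      proof
        fix w assume w: "w \<in> U"
        then have "s \<in> colon N w" using s(3) by blast
        then show "w \<in> colon N s" using XM(3) w UX s(1) by (auto simp: colon_def m_comm)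
      qed
    qed
    then have "u \<in> colon N s" using u by blast
    then show False using s(1,2) XM(3)[OF u] by (simp add: colon_def m_comm)
  qed
  show ?thesis
  proof (rule that[of ?F])
    show "finite ?F" using finU by simp
    show "primeideal p R \<and> (\<exists>u\<in>M. u \<notin> N \<and> p = colon N u)" if "p \<in> ?F" for p
      using that UX Xp XM by blast
    fix z u assume z: "z \<in> carrier R" "u \<in> M" "z \<otimes> u \<in> N" "u \<notin> N"
    obtain w where w: "w \<in> X" "colon N u \<subseteq> colon N w" using ex[OF z(2,4)] by blast
    have "z \<in> colon N u" using z idl_carr[OF M z(2)] by (simp add: colon_def m_comm)
    then have "z \<in> colon N w" using w(2) by (rule subsetD[rotated])
    then show "\<exists>p\<in>?F. z \<in> p" by (rule bexI[OF _ XF[OF w(1)]])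
  qed
qed

lemma prime_pow_sub:
  assumes p: "primeideal p R" and I: "ideal I R" and "ideal_pow R I k \<subseteq> p"
  shows "I \<subseteq> p"
proof (rule ccontr)
  assume "\<not> I \<subseteq> p"
  then obtain x where x: "x \<in> I" "x \<notin> p" by blast
  have xc: "x \<in> carrier R" using idl_carr[OF I x(1)] .
  have "x [^] k \<in> ideal_pow R I k"
    by (induction k) (use x in \<open>auto simp: idl_pow_0 intro: prod_in\<close>)
  then have "x [^] k \<in> p" using assms(3) by blast
  moreover have "x [^] k \<notin> p"
  proof (induction k)
    case 0
    then show ?case using ideal.one_imp_carrier[OF primeideal_ideal[OF p]] primeideal.I_notcarr[OF p] by auto
  next
    case (Suc k)
    then show ?case using primeideal.I_prime[OF p _ xc, of "x [^] k"] x xc by auto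
  qed
  ultimately show False by blast
qed

end

section \<open>Common regular sequences for two subquotients of a local ring\<close>

locale local_resolution = residue_resolution +
  assumes noeth: "noetherian_ring R" and max: "maximalideal \<mm> R"
    and uniq: "\<And>\<nn>. maximalideal \<nn> R \<Longrightarrow> \<nn> = \<mm>"
begin

text \<open>A zerodivisor on \<open>M/N\<close> lies in an associated prime \<open>p\<close>. If
  \<open>p\<close> contained \<open>y\<close> and \<open>L\<close>, it would contain
  \<open>W\<close>, which kills \<open>M/N\<close>, hence a power of \<open>\<mm>\<close> and
  \<open>\<mm>\<close> itself; then \<open>M/N\<close> would have a nonzero socle, against the
  vanishing in degree 0. Both modules are treated at once so that a single \<open>l\<close> serves
  them.\<close>

lemma exists_regular_elements:
  assumes M1: "ideal M1 R" "ideal N1 R" "vanish (Suc e1) M1 N1" "\<And>w u. \<lbrakk>w \<in> W; u \<in> M1\<rbrakk> \<Longrightarrow> w \<otimes> u \<in> N1"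
    and M2: "ideal M2 R" "ideal N2 R" "vanish (Suc e2) M2 N2" "\<And>w u. \<lbrakk>w \<in> W; u \<in> M2\<rbrakk> \<Longrightarrow> w \<otimes> u \<in> N2"
    and W: "ideal W R" and y: "y \<in> carrier R" and L: "ideal L R"
    and k: "ideal_pow R \<mm> k \<subseteq> W <+> (L <+> (y \<odot>\<^sub>s carrier R))"
  obtains l where "l \<in> L" "\<And>u. \<lbrakk>u \<in> M1; (y \<oplus> l) \<otimes> u \<in> N1\<rbrakk> \<Longrightarrow> u \<in> N1"
    "\<And>u. \<lbrakk>u \<in> M2; (y \<oplus> l) \<otimes> u \<in> N2\<rbrakk> \<Longrightarrow> u \<in> N2"
proof -
  obtain F1 where F1: "finite F1" "\<And>p. p \<in> F1 \<Longrightarrow> primeideal p R \<and> (\<exists>u\<in>M1. u \<notin> N1 \<and> p = colon N1 u)"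
    "\<And>z u. \<lbrakk>z \<in> carrier R; u \<in> M1; z \<otimes> u \<in> N1; u \<notin> N1\<rbrakk> \<Longrightarrow> \<exists>p\<in>F1. z \<in> p"
    using finite_associated_primes[OF noeth M1(1,2)] by blast
  obtain F2 where F2: "finite F2" "\<And>p. p \<in> F2 \<Longrightarrow> primeideal p R \<and> (\<exists>u\<in>M2. u \<notin> N2 \<and> p = colon N2 u)"
    "\<And>z u. \<lbrakk>z \<in> carrier R; u \<in> M2; z \<otimes> u \<in> N2; u \<notin> N2\<rbrakk> \<Longrightarrow> \<exists>p\<in>F2. z \<in> p"
    using finite_associated_primes[OF noeth M2(1,2)] by blast
  have no: False if M: "ideal M R" "ideal N R" "vanish (Suc e) M N" "\<And>w u. \<lbrakk>w \<in> W; u \<in> M\<rbrakk> \<Longrightarrow> w \<otimes> u \<in> N"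
    and p: "primeideal p R" "u \<in> M" "u \<notin> N" "p = colon N u" "y \<in> p" "L \<subseteq> p" for M N e p u
  proof -
    have pi: "ideal p R" using p(1) primeideal_ideal by blast
    have uc: "u \<in> carrier R" using idl_carr[OF M(1) p(2)] .
    have "W \<subseteq> p"
    proof
      fix w assume w: "w \<in> W"
      then have "w \<in> carrier R" using idl_carr[OF W] by blast
      then show "w \<in> p" using M(4)[OF w p(2)] uc unfolding p(4) by (simp add: colon_def m_comm)
    qed
    then have "W <+> (L <+> (y \<odot>\<^sub>s carrier R)) \<subseteq> p"
      using p pi by (intro idl_sum_least elt_mult_carrier_least)
    then have "\<mm> \<subseteq> p" using prime_pow_sub[OF p(1) m, of k] k by blast
    then have "c \<otimes> u \<in> N" if "c \<in> \<mm>" for c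
      using that uc idl_carr[OF m that] unfolding p(4) by (auto simp: colon_def m_comm)
    then show False using vanish_socle[OF M(1-3) p(2)] p(3) by blast
  qed
  have "\<exists>l\<in>L. \<forall>p\<in>F1 \<union> F2. y \<oplus> l \<notin> p"
  proof (rule coset_prime_avoidance[OF _ _ y L])
    show "finite (F1 \<union> F2)" using F1 F2 by blast
    show "primeideal p R" if "p \<in> F1 \<union> F2" for p using that F1(2) F2(2) by blast
    show "\<not> L \<subseteq> p" if "p \<in> F1 \<union> F2" "y \<in> p" for p
    proof
      assume Lp: "L \<subseteq> p"
      consider "p \<in> F1" | "p \<in> F2" using \<open>p \<in> F1 \<union> F2\<close> by blast
      then show False
      proof cases
        case 1
        then obtain u where "primeideal p R" "u \<in> M1" "u \<notin> N1" "p = colon N1 u" using F1(2) by blast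
        then show False using no[OF M1] \<open>y \<in> p\<close> Lp by blast
      next
        case 2
        then obtain u where "primeideal p R" "u \<in> M2" "u \<notin> N2" "p = colon N2 u" using F2(2) by blast
        then show False using no[OF M2] \<open>y \<in> p\<close> Lp by blast
      qed
    qed
  qed
  then obtain l where l: "l \<in> L" "\<And>p. p \<in> F1 \<union> F2 \<Longrightarrow> y \<oplus> l \<notin> p" by blast
  have c: "y \<oplus> l \<in> carrier R" using y idl_carr[OF L l(1)] by simp
  show ?thesis
  proof (rule that[OF l(1)])
    show "u \<in> N1" if "u \<in> M1" "(y \<oplus> l) \<otimes> u \<in> N1" for u using F1(3)[OF c that] l(2) by blast
    show "u \<in> N2" if "u \<in> M2" "(y \<oplus> l) \<otimes> u \<in> N2" for u using F2(3)[OF c that] l(2) by blast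
  qed
qed

text \<open>Each parameter is changed by an element of the ideal of the later ones, which preserves
  the generated ideal and leaves the last parameter alone; that one has to remain in
  \<open>I\<close>. \<open>W\<close> collects the new parameters already chosen and kills both
  current quotients. Regularity comes from vanishing of cohomology, which one regular sequence of
  the right length certifies for all parameters.\<close>

lemma system_of_parameters_regular:
  assumes "ideal M1 R" "ideal N1 R" "N1 \<subseteq> M1" "vanish (length ys) M1 N1"
    "\<And>w u. \<lbrakk>w \<in> W; u \<in> M1\<rbrakk> \<Longrightarrow> w \<otimes> u \<in> N1"
    and "ideal M2 R" "ideal N2 R" "N2 \<subseteq> M2" "vanish (length ys) M2 N2"
    "\<And>w u. \<lbrakk>w \<in> W; u \<in> M2\<rbrakk> \<Longrightarrow> w \<otimes> u \<in> N2"
    and "ideal W R" "set ys \<subseteq> \<mm>" "ideal_pow R \<mm> k \<subseteq> W <+> Idl (set ys)"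
  shows "\<exists>zs. length zs = length ys \<and> set zs \<subseteq> \<mm> \<and> regular_on M1 N1 zs \<and> regular_on M2 N2 zs \<and>
    W <+> Idl (set zs) = W <+> Idl (set ys) \<and> (ys \<noteq> [] \<longrightarrow> last zs = last ys)"
  using assms
proof (induction ys arbitrary: N1 N2 W)
  case Nil
  then show ?case by simp
next
  case (Cons y ys)
  note M1 = Cons.prems(1) and N1 = Cons.prems(2,3) and v1 = Cons.prems(4) and W1 = Cons.prems(5)
  note M2 = Cons.prems(6) and N2 = Cons.prems(7,8) and v2 = Cons.prems(9) and W2 = Cons.prems(10)
  note W = Cons.prems(11)
  have y: "y \<in> \<mm>" "y \<in> carrier R" "set ys \<subseteq> \<mm>" "set ys \<subseteq> carrier R"
    using Cons.prems(12) idl_carr[OF m] by auto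
  define L where "L = Idl (set ys)"
  have L: "ideal L R" unfolding L_def using y by (intro genideal_ideal)
  have Ly: "Idl (set (y # ys)) = L <+> (y \<odot>\<^sub>s carrier R)" unfolding L_def using Idl_insert[OF y(4,2)] by simp
  obtain l where l: "l \<in> L" and r1: "\<And>u. \<lbrakk>u \<in> M1; (y \<oplus> l) \<otimes> u \<in> N1\<rbrakk> \<Longrightarrow> u \<in> N1"
    and r2: "\<And>u. \<lbrakk>u \<in> M2; (y \<oplus> l) \<otimes> u \<in> N2\<rbrakk> \<Longrightarrow> u \<in> N2"
    using exists_regular_elements[OF M1 N1(1) v1[unfolded list.size add_Suc_right add_0_right] W1 M2 N2(1)
        v2[unfolded list.size add_Suc_right add_0_right] W2 W y(2) L Cons.prems(13)[unfolded Ly]] by blast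
  define z where "z = y \<oplus> l"
  have Lm: "L \<subseteq> \<mm>" unfolding L_def using y by (intro genideal_minimal m)
  have z: "z \<in> \<mm>" unfolding z_def using y l Lm m by (blast intro: idl_add)
  have zc: "z \<in> carrier R" using idl_carr[OF m z] .
  have lc: "l \<in> carrier R" using idl_carr[OF L l] .
  have zA: "ideal (z \<odot>\<^sub>s carrier R) R" and yA: "ideal (y \<odot>\<^sub>s carrier R) R" using zc y by (auto intro: principal_ideal)
  have Lz: "L <+> (z \<odot>\<^sub>s carrier R) = L <+> (y \<odot>\<^sub>s carrier R)"
  proof
    have "z \<in> L <+> (y \<odot>\<^sub>s carrier R)" unfolding z_def
      using idl_sum_upper[OF L yA] l elt_mult_self[OF y(2)] add_ideals[OF L yA] by (blast intro: idl_add)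
    then show "L <+> (z \<odot>\<^sub>s carrier R) \<subseteq> L <+> (y \<odot>\<^sub>s carrier R)"
      using idl_sum_upper(1)[OF L yA] add_ideals[OF L yA] by (intro idl_sum_least elt_mult_carrier_least)
    have "z \<ominus> l \<in> L <+> (z \<odot>\<^sub>s carrier R)"
      using idl_sum_upper[OF L zA] l elt_mult_self[OF zc] add_ideals[OF L zA] by (blast intro: idl_diff)
    also have "z \<ominus> l = y" unfolding z_def using y lc by algebra
    finally show "L <+> (y \<odot>\<^sub>s carrier R) \<subseteq> L <+> (z \<odot>\<^sub>s carrier R)"
      using idl_sum_upper(1)[OF L zA] add_ideals[OF L zA] by (intro idl_sum_least elt_mult_carrier_least)
  qed
  define W' where "W' = W <+> (z \<odot>\<^sub>s carrier R)"
  have W': "ideal W' R" unfolding W'_def by (intro add_ideals W zA)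
  have W'K: "W' <+> K = W <+> (K <+> (z \<odot>\<^sub>s carrier R))" if "ideal K R" for K
    unfolding W'_def idl_sum_assoc[OF W zA that] idl_sum_comm[OF zA that] ..
  note a1 = add_mult_ideal[OF M1 N1 zc] and a2 = add_mult_ideal[OF M2 N2 zc]
  have W'mult: "w \<otimes> u \<in> N <+> (z \<odot>\<^sub>s M)"
    if M: "ideal M R" and N: "ideal N R" "N \<subseteq> M" and WM: "\<And>w u. \<lbrakk>w \<in> W; u \<in> M\<rbrakk> \<Longrightarrow> w \<otimes> u \<in> N"
      and w: "w \<in> W'" and u: "u \<in> M" for M N w u
  proof -
    obtain v c where v: "v \<in> W" "c \<in> carrier R" "w = v \<oplus> z \<otimes> c"
      using w unfolding W'_def by (elim idl_sumE elt_multE) blast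
    have uc: "u \<in> carrier R" "v \<in> carrier R" using idl_carr[OF M u] idl_carr[OF W v(1)] .
    have "w \<otimes> u = v \<otimes> u \<oplus> z \<otimes> (c \<otimes> u)" unfolding v(3) using uc v zc by algebra
    then show ?thesis using WM[OF v(1) u] idl_lmult[OF M u v(2)] by (simp add: idl_sumI elt_multI)
  qed
  have v1': "vanish (length ys) M1 (N1 <+> (z \<odot>\<^sub>s M1))"
    using vanish_step[OF M1 N1 zc] r1 v1 unfolding z_def by simp
  have v2': "vanish (length ys) M2 (N2 <+> (z \<odot>\<^sub>s M2))"
    using vanish_step[OF M2 N2 zc] r2 v2 unfolding z_def by simp
  have k': "ideal_pow R \<mm> k \<subseteq> W' <+> Idl (set ys)"
    using Cons.prems(13) unfolding Ly W'K[OF L[unfolded L_def]] Lz[unfolded L_def] L_def .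
  obtain zs where zs: "length zs = length ys" "set zs \<subseteq> \<mm>" "regular_on M1 (N1 <+> (z \<odot>\<^sub>s M1)) zs"
    "regular_on M2 (N2 <+> (z \<odot>\<^sub>s M2)) zs" "W' <+> Idl (set zs) = W' <+> Idl (set ys)"
    "ys \<noteq> [] \<longrightarrow> last zs = last ys"
    using Cons.IH[OF M1 a1(1,2) v1' W'mult[OF M1 N1 W1] M2 a2(1,2) v2' W'mult[OF M2 N2 W2] W' y(3) k'] by blast
  have zsc: "set zs \<subseteq> carrier R" using zs(2) idl_sub[OF m] by blast
  have "W <+> Idl (set (z # zs)) = W' <+> Idl (set zs)"
    using Idl_insert[OF zsc zc] W'K[OF genideal_ideal[OF zsc]] by simp
  also have "\<dots> = W <+> Idl (set (y # ys))"
    unfolding zs(5) Ly W'K[OF L[unfolded L_def]] Lz[unfolded L_def] L_def ..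
  finally have eq: "W <+> Idl (set (z # zs)) = W <+> Idl (set (y # ys))" .
  have "last (z # zs) = last (y # ys)"
  \<comment> \<open>With no later parameters \<open>L\<close> is zero, so the last parameter is
    kept.\<close>
  proof (cases "ys = []")
    case True
    then have "l = \<zero>" using l unfolding L_def by (simp add: Idl_empty)
    then show ?thesis using True zs(1) y unfolding z_def by simp
  next
    case False
    then show ?thesis using zs(1,6) by auto
  qed
  moreover have "regular_on M1 N1 (z # zs)" "regular_on M2 N2 (z # zs)"
    using zs(3,4) r1 r2 unfolding z_def by auto
  moreover have "length (z # zs) = length (y # ys)" "set (z # zs) \<subseteq> \<mm>" using zs(1,2) z by auto
  ultimately show ?case using eq by (intro exI[of _ "z # zs"]) blast
qed

end

section \<open>Depth and type of a canonical ideal\<close>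

context module begin

lemma submod_span_submodule:
  assumes "X \<subseteq> carrier M"
  shows "submodule (submod_span R M X) R M"
proof (rule submoduleI')
  show "submod_span R M X \<subseteq> carrier M"
    unfolding submod_span_def using carrier_is_submodule assms by blast
qed (auto simp: submod_span_def submoduleE(4,5) submodule_zero)

lemma submod_span_least: "\<lbrakk>submodule N R M; X \<subseteq> N\<rbrakk> \<Longrightarrow> submod_span R M X \<subseteq> N"
  unfolding submod_span_def by blast

lemma submod_span_upper: "X \<subseteq> submod_span R M X"
  unfolding submod_span_def by blast

lemma submodule_adjoin:
  assumes N: "submodule N R M" and f: "f \<in> carrier M"
  shows "submodule {r \<odot>\<^bsub>M\<^esub> f \<oplus>\<^bsub>M\<^esub> n |r n. r \<in> carrier R \<and> n \<in> N} R M" (is "submodule ?L R M")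
    "N \<subseteq> {r \<odot>\<^bsub>M\<^esub> f \<oplus>\<^bsub>M\<^esub> n |r n. r \<in> carrier R \<and> n \<in> N}"
    "f \<in> {r \<odot>\<^bsub>M\<^esub> f \<oplus>\<^bsub>M\<^esub> n |r n. r \<in> carrier R \<and> n \<in> N}"
proof -
  note c = submodule_carr[OF N]
  have 0: "\<zero>\<^bsub>M\<^esub> \<in> N" by (rule submodule_zero[OF N])
  show up: "N \<subseteq> ?L"
  proof
    fix n assume n: "n \<in> N"
    then have "n = \<zero> \<odot>\<^bsub>M\<^esub> f \<oplus>\<^bsub>M\<^esub> n" using f c by simp
    then show "n \<in> ?L" using n by blast
  qed
  have "f = \<one> \<odot>\<^bsub>M\<^esub> f \<oplus>\<^bsub>M\<^esub> \<zero>\<^bsub>M\<^esub>" using f by simp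
  then show "f \<in> ?L" using 0 by blast
  show "submodule ?L R M"
  proof (rule submoduleI')
    show "?L \<subseteq> carrier M" using f c by auto
    show "\<zero>\<^bsub>M\<^esub> \<in> ?L" using up 0 by blast
    fix a b assume "a \<in> ?L" "b \<in> ?L"
    then obtain r n s k where "a = r \<odot>\<^bsub>M\<^esub> f \<oplus>\<^bsub>M\<^esub> n" "b = s \<odot>\<^bsub>M\<^esub> f \<oplus>\<^bsub>M\<^esub> k" and
      *: "r \<in> carrier R" "n \<in> N" "s \<in> carrier R" "k \<in> N" by blast
    then have "a \<oplus>\<^bsub>M\<^esub> b = (r \<oplus> s) \<odot>\<^bsub>M\<^esub> f \<oplus>\<^bsub>M\<^esub> (n \<oplus>\<^bsub>M\<^esub> k)"
      using f c by (simp add: smult_l_distr M.a_ac)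
    moreover have "n \<oplus>\<^bsub>M\<^esub> k \<in> N" "r \<oplus> s \<in> carrier R" using * submoduleE(5)[OF N] by auto
    ultimately show "a \<oplus>\<^bsub>M\<^esub> b \<in> ?L" by blast
  next
    fix t a assume t: "t \<in> carrier R" and "a \<in> ?L"
    then obtain r n where "a = r \<odot>\<^bsub>M\<^esub> f \<oplus>\<^bsub>M\<^esub> n" and *: "r \<in> carrier R" "n \<in> N" by blast
    then have "t \<odot>\<^bsub>M\<^esub> a = (t \<otimes> r) \<odot>\<^bsub>M\<^esub> f \<oplus>\<^bsub>M\<^esub> t \<odot>\<^bsub>M\<^esub> n"
      using f c t by (simp add: smult_r_distr smult_assoc1)
    moreover have "t \<odot>\<^bsub>M\<^esub> n \<in> N" "t \<otimes> r \<in> carrier R" using * t submoduleE(4)[OF N] by auto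
    ultimately show "t \<odot>\<^bsub>M\<^esub> a \<in> ?L" by blast
  qed
qed

text \<open>Otherwise \<open>N\<close>, \<open>N + Rf\<close> and \<open>N + Rf + Rg\<close> form a
  chain of length two.\<close>

lemma quot_length_one_generator:
  assumes N: "submodule N R M" and len: "module_length R (quot_module M N) = 1"
    and f: "f \<in> carrier M" "f \<notin> N" and g: "g \<in> carrier M"
  obtains r n where "r \<in> carrier R" "n \<in> N" "g = r \<odot>\<^bsub>M\<^esub> f \<oplus>\<^bsub>M\<^esub> n"
proof -
  define L where "L = {r \<odot>\<^bsub>M\<^esub> f \<oplus>\<^bsub>M\<^esub> n |r n. r \<in> carrier R \<and> n \<in> N}"
  note L = submodule_adjoin[OF N f(1), folded L_def]
  define L' where "L' = {r \<odot>\<^bsub>M\<^esub> g \<oplus>\<^bsub>M\<^esub> n |r n. r \<in> carrier R \<and> n \<in> L}"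
  note L' = submodule_adjoin[OF L(1) g, folded L'_def]
  have "g \<in> L"
  proof (rule ccontr)
    assume "g \<notin> L"
    let ?C = "\<lambda>i::nat. if i = 0 then N else if i = 1 then L else L'"
    have "enat 2 \<le> chain_length {L. submodule L R M \<and> N \<subseteq> L}"
    proof (rule chain_length_ge[where N = ?C])
      show "\<forall>i\<le>2. ?C i \<in> {L. submodule L R M \<and> N \<subseteq> L}" using N L L' by auto
      have "N \<subset> L" "L \<subset> L'" using L L' f(2) \<open>g \<notin> L\<close> by blast+
      then show "\<forall>i<2. ?C i \<subset> ?C (Suc i)" by (auto simp: less_2_cases_iff)
    qed
    then show False using len length_quot[OF N] by (simp add: one_enat_def)
  qed
  then show ?thesis unfolding L_def using that by blast
qed

end

section \<open>Hom modules and Ext of the residue field in the degree of the depth\<close>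

lemma hom_module_module:
  assumes "module R M" "module R N"
  shows "module R (hom_module R M N)"
proof -
  interpret M: module R M by fact
  interpret N: module R N by fact
  let ?H = "hom_module R M N"
  have c [simp]: "carrier ?H = mod_hom R M N" by (simp add: hom_module_def)
  have a [simp]: "f \<oplus>\<^bsub>?H\<^esub> g = (\<lambda>x\<in>carrier M. f x \<oplus>\<^bsub>N\<^esub> g x)" for f g by (simp add: hom_module_def)
  have s [simp]: "r \<odot>\<^bsub>?H\<^esub> f = (\<lambda>x\<in>carrier M. r \<odot>\<^bsub>N\<^esub> f x)" for r f by (simp add: hom_module_def)
  have z [simp]: "\<zero>\<^bsub>?H\<^esub> = (\<lambda>x\<in>carrier M. \<zero>\<^bsub>N\<^esub>)" by (simp add: hom_module_def)
  have lin: "linear R M N f" if "f \<in> mod_hom R M N" for f using that by (simp add: mod_hom_iff)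
  have cl: "f x \<in> carrier N" if "f \<in> mod_hom R M N" "x \<in> carrier M" for f x using linearD(1)[OF lin] that by blast
  have ext: "f \<in> extensional (carrier M)" if "f \<in> mod_hom R M N" for f using that by (simp add: mod_hom_iff)
  have smul: "(\<lambda>x\<in>carrier M. r \<odot>\<^bsub>N\<^esub> f x) \<in> mod_hom R M N" if "r \<in> carrier R" "f \<in> mod_hom R M N" for r f
    by (intro linear_restrict[OF assms(1)] linearI)
      (use that cl linearD[OF lin[OF that(2)]] in \<open>auto simp: N.smult_r_distr N.smult_assoc1[symmetric] M.R.m_comm\<close>)
  have zero: "(\<lambda>x\<in>carrier M. \<zero>\<^bsub>N\<^esub>) \<in> mod_hom R M N"
    by (intro linear_restrict[OF assms(1)] linearI) auto
  show ?thesis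
  proof (rule moduleI[OF M.R.is_cring])
    show "abelian_group ?H"
    proof (rule abelian_groupI)
      fix f g assume f: "f \<in> carrier ?H" and g: "g \<in> carrier ?H"
      show "f \<oplus>\<^bsub>?H\<^esub> g \<in> carrier ?H" unfolding a c
        by (intro linear_restrict[OF assms(1)] linearI)
          (use f g cl linearD[OF lin[of f]] linearD[OF lin[of g]] in \<open>auto simp: N.smult_r_distr N.M.a_ac\<close>)
      show "f \<oplus>\<^bsub>?H\<^esub> g = g \<oplus>\<^bsub>?H\<^esub> f" using f g cl by (auto simp: N.M.a_comm intro!: restrict_ext)
      show "(f \<oplus>\<^bsub>?H\<^esub> g) \<oplus>\<^bsub>?H\<^esub> h = f \<oplus>\<^bsub>?H\<^esub> (g \<oplus>\<^bsub>?H\<^esub> h)" if "h \<in> carrier ?H" for h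
        using f g that cl by (auto simp: N.M.a_assoc intro!: restrict_ext)
    next
      show "\<zero>\<^bsub>?H\<^esub> \<in> carrier ?H" using zero by simp
      fix f assume f: "f \<in> carrier ?H"
      show "\<zero>\<^bsub>?H\<^esub> \<oplus>\<^bsub>?H\<^esub> f = f" using f cl ext[of f] by (auto simp: fun_eq_iff extensional_def)
      have n: "(\<lambda>x\<in>carrier M. (\<ominus>\<^bsub>R\<^esub> \<one>\<^bsub>R\<^esub>) \<odot>\<^bsub>N\<^esub> f x) \<in> carrier ?H" using smul[of "\<ominus>\<^bsub>R\<^esub> \<one>\<^bsub>R\<^esub>" f] f by simp
      have "(\<lambda>x\<in>carrier M. (\<ominus>\<^bsub>R\<^esub> \<one>\<^bsub>R\<^esub>) \<odot>\<^bsub>N\<^esub> f x) \<oplus>\<^bsub>?H\<^esub> f = \<zero>\<^bsub>?H\<^esub>"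
        using f cl by (auto simp: N.smult_l_minus N.M.l_neg intro!: restrict_ext)
      then show "\<exists>g\<in>carrier ?H. g \<oplus>\<^bsub>?H\<^esub> f = \<zero>\<^bsub>?H\<^esub>" using n by blast
    qed
    fix r f assume r: "r \<in> carrier R" and f: "f \<in> carrier ?H"
    show "r \<odot>\<^bsub>?H\<^esub> f \<in> carrier ?H" using smul r f by simp
    show "(r \<oplus>\<^bsub>R\<^esub> t) \<odot>\<^bsub>?H\<^esub> f = r \<odot>\<^bsub>?H\<^esub> f \<oplus>\<^bsub>?H\<^esub> t \<odot>\<^bsub>?H\<^esub> f" if "t \<in> carrier R" for t
      using r f that cl by (auto simp: N.smult_l_distr intro!: restrict_ext)
    show "(r \<otimes>\<^bsub>R\<^esub> t) \<odot>\<^bsub>?H\<^esub> f = r \<odot>\<^bsub>?H\<^esub> (t \<odot>\<^bsub>?H\<^esub> f)" if "t \<in> carrier R" for t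
      using r f that cl by (auto simp: N.smult_assoc1 intro!: restrict_ext)
    show "r \<odot>\<^bsub>?H\<^esub> (f \<oplus>\<^bsub>?H\<^esub> g) = r \<odot>\<^bsub>?H\<^esub> f \<oplus>\<^bsub>?H\<^esub> r \<odot>\<^bsub>?H\<^esub> g" if "g \<in> carrier ?H" for g
      using r f that cl by (auto simp: N.smult_r_distr intro!: restrict_ext)
  next
    show "\<one>\<^bsub>R\<^esub> \<odot>\<^bsub>?H\<^esub> f = f" if "f \<in> carrier ?H" for f
      using that cl ext[of f] by (auto simp: fun_eq_iff extensional_def)
  qed
qed

lemma hom_module_simps:
  "carrier (hom_module R M N) = mod_hom R M N"
  "f \<oplus>\<^bsub>hom_module R M N\<^esub> g = (\<lambda>x\<in>carrier M. f x \<oplus>\<^bsub>N\<^esub> g x)"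
  "r \<odot>\<^bsub>hom_module R M N\<^esub> f = (\<lambda>x\<in>carrier M. r \<odot>\<^bsub>N\<^esub> f x)"
  "\<zero>\<^bsub>hom_module R M N\<^esub> = (\<lambda>x\<in>carrier M. \<zero>\<^bsub>N\<^esub>)"
  by (simp_all add: hom_module_def)

lemma compose_hom:
  assumes "module R G" "d \<in> mod_hom R G G'" "f \<in> mod_hom R G' K"
  shows "compose (carrier G) f d \<in> mod_hom R G K"
proof -
  have "linear R G G' d" "linear R G' K f" using assms(2,3) unfolding mod_hom_iff by blast+
  then have "linear R G K (\<lambda>x. f (d x))" by (rule linear_compose)
  then show ?thesis unfolding compose_def by (rule linear_restrict[OF assms(1)])
qed

text \<open>The shape of \<open>Z\<close>, \<open>B\<close> and \<open>len\<close> is that of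
  \<open>ext_of_resolution\<close> in positive degree after unfolding, so type one applies directly;
  the conclusion is one-dimensionality of Ext expressed by maps.\<close>

lemma hom_cohomology_length_one:
  assumes G: "module R G0" "module R G1" "module R G2" and K: "module R K"
    and d: "d1 \<in> mod_hom R G1 G0" "d2 \<in> mod_hom R G2 G1"
    and dd: "\<And>v. v \<in> carrier G2 \<Longrightarrow> d1 (d2 v) = \<zero>\<^bsub>G0\<^esub>"
    and Z: "Z = {f \<in> carrier (hom_module R G1 K). compose (carrier G2) f d2 = \<zero>\<^bsub>hom_module R G2 K\<^esub>}"
    and B: "B = (\<lambda>f. compose (carrier G1) f d1) ` carrier (hom_module R G0 K)"
    and len: "module_length R (quot_module ((hom_module R G1 K)\<lparr>carrier := Z\<rparr>) B) = 1"
    and f: "f \<in> mod_hom R G1 K" "\<And>v. v \<in> carrier G2 \<Longrightarrow> f (d2 v) = \<zero>\<^bsub>K\<^esub>"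
    and g: "g \<in> mod_hom R G1 K" "\<And>v. v \<in> carrier G2 \<Longrightarrow> g (d2 v) = \<zero>\<^bsub>K\<^esub>"
    and nf: "\<And>h. h \<in> mod_hom R G0 K \<Longrightarrow> \<exists>v\<in>carrier G1. f v \<noteq> h (d1 v)"
  obtains r h where "r \<in> carrier R" "h \<in> mod_hom R G0 K"
    "\<And>v. v \<in> carrier G1 \<Longrightarrow> g v = r \<odot>\<^bsub>K\<^esub> f v \<oplus>\<^bsub>K\<^esub> h (d1 v)"
proof -
  let ?H = "hom_module R G1 K"
  interpret H: module R ?H by (rule hom_module_module[OF G(2) K])
  interpret K: module R K by (rule K)
  have d2c: "d2 v \<in> carrier G1" if "v \<in> carrier G2" for v using d(2) that by (auto simp: mod_hom_def)
  have d1c: "d1 v \<in> carrier G0" if "v \<in> carrier G1" for v using d(1) that by (auto simp: mod_hom_def)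
  have Zi: "h \<in> Z \<longleftrightarrow> h \<in> mod_hom R G1 K \<and> (\<forall>v\<in>carrier G2. h (d2 v) = \<zero>\<^bsub>K\<^esub>)" for h
    unfolding Z by (auto simp: hom_module_simps compose_def fun_eq_iff)
  have Zs: "submodule Z R ?H"
  proof (rule H.submoduleI')
    show "Z \<subseteq> carrier ?H" using Z by blast
    show "\<zero>\<^bsub>?H\<^esub> \<in> Z" unfolding Zi using H.zero_closed d2c by (auto simp: hom_module_simps)
    show "a \<oplus>\<^bsub>?H\<^esub> b \<in> Z" if "a \<in> Z" "b \<in> Z" for a b
      using that H.M.a_closed[of a b] d2c unfolding Zi by (auto simp: hom_module_simps)
    show "r \<odot>\<^bsub>?H\<^esub> b \<in> Z" if "r \<in> carrier R" "b \<in> Z" for r b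
      using that H.smult_closed[of r b] d2c unfolding Zi by (auto simp: hom_module_simps)
  qed
  interpret HZ: module R "?H\<lparr>carrier := Z\<rparr>" by (rule submodule.submodule_is_module[OF Zs H.module_axioms])
  have Bc: "compose (carrier G1) h d1 \<in> Z" if "h \<in> mod_hom R G0 K" for h
  proof -
    have "h \<zero>\<^bsub>G0\<^esub> = \<zero>\<^bsub>K\<^esub>" using that linear_zero[OF G(1) K] by (simp add: mod_hom_iff)
    then show ?thesis unfolding Zi using compose_hom[OF G(2) d(1) that] d2c dd by (auto simp: compose_def)
  qed
  interpret H0: module R "hom_module R G0 K" by (rule hom_module_module[OF G(1) K])
  have Bs: "submodule B R (?H\<lparr>carrier := Z\<rparr>)"
  proof (rule HZ.submoduleI')
    show "B \<subseteq> carrier (?H\<lparr>carrier := Z\<rparr>)" using Bc unfolding B by (auto simp: hom_module_simps)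
    have "\<zero>\<^bsub>?H\<lparr>carrier := Z\<rparr>\<^esub> = compose (carrier G1) \<zero>\<^bsub>hom_module R G0 K\<^esub> d1"
      using d1c by (auto simp: hom_module_simps compose_def fun_eq_iff)
    then show "\<zero>\<^bsub>?H\<lparr>carrier := Z\<rparr>\<^esub> \<in> B" unfolding B using H0.zero_closed by blast
    fix a b assume "a \<in> B" "b \<in> B"
    then obtain h k where hk: "h \<in> carrier (hom_module R G0 K)" "k \<in> carrier (hom_module R G0 K)"
      "a = compose (carrier G1) h d1" "b = compose (carrier G1) k d1" unfolding B by blast
    then have "a \<oplus>\<^bsub>?H\<lparr>carrier := Z\<rparr>\<^esub> b = compose (carrier G1) (h \<oplus>\<^bsub>hom_module R G0 K\<^esub> k) d1"
      using d1c by (auto simp: hom_module_simps compose_def fun_eq_iff)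
    then show "a \<oplus>\<^bsub>?H\<lparr>carrier := Z\<rparr>\<^esub> b \<in> B" unfolding B using hk by blast
  next
    fix r a assume r: "r \<in> carrier R" and "a \<in> B"
    then obtain h where hk: "h \<in> carrier (hom_module R G0 K)" "a = compose (carrier G1) h d1" unfolding B by blast
    then have "r \<odot>\<^bsub>?H\<lparr>carrier := Z\<rparr>\<^esub> a = compose (carrier G1) (r \<odot>\<^bsub>hom_module R G0 K\<^esub> h) d1"
      using d1c by (auto simp: hom_module_simps compose_def fun_eq_iff)
    then show "r \<odot>\<^bsub>?H\<lparr>carrier := Z\<rparr>\<^esub> a \<in> B" unfolding B using hk r by blast
  qed
  have "f \<notin> B"
  proof
    assume "f \<in> B"
    then obtain h where h: "h \<in> mod_hom R G0 K" "f = compose (carrier G1) h d1" unfolding B by (auto simp: hom_module_simps)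
    then show False using nf[OF h(1)] by (auto simp: compose_def)
  qed
  moreover have "f \<in> carrier (?H\<lparr>carrier := Z\<rparr>)" "g \<in> carrier (?H\<lparr>carrier := Z\<rparr>)" using f g Zi by auto
  ultimately obtain r n where rn: "r \<in> carrier R" "n \<in> B" "g = r \<odot>\<^bsub>?H\<lparr>carrier := Z\<rparr>\<^esub> f \<oplus>\<^bsub>?H\<lparr>carrier := Z\<rparr>\<^esub> n"
    using HZ.quot_length_one_generator[OF Bs len] by blast
  then obtain h where h: "h \<in> mod_hom R G0 K" "n = compose (carrier G1) h d1" unfolding B by (auto simp: hom_module_simps)
  have "g v = r \<odot>\<^bsub>K\<^esub> f v \<oplus>\<^bsub>K\<^esub> h (d1 v)" if "v \<in> carrier G1" for v
    unfolding rn(3) h(2) using that by (simp add: hom_module_simps compose_def)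
  then show ?thesis using that rn(1) h(1) by blast
qed

text \<open>The resolution is the very one that \<open>ext_module\<close> selects, so cohomology
  never has to be compared between resolutions.\<close>

lemma residue_resolution_exists:
  fixes A (structure)
  assumes nl: "noetherian_local A \<mm>"
  obtains b d \<gamma> where "local_resolution A \<mm> b d \<gamma>"
    "\<And>i. d i \<in> mod_hom A (free_module A (b (Suc i))) (free_module A (b i))"
    "(SOME (b, d). \<exists>\<epsilon>. free_resolution A (quot_module (ring_module A) \<mm>) b d \<epsilon>) = (b, d)"
proof -
  interpret cring A using nl by (simp add: noetherian_local_def)
  have noeth: "noetherian_ring A" and max: "maximalideal \<mm> A" and uniq: "\<And>\<nn>. maximalideal \<nn> A \<Longrightarrow> \<nn> = \<mm>"
    using nl by (auto simp: noetherian_local_def)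
  have mi: "ideal \<mm> A" using max by (simp add: maximalideal.axioms(1))
  let ?k = "quot_module (ring_module A) \<mm>" and ?F = "free_module A"
  interpret RM: module A "ring_module A" by (rule ring_module_module)
  have m': "submodule \<mm> A (ring_module A)" using mi ideal_iff_submodule by simp
  interpret k: module A ?k by (rule RM.quot_is_module[OF m'])
  obtain b d where bd: "(SOME (b, d). \<exists>\<epsilon>. free_resolution A ?k b d \<epsilon>) = (b, d)" by fastforce
  have "\<exists>p. case p of (b, d) \<Rightarrow> \<exists>\<epsilon>. free_resolution A ?k b d \<epsilon>"
    using free_resolution_exists[OF noeth mi] by auto
  from someI_ex[OF this] obtain \<epsilon> where "free_resolution A ?k b d \<epsilon>" unfolding bd by auto
  then have \<epsilon>: "linear A (?F (b 0)) ?k \<epsilon>" and dh: "\<And>i. d i \<in> mod_hom A (?F (b (Suc i))) (?F (b i))"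
    and onto: "\<epsilon> ` carrier (?F (b 0)) = carrier ?k"
    and e0: "d 0 ` carrier (?F (b 1)) = {v \<in> carrier (?F (b 0)). \<epsilon> v = \<zero>\<^bsub>?k\<^esub>}"
    and eS: "\<And>i. d (Suc i) ` carrier (?F (b (Suc (Suc i)))) = {v \<in> carrier (?F (b (Suc i))). d i v = \<zero>\<^bsub>?F (b i)\<^esub>}"
    unfolding free_resolution_def Let_def mod_hom_iff by blast+
  have h: "linear A (ring_module A) ?k (\<lambda>x. \<mm> +> x)"
    using RM.quot_add[OF m'] RM.quot_smult[OF m'] RM.coset_closed[of _ \<mm>]
    by (intro linearI) (simp_all add: a_r_coset_ring_module)
  have 0: "submodule {\<zero>\<^bsub>?k\<^esub>} A ?k" by (rule k.submoduleI') auto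
  have sub0: "x = y" if "x \<ominus>\<^bsub>?k\<^esub> y \<in> {\<zero>\<^bsub>?k\<^esub>}" "x \<in> carrier ?k" "y \<in> carrier ?k" for x y
  proof -
    have "x = (x \<ominus>\<^bsub>?k\<^esub> y) \<oplus>\<^bsub>?k\<^esub> y" using that(2,3) by (simp add: a_minus_def k.M.a_assoc k.M.l_neg)
    then show ?thesis using that by simp
  qed
  have ex: "\<exists>x\<in>carrier (ring_module A). \<epsilon> v \<ominus>\<^bsub>?k\<^esub> (\<mm> +> x) \<in> {\<zero>\<^bsub>?k\<^esub>}" if v: "v \<in> carrier (?F (b 0))" for v
  proof -
    have "\<epsilon> v \<in> carrier ?k" using linearD(1)[OF \<epsilon> v] .
    moreover from this obtain x where "x \<in> carrier A" "\<epsilon> v = \<mm> +> x" by (auto elim!: RM.quot_cases simp: a_r_coset_ring_module)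
    ultimately show ?thesis by (intro bexI[of _ x]) (auto simp: a_minus_def k.M.r_neg)
  qed
  \<comment> \<open>The augmentation lifts along \<open>A \<rightarrow> A/\<mm>\<close> because the
    first module of the resolution is free.\<close>
  obtain \<gamma> where \<gamma>: "linear A (?F (b 0)) (ring_module A) \<gamma>"
    "\<And>v. v \<in> carrier (?F (b 0)) \<Longrightarrow> \<epsilon> v \<ominus>\<^bsub>?k\<^esub> (\<mm> +> \<gamma> v) \<in> {\<zero>\<^bsub>?k\<^esub>}"
    using k.free_module_lift[OF ring_module_module 0 \<epsilon> h ex] by blast
  have gc: "\<gamma> v \<in> carrier A" if "v \<in> carrier (?F (b 0))" for v using linearD(1)[OF \<gamma>(1) that] by simp
  have eg: "\<epsilon> v = \<mm> +> \<gamma> v" if "v \<in> carrier (?F (b 0))" for v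
    by (rule sub0[OF \<gamma>(2)[OF that] linearD(1)[OF \<epsilon> that]]) (use linearD(1)[OF h] gc[OF that] in simp)
  have ceq: "\<mm> +> x = \<mm> +> y \<longleftrightarrow> x \<ominus> y \<in> \<mm>" if "x \<in> carrier A" "y \<in> carrier A" for x y
    using RM.coset_eq_iff[OF m', of x y] that by (simp add: a_r_coset_ring_module minus_ring_module)
  have m0: "\<mm> +> \<zero> = \<mm>" using RM.coset_zero[OF m'] by (simp add: a_r_coset_ring_module)
  have e_iff: "\<epsilon> v = \<zero>\<^bsub>?k\<^esub> \<longleftrightarrow> \<gamma> v \<in> \<mm>" if "v \<in> carrier (?F (b 0))" for v
    using ceq[OF gc[OF that] zero_closed] gc[OF that] unfolding eg[OF that] RM.quot_zero m0 by (simp add: a_minus_def)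
  have "\<mm> +> \<one> \<in> carrier ?k" using linearD(1)[OF h] by simp
  then obtain v where v: "v \<in> carrier (?F (b 0))" "\<epsilon> v = \<mm> +> \<one>" using onto by (metis imageE)
  then have "\<one> \<ominus> \<gamma> v \<in> \<mm>" using ceq[OF one_closed gc[OF v(1)]] eg[OF v(1)] by simp
  then have s: "\<exists>v\<in>carrier (?F (b 0)). \<one> \<ominus> \<gamma> v \<in> \<mm>" using v(1) by blast
  have e0': "d 0 ` carrier (?F (b (Suc 0))) = {v \<in> carrier (?F (b 0)). \<gamma> v \<in> \<mm>}"
    using e0 e_iff unfolding One_nat_def by (metis (mono_tags, lifting) Collect_cong)
  have dl: "linear A (?F (b (Suc i))) (?F (b i)) (d i)" for i using dh[of i] unfolding mod_hom_iff ..
  have "residue_resolution A \<mm> b d \<gamma>"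
    by (intro residue_resolution.intro residue_resolution_axioms.intro is_cring mi \<gamma>(1) dl e0' eS s)
  then have "local_resolution A \<mm> b d \<gamma>"
    by (rule local_resolution.intro) (intro local_resolution_axioms.intro noeth max uniq)
  then show ?thesis by (rule that[OF _ dh bd])
qed

text \<open>Positive depth excludes the empty supremum, so the value is taken by some
  sequence.\<close>

lemma depth_attained:
  assumes "depth A \<mm> M = enat (Suc e)"
  obtains xs where "set xs \<subseteq> \<mm>" "regular_seq A M xs" "length xs = Suc e"
proof -
  let ?S = "{enat (length xs) |xs. set xs \<subseteq> \<mm> \<and> regular_seq A M xs}"
  have "?S \<noteq> {}"
  proof
    assume "?S = {}"
    then have "Sup ?S = 0" by (simp only: Sup_enat_def) simp
    then show False using assms unfolding depth_def by (simp add: zero_enat_def)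
  qed
  then have "enat (Suc e) \<in> ?S" using Sup_enat_attained assms unfolding depth_def by blast
  then show ?thesis using that by auto
qed

context cring begin

text \<open>The isomorphism \<open>\<theta>\<close> carries \<open>(xs)I\<close> onto
  \<open>(xs)K\<close>, for every initial part of the sequence. One inclusion allows regularity on
  \<open>K\<close> to be used, the other brings the conclusion back to \<open>I\<close>.\<close>

lemma regular_seq_imp_regular_on:
  assumes I: "ideal I R" and K: "module R K" and \<theta>: "\<theta> \<in> mod_hom R ((ring_module R)\<lparr>carrier := I\<rparr>) K"
    "bij_betw \<theta> I (carrier K)" and reg: "regular_seq R K xs"
  shows "regular_on I {\<zero>} xs"
  unfolding regular_on_iff
proof (intro allI impI ballI)
  interpret K: module R K by (rule K)
  let ?I = "(ring_module R)\<lparr>carrier := I\<rparr>"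
  have l: "linear R ?I K \<theta>" using \<theta>(1) by (simp add: mod_hom_iff)
  have \<theta>a: "\<theta> (x \<oplus> y) = \<theta> x \<oplus>\<^bsub>K\<^esub> \<theta> y" if "x \<in> I" "y \<in> I" for x y using linearD(2)[OF l, of x y] that by simp
  have \<theta>s: "\<theta> (r \<otimes> x) = r \<odot>\<^bsub>K\<^esub> \<theta> x" if "r \<in> carrier R" "x \<in> I" for r x using linearD(3)[OF l, of r x] that by simp
  have \<theta>0: "\<theta> \<zero> = \<zero>\<^bsub>K\<^esub>" using linear_zero[OF ideal_module[OF I] K l] by simp
  have \<theta>c: "\<theta> x \<in> carrier K" if "x \<in> I" for x using linearD(1)[OF l] that by simp
  fix i u assume i: "i < length xs" and u: "u \<in> I" and xu: "xs ! i \<otimes> u \<in> add_mults I {\<zero>} (take i xs)"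
  have xc: "set xs \<subseteq> carrier R" using reg by (simp add: regular_seq_def)
  then have xi: "xs ! i \<in> carrier R" using i by auto
  have tc: "set (take i xs) \<subseteq> carrier R" using xc set_take_subset by fast
  have z: "ideal {\<zero>} R" "{\<zero>} \<subseteq> I" using zeroideal idl_zero[OF I] by auto
  define Q where "Q = add_mults I {\<zero>} (take i xs)"
  have Q: "ideal Q R" "Q \<subseteq> I" unfolding Q_def using add_mults_ideal[OF I z tc] by auto
  define W where "W = seq_mult R K (take i xs)"
  have Xc: "{x \<odot>\<^bsub>K\<^esub> y |x y. x \<in> set (take i xs) \<and> y \<in> carrier K} \<subseteq> carrier K" using tc by auto
  have W: "submodule W R K" unfolding W_def seq_mult_def by (rule K.submod_span_submodule[OF Xc])
  have "Q \<subseteq> {u \<in> I. \<theta> u \<in> W}"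
    unfolding Q_def
  proof (rule add_mults_least)
    show "ideal {u \<in> I. \<theta> u \<in> W} R"
    proof (rule idealI')
      show "{u \<in> I. \<theta> u \<in> W} \<subseteq> carrier R" using idl_sub[OF I] by blast
      show "\<zero> \<in> {u \<in> I. \<theta> u \<in> W}" using \<theta>0 K.submodule_zero[OF W] idl_zero[OF I] by simp
      show "x \<oplus> y \<in> {u \<in> I. \<theta> u \<in> W}" if "x \<in> {u \<in> I. \<theta> u \<in> W}" "y \<in> {u \<in> I. \<theta> u \<in> W}" for x y
        using that \<theta>a[of x y] K.submoduleE(5)[OF W, of "\<theta> x" "\<theta> y"] idl_add[OF I, of x y] by simp
      show "c \<otimes> x \<in> {u \<in> I. \<theta> u \<in> W}" if "c \<in> carrier R" "x \<in> {u \<in> I. \<theta> u \<in> W}" for c x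
        using that \<theta>s[of c x] K.submoduleE(4)[OF W, of c "\<theta> x"] idl_lmult[OF I, of x c] by simp
    qed
    show "{\<zero>} \<subseteq> {u \<in> I. \<theta> u \<in> W}" using \<theta>0 K.submodule_zero[OF W] idl_zero[OF I] by simp
    fix x v assume x: "x \<in> set (take i xs)" and v: "v \<in> I"
    have xR: "x \<in> carrier R" using x tc by blast
    have "x \<odot>\<^bsub>K\<^esub> \<theta> v \<in> {x \<odot>\<^bsub>K\<^esub> y |x y. x \<in> set (take i xs) \<and> y \<in> carrier K}" using x \<theta>c[OF v] by blast
    then have "x \<odot>\<^bsub>K\<^esub> \<theta> v \<in> W" unfolding W_def seq_mult_def by (rule subsetD[OF K.submod_span_upper])
    then show "x \<otimes> v \<in> {u \<in> I. \<theta> u \<in> W}" using \<theta>s[OF xR v] idl_lmult[OF I v xR] by simp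
  qed
  then have "\<theta> (xs ! i \<otimes> u) \<in> W" using xu unfolding Q_def by blast
  then have "(xs ! i) \<odot>\<^bsub>K\<^esub> \<theta> u \<in> W" using \<theta>s[OF xi u] by simp
  then have \<theta>u: "\<theta> u \<in> W" using reg i \<theta>c[OF u] unfolding regular_seq_def W_def by blast
  have "W \<subseteq> \<theta> ` Q"
    unfolding W_def seq_mult_def
  proof (rule K.submod_span_least)
    show "submodule (\<theta> ` Q) R K"
    proof (rule K.submoduleI')
      show "\<theta> ` Q \<subseteq> carrier K" using Q \<theta>c by blast
      show "\<zero>\<^bsub>K\<^esub> \<in> \<theta> ` Q" using \<theta>0 idl_zero[OF Q(1)] by (metis imageI)
      fix a b assume "a \<in> \<theta> ` Q" "b \<in> \<theta> ` Q"
      then obtain x y where "x \<in> Q" "y \<in> Q" "a = \<theta> x" "b = \<theta> y" by blast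
      then have "a \<oplus>\<^bsub>K\<^esub> b = \<theta> (x \<oplus> y)" "x \<oplus> y \<in> Q" using \<theta>a[of x y] Q(2) idl_add[OF Q(1), of x y] by (simp_all add: subsetD)
      then show "a \<oplus>\<^bsub>K\<^esub> b \<in> \<theta> ` Q" by blast
    next
      fix r a assume r: "r \<in> carrier R" and "a \<in> \<theta> ` Q"
      then obtain x where "x \<in> Q" "a = \<theta> x" by blast
      then have "r \<odot>\<^bsub>K\<^esub> a = \<theta> (r \<otimes> x)" "r \<otimes> x \<in> Q" using \<theta>s[OF r, of x] Q(2) idl_lmult[OF Q(1) _ r, of x] by (simp_all add: subsetD)
      then show "r \<odot>\<^bsub>K\<^esub> a \<in> \<theta> ` Q" by blast
    qed
    show "{x \<odot>\<^bsub>K\<^esub> y |x y. x \<in> set (take i xs) \<and> y \<in> carrier K} \<subseteq> \<theta> ` Q"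
    proof
      fix w assume "w \<in> {x \<odot>\<^bsub>K\<^esub> y |x y. x \<in> set (take i xs) \<and> y \<in> carrier K}"
      then obtain x y where xy: "x \<in> set (take i xs)" "y \<in> carrier K" "w = x \<odot>\<^bsub>K\<^esub> y" by blast
      then obtain v where v: "v \<in> I" "y = \<theta> v" using \<theta>(2) unfolding bij_betw_def by blast
      then have "w = \<theta> (x \<otimes> v)" using xy \<theta>s[of x v] tc by (simp add: subsetD)
      moreover have "x \<otimes> v \<in> Q" unfolding Q_def by (rule add_mults_mem[OF I z tc xy(1) v(1)])
      ultimately show "w \<in> \<theta> ` Q" by blast
    qed
  qed
  then obtain q where "q \<in> Q" "\<theta> u = \<theta> q" using \<theta>u by blast
  then have "u = q" using \<theta>(2) u Q unfolding bij_betw_def inj_on_def by blast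
  then show "u \<in> add_mults I {\<zero>} (take i xs)" using \<open>q \<in> Q\<close> unfolding Q_def by simp
qed

end

text \<open>Depth gives the two vanishing statements and type one gives the last conclusion; all of
  them concern the same resolution.\<close>

lemma canonical_ideal_cohomology:
  assumes cm: "cohen_macaulay_local A \<mm>" and dim: "krull_dim A = enat (Suc e)"
    and can: "canonical_module A \<mm> K" "canonical_ideal A K I"
  obtains b d \<gamma> where "local_resolution A \<mm> b d \<gamma>"
    "residue_resolution.vanish A b d (Suc e) (carrier A) {\<zero>\<^bsub>A\<^esub>}"
    "residue_resolution.vanish A b d (Suc e) I {\<zero>\<^bsub>A\<^esub>}"
    "residue_resolution.onedim A b d (Suc e) I {\<zero>\<^bsub>A\<^esub>}"
proof -
  have nl: "noetherian_local A \<mm>" and dA: "depth A \<mm> (ring_module A) = enat (Suc e)"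
    using cm dim by (auto simp: cohen_macaulay_local_def)
  obtain b d \<gamma> where r: "local_resolution A \<mm> b d \<gamma>"
    and dh: "\<And>i. d i \<in> mod_hom A (free_module A (b (Suc i))) (free_module A (b i))"
    and some: "(SOME (b, d). \<exists>\<epsilon>. free_resolution A (quot_module (ring_module A) \<mm>) b d \<epsilon>) = (b, d)"
    by (rule residue_resolution_exists[OF nl]) (rule that)
  interpret local_resolution A \<mm> b d \<gamma> by (rule r)
  have I: "ideal I A" using can by (simp add: canonical_ideal_def)
  have K: "module A K" and dK: "depth A \<mm> K = enat (Suc e)" and ty: "cm_type A \<mm> K = 1"
    using can(1) dim by (auto simp: canonical_module_def maximal_cm_def)
  interpret K: module A K by (rule K)
  let ?I = "(ring_module A)\<lparr>carrier := I\<rparr>"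
  obtain \<theta> where \<theta>: "\<theta> \<in> mod_hom A ?I K" "bij_betw \<theta> I (carrier K)"
    using can(2) by (auto simp: canonical_ideal_def mod_isomorphic_def)
  have z: "ideal {\<zero>\<^bsub>A\<^esub>} A" "{\<zero>\<^bsub>A\<^esub>} \<subseteq> I" "{\<zero>\<^bsub>A\<^esub>} \<subseteq> carrier A" using zeroideal idl_zero[OF I] by auto
  obtain xs where xs: "set xs \<subseteq> \<mm>" "regular_seq A K xs" "length xs = Suc e" by (rule depth_attained[OF dK])
  have vI: "vanish (Suc e) I {\<zero>\<^bsub>A\<^esub>}"
    using vanish_regular[OF I z(1,2) xs(1) regular_seq_imp_regular_on[OF I K \<theta> xs(2)]] xs(3) by simp
  obtain ys where ys: "set ys \<subseteq> \<mm>" "regular_seq A (ring_module A) ys" "length ys = Suc e" by (rule depth_attained[OF dA])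
  \<comment> \<open>The ring is treated as the ideal \<open>carrier A\<close> with the identity as
    isomorphism, so the transport lemma applies again.\<close>
  have Rid: "(ring_module A)\<lparr>carrier := carrier A\<rparr> = ring_module A" by (simp add: ring_module_def)
  have "linear A (ring_module A) (ring_module A) (\<lambda>x. x)" by (rule linearI) auto
  then have "restrict (\<lambda>x. x) (carrier A) \<in> mod_hom A ((ring_module A)\<lparr>carrier := carrier A\<rparr>) (ring_module A)"
    using linear_restrict[OF ring_module_module, of "ring_module A" "\<lambda>x. x"] unfolding Rid by simp
  moreover have "bij_betw (restrict (\<lambda>x. x) (carrier A)) (carrier A) (carrier (ring_module A))"
    by (auto simp: bij_betw_def inj_on_def)
  ultimately have "regular_on (carrier A) {\<zero>\<^bsub>A\<^esub>} ys"
    by (rule regular_seq_imp_regular_on[OF oneideal ring_module_module _ _ ys(2)])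
  then have vA: "vanish (Suc e) (carrier A) {\<zero>\<^bsub>A\<^esub>}" using vanish_regular[OF oneideal z(1,3) ys(1)] ys(3) by simp
  have "onedim (Suc e) I {\<zero>\<^bsub>A\<^esub>}"
    unfolding onedim_def
  proof (intro allI impI)
    fix \<phi> \<psi> assume \<phi>: "cocycle (Suc e) \<phi> I {\<zero>\<^bsub>A\<^esub>}" and \<psi>: "cocycle (Suc e) \<psi> I {\<zero>\<^bsub>A\<^esub>}"
      and n: "\<not> cobound (Suc e) \<phi> I {\<zero>\<^bsub>A\<^esub>}"
    have len: "module_length A (quot_module ((hom_module A (F (Suc e)) K)\<lparr>carrier :=
        {f \<in> carrier (hom_module A (F (Suc e)) K). compose (carrier (F (Suc (Suc e)))) f (d (Suc e)) = \<zero>\<^bsub>hom_module A (F (Suc (Suc e))) K\<^esub>}\<rparr>)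
        ((\<lambda>f. compose (carrier (F (Suc e))) f (d e)) ` carrier (hom_module A (F e) K))) = 1"
      using ty unfolding cm_type_def dK ext_module_def some by (simp add: ext_of_resolution_def Let_def)
    have l\<theta>: "linear A ?I K \<theta>" using \<theta>(1) by (simp add: mod_hom_iff)
    have \<theta>0: "\<theta> \<zero>\<^bsub>A\<^esub> = \<zero>\<^bsub>K\<^esub>" using linear_zero[OF ideal_module[OF I] K l\<theta>] by simp
    have toK: "restrict (\<lambda>v. \<theta> (\<eta> v)) (carrier (F (Suc e))) \<in> mod_hom A (F (Suc e)) K"
      "restrict (\<lambda>v. \<theta> (\<eta> v)) (carrier (F (Suc e))) (d (Suc e) v) = \<zero>\<^bsub>K\<^esub>"
      if "cocycle (Suc e) \<eta> I {\<zero>\<^bsub>A\<^esub>}" "v \<in> carrier (F (Suc (Suc e)))" for \<eta> v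
    proof -
      have \<eta>: "lin (Suc e) I \<eta>" "\<eta> (d (Suc e) v) = \<zero>\<^bsub>A\<^esub>" using that by (auto simp: cocycle_def)
      have "linear A (F (Suc e)) ?I \<eta>" by (rule linearI) (use linD[OF \<eta>(1)] in auto)
      from linear_compose[OF this l\<theta>] show "restrict (\<lambda>v. \<theta> (\<eta> v)) (carrier (F (Suc e))) \<in> mod_hom A (F (Suc e)) K"
        by (rule linear_restrict[OF Fm])
      show "restrict (\<lambda>v. \<theta> (\<eta> v)) (carrier (F (Suc e))) (d (Suc e) v) = \<zero>\<^bsub>K\<^esub>"
        using dc[OF that(2)] \<eta>(2) \<theta>0 by simp
    qed
    \<comment> \<open>A witness for the premise on \<open>v\<close> when \<open>toK(1)\<close> is
      instantiated.\<close>
    have fz: "\<zero>\<^bsub>F (Suc (Suc e))\<^esub> \<in> carrier (F (Suc (Suc e)))"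
      by (simp add: free_simps)
    let ?i = "the_inv_into I \<theta>"
    have inj: "inj_on \<theta> I" and im: "\<theta> ` I = carrier K" using \<theta>(2) by (auto simp: bij_betw_def)
    have ic: "?i x \<in> I" "\<theta> (?i x) = x" if "x \<in> carrier K" for x
      using the_inv_into_into[OF inj, of x I] f_the_inv_into_f[OF inj, of x] that im by auto
    have il: "linear A K ?I ?i"
    proof (rule linearI)
      fix x y assume x: "x \<in> carrier K" and y: "y \<in> carrier K"
      have "\<theta> (?i x \<oplus>\<^bsub>A\<^esub> ?i y) = x \<oplus>\<^bsub>K\<^esub> y" using linearD(2)[OF l\<theta>, of "?i x" "?i y"] ic x y by simp
      from the_inv_into_f_eq[OF inj this idl_add[OF I ic(1)[OF x] ic(1)[OF y]]]
      show "?i (x \<oplus>\<^bsub>K\<^esub> y) = ?i x \<oplus>\<^bsub>?I\<^esub> ?i y" by simp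
    next
      fix c x assume c: "c \<in> carrier A" and x: "x \<in> carrier K"
      have "\<theta> (c \<otimes>\<^bsub>A\<^esub> ?i x) = c \<odot>\<^bsub>K\<^esub> x" using linearD(3)[OF l\<theta>, of c "?i x"] ic x c by simp
      from the_inv_into_f_eq[OF inj this idl_lmult[OF I ic(1)[OF x] c]]
      show "?i (c \<odot>\<^bsub>K\<^esub> x) = c \<odot>\<^bsub>?I\<^esub> ?i x" by simp
    qed (use ic in simp)
    have toI: "lin e I (\<lambda>v. ?i (h v))" if "h \<in> mod_hom A (F e) K" for h
    proof -
      have l: "linear A (F e) ?I (\<lambda>v. ?i (h v))" by (rule linear_compose[OF _ il]) (use that in \<open>simp add: mod_hom_iff\<close>)
      show ?thesis
      proof (rule linI[OF _ idl_sub[OF I]])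
        fix v assume v: "v \<in> carrier (F e)"
        show "?i (h v) \<in> I" using linearD(1)[OF l v] by simp
        show "?i (h (v \<oplus>\<^bsub>F e\<^esub> w)) = ?i (h v) \<oplus>\<^bsub>A\<^esub> ?i (h w)" if "w \<in> carrier (F e)" for w
          using linearD(2)[OF l v that] by simp
        show "?i (h (r \<odot>\<^bsub>F e\<^esub> v)) = r \<otimes>\<^bsub>A\<^esub> ?i (h v)" if "r \<in> carrier A" for r
          using linearD(3)[OF l that v] by simp
      qed
    qed
    have hc: "h v \<in> carrier K" if "h \<in> mod_hom A (F e) K" "v \<in> carrier (F e)" for h v
      using that(1) linearD(1)[OF _ that(2)] unfolding mod_hom_iff by blast
    have l\<phi>: "lin (Suc e) I \<phi>" and l\<psi>: "lin (Suc e) I \<psi>" using \<phi> \<psi> by (auto simp: cocycle_def)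
    have nf: "\<exists>v\<in>carrier (F (Suc e)). restrict (\<lambda>v. \<theta> (\<phi> v)) (carrier (F (Suc e))) v \<noteq> h (d e v)"
      if h: "h \<in> mod_hom A (F e) K" for h
    proof (rule ccontr)
      assume "\<not> ?thesis"
      then have *: "\<theta> (\<phi> v) = h (d e v)" if "v \<in> carrier (F (Suc e))" for v using that by auto
      have "\<phi> v \<ominus>\<^bsub>A\<^esub> ?i (h (d e v)) \<in> {\<zero>\<^bsub>A\<^esub>}" if v: "v \<in> carrier (F (Suc e))" for v
      proof -
        have "?i (h (d e v)) = \<phi> v" using the_inv_into_f_eq[OF inj *[OF v] linD(1)[OF l\<phi> v]] .
        then show ?thesis using linD(2)[OF l\<phi> v] by (simp add: a_minus_def r_neg)
      qed
      then show False using n toI[OF h] unfolding cobound.simps by blast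
    qed
    obtain r h where rh: "r \<in> carrier A" "h \<in> mod_hom A (F e) K"
      "\<And>v. v \<in> carrier (F (Suc e)) \<Longrightarrow> restrict (\<lambda>v. \<theta> (\<psi> v)) (carrier (F (Suc e))) v =
          r \<odot>\<^bsub>K\<^esub> restrict (\<lambda>v. \<theta> (\<phi> v)) (carrier (F (Suc e))) v \<oplus>\<^bsub>K\<^esub> h (d e v)"
      using hom_cohomology_length_one[OF Fm Fm Fm K dh dh dd refl refl len toK(1)[OF \<phi> fz] toK(2)[OF \<phi>]
          toK(1)[OF \<psi> fz] toK(2)[OF \<psi>] nf] by blast
    have "(\<psi> v \<ominus>\<^bsub>A\<^esub> r \<otimes>\<^bsub>A\<^esub> \<phi> v) \<ominus>\<^bsub>A\<^esub> ?i (h (d e v)) \<in> {\<zero>\<^bsub>A\<^esub>}" if v: "v \<in> carrier (F (Suc e))" for v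
    proof -
      note c = linD(1)[OF l\<phi> v] linD(1)[OF l\<psi> v] hc[OF rh(2) dc[OF v]]
      have "\<theta> (r \<otimes>\<^bsub>A\<^esub> \<phi> v \<oplus>\<^bsub>A\<^esub> ?i (h (d e v))) = r \<odot>\<^bsub>K\<^esub> \<theta> (\<phi> v) \<oplus>\<^bsub>K\<^esub> h (d e v)"
        using linearD(2)[OF l\<theta>, of "r \<otimes>\<^bsub>A\<^esub> \<phi> v" "?i (h (d e v))"] linearD(3)[OF l\<theta> rh(1), of "\<phi> v"] c ic
          idl_lmult[OF I c(1) rh(1)] by simp
      also have "\<dots> = \<theta> (\<psi> v)" using rh(3)[OF v] v by simp
      finally have "r \<otimes>\<^bsub>A\<^esub> \<phi> v \<oplus>\<^bsub>A\<^esub> ?i (h (d e v)) = \<psi> v"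
        using inj_onD[OF inj] c ic I rh(1) by (blast intro: idl_add idl_lmult)
      moreover have "\<phi> v \<in> carrier A" "?i (h (d e v)) \<in> carrier A" using c ic idl_carr[OF I] by auto
      moreover have "(p \<oplus>\<^bsub>A\<^esub> q \<ominus>\<^bsub>A\<^esub> p) \<ominus>\<^bsub>A\<^esub> q = \<zero>\<^bsub>A\<^esub>" if "p \<in> carrier A" "q \<in> carrier A" for p q
        using that by algebra
      ultimately show ?thesis using rh(1) by (metis m_closed singletonI)
    qed
    then show "\<exists>r\<in>carrier A. cobound (Suc e) (\<lambda>v. \<psi> v \<ominus>\<^bsub>A\<^esub> r \<otimes>\<^bsub>A\<^esub> \<phi> v) I {\<zero>\<^bsub>A\<^esub>}"
      using rh(1) toI[OF rh(2)] unfolding cobound.simps by blast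
  qed
  then show ?thesis using that r vA vI by blast
qed

section \<open>The square of the ideal\<close>

locale noeth_local = cring +
  fixes \<mm> :: "'a set"
  assumes noeth: "noetherian_ring R" and max: "maximalideal \<mm> R"
    and uniq: "\<And>\<nn>. maximalideal \<nn> R \<Longrightarrow> \<nn> = \<mm>"
begin

lemma max_ideal: "ideal \<mm> R"
  using max by (rule maximalideal.axioms(1))

lemma max_proper: "\<one> \<notin> \<mm>"
  using max maximalideal.I_notcarr ideal.one_imp_carrier[OF max_ideal] by metis

lemma proper_ideal_sub_max:
  assumes I: "ideal I R" "\<one> \<notin> I"
  shows "I \<subseteq> \<mm>"
proof -
  let ?A = "{L. ideal L R \<and> I \<subseteq> L \<and> \<one> \<notin> L}"
  have "\<exists>P\<in>?A. \<forall>Q\<in>?A. P \<subseteq> Q \<longrightarrow> Q = P"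
  proof (rule subset_Zorn_nonempty)
    show "?A \<noteq> {}" using I by blast
    fix C assume C: "C \<noteq> {}" "subset.chain ?A C"
    then have "subset.chain {I. ideal I R} C" by (auto simp: subset.chain_def)
    then have "\<Union>C \<in> C" using noetherian_ring.ideal_chain_is_trivial[OF noeth C(1)] by blast
    then show "\<Union>C \<in> ?A" using C(2) by (auto simp: subset.chain_def)
  qed
  then obtain P where P: "P \<in> ?A" "\<forall>Q\<in>?A. P \<subseteq> Q \<longrightarrow> Q = P" ..
  then have Pi: "ideal P R" "I \<subseteq> P" "\<one> \<notin> P" by auto
  have "maximalideal P R"
  proof (rule maximalidealI)
    show "ideal P R" "carrier R \<noteq> P" using Pi one_closed by auto
    show "L = P \<or> L = carrier R" if "ideal L R" "P \<subseteq> L" "L \<subseteq> carrier R" for L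
    proof (cases "\<one> \<in> L")
      case True
      then show ?thesis using ideal.one_imp_carrier[OF that(1)] by blast
    next
      case False
      then show ?thesis using P that Pi by blast
    qed
  qed
  then show ?thesis using uniq Pi by blast
qed

text \<open>Nakayama for one element: \<open>1 - y\<close> lies in \<open>L : c\<close> but not in
  \<open>\<mm>\<close>, so \<open>L : c\<close> is not proper.\<close>

lemma colon_cancel:
  assumes L: "ideal L R" and c: "c \<in> carrier R" and y: "y \<in> \<mm>" "c \<ominus> y \<otimes> c \<in> L"
  shows "c \<in> L"
proof (rule ccontr)
  assume n: "c \<notin> L"
  have yc: "y \<in> carrier R" using idl_carr[OF max_ideal y(1)] .
  have "\<one> \<notin> colon L c" using n c by (simp add: colon_def)
  then have "colon L c \<subseteq> \<mm>" using proper_ideal_sub_max colon_ideal[OF L c] by blast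
  moreover have "c \<otimes> (\<one> \<ominus> y) = c \<ominus> y \<otimes> c" using c yc by algebra
  then have "\<one> \<ominus> y \<in> colon L c" using y yc by (simp add: colon_def)
  ultimately have "\<one> \<in> \<mm>" using idl_diff_cancel[OF max_ideal _ y(1)] by blast
  then show False using max_proper by blast
qed

text \<open>\<open>\<aa>/L\<close> is simple, so any element outside \<open>L\<close> generates it.
  If \<open>y c\<close> were outside \<open>L\<close>, it would generate as well, giving
  \<open>c = l + r y c\<close>, and Nakayama puts \<open>c\<close> into \<open>L\<close>.\<close>

lemma simple_step:
  assumes a: "ideal \<aa> R" and L: "ideal L R" "L \<subseteq> \<aa>" and len: "len R \<aa> L \<le> 1" and c: "c \<in> \<aa>" "c \<notin> L"
  shows "\<aa> = L <+> (c \<odot>\<^sub>s carrier R)" "\<And>y. y \<in> \<mm> \<Longrightarrow> y \<otimes> c \<in> L"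
proof -
  have cc: "c \<in> carrier R" using idl_carr[OF a c(1)] .
  have no: "X = \<aa>" if X: "ideal X R" "L \<subset> X" "X \<subseteq> \<aa>" for X
  proof (rule ccontr)
    assume "X \<noteq> \<aa>"
    then have "eSuc (len R X L) \<le> len R \<aa> L" using X by (intro len_Suc a) auto
    moreover have "eSuc (len R L L) \<le> len R X L" using X by (intro len_Suc L) auto
    ultimately have "eSuc (eSuc (len R L L)) \<le> 1" using len by (meson eSuc_ile_mono order_trans)
    then show False by (simp add: one_eSuc)
  qed
  have cA: "ideal (z \<odot>\<^sub>s carrier R) R" if "z \<in> carrier R" for z using that by (rule principal_ideal)
  have "c \<in> L <+> (c \<odot>\<^sub>s carrier R)" using idl_sum_upper(2)[OF L(1) cA[OF cc]] elt_mult_self[OF cc] by blast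
  then have "L \<subset> L <+> (c \<odot>\<^sub>s carrier R)" using c idl_sum_upper(1)[OF L(1) cA[OF cc]] by blast
  moreover have "L <+> (c \<odot>\<^sub>s carrier R) \<subseteq> \<aa>" using L c by (intro idl_sum_least a elt_mult_carrier_least) auto
  ultimately show "\<aa> = L <+> (c \<odot>\<^sub>s carrier R)" using no add_ideals[OF L(1) cA[OF cc]] by blast
  fix y assume y: "y \<in> \<mm>"
  have yc: "y \<in> carrier R" using idl_carr[OF max_ideal y(1)] .
  show "y \<otimes> c \<in> L"
  proof (rule ccontr)
    assume n: "y \<otimes> c \<notin> L"
    have z: "y \<otimes> c \<in> carrier R" using yc cc by simp
    have "y \<otimes> c \<in> L <+> ((y \<otimes> c) \<odot>\<^sub>s carrier R)" using idl_sum_upper(2)[OF L(1) cA[OF z]] elt_mult_self[OF z] by blast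
    then have "L \<subset> L <+> ((y \<otimes> c) \<odot>\<^sub>s carrier R)" using n idl_sum_upper(1)[OF L(1) cA[OF z]] by blast
    moreover have "L <+> ((y \<otimes> c) \<odot>\<^sub>s carrier R) \<subseteq> \<aa>" using L c a yc
      by (intro idl_sum_least a elt_mult_carrier_least idl_lmult) auto
    ultimately have "c \<in> L <+> ((y \<otimes> c) \<odot>\<^sub>s carrier R)" using no add_ideals[OF L(1) cA[OF z]] c by blast
    then obtain l w where lw: "l \<in> L" "w \<in> (y \<otimes> c) \<odot>\<^sub>s carrier R" "c = l \<oplus> w" by (rule idl_sumE)
    obtain r where r: "r \<in> carrier R" "w = (y \<otimes> c) \<otimes> r" using lw(2) by (rule elt_multE)
    have lr: "l \<in> L" "r \<in> carrier R" "c = l \<oplus> (y \<otimes> c) \<otimes> r" using lw(1,3) r by simp_all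
    have lc: "l \<in> carrier R" using idl_carr[OF L(1) lr(1)] .
    have "l \<oplus> (y \<otimes> c) \<otimes> r \<ominus> (y \<otimes> r) \<otimes> c = l" using lc lr(2) yc cc by algebra
    then have "c \<ominus> (y \<otimes> r) \<otimes> c \<in> L" using lr(1) by (simp only: lr(3)[symmetric])
    then show False using colon_cancel[OF L(1) cc idl_rmult[OF max_ideal y lr(2)]] c by blast
  qed
qed

lemma len_max: "len R (carrier R) \<mm> \<le> 1"
  unfolding len_def
proof (rule chain_length_le)
  fix n C assume C: "\<forall>i\<le>n. C i \<in> {L. ideal L R \<and> \<mm> \<subseteq> L \<and> L \<subseteq> carrier R}" "\<forall>i<n. C i \<subset> C (Suc i)"
  show "enat n \<le> 1"
  proof (rule ccontr)
    assume "\<not> enat n \<le> 1"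
    then have n: "2 \<le> n" by (simp add: one_enat_def)
    have "C 0 \<subset> C 1" "C 1 \<subset> C 2" using C(2) n by (auto simp: numeral_2_eq_2)
    moreover have "C 1 = \<mm> \<or> C 1 = carrier R"
      using C(1) n maximalideal.I_maximal[OF max, of "C 1"] by simp
    moreover have "\<mm> \<subseteq> C 0" "C 2 \<subseteq> carrier R" using C(1) n by auto
    ultimately show False by blast
  qed
qed

text \<open>The quotient is cyclic and killed by \<open>\<mm>\<close>, hence an image of
  \<open>R/\<mm>\<close>.\<close>

lemma len_add_elt:
  assumes N: "ideal N R" and c: "c \<in> carrier R" "\<And>y. y \<in> \<mm> \<Longrightarrow> y \<otimes> c \<in> N"
  shows "len R (N <+> (c \<odot>\<^sub>s carrier R)) N \<le> 1"
proof -
  have cA: "ideal (c \<odot>\<^sub>s carrier R) R" using c by (intro principal_ideal)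
  have "len R ((c \<odot>\<^sub>s carrier R) <+> N) N = len R (carrier R) (carrier R \<inter> colon N c)"
    by (rule len_mult[OF oneideal N c(1)])
  also have "\<dots> \<le> len R (carrier R) \<mm>"
  proof (rule len_mono)
    show "\<mm> \<subseteq> carrier R \<inter> colon N c" using c idl_carr[OF max_ideal] by (auto simp: colon_def m_comm)
  qed simp
  finally show ?thesis using len_max idl_sum_comm[OF N cA] by simp
qed

lemma len_add_finite:
  assumes "finite X" "ideal N R" "X \<subseteq> carrier R" "\<And>x y. \<lbrakk>x \<in> X; y \<in> \<mm>\<rbrakk> \<Longrightarrow> y \<otimes> x \<in> N"
  shows "len R (N <+> Idl X) N \<noteq> \<infinity>"
  using assms
proof (induction X)
  case empty
  then have "N <+> {\<zero>} = N" using idl_sum_absorb[OF _ zeroideal, of N] idl_zero by simp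
  moreover have "len R N N = 0" using len_0_iff[of N N] empty by simp
  ultimately show ?case by (simp add: Idl_empty zero_enat_def)
next
  case (insert c X)
  note N = insert.prems(1)
  have c: "c \<in> carrier R" "X \<subseteq> carrier R" using insert.prems by auto
  have iX: "ideal (Idl X) R" using c by (intro genideal_ideal)
  have cA: "ideal (c \<odot>\<^sub>s carrier R) R" using c by (intro principal_ideal)
  have NX: "ideal (N <+> Idl X) R" by (intro add_ideals N iX)
  have e: "N <+> Idl (insert c X) = (N <+> Idl X) <+> (c \<odot>\<^sub>s carrier R)"
    unfolding Idl_insert[OF c(2,1)] using idl_sum_assoc[OF N iX cA] by simp
  have "len R ((N <+> Idl X) <+> (c \<odot>\<^sub>s carrier R)) N =
      len R ((N <+> Idl X) <+> (c \<odot>\<^sub>s carrier R)) (N <+> Idl X) + len R (N <+> Idl X) N"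
    by (intro len_add add_ideals NX cA N idl_sum_upper iX)
  moreover have "len R ((N <+> Idl X) <+> (c \<odot>\<^sub>s carrier R)) (N <+> Idl X) \<le> 1"
    using len_add_elt[OF NX c(1)] insert.prems(3) idl_sum_upper(1)[OF N iX] by blast
  moreover have "len R (N <+> Idl X) N \<noteq> \<infinity>" using insert c by auto
  ultimately show ?case unfolding e by (metis enat_ord_code(4) enat_ord_simps(4) infinity_ileE plus_eq_infty_iff_enat one_enat_def not_infinity_eq)
qed

text \<open>Each \<open>\<mm>^k/\<mm>^(k+1)\<close> is finitely generated and killed by
  \<open>\<mm>\<close>.\<close>

lemma len_max_pow_finite: "len R (carrier R) (ideal_pow R \<mm> k) \<noteq> \<infinity>"
proof (induction k)
  case 0
  then show ?case using len_0_iff[OF oneideal oneideal] by (simp add: idl_pow_0)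
next
  case (Suc k)
  have i: "ideal (ideal_pow R \<mm> k) R" for k by (rule idl_pow_ideal[OF max_ideal])
  obtain X where X: "X \<subseteq> carrier R" "finite X" "ideal_pow R \<mm> k = Idl X" by (rule noetherian_fg[OF noeth i])
  have XS: "X \<subseteq> ideal_pow R \<mm> k" unfolding X(3) by (rule genideal_self[OF X(1)])
  have sub: "ideal_pow R \<mm> (Suc k) \<subseteq> ideal_pow R \<mm> k" by (rule idl_pow_antimono[OF max_ideal]) simp
  have "len R (ideal_pow R \<mm> (Suc k) <+> Idl X) (ideal_pow R \<mm> (Suc k)) \<noteq> \<infinity>"
  proof (rule len_add_finite[OF X(2) i X(1)])
    fix x y assume xy: "x \<in> X" "y \<in> \<mm>"
    then have "x \<otimes> y \<in> ideal_pow R \<mm> (Suc k)" unfolding idl_pow_Suc using XS by (intro prod_in) auto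
    moreover have "x \<in> carrier R" "y \<in> carrier R" using xy X idl_carr[OF max_ideal] by auto
    ultimately show "y \<otimes> x \<in> ideal_pow R \<mm> (Suc k)" by (simp only: m_comm)
  qed
  moreover have "ideal_pow R \<mm> (Suc k) <+> Idl X = ideal_pow R \<mm> k"
    unfolding X(3)[symmetric] idl_sum_comm[OF i i] by (rule idl_sum_absorb[OF i i sub])
  ultimately have "len R (ideal_pow R \<mm> k) (ideal_pow R \<mm> (Suc k)) \<noteq> \<infinity>" by simp
  moreover have "len R (carrier R) (ideal_pow R \<mm> (Suc k)) =
      len R (carrier R) (ideal_pow R \<mm> k) + len R (ideal_pow R \<mm> k) (ideal_pow R \<mm> (Suc k))"
    by (rule len_add[OF oneideal i i sub idl_sub[OF i]])
  ultimately show ?case using Suc by (metis plus_eq_infty_iff_enat)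
qed

lemma len_finite:
  assumes "ideal_pow R \<mm> k \<subseteq> N" shows "len R (carrier R) N \<noteq> \<infinity>"
  using len_mono[OF assms, of "carrier R" "carrier R"] len_max_pow_finite[of k]
  by (cases "len R (carrier R) N") auto

end

sublocale local_resolution \<subseteq> noeth_local R \<mm>
  by (rule noeth_local.intro[OF is_cring noeth_local_axioms.intro[OF noeth max uniq]])

section \<open>From regular sequences to regular ideals; annihilators in a subquotient\<close>

context cring begin

lemma add_mults_carrier:
  assumes "ideal N R" "set xs \<subseteq> carrier R"
  shows "add_mults (carrier R) N xs = N <+> Idl (set xs)"
  using assms
proof (induction xs arbitrary: N)
  case Nil
  then show ?case using idl_sum_absorb[OF _ zeroideal, of N] idl_zero by (simp add: Idl_empty)
next
  case (Cons x xs)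
  then have x: "x \<in> carrier R" "set xs \<subseteq> carrier R" by auto
  have xA: "ideal (x \<odot>\<^sub>s carrier R) R" using x by (intro principal_ideal)
  have i: "ideal (Idl (set xs)) R" using x by (intro genideal_ideal)
  show ?case
    using Cons.IH[OF add_ideals[OF Cons.prems(1) xA] x(2)] idl_sum_assoc[OF Cons.prems(1) xA i]
      idl_sum_comm[OF xA i] Idl_insert[OF x(2,1)] by simp
qed

lemma zero_sum: "ideal I R \<Longrightarrow> {\<zero>} <+> I = I"
  using idl_sum_comm[OF zeroideal, of I] idl_sum_absorb[of I "{\<zero>}"] zeroideal idl_zero by simp

lemma regular_on_carrier_regular_ideal:
  assumes "set xs \<subseteq> carrier R" "regular_on (carrier R) {\<zero>} xs" "i \<le> length xs"
  shows "regular_ideal i (Idl (set (take i xs)))" "i < length xs \<Longrightarrow> regular_mod (Idl (set (take i xs))) (xs ! i)"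
proof -
  have reg: "regular_mod (Idl (set (take j xs))) (xs ! j)" if "j < length xs" for j
  proof -
    have tc: "set (take j xs) \<subseteq> carrier R" using assms(1) set_take_subset by fast
    have eq: "add_mults (carrier R) {\<zero>} (take j xs) = Idl (set (take j xs))"
      using add_mults_carrier[OF zeroideal tc] zero_sum[OF genideal_ideal[OF tc]] by simp
    have "xs ! j \<in> carrier R" using that assms(1) by auto
    moreover have "\<forall>u\<in>carrier R. xs ! j \<otimes> u \<in> add_mults (carrier R) {\<zero>} (take j xs) \<longrightarrow> u \<in> add_mults (carrier R) {\<zero>} (take j xs)"
      using assms(2) that unfolding regular_on_iff by blast
    ultimately show ?thesis unfolding regular_mod_def eq by blast
  qed
  then show "i < length xs \<Longrightarrow> regular_mod (Idl (set (take i xs))) (xs ! i)" .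
  show "regular_ideal i (Idl (set (take i xs)))"
    using assms(3)
  proof (induction i)
    case 0
    then show ?case using regular_ideal_0 by (simp add: Idl_empty)
  next
    case (Suc i)
    have tc: "set (take i xs) \<subseteq> carrier R" "xs ! i \<in> carrier R" using assms(1) set_take_subset Suc by (fast, auto)
    have "regular_ideal (Suc i) (Idl (set (take i xs)) <+> ((xs ! i) \<odot>\<^sub>s carrier R))"
      using regular_ideal_Suc[OF _ reg] Suc by simp
    then show ?case using Suc.prems Idl_insert[OF tc] by (simp add: take_Suc_conv_app_nth)
  qed
qed

text \<open>\<open>L\<close> is the last but one member of a longest chain; additivity forces both
  lengths.\<close>

lemma len_Suc_split:
  assumes b: "ideal \<bb> R" and a: "ideal \<aa> R" "\<bb> \<subseteq> \<aa>" and len: "len R \<aa> \<bb> = enat (Suc n)"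
  obtains L where "ideal L R" "\<bb> \<subseteq> L" "L \<subset> \<aa>" "len R L \<bb> = enat n" "len R \<aa> L \<le> 1"
proof -
  have "{L. ideal L R \<and> \<bb> \<subseteq> L \<and> L \<subseteq> \<aa>} \<noteq> {}" using b a by blast
  then obtain C where C: "\<forall>i\<le>Suc n. C i \<in> {L. ideal L R \<and> \<bb> \<subseteq> L \<and> L \<subseteq> \<aa>}" "\<forall>i<Suc n. C i \<subset> C (Suc i)"
    using chain_length_attained[OF len[unfolded len_def]] by blast
  define L where "L = C n"
  have "C n \<subset> C (Suc n)" "C (Suc n) \<subseteq> \<aa>" using C by blast+
  then have L: "ideal L R" "\<bb> \<subseteq> L" "L \<subset> \<aa>" using C(1) unfolding L_def by auto
  have l1: "enat n \<le> len R L \<bb>"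
    unfolding len_def
  proof (rule chain_length_ge[where N = C])
    show "\<forall>i<n. C i \<subset> C (Suc i)" using C(2) by simp
    then have "C i \<subseteq> L" if "i \<le> n" for i unfolding L_def using that by (rule chain_mono) simp
    then show "\<forall>i\<le>n. C i \<in> {X. ideal X R \<and> \<bb> \<subseteq> X \<and> X \<subseteq> L}" using C(1) by simp
  qed
  have "1 \<le> eSuc (len R L L)" by (simp add: one_eSuc)
  then have l2: "1 \<le> len R \<aa> L" using len_Suc[OF L(1) a(1) subset_refl L(3)] by (rule order_trans)
  have sum: "enat (Suc n) = len R \<aa> L + len R L \<bb>" using len_add[OF a(1) L(1) b L(2)] L(3) len by auto
  obtain p q where pq: "len R \<aa> L = enat p" "len R L \<bb> = enat q" using sum by (cases "len R \<aa> L"; cases "len R L \<bb>") auto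
  then have "q = n" "p = 1" using sum l1 l2 by (auto simp: one_enat_def)
  then have len1: "len R L \<bb> = enat n" "len R \<aa> L \<le> 1" using pq by (auto simp: one_enat_def)
  show ?thesis by (rule that[OF L len1])
qed

text \<open>The annihilator of \<open>\<aa>\<close> in \<open>I/N\<close>, pulled back to
  \<open>I\<close>; modulo \<open>N\<close> it is Hom of \<open>R/\<aa>\<close> into
  \<open>I/N\<close>.\<close>

definition ann :: "'a set \<Rightarrow> 'a set \<Rightarrow> 'a set \<Rightarrow> 'a set" where
  "ann I N \<aa> = {u \<in> I. \<forall>c\<in>\<aa>. c \<otimes> u \<in> N}"

lemma ann_ideal:
  assumes "ideal I R" "ideal N R" "\<aa> \<subseteq> carrier R"
  shows "ideal (ann I N \<aa>) R"
proof (rule idealI')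
  show "ann I N \<aa> \<subseteq> carrier R" using idl_sub[OF assms(1)] by (auto simp: ann_def)
  show "\<zero> \<in> ann I N \<aa>" using assms idl_zero by (auto simp: ann_def subset_iff)
  fix x y assume xy: "x \<in> ann I N \<aa>" "y \<in> ann I N \<aa>"
  have "c \<otimes> (x \<oplus> y) \<in> N" if c: "c \<in> \<aa>" for c
  proof -
    have "x \<in> carrier R" "y \<in> carrier R" "c \<in> carrier R" using xy c assms idl_carr[OF assms(1)] by (auto simp: ann_def)
    then have "c \<otimes> (x \<oplus> y) = c \<otimes> x \<oplus> c \<otimes> y" by (simp add: r_distr)
    then show ?thesis using xy c by (auto simp: ann_def intro: idl_add[OF assms(2)])
  qed
  then show "x \<oplus> y \<in> ann I N \<aa>" using xy idl_add[OF assms(1)] by (simp add: ann_def)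
next
  fix r x assume r: "r \<in> carrier R" and x: "x \<in> ann I N \<aa>"
  have "c \<otimes> (r \<otimes> x) \<in> N" if c: "c \<in> \<aa>" for c
  proof -
    have "x \<in> carrier R" "c \<in> carrier R" using x c assms idl_carr[OF assms(1)] by (auto simp: ann_def)
    then have "c \<otimes> (r \<otimes> x) = r \<otimes> (c \<otimes> x)" using r by (simp add: m_lcomm)
    then show ?thesis using x c r idl_lmult[OF assms(2)] by (simp add: ann_def)
  qed
  then show "r \<otimes> x \<in> ann I N \<aa>" using x r idl_lmult[OF assms(1)] by (simp add: ann_def)
qed

end

section \<open>Faithfulness of \<open>I/QI\<close> and the square of \<open>J\<close>\<close>

context noeth_local begin

text \<open>Half of Matlis duality: for a module with simple socle the length of Hom is bounded by
  the length of the argument. In a simple step \<open>\<aa> = L + cR\<close> with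
  \<open>\<mm>c \<subseteq> L\<close>, multiplication by \<open>c\<close> embeds the annihilator of
  \<open>L\<close> modulo that of \<open>\<aa>\<close> into the socle of \<open>I/N\<close>.\<close>

lemma len_ann_le:
  assumes I: "ideal I R" and N: "ideal N R" "N \<subseteq> I"
    and socle: "\<And>u w. \<lbrakk>u \<in> ann I N \<mm>; w \<in> ann I N \<mm>; u \<notin> N\<rbrakk> \<Longrightarrow> \<exists>r\<in>carrier R. w \<ominus> r \<otimes> u \<in> N"
    and b: "ideal \<bb> R" and a: "ideal \<aa> R" "\<bb> \<subseteq> \<aa>" and len: "len R \<aa> \<bb> = enat n"
  shows "len R (ann I N \<bb>) (ann I N \<aa>) \<le> enat n"
  using a len
proof (induction n arbitrary: \<aa>)
  case 0
  then have "\<aa> = \<bb>" using len_0_iff[OF 0(1) b 0(2)] by (simp add: zero_enat_def)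
  have i: "ideal (ann I N \<bb>) R" by (rule ann_ideal[OF I N(1) idl_sub[OF b]])
  then have "len R (ann I N \<bb>) (ann I N \<aa>) = 0" unfolding \<open>\<aa> = \<bb>\<close> using len_0_iff[OF i i] by simp
  then show ?case by simp
next
  case (Suc n)
  have an: "ideal (ann I N \<dd>) R" if "ideal \<dd> R" for \<dd> using ann_ideal[OF I N(1) idl_sub[OF that]] .
  obtain L where L: "ideal L R" "\<bb> \<subseteq> L" "L \<subset> \<aa>" and len1: "len R L \<bb> = enat n" "len R \<aa> L \<le> 1"
    using len_Suc_split[OF b Suc.prems] by blast
  obtain c where c: "c \<in> \<aa>" "c \<notin> L" using L by blast
  have cc: "c \<in> carrier R" using idl_carr[OF Suc.prems(1) c(1)] .
  note step = simple_step[OF Suc.prems(1) L(1) _ len1(2) c]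
  have aL: "\<aa> = L <+> (c \<odot>\<^sub>s carrier R)" and mc: "\<And>y. y \<in> \<mm> \<Longrightarrow> y \<otimes> c \<in> L" using step L(3) by auto
  have eq: "ann I N \<aa> = ann I N L \<inter> colon N c"
  proof
    show "ann I N \<aa> \<subseteq> ann I N L \<inter> colon N c" using L(3) c(1) idl_carr[OF I] by (auto simp: ann_def colon_def)
    show "ann I N L \<inter> colon N c \<subseteq> ann I N \<aa>"
    proof
      fix u assume u: "u \<in> ann I N L \<inter> colon N c"
      then have uc: "u \<in> carrier R" "c \<otimes> u \<in> N" "u \<in> I" by (auto simp: colon_def ann_def)
      have "x \<otimes> u \<in> N" if xa: "x \<in> \<aa>" for x
      proof -
        obtain l r where lr: "l \<in> L" "r \<in> carrier R" "x = l \<oplus> c \<otimes> r" using xa unfolding aL by (elim idl_sumE elt_multE) blast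
        have lc: "l \<in> carrier R" using idl_carr[OF L(1) lr(1)] .
        have "x \<otimes> u = l \<otimes> u \<oplus> r \<otimes> (c \<otimes> u)" unfolding lr(3) using lc lr(2) cc uc by algebra
        moreover have "l \<otimes> u \<in> N" using u lr by (auto simp: ann_def)
        ultimately show ?thesis using uc lr N by (simp add: idl_add idl_lmult)
      qed
      then show "u \<in> ann I N \<aa>" using uc by (simp add: ann_def)
    qed
  qed
  have cs: "c \<odot>\<^sub>s ann I N L \<subseteq> ann I N \<mm>"
  proof
    fix z assume "z \<in> c \<odot>\<^sub>s ann I N L"
    then obtain u where u: "u \<in> ann I N L" "z = c \<otimes> u" by (rule elt_multE)
    have uI: "u \<in> I" "u \<in> carrier R" using u idl_carr[OF I] by (auto simp: ann_def)
    have "y \<otimes> (c \<otimes> u) \<in> N" if y: "y \<in> \<mm>" for y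
    proof -
      have "y \<in> carrier R" using idl_carr[OF max_ideal y] .
      then have "y \<otimes> (c \<otimes> u) = (y \<otimes> c) \<otimes> u" using cc uI by (simp add: m_assoc)
      then show ?thesis using u mc[OF y] by (simp add: ann_def)
    qed
    then show "z \<in> ann I N \<mm>" using u uI cc idl_lmult[OF I] by (simp add: ann_def)
  qed
  have Nm: "N \<subseteq> ann I N \<mm>" using N idl_lmult[OF N(1)] idl_carr[OF max_ideal] by (auto simp: ann_def)
  have soc1: "len R (ann I N \<mm>) N \<le> 1"
    unfolding len_def
  proof (rule chain_length_le)
    fix k D assume D: "\<forall>i\<le>k. D i \<in> {L. ideal L R \<and> N \<subseteq> L \<and> L \<subseteq> ann I N \<mm>}" "\<forall>i<k. D i \<subset> D (Suc i)"
    show "enat k \<le> 1"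
    proof (rule ccontr)
      assume "\<not> enat k \<le> 1"
      then have k: "2 \<le> k" by (simp add: one_enat_def)
      have "D 0 \<subset> D 1" "D 1 \<subset> D 2" using D(2) k by (auto simp: numeral_2_eq_2)
      then obtain u w where uw: "u \<in> D 1" "u \<notin> D 0" "w \<in> D 2" "w \<notin> D 1" by blast
      have Di: "ideal (D 1) R" "N \<subseteq> D 0" "N \<subseteq> D 1" "D 1 \<subseteq> ann I N \<mm>" "D 2 \<subseteq> ann I N \<mm>" using D(1) k by auto
      obtain r where r: "r \<in> carrier R" "w \<ominus> r \<otimes> u \<in> N" using socle[of u w] uw Di by blast
      have "w \<in> carrier R" using uw Di idl_carr[OF I] by (auto simp: ann_def)
      then have "w \<in> D 1" using idl_diff_cancel[OF Di(1) _ idl_lmult[OF Di(1) uw(1) r(1)]] r Di by blast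
      then show False using uw by blast
    qed
  qed
  have "len R (ann I N L) (ann I N \<aa>) = len R ((c \<odot>\<^sub>s ann I N L) <+> N) N"
    unfolding eq by (rule len_mult[OF an[OF L(1)] N(1) cc, symmetric])
  also have "\<dots> \<le> len R (ann I N \<mm>) N"
    by (intro len_mono subset_refl idl_sum_least an[OF max_ideal] cs Nm)
  also have "\<dots> \<le> 1" by (rule soc1)
  finally have 1: "len R (ann I N L) (ann I N \<aa>) \<le> 1" .
  have sub: "ann I N \<aa> \<subseteq> ann I N L" "ann I N L \<subseteq> ann I N \<bb>" using L by (auto simp: ann_def)
  have "len R (ann I N \<bb>) (ann I N \<aa>) = len R (ann I N \<bb>) (ann I N L) + len R (ann I N L) (ann I N \<aa>)"
    by (rule len_add[OF an an an sub]) (use b L Suc.prems in auto)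
  also have "\<dots> \<le> enat n + 1" using Suc.IH[OF L(1,2) len1(1)] 1 by (rule add_mono)
  finally show ?case by (simp add: one_enat_def)
qed

text \<open>\<open>I/QI\<close> is a module with one-dimensional socle and of the same length as \<open>R/Q\<close>, so it is
  faithful over \<open>R/Q\<close>; this plays the role of the injective hull of the residue field.\<close>

lemma faithful_of_socle:
  assumes I: "ideal I R" and P: "ideal P R" and a: "regular_mod P a" "a \<in> I"
    and Q: "Q = P <+> (a \<odot>\<^sub>s carrier R)" "ideal_pow R \<mm> k \<subseteq> Q"
    and N: "ideal N R" "N = PI <+> (a \<odot>\<^sub>s I)" "ideal PI R" "PI \<subseteq> P \<inter> I" "P \<inter> I \<subseteq> PI"
    and QN: "\<And>q u. \<lbrakk>q \<in> Q; u \<in> I\<rbrakk> \<Longrightarrow> q \<otimes> u \<in> N"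
    and socle: "\<And>u w. \<lbrakk>u \<in> ann I N \<mm>; w \<in> ann I N \<mm>; u \<notin> N\<rbrakk> \<Longrightarrow> \<exists>r\<in>carrier R. w \<ominus> r \<otimes> u \<in> N"
    and y: "y \<in> carrier R" "\<And>u. u \<in> I \<Longrightarrow> y \<otimes> u \<in> N"
  shows "y \<in> Q"
proof -
  note ac = regular_mod_carrier[OF a(1)]
  have aA: "ideal (a \<odot>\<^sub>s carrier R) R" by (rule principal_ideal[OF ac])
  have aI: "ideal (a \<odot>\<^sub>s I) R" by (rule elt_mult_ideal[OF I ac])
  have iQ: "ideal Q R" unfolding Q by (intro add_ideals P aA)
  have NI: "N \<subseteq> I" unfolding N(2) using N(4) by (intro idl_sum_least I elt_mult_sub ac) auto
  define J where "J = I <+> P"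
  have iJ: "ideal J R" unfolding J_def by (intro add_ideals I P)
  \<comment> \<open>The length of \<open>R/W\<close> is counted in two ways: through
    \<open>J\<close>, with \<open>J/W\<close> isomorphic to \<open>I/N\<close>, and through
    \<open>Q\<close>, with \<open>Q/W\<close> isomorphic to \<open>R/J\<close> by multiplication by
    \<open>a\<close>. Hence \<open>I/N\<close> and \<open>R/Q\<close> have equal length.\<close>
  define W where "W = P <+> (a \<odot>\<^sub>s I)"
  have iW: "ideal W R" unfolding W_def by (intro add_ideals P aI)
  have WQ: "W \<subseteq> Q" unfolding W_def Q(1) by (intro idl_sum_mono subset_refl elt_mult_mono idl_sub I)
  have WJ: "W \<subseteq> J" unfolding W_def J_def
    using idl_sum_upper[OF I P] elt_mult_sub[OF I ac] by (intro idl_sum_least add_ideals I P) auto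
  have QJ: "Q \<subseteq> J" unfolding Q(1) J_def
    using idl_sum_upper[OF I P] a(2) by (intro idl_sum_least add_ideals I P elt_mult_carrier_least) auto
  have IW: "I \<inter> W = N"
  proof
    show "N \<subseteq> I \<inter> W" using NI unfolding N(2) W_def using N(4) by (auto intro: idl_sum_mono[THEN subsetD])
    show "I \<inter> W \<subseteq> N"
    proof
      fix x assume x: "x \<in> I \<inter> W"
      then obtain p u where pu: "p \<in> P" "u \<in> I" "x = p \<oplus> a \<otimes> u" unfolding W_def by (elim IntE idl_sumE elt_multE) blast
      have "a \<otimes> u \<in> I" using idl_lmult[OF I pu(2) ac] .
      then have "p \<in> I" using idl_add_cancel[OF I, of p "a \<otimes> u"] x pu idl_carr[OF P] by blast
      then have "p \<in> PI" using N(5) pu by blast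
      then show "x \<in> N" unfolding N(2) pu(3) using pu by (intro idl_sumI elt_multI)
    qed
  qed
  have IWJ: "I <+> W = J"
  proof
    show "I <+> W \<subseteq> J" using WJ idl_sum_upper(1)[OF I P] unfolding J_def by (intro idl_sum_least add_ideals I P) auto
    show "J \<subseteq> I <+> W" unfolding J_def W_def using idl_sum_upper(1)[OF P aI] by (intro idl_sum_mono) auto
  qed
  have l1: "len R J W = len R I N" using len_sum[OF I iW] IWJ IW by simp
  have l2: "len R Q W = len R (carrier R) J"
  proof -
    have "(a \<odot>\<^sub>s carrier R) <+> W = Q"
    proof
      show "(a \<odot>\<^sub>s carrier R) <+> W \<subseteq> Q" using idl_sum_upper(2)[OF P aA] WQ unfolding Q(1)
        by (intro idl_sum_least add_ideals P aA) auto
      show "Q \<subseteq> (a \<odot>\<^sub>s carrier R) <+> W" unfolding Q(1) idl_sum_comm[OF P aA] W_def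
        using idl_sum_upper(1)[OF P aI] by (intro idl_sum_mono) auto
    qed
    moreover have "carrier R \<inter> colon W a = J"
    proof
      show "carrier R \<inter> colon W a \<subseteq> J"
      proof
        fix x assume "x \<in> carrier R \<inter> colon W a"
        then have x: "x \<in> carrier R" "a \<otimes> x \<in> W" by (auto simp: colon_def)
        then obtain p u where pu: "p \<in> P" "u \<in> I" "a \<otimes> x = p \<oplus> a \<otimes> u" unfolding W_def by (elim idl_sumE elt_multE) blast
        have c: "p \<in> carrier R" "u \<in> carrier R" using pu idl_carr P I by blast+
        have "a \<otimes> (x \<ominus> u) = (p \<oplus> a \<otimes> u) \<ominus> a \<otimes> u" unfolding pu(3)[symmetric] using x c ac by algebra
        also have "\<dots> = p" using c ac by algebra
        finally have "x \<ominus> u \<in> P" using regular_modD[OF a(1)] pu c x by simp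
        then have "u \<oplus> (x \<ominus> u) \<in> J" unfolding J_def using pu by (intro idl_sumI)
        also have "u \<oplus> (x \<ominus> u) = x" using c x by algebra
        finally show "x \<in> J" .
      qed
      show "J \<subseteq> carrier R \<inter> colon W a"
      proof
        fix x assume "x \<in> J"
        then obtain u p where up: "u \<in> I" "p \<in> P" "x = u \<oplus> p" unfolding J_def by (rule idl_sumE)
        have c: "p \<in> carrier R" "u \<in> carrier R" using up idl_carr P I by blast+
        have "a \<otimes> x = a \<otimes> p \<oplus> a \<otimes> u" unfolding up(3) using c ac by algebra
        also have "\<dots> \<in> W" unfolding W_def using up idl_lmult[OF P up(2) ac] by (intro idl_sumI elt_multI)
        finally show "x \<in> carrier R \<inter> colon W a" using c up by (simp add: colon_def)
      qed
    qed
    ultimately show ?thesis using len_mult[OF oneideal iW ac] by simp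
  qed
  have fin: "len R (carrier R) Q \<noteq> \<infinity>" using len_finite[OF Q(2)] .
  have finJ: "len R (carrier R) J \<noteq> \<infinity>"
    using len_mono[OF QJ, of "carrier R" "carrier R"] fin by (cases "len R (carrier R) J") auto
  have "len R (carrier R) W = len R (carrier R) J + len R J W" by (rule len_add[OF oneideal iJ iW WJ idl_sub[OF iJ]])
  moreover have "len R (carrier R) W = len R (carrier R) Q + len R Q W" by (rule len_add[OF oneideal iQ iW WQ idl_sub[OF iQ]])
  ultimately have lIN: "len R I N = len R (carrier R) Q" unfolding l1 l2 using finJ by (metis add.commute enat_add_left_cancel)
  \<comment> \<open>\<open>B\<close> kills \<open>I/N\<close> since \<open>Q\<close> and
    \<open>y\<close> do. The annihilator of \<open>B\<close> is therefore all of \<open>I/N\<close>,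
    which has the length of \<open>R/Q\<close>, while the bound allows only the length of
    \<open>R/B\<close>.\<close>
  define B where "B = Q <+> (y \<odot>\<^sub>s carrier R)"
  have yA: "ideal (y \<odot>\<^sub>s carrier R) R" by (rule principal_ideal[OF y(1)])
  have iB: "ideal B R" unfolding B_def by (intro add_ideals iQ yA)
  have QB: "Q \<subseteq> B" and yB: "y \<in> B" unfolding B_def using idl_sum_upper[OF iQ yA] elt_mult_self[OF y(1)] by auto
  have annB: "ann I N B = I"
  proof -
    have "c \<otimes> u \<in> N" if cu: "c \<in> B" "u \<in> I" for c u
    proof -
      obtain q r where qr: "q \<in> Q" "r \<in> carrier R" "c = q \<oplus> y \<otimes> r" using cu(1) unfolding B_def by (elim idl_sumE elt_multE) blast
      have "u \<in> carrier R" "q \<in> carrier R" using idl_carr I iQ that qr by blast+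
      then have "c \<otimes> u = q \<otimes> u \<oplus> r \<otimes> (y \<otimes> u)" unfolding qr(3) using y(1) qr(2) by algebra
      then show ?thesis using QN[OF qr(1) that(2)] y(2)[OF that(2)] qr N(1) by (simp add: idl_add idl_lmult)
    qed
    then show ?thesis by (auto simp: ann_def)
  qed
  have annA: "ann I N (carrier R) = N"
  proof
    show "ann I N (carrier R) \<subseteq> N"
    proof
      fix u assume u: "u \<in> ann I N (carrier R)"
      then have "\<one> \<otimes> u \<in> N" by (auto simp: ann_def)
      moreover have "u \<in> carrier R" using u idl_carr[OF I] by (auto simp: ann_def)
      ultimately show "u \<in> N" by simp
    qed
    show "N \<subseteq> ann I N (carrier R)" using NI idl_lmult[OF N(1)] by (auto simp: ann_def)
  qed
  have finB: "len R (carrier R) B \<noteq> \<infinity>"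
    using len_mono[OF QB, of "carrier R" "carrier R"] fin by (cases "len R (carrier R) B") auto
  then obtain n where n: "len R (carrier R) B = enat n" by auto
  have "len R (ann I N B) (ann I N (carrier R)) \<le> enat n"
    by (rule len_ann_le[OF I N(1) NI socle iB oneideal idl_sub[OF iB] n])
  then have "len R (carrier R) Q \<le> len R (carrier R) B" unfolding annB annA lIN n .
  moreover have "len R (carrier R) Q = len R (carrier R) B + len R B Q" by (rule len_add[OF oneideal iB iQ QB idl_sub[OF iB]])
  ultimately have "len R B Q = 0" using finB by (cases "len R (carrier R) B"; cases "len R B Q") (auto simp: zero_enat_def)
  then have "B = Q" using len_0_iff[OF iB iQ QB] by simp
  then show ?thesis using yB by simp
qed

text \<open>Modulo \<open>QJ\<close> a product of two elements of \<open>J\<close> reduces to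
  \<open>i i'\<close> with \<open>i, i' \<in> I\<close>. It lies in
  \<open>I\<^sup>2 \<subseteq> Q = P + aR\<close>, and its component in \<open>P\<close> also lies
  in \<open>I\<close>, hence in \<open>P \<inter> I \<subseteq> PI \<subseteq> QJ\<close>; so only a
  multiple of \<open>a\<close> remains.\<close>

lemma square_decomposition:
  assumes I: "ideal I R" and P: "ideal P R" and a: "a \<in> carrier R" "a \<in> I" and Q: "Q = P <+> (a \<odot>\<^sub>s carrier R)"
    and J: "J = I <+> Q" and J3: "ideal_pow R J 3 \<subseteq> Q \<cdot> ideal_pow R J 2"
    and PI: "ideal PI R" "P \<inter> I \<subseteq> PI" "PI \<subseteq> Q \<cdot> J"
    and faith: "\<And>y. \<lbrakk>y \<in> carrier R; \<And>u. u \<in> I \<Longrightarrow> y \<otimes> u \<in> PI <+> (a \<odot>\<^sub>s I)\<rbrakk> \<Longrightarrow> y \<in> Q"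
  shows "ideal_pow R J 2 = (a \<odot>\<^sub>s colon (ideal_pow R J 2) a) <+> (Q \<cdot> J)" "J \<subseteq> colon (ideal_pow R J 2) a"
proof -
  have aA: "ideal (a \<odot>\<^sub>s carrier R) R" by (rule principal_ideal[OF a(1)])
  have iQ: "ideal Q R" unfolding Q by (intro add_ideals P aA)
  have iJ: "ideal J R" unfolding J by (intro add_ideals I iQ)
  have IJ: "I \<subseteq> J" "Q \<subseteq> J" unfolding J using idl_sum_upper[OF I iQ] by auto
  have PQ: "P \<subseteq> Q" unfolding Q using idl_sum_upper[OF P aA] by auto
  have J2: "ideal_pow R J 2 = J \<cdot> J" by (simp add: numeral_2_eq_2 idl_pow_0 carrier_prod iJ)
  have J3': "ideal_pow R J 3 = (J \<cdot> J) \<cdot> J" by (simp add: numeral_3_eq_3 idl_pow_0 carrier_prod iJ)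
  have II: "ideal (I \<cdot> I) R" by (rule ideal_prod_is_ideal[OF I I])
  have QJi: "ideal (Q \<cdot> J) R" by (rule ideal_prod_is_ideal[OF iQ iJ])
  have JJi: "ideal (J \<cdot> J) R" by (rule ideal_prod_is_ideal[OF iJ iJ])
  have JIP: "J \<subseteq> I <+> P" unfolding J Q
    using idl_sum_upper[OF I P] a by (intro idl_sum_least add_ideals I P elt_mult_carrier_least) auto
  have J2sub: "J \<cdot> J \<subseteq> (I \<cdot> I) <+> P"
  proof (rule idl_prod_least)
    show "ideal ((I \<cdot> I) <+> P) R" by (intro add_ideals II P)
    fix x y assume "x \<in> J" "y \<in> J"
    then have xy: "x \<in> I <+> P" "y \<in> I <+> P" using JIP by auto
    obtain i p where ip1: "i \<in> I" "p \<in> P" "x = i \<oplus> p" using xy(1) by (rule idl_sumE)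
    obtain i' p' where ip2: "i' \<in> I" "p' \<in> P" "y = i' \<oplus> p'" using xy(2) by (rule idl_sumE)
    note ip = ip1 ip2
    have c: "i \<in> carrier R" "p \<in> carrier R" "i' \<in> carrier R" "p' \<in> carrier R" using ip idl_carr I P by blast+
    have "x \<otimes> y = i \<otimes> i' \<oplus> (p \<otimes> (i' \<oplus> p') \<oplus> i \<otimes> p')" unfolding ip using c by algebra
    moreover have "p \<otimes> (i' \<oplus> p') \<oplus> i \<otimes> p' \<in> P" using ip c P by (simp add: idl_add idl_lmult idl_rmult)
    ultimately show "x \<otimes> y \<in> (I \<cdot> I) <+> P" using ip by (simp add: idl_sumI prod_in)
  qed
  \<comment> \<open>Modulo \<open>P\<close> the ideal \<open>Q\<close> reduces to \<open>aR\<close>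
    and \<open>J\<^sup>2\<close> to \<open>I\<^sup>2\<close>.\<close>
  have QJ2: "Q \<cdot> (J \<cdot> J) \<subseteq> (a \<odot>\<^sub>s (I \<cdot> I)) <+> P"
  proof (rule idl_prod_least)
    show "ideal ((a \<odot>\<^sub>s (I \<cdot> I)) <+> P) R" by (intro add_ideals elt_mult_ideal II P a)
    fix x y assume xy: "x \<in> Q" "y \<in> J \<cdot> J"
    obtain p r where ip1: "p \<in> P" "r \<in> carrier R" "x = p \<oplus> a \<otimes> r"
      using xy(1) unfolding Q by (elim idl_sumE elt_multE) blast
    have "y \<in> (I \<cdot> I) <+> P" using xy(2) J2sub by blast
    then obtain t p' where ip2: "t \<in> I \<cdot> I" "p' \<in> P" "y = t \<oplus> p'" by (rule idl_sumE)
    note ip = ip1 ip2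
    have c: "p \<in> carrier R" "t \<in> carrier R" "p' \<in> carrier R" using ip idl_carr II P by blast+
    have "x \<otimes> y = a \<otimes> (r \<otimes> t) \<oplus> (p \<otimes> (t \<oplus> p') \<oplus> (a \<otimes> r) \<otimes> p')" unfolding ip using c a(1) ip(2) by algebra
    moreover have "p \<otimes> (t \<oplus> p') \<oplus> (a \<otimes> r) \<otimes> p' \<in> P" using ip c P a by (simp add: idl_add idl_lmult idl_rmult)
    moreover have "r \<otimes> t \<in> I \<cdot> I" using ip II by (intro idl_lmult)
    ultimately show "x \<otimes> y \<in> (a \<odot>\<^sub>s (I \<cdot> I)) <+> P" by (simp add: idl_sumI elt_multI)
  qed
  have II_Q: "I \<cdot> I \<subseteq> Q"
  proof (rule idl_prod_least[OF iQ])
    fix x y assume xy: "x \<in> I" "y \<in> I"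
    have c: "x \<in> carrier R" "y \<in> carrier R" using xy idl_carr I by blast+
    show "x \<otimes> y \<in> Q"
    proof (rule faith)
      fix u assume u: "u \<in> I"
      have "(x \<otimes> y) \<otimes> u \<in> (J \<cdot> J) \<cdot> J" using xy u IJ by (intro prod_in) auto
      then have "(x \<otimes> y) \<otimes> u \<in> (a \<odot>\<^sub>s (I \<cdot> I)) <+> P" using J3 QJ2 unfolding J2 J3' by blast
      then obtain t p where tp: "t \<in> I \<cdot> I" "p \<in> P" "(x \<otimes> y) \<otimes> u = a \<otimes> t \<oplus> p" by (elim idl_sumE elt_multE) blast
      have tI: "t \<in> I" using tp idl_prod_sub(1)[OF I I] by blast
      have cc: "t \<in> carrier R" "p \<in> carrier R" "u \<in> carrier R" using tI tp u idl_carr I P by blast+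
      have "(x \<otimes> y) \<otimes> u \<in> I" using u c by (intro idl_lmult[OF I]) auto
      then have "p \<oplus> a \<otimes> t \<in> I" unfolding tp(3) using cc a by (simp add: a_comm)
      then have "p \<in> I" using idl_add_cancel[OF I _ idl_lmult[OF I tI a(1)]] cc by blast
      then have "p \<in> PI" using PI tp by blast
      then have "p \<oplus> a \<otimes> t \<in> PI <+> (a \<odot>\<^sub>s I)" using tI by (intro idl_sumI elt_multI)
      then show "(x \<otimes> y) \<otimes> u \<in> PI <+> (a \<odot>\<^sub>s I)" unfolding tp(3) using cc a by (simp add: a_comm)
    qed (use c in simp)
  qed
  have QJJ: "Q \<cdot> J \<subseteq> J \<cdot> J" using IJ by (intro idl_prod_mono) auto
  have J2Q: "J \<cdot> J \<subseteq> (a \<odot>\<^sub>s carrier R) <+> (Q \<cdot> J)"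
  proof (rule idl_prod_least)
    show K: "ideal ((a \<odot>\<^sub>s carrier R) <+> (Q \<cdot> J)) R" by (intro add_ideals aA QJi)
    fix x y assume xy: "x \<in> J" "y \<in> J"
    obtain i q where ip1: "i \<in> I" "q \<in> Q" "x = i \<oplus> q" using xy(1) unfolding J by (rule idl_sumE)
    obtain i' q' where ip2: "i' \<in> I" "q' \<in> Q" "y = i' \<oplus> q'" using xy(2) unfolding J by (rule idl_sumE)
    note ip = ip1 ip2
    have c: "i \<in> carrier R" "q \<in> carrier R" "i' \<in> carrier R" "q' \<in> carrier R" "y \<in> carrier R" using ip xy idl_carr I iQ iJ by blast+
    have "i \<otimes> i' \<in> Q" using II_Q ip by (blast intro: prod_in)
    then obtain p r where pr: "p \<in> P" "r \<in> carrier R" "i \<otimes> i' = p \<oplus> a \<otimes> r" unfolding Q by (elim idl_sumE elt_multE) blast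
    have pc: "p \<in> carrier R" using pr idl_carr P by blast
    have "i \<otimes> i' \<in> I" using ip c by (intro idl_rmult[OF I])
    then have "p \<in> I" using idl_add_cancel[OF I, of p "a \<otimes> r"] idl_rmult[OF I a(2) pr(2)] pr pc by simp
    then have pQ: "p \<in> Q \<cdot> J" using PI pr by blast
    have "x \<otimes> y = i \<otimes> i' \<oplus> (q \<otimes> y \<oplus> q' \<otimes> i)" unfolding ip using c by algebra
    also have "\<dots> = a \<otimes> r \<oplus> (p \<oplus> (q \<otimes> y \<oplus> q' \<otimes> i))" unfolding pr(3) using c pc pr(2) a(1) by algebra
    also have "\<dots> \<in> (a \<odot>\<^sub>s carrier R) <+> (Q \<cdot> J)"
      using pQ pr ip xy IJ by (intro idl_sumI elt_multI idl_add[OF QJi] prod_in) auto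
    finally show "x \<otimes> y \<in> (a \<odot>\<^sub>s carrier R) <+> (Q \<cdot> J)" .
  qed
  let ?B = "colon (ideal_pow R J 2) a"
  show "J \<subseteq> ?B"
  proof
    fix x assume x: "x \<in> J"
    then have "a \<otimes> x \<in> J \<cdot> J" using a IJ by (intro prod_in) auto
    then show "x \<in> ?B" unfolding J2 colon_def using x idl_carr[OF iJ] by blast
  qed
  show "ideal_pow R J 2 = (a \<odot>\<^sub>s ?B) <+> (Q \<cdot> J)"
    unfolding J2
  proof
    show "(a \<odot>\<^sub>s colon (J \<cdot> J) a) <+> (Q \<cdot> J) \<subseteq> J \<cdot> J"
      by (intro idl_sum_least JJi QJJ) (auto simp: colon_def elim!: elt_multE)
    show "J \<cdot> J \<subseteq> (a \<odot>\<^sub>s colon (J \<cdot> J) a) <+> (Q \<cdot> J)"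
    proof
      fix x assume x: "x \<in> J \<cdot> J"
      obtain r w where rw: "r \<in> carrier R" "w \<in> Q \<cdot> J" "x = a \<otimes> r \<oplus> w"
        using subsetD[OF J2Q x] by (elim idl_sumE elt_multE) blast
      then have "a \<otimes> r \<in> J \<cdot> J" using idl_add_cancel[OF JJi, of "a \<otimes> r" w] x QJJ a by blast
      then have "r \<in> colon (J \<cdot> J) a" using rw by (simp add: colon_def)
      then show "x \<in> (a \<odot>\<^sub>s colon (J \<cdot> J) a) <+> (Q \<cdot> J)" unfolding rw(3) using rw by (intro idl_sumI elt_multI)
    qed
  qed
qed

end

theorem sharp_parameter_structure:
  fixes A (structure)
  assumes cm: "cohen_macaulay_local A \<mm>" and dim: "krull_dim A = enat (Suc e)"
    and can: "canonical_module A \<mm> K" "canonical_ideal A K I"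
    and sharp: "sharp A \<mm> I Q" and J: "J = I <+> Q"
    and J3: "ideal_pow A J 3 \<subseteq> Q \<cdot> ideal_pow A J 2"
  obtains P a k where "noeth_local A \<mm>" "cring.regular_ideal A e P" "cring.regular_mod A P a"
    "Q = P <+> (cring.elt_mult A a (carrier A))" "ideal_pow A \<mm> k \<subseteq> Q" "Q \<subseteq> \<mm>" "ideal I A" "a \<in> I"
    "ideal_pow A J 2 = cring.elt_mult A a (cring.colon A (ideal_pow A J 2) a) <+> (Q \<cdot> J)"
    "J \<subseteq> cring.colon A (ideal_pow A J 2) a"
proof -
  obtain b d \<gamma> where r: "local_resolution A \<mm> b d \<gamma>"
    and v: "residue_resolution.vanish A b d (Suc e) (carrier A) {\<zero>}"
    "residue_resolution.vanish A b d (Suc e) I {\<zero>}"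
    "residue_resolution.onedim A b d (Suc e) I {\<zero>}"
    using canonical_ideal_cohomology[OF cm dim can] by blast
  interpret local_resolution A \<mm> b d \<gamma> by (rule r)
  have I: "ideal I A" using can by (simp add: canonical_ideal_def)
  obtain as k where as: "set as \<subseteq> \<mm>" "length as = Suc e" "ideal_pow A \<mm> k \<subseteq> Idl (set as)" "Q = Idl (set as)" "hd as \<in> I" "as \<noteq> []"
    using sharp dim by (auto simp: sharp_def system_of_parameters_def)
  \<comment> \<open>The parameter lying in \<open>I\<close> is moved to the end, the one place that
    \<open>system_of_parameters_regular\<close> leaves unchanged.\<close>
  define ys where "ys = tl as @ [hd as]"
  have ys: "set ys = set as" "length ys = Suc e" "last ys = hd as" "ys \<noteq> []"
    using as unfolding ys_def by (auto simp: neq_Nil_conv)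
  have asc: "set as \<subseteq> carrier A" using as(1) idl_sub[OF m] by blast
  have z: "ideal {\<zero>} A" "{\<zero>} \<subseteq> carrier A" "{\<zero>} \<subseteq> I" using zeroideal idl_zero[OF I] by auto
  have zm: "w \<otimes> u \<in> {\<zero>}" if "w \<in> {\<zero>}" "u \<in> M" "ideal M A" for w u M using that idl_carr by auto
  obtain zs where zs: "length zs = length ys" "set zs \<subseteq> \<mm>" "regular_on (carrier A) {\<zero>} zs" "regular_on I {\<zero>} zs"
    "{\<zero>} <+> Idl (set zs) = {\<zero>} <+> Idl (set ys)" "last zs = last ys"
    using system_of_parameters_regular[OF oneideal z(1,2) _ zm[OF _ _ oneideal] I z(1,3) _ zm[OF _ _ I] z(1), of ys k]
      v as ys zero_sum[OF genideal_ideal[OF asc]] by auto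
  have zsc: "set zs \<subseteq> carrier A" using zs(2) idl_sub[OF m] by blast
  define ps where "ps = butlast zs"
  define a where "a = hd as"
  have zne: "zs \<noteq> []" using zs(1) ys by auto
  have zsp: "zs = ps @ [a]" unfolding ps_def a_def using zne zs(6) ys(3) append_butlast_last_id by metis
  have lp: "length ps = e" using zs(1) ys(2) zsp by simp
  have psc: "set ps \<subseteq> carrier A" and ac: "a \<in> carrier A" using zsc zsp by auto
  have aI: "a \<in> I" using as a_def by simp
  define P where "P = Idl (set ps)"
  have iP: "ideal P A" unfolding P_def by (rule genideal_ideal[OF psc])
  have tk: "take e zs = ps" "zs ! e = a" unfolding zsp using lp by auto
  have rP: "regular_ideal e P" "regular_mod P a"
    using regular_on_carrier_regular_ideal[OF zsc zs(3), of e] zs(1) ys(2) unfolding tk P_def by auto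
  have Qz: "Q = Idl (set zs)"
    using zs(5) zero_sum[OF genideal_ideal[OF zsc]] zero_sum[OF genideal_ideal[OF asc]] ys(1) as(4) by simp
  have Q: "Q = P <+> (elt_mult a (carrier A))" unfolding Qz P_def using Idl_insert[OF psc ac] zsp by simp
  have Qm: "Q \<subseteq> \<mm>" unfolding as(4) using as(1) by (intro genideal_minimal m)
  define PI where "PI = add_mults I {\<zero>} ps"
  have PI: "ideal PI A" "PI \<subseteq> I" unfolding PI_def using add_mults_ideal[OF I z(1,3) psc] by auto
  have PIP: "PI \<subseteq> P" unfolding PI_def P_def
  proof (rule add_mults_least)
    show "ideal (Idl (set ps)) A" by (rule genideal_ideal[OF psc])
    then show "{\<zero>} \<subseteq> Idl (set ps)" using idl_zero by simp
    show "x \<otimes> u \<in> Idl (set ps)" if "x \<in> set ps" "u \<in> I" for x u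
      using that genideal_self[OF psc] idl_carr[OF I] \<open>ideal (Idl (set ps)) A\<close> by (blast intro: idl_rmult)
  qed
  have regI: "u \<in> PI" if "u \<in> I" "a \<otimes> u \<in> PI" for u
    using zs(4) that lp tk zs(1) ys(2) unfolding regular_on_iff PI_def by (metis lessI)
  \<comment> \<open>For \<open>x \<in> P \<inter> I\<close> the product \<open>a x\<close> lies in
    \<open>aP \<subseteq> PI\<close> because \<open>a \<in> I\<close>, and \<open>a\<close> is
    regular on \<open>I/PI\<close>.\<close>
  have PI2: "P \<inter> I \<subseteq> PI"
  proof
    fix x assume x: "x \<in> P \<inter> I"
    have "P \<subseteq> colon PI a" unfolding P_def
    proof (rule genideal_minimal[OF colon_ideal[OF PI(1) ac]])
      show "set ps \<subseteq> colon PI a"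
      proof
        fix p assume p: "p \<in> set ps"
        then have pc: "p \<in> carrier A" using psc by blast
        have "p \<otimes> a \<in> PI" unfolding PI_def by (rule add_mults_mem[OF I z(1,3) psc p aI])
        then show "p \<in> colon PI a" using pc ac by (simp add: colon_def m_comm)
      qed
    qed
    then show "x \<in> PI" using x regI by (auto simp: colon_def)
  qed
  define N where "N = add_mults I {\<zero>} zs"
  have N: "ideal N A" unfolding N_def using add_mults_ideal[OF I z(1,3) zsc] by auto
  have app: "add_mults I M (xs @ [x]) = add_mults I M xs <+> (elt_mult x I)" for M xs x by (induction xs arbitrary: M) auto
  have Ne: "N = PI <+> (elt_mult a I)" unfolding N_def zsp app PI_def ..
  have QN: "q \<otimes> u \<in> N" if "q \<in> Q" "u \<in> I" for q u
  proof -
    have uc: "u \<in> carrier A" using idl_carr[OF I that(2)] .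
    have "Q \<subseteq> colon N u" unfolding Qz
    proof (rule genideal_minimal[OF colon_ideal[OF N uc]])
      show "set zs \<subseteq> colon N u"
      proof
        fix x assume x: "x \<in> set zs"
        have "x \<otimes> u \<in> N" unfolding N_def by (rule add_mults_mem[OF I z(1,3) zsc x that(2)])
        then show "x \<in> colon N u" using x zsc uc by (auto simp: colon_def m_comm)
      qed
    qed
    then show ?thesis using that uc by (auto simp: colon_def m_comm)
  qed
  have od: "onedim 0 I N" unfolding N_def
    using onedim_regular[OF I z(1,3) zs(2,4)] v(3) zs(1) ys(2) by simp
  have soc: "\<exists>r\<in>carrier A. w \<ominus> r \<otimes> u \<in> N" if "u \<in> ann I N \<mm>" "w \<in> ann I N \<mm>" "u \<notin> N" for u w
    using onedim_socle[OF I N od, of u w] that by (auto simp: ann_def)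
  have kQ: "ideal_pow A \<mm> k \<subseteq> Q" using as by simp
  have PIPI: "PI \<subseteq> P \<inter> I" using PI PIP by blast
  have faith: "y \<in> Q" if "y \<in> carrier A" "\<And>u. u \<in> I \<Longrightarrow> y \<otimes> u \<in> PI <+> (elt_mult a I)" for y
    by (rule faithful_of_socle[OF I iP rP(2) aI Q kQ N Ne PI(1) PIPI PI2 QN soc that(1)])
      (use that(2) Ne in simp_all)
  have iQ: "ideal Q A" unfolding as(4) by (rule genideal_ideal[OF asc])
  have PIQJ: "PI \<subseteq> Q \<cdot> J" unfolding PI_def
  proof (rule add_mults_least)
    have iJ: "ideal J A" unfolding J by (intro add_ideals I iQ)
    show QJ: "ideal (Q \<cdot> J) A" by (rule ideal_prod_is_ideal[OF iQ iJ])
    show "{\<zero>} \<subseteq> Q \<cdot> J" using idl_zero[OF QJ] by simp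
    have "set ps \<subseteq> Q" using genideal_self[OF zsc] zsp unfolding Qz by auto
    then show "x \<otimes> u \<in> Q \<cdot> J" if "x \<in> set ps" "u \<in> I" for x u
      using that idl_sum_upper(1)[OF I iQ] unfolding J by (intro prod_in) auto
  qed
  note dec = square_decomposition[OF I iP ac aI Q J J3 PI(1) PI2 PIQJ faith]
  show ?thesis
    by (rule that[OF noeth_local_axioms rP Q kQ Qm I aI dec])
qed

section \<open>Submodules of a localized module\<close>

locale localized_module = module +
  fixes S :: "'a set"
  assumes S_sub: "S \<subseteq> carrier R" and S_one: "\<one> \<in> S" and S_mult: "\<lbrakk>s \<in> S; t \<in> S\<rbrakk> \<Longrightarrow> s \<otimes> t \<in> S"
begin

lemma S_carr: "s \<in> S \<Longrightarrow> s \<in> carrier R"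
  using S_sub by blast

abbreviation frac where "frac \<equiv> loc_frac R S M"

lemma loc_rel_iff:
  "((x, s), (y, t)) \<in> loc_rel R S M \<longleftrightarrow> x \<in> carrier M \<and> y \<in> carrier M \<and> s \<in> S \<and> t \<in> S \<and>
     (\<exists>u\<in>S. (u \<otimes> t) \<odot>\<^bsub>M\<^esub> x = (u \<otimes> s) \<odot>\<^bsub>M\<^esub> y)"
  unfolding loc_rel_def by (auto simp: smult_assoc1 S_carr)

text \<open>The multiplier \<open>u v t\<close> combines the two witnesses with the middle
  denominator, which may be a zerodivisor.\<close>

lemma loc_rel_trans_aux:
  assumes "x \<in> carrier M" "y \<in> carrier M" "z \<in> carrier M" "s \<in> S" "t \<in> S" "r \<in> S" "u \<in> S" "v \<in> S"
    "(u \<otimes> t) \<odot>\<^bsub>M\<^esub> x = (u \<otimes> s) \<odot>\<^bsub>M\<^esub> y" "(v \<otimes> r) \<odot>\<^bsub>M\<^esub> y = (v \<otimes> t) \<odot>\<^bsub>M\<^esub> z"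
  shows "((u \<otimes> v \<otimes> t) \<otimes> r) \<odot>\<^bsub>M\<^esub> x = ((u \<otimes> v \<otimes> t) \<otimes> s) \<odot>\<^bsub>M\<^esub> z"
proof -
  note c = assms(1-3) S_carr[OF assms(4)] S_carr[OF assms(5)] S_carr[OF assms(6)] S_carr[OF assms(7)] S_carr[OF assms(8)]
  have "((u \<otimes> v \<otimes> t) \<otimes> r) \<odot>\<^bsub>M\<^esub> x = (v \<otimes> r) \<odot>\<^bsub>M\<^esub> ((u \<otimes> t) \<odot>\<^bsub>M\<^esub> x)"
    using c by (simp add: smult_assoc1[symmetric] R.m_ac)
  also have "\<dots> = (u \<otimes> s) \<odot>\<^bsub>M\<^esub> ((v \<otimes> r) \<odot>\<^bsub>M\<^esub> y)"
    unfolding assms(9) using c by (simp add: smult_assoc1[symmetric] R.m_ac)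
  also have "\<dots> = ((u \<otimes> v \<otimes> t) \<otimes> s) \<odot>\<^bsub>M\<^esub> z"
    unfolding assms(10) using c by (simp add: smult_assoc1[symmetric] R.m_ac)
  finally show ?thesis .
qed

lemma loc_rel_equiv: "equiv (carrier M \<times> S) (loc_rel R S M)"
proof (rule equivI)
  show "loc_rel R S M \<subseteq> (carrier M \<times> S) \<times> (carrier M \<times> S)" by (auto simp: loc_rel_def)
  show "refl_on (carrier M \<times> S) (loc_rel R S M)"
    by (rule refl_onI) (use S_one in \<open>auto simp: loc_rel_iff\<close>)
  show "sym (loc_rel R S M)"
  proof (rule symI)
    fix p q assume "(p, q) \<in> loc_rel R S M"
    then show "(q, p) \<in> loc_rel R S M" by (cases p; cases q) (auto simp: loc_rel_iff intro: sym)
  qed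
  show "trans (loc_rel R S M)"
  proof (rule transI)
    fix p q w assume pq: "(p, q) \<in> loc_rel R S M" and qw: "(q, w) \<in> loc_rel R S M"
    obtain x s y t z r where e: "p = (x, s)" "q = (y, t)" "w = (z, r)" by (cases p; cases q; cases w)
    from pq qw obtain u v where uv: "x \<in> carrier M" "y \<in> carrier M" "z \<in> carrier M" "s \<in> S" "t \<in> S" "r \<in> S" "u \<in> S" "v \<in> S"
      "(u \<otimes> t) \<odot>\<^bsub>M\<^esub> x = (u \<otimes> s) \<odot>\<^bsub>M\<^esub> y" "(v \<otimes> r) \<odot>\<^bsub>M\<^esub> y = (v \<otimes> t) \<odot>\<^bsub>M\<^esub> z"
      unfolding e loc_rel_iff by blast
    have "u \<otimes> v \<otimes> t \<in> S" using uv by (intro S_mult)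
    then show "(p, w) \<in> loc_rel R S M" unfolding e loc_rel_iff using loc_rel_trans_aux[OF uv] uv by blast
  qed
qed

lemma frac_eq_iff:
  assumes "x \<in> carrier M" "y \<in> carrier M" "s \<in> S" "t \<in> S"
  shows "frac x s = frac y t \<longleftrightarrow> (\<exists>u\<in>S. (u \<otimes> t) \<odot>\<^bsub>M\<^esub> x = (u \<otimes> s) \<odot>\<^bsub>M\<^esub> y)"
  unfolding loc_frac_def using eq_equiv_class_iff[OF loc_rel_equiv, of "(x, s)" "(y, t)"] assms
  by (simp add: loc_rel_iff)

lemma frac_mem: "(y, t) \<in> frac x s \<longleftrightarrow> ((x, s), (y, t)) \<in> loc_rel R S M"
  by (auto simp: loc_frac_def)

lemma frac_self: "\<lbrakk>x \<in> carrier M; s \<in> S\<rbrakk> \<Longrightarrow> (x, s) \<in> frac x s"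
  unfolding frac_mem loc_rel_iff using S_one by blast

lemma frac_memD:
  assumes "(y, t) \<in> frac x s"
  shows "x \<in> carrier M" "y \<in> carrier M" "s \<in> S" "t \<in> S" "frac y t = frac x s"
proof -
  show c: "x \<in> carrier M" "y \<in> carrier M" "s \<in> S" "t \<in> S" using assms by (auto simp: frac_mem loc_rel_iff)
  show "frac y t = frac x s" using assms equiv_class_eq[OF loc_rel_equiv] unfolding frac_mem loc_frac_def by blast
qed

lemma frac_cancel:
  assumes "x \<in> carrier M" "s \<in> S" "t \<in> S" shows "frac (t \<odot>\<^bsub>M\<^esub> x) (s \<otimes> t) = frac x s"
  using frac_eq_iff[of "t \<odot>\<^bsub>M\<^esub> x" x "s \<otimes> t" s] assms S_carr[OF assms(2)] S_carr[OF assms(3)] S_one S_mult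
  by (auto simp: smult_assoc1[symmetric] intro!: bexI[of _ \<one>])

lemma loc_module_carrier: "carrier (loc_module R S M) = {frac x s |x s. x \<in> carrier M \<and> s \<in> S}"
  unfolding loc_module_def Let_def loc_frac_def quotient_def by auto

lemma loc_module_zero: "\<zero>\<^bsub>loc_module R S M\<^esub> = frac \<zero>\<^bsub>M\<^esub> \<one>"
  by (simp add: loc_module_def Let_def)

lemma frac_add_cong:
  assumes "frac x s = frac x' s'" "frac y t = frac y' t'" "x \<in> carrier M" "x' \<in> carrier M" "y \<in> carrier M" "y' \<in> carrier M"
    "s \<in> S" "s' \<in> S" "t \<in> S" "t' \<in> S"
  shows "frac (t \<odot>\<^bsub>M\<^esub> x \<oplus>\<^bsub>M\<^esub> s \<odot>\<^bsub>M\<^esub> y) (s \<otimes> t) = frac (t' \<odot>\<^bsub>M\<^esub> x' \<oplus>\<^bsub>M\<^esub> s' \<odot>\<^bsub>M\<^esub> y') (s' \<otimes> t')"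
proof -
  obtain u where u: "u \<in> S" "(u \<otimes> s') \<odot>\<^bsub>M\<^esub> x = (u \<otimes> s) \<odot>\<^bsub>M\<^esub> x'" using assms frac_eq_iff by blast
  obtain v where v: "v \<in> S" "(v \<otimes> t') \<odot>\<^bsub>M\<^esub> y = (v \<otimes> t) \<odot>\<^bsub>M\<^esub> y'" using assms frac_eq_iff by blast
  note sc = S_carr[OF assms(7)] S_carr[OF assms(8)] S_carr[OF assms(9)] S_carr[OF assms(10)] S_carr[OF u(1)] S_carr[OF v(1)]
  note c = assms(3-6) sc
  have 1: "(u \<otimes> v \<otimes> (s' \<otimes> t') \<otimes> t) \<odot>\<^bsub>M\<^esub> x = (u \<otimes> v \<otimes> (s \<otimes> t) \<otimes> t') \<odot>\<^bsub>M\<^esub> x'"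
  proof -
    have "(u \<otimes> v \<otimes> (s' \<otimes> t') \<otimes> t) \<odot>\<^bsub>M\<^esub> x = (v \<otimes> t \<otimes> t') \<odot>\<^bsub>M\<^esub> ((u \<otimes> s') \<odot>\<^bsub>M\<^esub> x)"
      using c by (simp add: smult_assoc1[symmetric] R.m_ac)
    also have "\<dots> = (u \<otimes> v \<otimes> (s \<otimes> t) \<otimes> t') \<odot>\<^bsub>M\<^esub> x'" unfolding u(2) using c by (simp add: smult_assoc1[symmetric] R.m_ac)
    finally show ?thesis .
  qed
  have 2: "(u \<otimes> v \<otimes> (s' \<otimes> t') \<otimes> s) \<odot>\<^bsub>M\<^esub> y = (u \<otimes> v \<otimes> (s \<otimes> t) \<otimes> s') \<odot>\<^bsub>M\<^esub> y'"
  proof -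
    have "(u \<otimes> v \<otimes> (s' \<otimes> t') \<otimes> s) \<odot>\<^bsub>M\<^esub> y = (u \<otimes> s \<otimes> s') \<odot>\<^bsub>M\<^esub> ((v \<otimes> t') \<odot>\<^bsub>M\<^esub> y)"
      using c by (simp add: smult_assoc1[symmetric] R.m_ac)
    also have "\<dots> = (u \<otimes> v \<otimes> (s \<otimes> t) \<otimes> s') \<odot>\<^bsub>M\<^esub> y'" unfolding v(2) using c by (simp add: smult_assoc1[symmetric] R.m_ac)
    finally show ?thesis .
  qed
  have "(u \<otimes> v \<otimes> (s' \<otimes> t')) \<odot>\<^bsub>M\<^esub> (t \<odot>\<^bsub>M\<^esub> x \<oplus>\<^bsub>M\<^esub> s \<odot>\<^bsub>M\<^esub> y) =
      (u \<otimes> v \<otimes> (s' \<otimes> t') \<otimes> t) \<odot>\<^bsub>M\<^esub> x \<oplus>\<^bsub>M\<^esub> (u \<otimes> v \<otimes> (s' \<otimes> t') \<otimes> s) \<odot>\<^bsub>M\<^esub> y"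
    using c by (simp add: smult_r_distr smult_assoc1[symmetric])
  also have "\<dots> = (u \<otimes> v \<otimes> (s \<otimes> t)) \<odot>\<^bsub>M\<^esub> (t' \<odot>\<^bsub>M\<^esub> x' \<oplus>\<^bsub>M\<^esub> s' \<odot>\<^bsub>M\<^esub> y')"
    unfolding 1 2 using c by (simp add: smult_r_distr smult_assoc1[symmetric])
  finally show ?thesis
    using frac_eq_iff[of "t \<odot>\<^bsub>M\<^esub> x \<oplus>\<^bsub>M\<^esub> s \<odot>\<^bsub>M\<^esub> y" "t' \<odot>\<^bsub>M\<^esub> x' \<oplus>\<^bsub>M\<^esub> s' \<odot>\<^bsub>M\<^esub> y'" "s \<otimes> t" "s' \<otimes> t'"]
      c S_mult[OF u(1) v(1)] S_mult[OF assms(7,9)] S_mult[OF assms(8,10)] by auto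
qed

lemma loc_module_add:
  assumes "x \<in> carrier M" "y \<in> carrier M" "s \<in> S" "t \<in> S"
  shows "frac x s \<oplus>\<^bsub>loc_module R S M\<^esub> frac y t = frac (t \<odot>\<^bsub>M\<^esub> x \<oplus>\<^bsub>M\<^esub> s \<odot>\<^bsub>M\<^esub> y) (s \<otimes> t)"
proof -
  have "(case p of (x', s') \<Rightarrow> \<Union>(y', t')\<in>frac y t. frac (t' \<odot>\<^bsub>M\<^esub> x' \<oplus>\<^bsub>M\<^esub> s' \<odot>\<^bsub>M\<^esub> y') (s' \<otimes> t')) =
      frac (t \<odot>\<^bsub>M\<^esub> x \<oplus>\<^bsub>M\<^esub> s \<odot>\<^bsub>M\<^esub> y) (s \<otimes> t)" if p: "p \<in> frac x s" for p
  proof -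
    obtain x' s' where e: "p = (x', s')" by (cases p)
    note xs = frac_memD[OF p[unfolded e]]
    have "(case q of (y', t') \<Rightarrow> frac (t' \<odot>\<^bsub>M\<^esub> x' \<oplus>\<^bsub>M\<^esub> s' \<odot>\<^bsub>M\<^esub> y') (s' \<otimes> t')) =
        frac (t \<odot>\<^bsub>M\<^esub> x \<oplus>\<^bsub>M\<^esub> s \<odot>\<^bsub>M\<^esub> y) (s \<otimes> t)" if q: "q \<in> frac y t" for q
    proof -
      obtain y' t' where e: "q = (y', t')" by (cases q)
      note yt = frac_memD[OF q[unfolded e]]
      show ?thesis unfolding e prod.case
        by (rule frac_add_cong[OF xs(5) yt(5) xs(2,1) yt(2,1) xs(4,3) yt(4,3)])
    qed
    then show ?thesis unfolding e prod.case by (intro SUP_eq_const) (use frac_self[OF assms(2,4)] in blast)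
  qed
  then have "(\<Union>p\<in>frac x s. case p of (x', s') \<Rightarrow> \<Union>(y', t')\<in>frac y t. frac (t' \<odot>\<^bsub>M\<^esub> x' \<oplus>\<^bsub>M\<^esub> s' \<odot>\<^bsub>M\<^esub> y') (s' \<otimes> t')) =
      frac (t \<odot>\<^bsub>M\<^esub> x \<oplus>\<^bsub>M\<^esub> s \<odot>\<^bsub>M\<^esub> y) (s \<otimes> t)"
    by (intro SUP_eq_const) (use frac_self[OF assms(1,3)] in blast)
  then show ?thesis by (simp add: loc_module_def Let_def)
qed

lemma ring_localized: "localized_module R (ring_module R) S"
  by (intro localized_module.intro R.ring_module_module localized_module_axioms.intro S_sub S_one S_mult)

lemma loc_ring_carrier: "carrier (loc_ring R S) = {loc_frac R S (ring_module R) a s |a s. a \<in> carrier R \<and> s \<in> S}"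
  unfolding loc_ring_def Let_def loc_frac_def quotient_def by auto

lemma loc_module_smult:
  assumes "a \<in> carrier R" "s \<in> S" "y \<in> carrier M" "t \<in> S"
  shows "loc_frac R S (ring_module R) a s \<odot>\<^bsub>loc_module R S M\<^esub> frac y t = frac (a \<odot>\<^bsub>M\<^esub> y) (s \<otimes> t)"
proof -
  interpret L: localized_module R "ring_module R" S by (rule ring_localized)
  have "(case p of (a', s') \<Rightarrow> \<Union>(y', t')\<in>frac y t. frac (a' \<odot>\<^bsub>M\<^esub> y') (s' \<otimes> t')) = frac (a \<odot>\<^bsub>M\<^esub> y) (s \<otimes> t)"
    if p: "p \<in> L.frac a s" for p
  proof -
    obtain a' s' where e: "p = (a', s')" by (cases p)
    note as = L.frac_memD[OF p[unfolded e]]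
    have a'c: "a' \<in> carrier R" using as(2) by simp
    have "(case q of (y', t') \<Rightarrow> frac (a' \<odot>\<^bsub>M\<^esub> y') (s' \<otimes> t')) = frac (a \<odot>\<^bsub>M\<^esub> y) (s \<otimes> t)" if q: "q \<in> frac y t" for q
    proof -
      obtain y' t' where e: "q = (y', t')" by (cases q)
      note yt = frac_memD[OF q[unfolded e]]
      obtain u where u: "u \<in> S" "u \<otimes> s \<otimes> a' = u \<otimes> s' \<otimes> a"
        using as(5) L.frac_eq_iff[OF as(2) as(1) as(4) as(3)] by auto
      obtain v where v: "v \<in> S" "(v \<otimes> t) \<odot>\<^bsub>M\<^esub> y' = (v \<otimes> t') \<odot>\<^bsub>M\<^esub> y"
        using yt(5) frac_eq_iff[OF yt(2) yt(1) yt(4) yt(3)] by auto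
      note c = a'c assms(1) yt(1,2) S_carr[OF as(3)] S_carr[OF as(4)] S_carr[OF yt(3)] S_carr[OF yt(4)] S_carr[OF u(1)] S_carr[OF v(1)]
      have "(u \<otimes> v \<otimes> (s \<otimes> t)) \<odot>\<^bsub>M\<^esub> (a' \<odot>\<^bsub>M\<^esub> y') = (u \<otimes> s \<otimes> a') \<odot>\<^bsub>M\<^esub> ((v \<otimes> t) \<odot>\<^bsub>M\<^esub> y')"
        using c by (simp add: smult_assoc1[symmetric] R.m_ac)
      also have "\<dots> = (u \<otimes> v \<otimes> (s' \<otimes> t')) \<odot>\<^bsub>M\<^esub> (a \<odot>\<^bsub>M\<^esub> y)"
        unfolding u(2) v(2) using c by (simp add: smult_assoc1[symmetric] R.m_ac)
      finally show ?thesis unfolding e prod.case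
        using frac_eq_iff[of "a' \<odot>\<^bsub>M\<^esub> y'" "a \<odot>\<^bsub>M\<^esub> y" "s' \<otimes> t'" "s \<otimes> t"] c S_mult[OF u(1) v(1)]
          S_mult[OF as(3) yt(3)] S_mult[OF as(4) yt(4)] by auto
    qed
    then show ?thesis unfolding e prod.case by (intro SUP_eq_const) (use frac_self[OF assms(3,4)] in blast)
  qed
  then have "(\<Union>p\<in>L.frac a s. case p of (a', s') \<Rightarrow> \<Union>(y', t')\<in>frac y t. frac (a' \<odot>\<^bsub>M\<^esub> y') (s' \<otimes> t')) = frac (a \<odot>\<^bsub>M\<^esub> y) (s \<otimes> t)"
    by (intro SUP_eq_const) (use L.frac_self[of a s] assms in auto)
  then show ?thesis by (simp add: loc_module_def Let_def)
qed

text \<open>A submodule is saturated when it is the contraction of its extension, so these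
  correspond to the submodules of the localized module.\<close>

definition saturated :: "'c set \<Rightarrow> bool" where
  "saturated Z \<longleftrightarrow> (\<forall>s\<in>S. \<forall>x\<in>carrier M. s \<odot>\<^bsub>M\<^esub> x \<in> Z \<longrightarrow> x \<in> Z)"

text \<open>\<open>submodule\<close> asks for closure under the inverse of the additive monoid. That
  the localized structure is a group has not been shown, so the description behind
  \<open>m_inv\<close> is evaluated directly.\<close>

lemma loc_inverse:
  assumes x: "x \<in> carrier M" and s: "s \<in> S"
  shows "m_inv (add_monoid (loc_module R S M)) (frac x s) = frac (\<ominus>\<^bsub>M\<^esub> x) s"
  unfolding m_inv_def
proof (rule the_equality)
  let ?L = "loc_module R S M"
  note sc = S_carr[OF s]
  have z: "frac \<zero>\<^bsub>M\<^esub> (s \<otimes> s) = frac \<zero>\<^bsub>M\<^esub> \<one>"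
    using frac_eq_iff[of "\<zero>\<^bsub>M\<^esub>" "\<zero>\<^bsub>M\<^esub>" "s \<otimes> s" \<one>] s sc S_one S_mult[OF s s] by (auto intro!: bexI[of _ \<one>])
  have 1: "s \<odot>\<^bsub>M\<^esub> x \<oplus>\<^bsub>M\<^esub> s \<odot>\<^bsub>M\<^esub> (\<ominus>\<^bsub>M\<^esub> x) = \<zero>\<^bsub>M\<^esub>" "s \<odot>\<^bsub>M\<^esub> (\<ominus>\<^bsub>M\<^esub> x) \<oplus>\<^bsub>M\<^esub> s \<odot>\<^bsub>M\<^esub> x = \<zero>\<^bsub>M\<^esub>"
    using x sc by (simp_all add: smult_r_minus M.r_neg M.l_neg)
  show "frac (\<ominus>\<^bsub>M\<^esub> x) s \<in> carrier (add_monoid ?L) \<and>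
      frac x s \<otimes>\<^bsub>add_monoid ?L\<^esub> frac (\<ominus>\<^bsub>M\<^esub> x) s = \<one>\<^bsub>add_monoid ?L\<^esub> \<and>
      frac (\<ominus>\<^bsub>M\<^esub> x) s \<otimes>\<^bsub>add_monoid ?L\<^esub> frac x s = \<one>\<^bsub>add_monoid ?L\<^esub>"
    using x s z 1 loc_module_add[of x "\<ominus>\<^bsub>M\<^esub> x" s s] loc_module_add[of "\<ominus>\<^bsub>M\<^esub> x" x s s]
    by (auto simp: loc_module_carrier loc_module_zero)
  fix w assume w: "w \<in> carrier (add_monoid ?L) \<and> frac x s \<otimes>\<^bsub>add_monoid ?L\<^esub> w = \<one>\<^bsub>add_monoid ?L\<^esub> \<and>
      w \<otimes>\<^bsub>add_monoid ?L\<^esub> frac x s = \<one>\<^bsub>add_monoid ?L\<^esub>"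
  then obtain y t where y: "y \<in> carrier M" "t \<in> S" "w = frac y t" by (auto simp: loc_module_carrier)
  note tc = S_carr[OF y(2)]
  have "frac (t \<odot>\<^bsub>M\<^esub> x \<oplus>\<^bsub>M\<^esub> s \<odot>\<^bsub>M\<^esub> y) (s \<otimes> t) = frac \<zero>\<^bsub>M\<^esub> \<one>"
    using w loc_module_add[OF x y(1) s y(2)] unfolding y(3) by (simp add: loc_module_zero)
  then obtain u where u: "u \<in> S" "(u \<otimes> \<one>) \<odot>\<^bsub>M\<^esub> (t \<odot>\<^bsub>M\<^esub> x \<oplus>\<^bsub>M\<^esub> s \<odot>\<^bsub>M\<^esub> y) = (u \<otimes> (s \<otimes> t)) \<odot>\<^bsub>M\<^esub> \<zero>\<^bsub>M\<^esub>"
    using frac_eq_iff[of "t \<odot>\<^bsub>M\<^esub> x \<oplus>\<^bsub>M\<^esub> s \<odot>\<^bsub>M\<^esub> y" "\<zero>\<^bsub>M\<^esub>" "s \<otimes> t" \<one>] x y s sc tc S_one S_mult[OF s y(2)] by auto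
  note uc = S_carr[OF u(1)]
  have "(u \<otimes> t) \<odot>\<^bsub>M\<^esub> x \<oplus>\<^bsub>M\<^esub> (u \<otimes> s) \<odot>\<^bsub>M\<^esub> y = \<zero>\<^bsub>M\<^esub>"
    using u(2) uc sc tc x y by (simp add: smult_r_distr smult_assoc1[symmetric])
  then have "(u \<otimes> s) \<odot>\<^bsub>M\<^esub> y = \<ominus>\<^bsub>M\<^esub> ((u \<otimes> t) \<odot>\<^bsub>M\<^esub> x)"
    using uc sc tc x y by (intro M.minus_equality[symmetric]) (simp_all add: M.a_comm)
  also have "\<dots> = (u \<otimes> t) \<odot>\<^bsub>M\<^esub> (\<ominus>\<^bsub>M\<^esub> x)" using uc tc x by (simp add: smult_r_minus)
  finally show "w = frac (\<ominus>\<^bsub>M\<^esub> x) s" unfolding y(3)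
    using frac_eq_iff[OF y(1) _ y(2) s, of "\<ominus>\<^bsub>M\<^esub> x"] x u(1) by auto
qed

text \<open>Denominators can be multiplied in and out by scalars of the localized ring, so
  membership of \<open>frac x s\<close> does not depend on \<open>s\<close>; saturation is the same
  fact read in \<open>M\<close>.\<close>

lemma loc_submodule_contract:
  assumes W: "submodule W (loc_ring R S) (loc_module R S M)"
  shows "submodule {x \<in> carrier M. frac x \<one> \<in> W} R M" (is "submodule ?Z R M") "saturated {x \<in> carrier M. frac x \<one> \<in> W}"
    "\<And>x s. \<lbrakk>x \<in> carrier M; s \<in> S\<rbrakk> \<Longrightarrow> frac x s \<in> W \<longleftrightarrow> x \<in> {x \<in> carrier M. frac x \<one> \<in> W}"
proof -
  let ?L = "loc_module R S M"
  have Wadd: "a \<oplus>\<^bsub>?L\<^esub> b \<in> W" if "a \<in> W" "b \<in> W" for a b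
    using subgroup.m_closed[OF submodule.axioms(1)[OF W] that] by simp
  have Wz: "frac \<zero>\<^bsub>M\<^esub> \<one> \<in> W" using subgroup.one_closed[OF submodule.axioms(1)[OF W]] by (simp add: loc_module_zero)
  have Ws: "frac (a \<odot>\<^bsub>M\<^esub> x) (s \<otimes> t) \<in> W" if "a \<in> carrier R" "s \<in> S" "x \<in> carrier M" "t \<in> S" "frac x t \<in> W" for a s x t
    using submodule.smult_closed[OF W, of "loc_frac R S (ring_module R) a s" "frac x t"] that loc_module_smult[OF that(1-4)]
    by (auto simp: loc_ring_carrier)
  show "submodule ?Z R M"
  proof (rule submoduleI')
    show "\<zero>\<^bsub>M\<^esub> \<in> ?Z" using Wz by simp
    show "a \<oplus>\<^bsub>M\<^esub> b \<in> ?Z" if "a \<in> ?Z" "b \<in> ?Z" for a b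
      using that Wadd[of "frac a \<one>" "frac b \<one>"] loc_module_add[of a b \<one> \<one>] S_one by simp
    show "a \<odot>\<^bsub>M\<^esub> x \<in> ?Z" if "a \<in> carrier R" "x \<in> ?Z" for a x
      using that Ws[of a \<one> x \<one>] S_one by simp
  qed auto
  show iff: "frac x s \<in> W \<longleftrightarrow> x \<in> ?Z" if x: "x \<in> carrier M" and s: "s \<in> S" for x s
  proof
    show "x \<in> ?Z" if "frac x s \<in> W"
      using Ws[of s \<one> x s] frac_cancel[of x \<one> s] that x s S_carr S_one by simp
    show "frac x s \<in> W" if "x \<in> ?Z"
      using Ws[of \<one> s x \<one>] that x s S_carr S_one by simp
  qed
  show "saturated ?Z"
    unfolding saturated_def
  proof (intro ballI impI)
    fix s x assume s: "s \<in> S" and x: "x \<in> carrier M" and sx: "s \<odot>\<^bsub>M\<^esub> x \<in> ?Z"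
    then have "frac (\<one> \<odot>\<^bsub>M\<^esub> (s \<odot>\<^bsub>M\<^esub> x)) (s \<otimes> \<one>) \<in> W" using Ws[of \<one> s "s \<odot>\<^bsub>M\<^esub> x" \<one>] S_one S_carr by simp
    then show "x \<in> ?Z" using frac_cancel[of x \<one> s] s x S_one S_carr[OF s] by simp
  qed
qed

lemma loc_submodule_extend:
  assumes Z: "submodule Z R M"
  shows "submodule {frac x s |x s. x \<in> Z \<and> s \<in> S} (loc_ring R S) (loc_module R S M)" (is "submodule ?W _ ?L")
proof (intro submodule.intro subgroup.intro submodule_axioms.intro)
  note c = submodule_carr[OF Z]
  show "?W \<subseteq> carrier (add_monoid ?L)" using c by (auto simp: loc_module_carrier)
  show "\<one>\<^bsub>add_monoid ?L\<^esub> \<in> ?W" using submodule_zero[OF Z] S_one by (auto simp: loc_module_zero)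
  fix a assume "a \<in> ?W"
  then obtain x s where x: "x \<in> Z" "s \<in> S" "a = frac x s" by blast
  show "inv\<^bsub>add_monoid ?L\<^esub> a \<in> ?W" unfolding x(3) loc_inverse[OF c[OF x(1)] x(2)] using x submoduleE(3)[OF Z] by blast
  { fix b assume "b \<in> ?W"
    then obtain y t where y: "y \<in> Z" "t \<in> S" "b = frac y t" by blast
    have "t \<odot>\<^bsub>M\<^esub> x \<oplus>\<^bsub>M\<^esub> s \<odot>\<^bsub>M\<^esub> y \<in> Z" using x y S_carr by (intro submoduleE(4,5)[OF Z]) auto
    then show "a \<otimes>\<^bsub>add_monoid ?L\<^esub> b \<in> ?W"
      using loc_module_add[OF c[OF x(1)] c[OF y(1)] x(2) y(2)] S_mult[OF x(2) y(2)] x(3) y(3) by auto }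
  { fix r assume "r \<in> carrier (loc_ring R S)"
    then obtain p u where p: "p \<in> carrier R" "u \<in> S" "r = loc_frac R S (ring_module R) p u" by (auto simp: loc_ring_carrier)
    show "r \<odot>\<^bsub>?L\<^esub> a \<in> ?W"
      using loc_module_smult[OF p(1,2) c[OF x(1)] x(2)] submoduleE(4)[OF Z p(1) x(1)] S_mult[OF p(2) x(2)] x(3) p(3) by auto }
qed

theorem length_localization:
  "module_length (loc_ring R S) (loc_module R S M) = chain_length {Z. submodule Z R M \<and> saturated Z}"
  unfolding module_length_eq_chain_length
proof (rule antisym)
  let ?L = "loc_module R S M"
  let ?c = "\<lambda>W. {x \<in> carrier M. frac x \<one> \<in> W}"
  show "chain_length {W. submodule W (loc_ring R S) ?L} \<le> chain_length {Z. submodule Z R M \<and> saturated Z}"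
  proof (rule chain_length_mono_map[where f = ?c])
    show "?c W \<in> {Z. submodule Z R M \<and> saturated Z}" if "W \<in> {W. submodule W (loc_ring R S) ?L}" for W
      using loc_submodule_contract[of W] that by simp
    fix V W assume V: "V \<in> {W. submodule W (loc_ring R S) ?L}" and W: "W \<in> {W. submodule W (loc_ring R S) ?L}" and VW: "V \<subset> W"
    then obtain w where w: "w \<in> W" "w \<notin> V" by blast
    have "w \<in> carrier ?L" using subgroup.subset[OF submodule.axioms(1)] W w by force
    then obtain x s where x: "x \<in> carrier M" "s \<in> S" "w = frac x s" by (auto simp: loc_module_carrier)
    have "x \<in> ?c W" "x \<notin> ?c V" using w loc_submodule_contract(3)[of W x s] loc_submodule_contract(3)[of V x s] V W x by auto
    moreover have "?c V \<subseteq> ?c W" using VW by blast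
    ultimately show "?c V \<subset> ?c W" by blast
  qed
  let ?e = "\<lambda>Z. {frac x s |x s. x \<in> Z \<and> s \<in> S}"
  show "chain_length {Z. submodule Z R M \<and> saturated Z} \<le> chain_length {W. submodule W (loc_ring R S) ?L}"
  proof (rule chain_length_mono_map[where f = ?e])
    show "?e Z \<in> {W. submodule W (loc_ring R S) ?L}" if "Z \<in> {Z. submodule Z R M \<and> saturated Z}" for Z
      using loc_submodule_extend that by simp
    fix Y Z assume Y: "Y \<in> {Z. submodule Z R M \<and> saturated Z}" and Z: "Z \<in> {Z. submodule Z R M \<and> saturated Z}" and YZ: "Y \<subset> Z"
    then obtain z where z: "z \<in> Z" "z \<notin> Y" by blast
    have zc: "z \<in> carrier M" using z Z submodule_carr by blast
    have "frac z \<one> \<notin> ?e Y"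
    proof
      assume "frac z \<one> \<in> ?e Y"
      then obtain x s where x: "x \<in> Y" "s \<in> S" "frac z \<one> = frac x s" by blast
      have xc: "x \<in> carrier M" using x Y submodule_carr by blast
      obtain u where u: "u \<in> S" "(u \<otimes> s) \<odot>\<^bsub>M\<^esub> z = (u \<otimes> \<one>) \<odot>\<^bsub>M\<^esub> x" using x(3) frac_eq_iff[OF zc xc S_one x(2)] by blast
      have "(u \<otimes> \<one>) \<odot>\<^bsub>M\<^esub> x \<in> Y" using submoduleE(4)[of Y] Y x u S_carr by simp
      then have "(u \<otimes> s) \<odot>\<^bsub>M\<^esub> z \<in> Y" using u by simp
      then have "z \<in> Y" using Y zc S_mult[OF u(1) x(2)] unfolding saturated_def by blast
      then show False using z by blast
    qed
    moreover have "frac z \<one> \<in> ?e Z" using z S_one by blast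
    moreover have "?e Y \<subseteq> ?e Z" using YZ by blast
    ultimately show "?e Y \<subset> ?e Z" by blast
  qed
qed

end

lemma (in module) mem_of_coset_mem:
  assumes N: "submodule N R M" and Z: "submodule Z R M" "N \<subseteq> Z" and x: "x \<in> carrier M" "N +>\<^bsub>M\<^esub> x \<in> (\<lambda>x. N +>\<^bsub>M\<^esub> x) ` Z"
  shows "x \<in> Z"
proof -
  obtain z where z: "z \<in> Z" "N +>\<^bsub>M\<^esub> x = N +>\<^bsub>M\<^esub> z" using x(2) by blast
  have "x \<ominus>\<^bsub>M\<^esub> z \<in> Z" using coset_eq_iff[OF N x(1)] z submodule_carr[OF Z(1)] Z(2) by blast
  then show ?thesis using submodule_diff_cancel[OF Z(1) _ z(1) x(1)] by blast
qed

text \<open>Localization and quotient are removed together: the length is that of a family of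
  submodules of \<open>M\<close> itself, so the rank of the Sally module becomes a question about
  sets of polynomials.\<close>

theorem (in module) length_localized_quot:
  assumes N: "submodule N R M" and S: "S \<subseteq> carrier R" "\<one> \<in> S" "\<And>s t. \<lbrakk>s \<in> S; t \<in> S\<rbrakk> \<Longrightarrow> s \<otimes> t \<in> S"
  shows "module_length (loc_ring R S) (loc_module R S (quot_module M N)) =
    chain_length {Z. submodule Z R M \<and> N \<subseteq> Z \<and> (\<forall>s\<in>S. \<forall>x\<in>carrier M. s \<odot>\<^bsub>M\<^esub> x \<in> Z \<longrightarrow> x \<in> Z)}"
proof -
  interpret Q: module R "quot_module M N" by (rule quot_is_module[OF N])
  interpret L: localized_module R "quot_module M N" S
    by (intro localized_module.intro Q.module_axioms localized_module_axioms.intro S)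
  let ?p = "\<lambda>x. N +>\<^bsub>M\<^esub> x"
  let ?A = "{Z. submodule Z R (quot_module M N) \<and> L.saturated Z}"
  let ?B = "{Z. submodule Z R M \<and> N \<subseteq> Z \<and> (\<forall>s\<in>S. \<forall>x\<in>carrier M. s \<odot>\<^bsub>M\<^esub> x \<in> Z \<longrightarrow> x \<in> Z)}"
  have "chain_length ?A = chain_length ?B"
  proof (rule antisym)
    show "chain_length ?A \<le> chain_length ?B"
    proof (rule chain_length_mono_map[where f = "\<lambda>W. {x \<in> carrier M. ?p x \<in> W}"])
      fix X assume X: "X \<in> ?A"
      have "x \<in> {x \<in> carrier M. ?p x \<in> X}" if s: "s \<in> S" and x: "x \<in> carrier M" and sx: "s \<odot>\<^bsub>M\<^esub> x \<in> {x \<in> carrier M. ?p x \<in> X}" for s x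
      proof -
        have sc: "s \<in> carrier R" using s S by blast
        have "s \<odot>\<^bsub>quot_module M N\<^esub> ?p x \<in> X" using sx quot_smult[OF N sc x] by simp
        then have "?p x \<in> X" using X s coset_closed[OF x, of N] unfolding L.saturated_def by blast
        then show ?thesis using x by simp
      qed
      then show "{x \<in> carrier M. ?p x \<in> X} \<in> ?B" using submodule_quotD[OF N, of X] X by blast
      fix Y assume "Y \<in> ?A" "X \<subset> Y"
      then obtain y where y: "y \<in> Y" "y \<notin> X" "y \<in> carrier (quot_module M N)" using Q.submodule_carr by blast
      then obtain x where "x \<in> carrier M" "y = ?p x" by (elim quot_cases)
      then have "x \<in> {x \<in> carrier M. ?p x \<in> Y}" "x \<notin> {x \<in> carrier M. ?p x \<in> X}" using y by auto
      moreover have "{x \<in> carrier M. ?p x \<in> X} \<subseteq> {x \<in> carrier M. ?p x \<in> Y}" using \<open>X \<subset> Y\<close> by blast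
      ultimately show "{x \<in> carrier M. ?p x \<in> X} \<subset> {x \<in> carrier M. ?p x \<in> Y}" by blast
    qed
    note mem = mem_of_coset_mem[OF N]
    show "chain_length ?B \<le> chain_length ?A"
    proof (rule chain_length_mono_map[where f = "\<lambda>L. ?p ` L"])
      fix X assume X: "X \<in> ?B"
      have "L.saturated (?p ` X)" unfolding L.saturated_def
      proof (intro ballI impI)
        fix s w assume s: "s \<in> S" and "w \<in> carrier (quot_module M N)" and sw: "s \<odot>\<^bsub>quot_module M N\<^esub> w \<in> ?p ` X"
        then obtain x where x: "x \<in> carrier M" "w = ?p x" by (elim quot_cases)
        have sc: "s \<in> carrier R" using s S by blast
        have "s \<odot>\<^bsub>M\<^esub> x \<in> X" using mem[of X "s \<odot>\<^bsub>M\<^esub> x"] X sw quot_smult[OF N sc x(1)] x sc by simp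
        then show "w \<in> ?p ` X" using X s x by blast
      qed
      then show "?p ` X \<in> ?A" using submodule_quotI[OF N, of X] X by blast
      fix Y assume Y: "Y \<in> ?B" "X \<subset> Y"
      then obtain y where y: "y \<in> Y" "y \<notin> X" by blast
      then have "y \<in> carrier M" using Y submodule_carr by blast
      then have "?p y \<notin> ?p ` X" using mem[of X y] X y by blast
      then show "?p ` X \<subset> ?p ` Y" using y Y(2) by blast
    qed
  qed
  then show ?thesis using L.length_localization by simp
qed

section \<open>Rees algebras and the Sally module\<close>

lemma (in abelian_monoid) finsum_mem:
  assumes "finite A" "\<zero> \<in> H" "H \<subseteq> carrier G" "\<And>x y. \<lbrakk>x \<in> H; y \<in> H\<rbrakk> \<Longrightarrow> x \<oplus> y \<in> H" "\<And>i. i \<in> A \<Longrightarrow> f i \<in> H"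
  shows "finsum G f A \<in> H"
  using assms(1,5)
proof (induction A)
  case (insert i A)
  then have "f \<in> A \<rightarrow> carrier G" "f i \<in> carrier G" using assms(3) by auto
  then show ?case using insert assms(4) by simp
qed (use assms(2) in simp)

text \<open>A copy of \<open>cring\<close> that carries the polynomial ring. Attached to
  \<open>cring\<close> itself, the construction would apply again to the polynomial ring, which is a
  \<open>cring\<close> too.\<close>

locale poly_cring = cring

sublocale poly_cring \<subseteq> P: UP_cring R "UP R"
  by (rule UP_cring.intro[OF is_cring])

context poly_cring begin

abbreviation cf where "cf \<equiv> coeff (UP R)"

lemma cf_carr: "p \<in> carrier (UP R) \<Longrightarrow> cf p i \<in> carrier R"
  by (rule P.coeff_closed)

lemma cf_mult_mem:
  assumes "p \<in> carrier (UP R)" "q \<in> carrier (UP R)" "ideal Z R"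
    "\<And>i. i \<le> n \<Longrightarrow> cf p i \<otimes> cf q (n - i) \<in> Z"
  shows "cf (p \<otimes>\<^bsub>UP R\<^esub> q) n \<in> Z"
  unfolding P.coeff_mult[OF assms(1,2)]
  by (rule finsum_mem) (use assms(3,4) idl_zero idl_sub idl_add in auto)

lemma cf_mult_monom:
  assumes p: "p \<in> carrier (UP R)" and c: "c \<in> carrier R"
  shows "cf (p \<otimes>\<^bsub>UP R\<^esub> monom (UP R) c k) (l + k) = cf p l \<otimes> c"
proof -
  have "cf (p \<otimes>\<^bsub>UP R\<^esub> monom (UP R) c k) (l + k) = (\<Oplus>i\<in>{..l + k}. cf p i \<otimes> cf (monom (UP R) c k) (l + k - i))"
    using p c by (intro P.coeff_mult) auto
  also have "\<dots> = (\<Oplus>i\<in>{..l + k}. if i = l then cf p i \<otimes> c else \<zero>)"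
  proof (rule add.finprod_cong')
    show "(\<lambda>i. if i = l then cf p i \<otimes> c else \<zero>) \<in> {..l + k} \<rightarrow> carrier R" using p c by auto
    show "cf p i \<otimes> cf (monom (UP R) c k) (l + k - i) = (if i = l then cf p i \<otimes> c else \<zero>)" if "i \<in> {..l + k}" for i
      using that p c by auto
  qed simp
  also have "\<dots> = cf p l \<otimes> c"
    using add.finprod_singleton_swap[of l "{..l + k}" "\<lambda>i. cf p i \<otimes> c"] p c by simp
  finally show ?thesis .
qed

lemma cf_mult_monom_0:
  assumes p: "p \<in> carrier (UP R)" and c: "c \<in> carrier R"
  shows "cf (p \<otimes>\<^bsub>UP R\<^esub> monom (UP R) c (Suc k)) 0 = \<zero>"
  using p c by (simp add: P.coeff_mult)

lemma rees_simps [simp]: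
  "add (rees R J) = add (UP R)" "mult (rees R J) = mult (UP R)" "zero (rees R J) = zero (UP R)" "one (rees R J) = one (UP R)"
  by (simp_all add: rees_def)

lemma rees_mem: "p \<in> carrier (rees R J) \<longleftrightarrow> p \<in> carrier (UP R) \<and> (\<forall>i. cf p i \<in> ideal_pow R J i)"
  by (simp add: rees_def)

lemma rees_cring:
  assumes J: "ideal J R"
  shows "cring (rees R J)"
proof -
  note Ji = idl_pow_ideal[OF J]
  let ?H = "{p \<in> carrier (UP R). \<forall>i. cf p i \<in> ideal_pow R J i}"
  have "subring ?H (UP R)"
  proof (rule P.P.subringI)
    show "\<one>\<^bsub>UP R\<^esub> \<in> ?H" using idl_zero[OF Ji] by (auto simp: idl_pow_0)
    show "\<ominus>\<^bsub>UP R\<^esub> p \<in> ?H" if "p \<in> ?H" for p using that idl_neg[OF Ji] by auto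
    show "p \<otimes>\<^bsub>UP R\<^esub> q \<in> ?H" if pq: "p \<in> ?H" "q \<in> ?H" for p q
    proof -
      have "cf (p \<otimes>\<^bsub>UP R\<^esub> q) n \<in> ideal_pow R J n" for n
      proof (rule cf_mult_mem[OF _ _ Ji])
        show "cf p i \<otimes> cf q (n - i) \<in> ideal_pow R J n" if "i \<le> n" for i
          using idl_pow_add[OF J, of i "n - i"] pq that by (simp add: prod_in)
      qed (use pq in auto)
      then show ?thesis using pq by simp
    qed
    show "p \<oplus>\<^bsub>UP R\<^esub> q \<in> ?H" if "p \<in> ?H" "q \<in> ?H" for p q using that idl_add[OF Ji] by auto
  qed auto
  then have "subcring ?H (UP R)" by (rule P.P.subcringI')
  then have "cring ((UP R)\<lparr>carrier := ?H\<rparr>)" using P.P.subcring_iff[of ?H] by auto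
  then show ?thesis by (simp add: rees_def)
qed

lemma poly_mem_of_monoms:
  assumes p: "p \<in> carrier (UP R)" and H: "H \<subseteq> carrier (UP R)" "\<zero>\<^bsub>UP R\<^esub> \<in> H" "\<And>x y. \<lbrakk>x \<in> H; y \<in> H\<rbrakk> \<Longrightarrow> x \<oplus>\<^bsub>UP R\<^esub> y \<in> H"
    "\<And>i. monom (UP R) (cf p i) i \<in> H"
  shows "p \<in> H"
proof -
  have "(\<Oplus>\<^bsub>UP R\<^esub>i\<in>{..deg R p}. monom (UP R) (cf p i) i) \<in> H"
    by (rule P.P.finsum_mem) (use H in auto)
  then show ?thesis using P.up_repr[OF p] by simp
qed

text \<open>The polynomials on the right form an ideal of the Rees algebra containing the constants
  from \<open>\<aa>\<close>; conversely each of them is a sum of monomials whose coefficients are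
  sums of products of an element of \<open>J^i\<close> and one of \<open>\<aa>\<close>.\<close>

lemma rees_ext_mem:
  assumes J: "ideal J R" and a: "ideal \<aa> R"
  shows "p \<in> rees_ext R J \<aa> \<longleftrightarrow> p \<in> carrier (UP R) \<and> (\<forall>i. cf p i \<in> ideal_pow R J i \<cdot> \<aa>)"
proof -
  interpret RJ: cring "rees R J" by (rule rees_cring[OF J])
  note Ji = idl_pow_ideal[OF J]
  have Jai: "ideal (ideal_pow R J i \<cdot> \<aa>) R" for i by (rule ideal_prod_is_ideal[OF Ji a])
  let ?G = "{p \<in> carrier (UP R). \<forall>i. cf p i \<in> ideal_pow R J i \<cdot> \<aa>}"
  let ?m = "(\<lambda>a. monom (UP R) a 0) ` \<aa>"
  have ac: "x \<in> carrier R" if "x \<in> \<aa>" for x using idl_carr[OF a that] .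
  have mG: "?m \<subseteq> ?G"
  proof
    fix q assume "q \<in> ?m"
    then obtain x where x: "x \<in> \<aa>" "q = monom (UP R) x 0" by blast
    have "cf q i \<in> ideal_pow R J i \<cdot> \<aa>" for i
      unfolding x(2) using x(1) ac[OF x(1)] idl_zero[OF Jai] by (simp add: idl_pow_0 carrier_prod[OF a])
    then show "q \<in> ?G" using x ac by simp
  qed
  have Gsub: "?G \<subseteq> carrier (rees R J)" using subsetD[OF idl_prod_sub(1)[OF Ji a]] by (auto simp: rees_mem)
  have Gi: "ideal ?G (rees R J)"
  proof (rule RJ.idealI')
    show "\<zero>\<^bsub>rees R J\<^esub> \<in> ?G" using idl_zero[OF Jai] by simp
    show "p \<oplus>\<^bsub>rees R J\<^esub> q \<in> ?G" if "p \<in> ?G" "q \<in> ?G" for p q using that idl_add[OF Jai] by simp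
    show "c \<otimes>\<^bsub>rees R J\<^esub> q \<in> ?G" if cq: "c \<in> carrier (rees R J)" "q \<in> ?G" for c q
    proof -
      have "cf (c \<otimes>\<^bsub>UP R\<^esub> q) n \<in> ideal_pow R J n \<cdot> \<aa>" for n
      proof (rule cf_mult_mem[OF _ _ Jai])
        show "cf c i \<otimes> cf q (n - i) \<in> ideal_pow R J n \<cdot> \<aa>" if "i \<le> n" for i
          using idl_pow_add[OF J, of i "n - i"] ideal_prod_assoc[OF Ji[of i] Ji[of "n - i"] a] cq that by (simp add: rees_mem prod_in)
      qed (use cq in \<open>auto simp: rees_mem\<close>)
      then show ?thesis using cq by (simp add: rees_mem)
    qed
  qed (rule Gsub)
  have "rees_ext R J \<aa> \<subseteq> ?G" unfolding rees_ext_def by (rule RJ.genideal_minimal[OF Gi mG])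
  moreover have "?G \<subseteq> rees_ext R J \<aa>"
  proof
    have mc: "?m \<subseteq> carrier (rees R J)" using mG Gsub by blast
    have I0: "ideal (rees_ext R J \<aa>) (rees R J)" unfolding rees_ext_def by (rule RJ.genideal_ideal[OF mc])
    have mI: "?m \<subseteq> rees_ext R J \<aa>" unfolding rees_ext_def by (rule RJ.genideal_self[OF mc])
    have mon: "monom (UP R) x i \<in> rees_ext R J \<aa>" if "x \<in> ideal_pow R J i \<cdot> \<aa>" for x i
      using that
    proof induct
      case (prod j x)
      have c: "j \<in> carrier R" "x \<in> carrier R" using prod idl_carr[OF Ji] ac by blast+
      have "monom (UP R) j i \<in> carrier (rees R J)" using prod c idl_zero[OF Ji] by (simp add: rees_mem)
      then have "monom (UP R) j i \<otimes>\<^bsub>UP R\<^esub> monom (UP R) x 0 \<in> rees_ext R J \<aa>"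
        using RJ.idl_lmult[OF I0, of "monom (UP R) x 0" "monom (UP R) j i"] mI prod by auto
      then show ?case using P.monom_mult[OF c, of i 0] by simp
    next
      case (sum s t)
      have "s \<in> carrier R" "t \<in> carrier R" using sum ideal_prod_in_carrier[OF Ji a] by blast+
      then show ?case using sum RJ.idl_add[OF I0, of "monom (UP R) s i" "monom (UP R) t i"] by simp
    qed
    fix p assume p: "p \<in> ?G"
    show "p \<in> rees_ext R J \<aa>"
    proof (rule poly_mem_of_monoms)
      show "p \<in> carrier (UP R)" using p by simp
      show "rees_ext R J \<aa> \<subseteq> carrier (UP R)" using RJ.idl_sub[OF I0] by (auto simp: rees_mem)
      show "\<zero>\<^bsub>UP R\<^esub> \<in> rees_ext R J \<aa>" using RJ.idl_zero[OF I0] by simp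
      show "x \<oplus>\<^bsub>UP R\<^esub> y \<in> rees_ext R J \<aa>" if "x \<in> rees_ext R J \<aa>" "y \<in> rees_ext R J \<aa>" for x y
        using RJ.idl_add[OF I0 that] by simp
    qed (use mon p in auto)
  qed
  ultimately show ?thesis by blast
qed

lemma ring_module_rees_module:
  assumes Q: "ideal Q R"
  shows "module (rees R Q) (ring_module (UP R))"
proof -
  interpret T: cring "rees R Q" by (rule rees_cring[OF Q])
  interpret RP: module "UP R" "ring_module (UP R)" by (rule P.P.ring_module_module)
  have Tc: "t \<in> carrier (UP R)" if "t \<in> carrier (rees R Q)" for t using that by (simp add: rees_mem)
  show ?thesis
  proof (rule moduleI[OF T.is_cring])
    show "abelian_group (ring_module (UP R))" by (rule RP.M.abelian_group_axioms)
  qed (use Tc in \<open>auto simp: P.P.l_distr P.P.r_distr P.P.m_assoc\<close>)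
qed

text \<open>The source of the base module \<open>JA[Jt]\<close>, of \<open>J\<T>\<close> and of
  every step of the filtration used for the rank.\<close>

lemma graded_submodule:
  assumes Q: "ideal Q R" and N: "\<And>i. ideal (N i) R"
    "\<And>k i x y. \<lbrakk>x \<in> ideal_pow R Q k; y \<in> N i\<rbrakk> \<Longrightarrow> x \<otimes> y \<in> N (k + i)"
  shows "submodule {p \<in> carrier (UP R). \<forall>i. cf p i \<in> N i} (rees R Q) (ring_module (UP R))"
proof -
  interpret M: module "rees R Q" "ring_module (UP R)" by (rule ring_module_rees_module[OF Q])
  let ?G = "{p \<in> carrier (UP R). \<forall>i. cf p i \<in> N i}"
  show ?thesis
  proof (rule M.submoduleI')
    show "\<zero>\<^bsub>ring_module (UP R)\<^esub> \<in> ?G" using idl_zero[OF N(1)] by simp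
    show "p \<oplus>\<^bsub>ring_module (UP R)\<^esub> q \<in> ?G" if "p \<in> ?G" "q \<in> ?G" for p q using that idl_add[OF N(1)] by simp
    show "c \<odot>\<^bsub>ring_module (UP R)\<^esub> q \<in> ?G" if cq: "c \<in> carrier (rees R Q)" "q \<in> ?G" for c q
    proof -
      have "cf (c \<otimes>\<^bsub>UP R\<^esub> q) n \<in> N n" for n
      proof (rule cf_mult_mem[OF _ _ N(1)])
        show "cf c i \<otimes> cf q (n - i) \<in> N n" if "i \<le> n" for i
          using N(2)[of "cf c i" i "cf q (n - i)" "n - i"] cq that by (simp add: rees_mem)
      qed (use cq in \<open>auto simp: rees_mem\<close>)
      then show ?thesis using cq by (simp add: rees_mem)
    qed
  qed auto
qed

end

lemma submodule_restrict:
  assumes "module R M" "submodule L R M"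
  shows "submodule N R (M\<lparr>carrier := L\<rparr>) \<longleftrightarrow> N \<subseteq> L \<and> submodule N R M"
proof -
  interpret M: module R M by fact
  interpret L: module R "M\<lparr>carrier := L\<rparr>" by (rule submodule.submodule_is_module[OF assms(2,1)])
  show ?thesis
  proof (intro iffI conjI)
    assume N: "submodule N R (M\<lparr>carrier := L\<rparr>)"
    show NL: "N \<subseteq> L" using L.submodule_sub[OF N] by simp
    show "submodule N R M"
      by (rule M.submoduleI') (use NL M.submodule_sub[OF assms(2)] L.submodule_zero[OF N] L.submoduleE(4,5)[OF N] in auto)
  next
    assume N: "N \<subseteq> L \<and> submodule N R M"
    show "submodule N R (M\<lparr>carrier := L\<rparr>)"
      by (rule L.submoduleI') (use N M.submodule_zero[of N] M.submoduleE(4,5)[of N] in auto)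
  qed
qed

context poly_cring begin

text \<open>This is \<open>JA[Jt]\<close>, with \<open>J^(i+1)\<close> in degree \<open>i\<close>;
  the Sally module is its quotient by \<open>J\<T>\<close>.\<close>

abbreviation sally_base where "sally_base J \<equiv> (ring_module (UP R))\<lparr>carrier := rees_ext R J J\<rparr>"

lemma rees_ext_self_mem:
  assumes "ideal J R" shows "p \<in> rees_ext R J J \<longleftrightarrow> p \<in> carrier (UP R) \<and> (\<forall>i. cf p i \<in> ideal_pow R J (Suc i))"
  unfolding rees_ext_mem[OF assms assms] by (simp add: idl_pow_Suc)

lemma sally_base_module:
  assumes Q: "ideal Q R" and J: "ideal J R" "Q \<subseteq> J"
  shows "submodule (rees_ext R J J) (rees R Q) (ring_module (UP R))" "module (rees R Q) (sally_base J)"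
proof -
  have "rees_ext R J J = {p \<in> carrier (UP R). \<forall>i. cf p i \<in> ideal_pow R J (Suc i)}" using rees_ext_self_mem[OF J(1)] by blast
  moreover have "submodule {p \<in> carrier (UP R). \<forall>i. cf p i \<in> ideal_pow R J (Suc i)} (rees R Q) (ring_module (UP R))"
  proof (rule graded_submodule[OF Q idl_pow_ideal[OF J(1)]])
    fix k i x y assume "x \<in> ideal_pow R Q k" "y \<in> ideal_pow R J (Suc i)"
    then have "x \<otimes> y \<in> ideal_pow R J k \<cdot> ideal_pow R J (Suc i)" using idl_pow_mono[OF J(2)] by (intro prod_in) auto
    then show "x \<otimes> y \<in> ideal_pow R J (Suc (k + i))" using idl_pow_add[OF J(1), of k "Suc i"] by (simp del: nat_pow_Suc)
  qed
  ultimately show s: "submodule (rees_ext R J J) (rees R Q) (ring_module (UP R))" by simp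
  show "module (rees R Q) (sally_base J)" by (rule submodule.submodule_is_module[OF s ring_module_rees_module[OF Q]])
qed

lemma sally_base_graded_submodule:
  assumes Q: "ideal Q R" and J: "ideal J R" "Q \<subseteq> J" and N: "\<And>i. ideal (N i) R" "\<And>i. N i \<subseteq> ideal_pow R J (Suc i)"
    "\<And>k i x y. \<lbrakk>x \<in> ideal_pow R Q k; y \<in> N i\<rbrakk> \<Longrightarrow> x \<otimes> y \<in> N (k + i)"
  shows "submodule {p \<in> carrier (UP R). \<forall>i. cf p i \<in> N i} (rees R Q) (sally_base J)"
  unfolding submodule_restrict[OF ring_module_rees_module[OF Q] sally_base_module(1)[OF Q J]]
proof
  show "{p \<in> carrier (UP R). \<forall>i. cf p i \<in> N i} \<subseteq> rees_ext R J J" using N(2) rees_ext_self_mem[OF J(1)] by blast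
  show "submodule {p \<in> carrier (UP R). \<forall>i. cf p i \<in> N i} (rees R Q) (ring_module (UP R))"
    by (rule graded_submodule[where N = N]) (use Q N in auto)
qed

lemma rees_ext_eq: "\<lbrakk>ideal Q R; ideal J R\<rbrakk> \<Longrightarrow> rees_ext R Q J = {p \<in> carrier (UP R). \<forall>i. cf p i \<in> ideal_pow R Q i \<cdot> J}"
  using rees_ext_mem by blast

lemma pow_prod_mult_mem:
  assumes Q: "ideal Q R" and c: "ideal \<cc> R" and "x \<in> ideal_pow R Q k" "y \<in> ideal_pow R Q i \<cdot> \<cc>"
  shows "x \<otimes> y \<in> ideal_pow R Q (k + i) \<cdot> \<cc>"
  unfolding idl_pow_add[OF Q] ideal_prod_assoc[OF idl_pow_ideal[OF Q] idl_pow_ideal[OF Q] c] using assms by (intro prod_in)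

lemma pow_prod_sub_pow:
  assumes Q: "ideal Q R" and J: "ideal J R" "Q \<subseteq> J"
  shows "ideal_pow R Q i \<cdot> J \<subseteq> ideal_pow R J (Suc i)"
  unfolding idl_pow_Suc by (intro idl_prod_mono idl_pow_mono J subset_refl)

lemma sally_sub_submodule:
  assumes Q: "ideal Q R" and J: "ideal J R" "Q \<subseteq> J"
  shows "submodule (rees_ext R Q J) (rees R Q) (sally_base J)"
  unfolding rees_ext_eq[OF Q J(1)]
  by (intro sally_base_graded_submodule Q J ideal_prod_is_ideal idl_pow_ideal pow_prod_sub_pow pow_prod_mult_mem)

lemma sally_eq: "sally R Q J = quot_module (sally_base J) (rees_ext R Q J)"
  by (simp add: sally_def)

text \<open>Generation in degree one says \<open>J^(l+2) = Q^l J^2\<close> in terms of graded components.\<close>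

lemma sally_generated_degree_one:
  assumes Q: "ideal Q R" and J: "ideal J R" "Q \<subseteq> J"
    and gen: "carrier (sally R Q J) = submod_span (rees R Q) (sally R Q J) (sally_component R Q J 1)"
  shows "ideal_pow R J (Suc (Suc l)) \<subseteq> ideal_pow R Q l \<cdot> ideal_pow R J 2"
proof -
  interpret M: module "rees R Q" "sally_base J" by (rule sally_base_module(2)[OF Q J])
  note U = sally_sub_submodule[OF Q J]
  \<comment> \<open>The graded pieces of the submodule generated by \<open>J\<T>\<close> and degree
    one: \<open>J\<close> in degree 0 and \<open>Q^kJ\<^sup>2\<close> in degree
    \<open>k + 1\<close>, which contains \<open>Q^(k+1)J\<close>.\<close>
  define N where "N i = (case i of 0 \<Rightarrow> J | Suc k \<Rightarrow> ideal_pow R Q k \<cdot> ideal_pow R J 2)" for i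
  have N0: "N 0 = J" and NS: "N (Suc k) = ideal_pow R Q k \<cdot> ideal_pow R J 2" for k by (simp_all add: N_def)
  note Qi = idl_pow_ideal[OF Q] and Ji = idl_pow_ideal[OF J(1)]
  have J2: "ideal_pow R J 2 = J \<cdot> J" by (simp add: numeral_2_eq_2 idl_pow_0 carrier_prod J)
  have JJ: "ideal (J \<cdot> J) R" by (rule ideal_prod_is_ideal[OF J(1) J(1)])
  have Ni: "ideal (N i) R" for i by (cases i) (simp_all add: N0 NS J ideal_prod_is_ideal Qi J2 del: nat_pow_Suc)
  have UN: "ideal_pow R Q i \<cdot> J \<subseteq> N i" for i
  proof (cases i)
    case 0
    then show ?thesis by (simp add: N0 idl_pow_0 carrier_prod J)
  next
    case (Suc k)
    have "ideal_pow R Q (Suc k) \<cdot> J = ideal_pow R Q k \<cdot> (Q \<cdot> J)" unfolding idl_pow_Suc by (rule ideal_prod_assoc[OF Qi Q J(1)])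
    also have "\<dots> \<subseteq> N (Suc k)" unfolding NS J2 by (intro idl_prod_mono subset_refl J)
    finally show ?thesis using Suc by simp
  qed
  define V where "V = {p \<in> carrier (UP R). \<forall>i. cf p i \<in> N i}"
  have V: "submodule V (rees R Q) (sally_base J)" unfolding V_def
  proof (rule sally_base_graded_submodule[OF Q J Ni])
    show "N i \<subseteq> ideal_pow R J (Suc i)" for i
    proof (cases i)
      case 0
      then show ?thesis by (simp add: N0 idl_pow_0 carrier_prod J)
    next
      case (Suc k)
      have "ideal_pow R Q k \<cdot> ideal_pow R J 2 \<subseteq> ideal_pow R J k \<cdot> ideal_pow R J 2" by (intro idl_prod_mono idl_pow_mono J subset_refl)
      also have "\<dots> = ideal_pow R J (Suc (Suc k))" using idl_pow_add[OF J(1), of k 2] by simp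
      finally show ?thesis unfolding Suc NS .
    qed
    fix k i x y assume x: "x \<in> ideal_pow R Q k" and y: "y \<in> N i"
    show "x \<otimes> y \<in> N (k + i)"
    proof (cases i)
      case 0
      then have "x \<otimes> y \<in> ideal_pow R Q k \<cdot> J" using x y by (simp add: N0 prod_in)
      then show ?thesis using UN[of k] 0 by auto
    next
      case (Suc j)
      then show ?thesis using pow_prod_mult_mem[OF Q _ x, of "ideal_pow R J 2" y j] y JJ by (simp add: NS J2 del: nat_pow_Suc)
    qed
  qed
  have UV: "rees_ext R Q J \<subseteq> V" unfolding V_def rees_ext_eq[OF Q J(1)] using UN by blast
  let ?p = "\<lambda>x. rees_ext R Q J +>\<^bsub>sally_base J\<^esub> x"
  have cos: "rees_ext R Q J +>\<^bsub>UP R\<^esub> x = ?p x" for x by (simp add: a_r_coset_def')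
  have "sally_component R Q J 1 \<subseteq> ?p ` V"
  proof
    fix w assume "w \<in> sally_component R Q J 1"
    then obtain p where p: "w = ?p p" "p \<in> rees_ext R J J" "\<And>j. j \<noteq> 1 \<Longrightarrow> cf p j = \<zero>"
      unfolding sally_component_def cos by blast
    have "cf p i \<in> N i" for i
    proof (cases "i = 1")
      case True
      have "cf p 1 \<in> ideal_pow R J 2" using p(2) rees_ext_self_mem[OF J(1)] by (metis Suc_1 One_nat_def)
      then show ?thesis using True NS[of 0] by (simp add: idl_pow_0 carrier_prod J2 JJ)
    next
      case False
      then show ?thesis using p(3) idl_zero[OF Ni] by simp
    qed
    then have "p \<in> V" unfolding V_def using p(2) rees_ext_self_mem[OF J(1)] by blast
    then show "w \<in> ?p ` V" using p(1) by blast
  qed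
  then have "submod_span (rees R Q) (sally R Q J) (sally_component R Q J 1) \<subseteq> ?p ` V"
    unfolding submod_span_def sally_eq using M.submodule_quotI[OF U V] by blast
  then have sub: "carrier (sally R Q J) \<subseteq> ?p ` V" unfolding gen .
  have all: "?p x \<in> ?p ` V" if "x \<in> rees_ext R J J" for x
  proof -
    have "?p x \<in> carrier (sally R Q J)" unfolding sally_eq using that by (intro M.coset_closed) simp
    then show ?thesis using sub by blast
  qed
  have PV: "x \<in> V" if "x \<in> rees_ext R J J" for x
    by (rule M.mem_of_coset_mem[OF U V UV _ all[OF that]]) (use that in simp)
  show ?thesis
  proof
    fix x assume x: "x \<in> ideal_pow R J (Suc (Suc l))"
    have xc: "x \<in> carrier R" using idl_carr[OF Ji x] .
    have "cf (monom (UP R) x (Suc l)) i \<in> ideal_pow R J (Suc i)" for i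
    proof (cases "i = Suc l")
      case True
      then show ?thesis using x xc by (simp del: nat_pow_Suc)
    next
      case False
      then show ?thesis using idl_zero[OF Ji, of "Suc i"] xc by (simp del: nat_pow_Suc)
    qed
    then have "monom (UP R) x (Suc l) \<in> rees_ext R J J" using rees_ext_self_mem[OF J(1)] xc by simp
    then have "cf (monom (UP R) x (Suc l)) (Suc l) \<in> N (Suc l)" using PV unfolding V_def by blast
    then show "x \<in> ideal_pow R Q l \<cdot> ideal_pow R J 2" using xc by (simp add: NS)
  qed
qed

end


section \<open>The rank of the Sally module\<close>

text \<open>A composition series of \<open>B/J\<close>, indexed from \<open>J\<close> upward. The
  bound 1 on the factors is all that \<open>simple_step\<close> asks for.\<close>

lemma (in cring) length_filtration:
  assumes "ideal J R" "ideal B R" "J \<subseteq> B" "len R B J = enat r"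
  shows "\<exists>b. b 0 = J \<and> b r = B \<and> (\<forall>i\<le>r. ideal (b i) R \<and> J \<subseteq> b i) \<and>
    (\<forall>i<r. b i \<subset> b (Suc i) \<and> len R (b (Suc i)) (b i) \<le> 1)"
  using assms(2-4)
proof (induction r arbitrary: B)
  case 0
  then have "B = J" using len_0_iff[OF 0(1) assms(1) 0(2)] by (simp add: zero_enat_def)
  then show ?case using assms(1) by (intro exI[of _ "\<lambda>_. J"]) auto
next
  case (Suc r)
  obtain L where L: "ideal L R" "J \<subseteq> L" "L \<subset> B" "len R L J = enat r" "len R B L \<le> 1"
    by (rule len_Suc_split[OF assms(1) Suc.prems])
  obtain b where b: "b 0 = J" "b r = L" "\<forall>i\<le>r. ideal (b i) R \<and> J \<subseteq> b i"
    "\<forall>i<r. b i \<subset> b (Suc i) \<and> len R (b (Suc i)) (b i) \<le> 1" using Suc.IH[OF L(1,2,4)] by blast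
  show ?case
  proof (intro exI[of _ "b(Suc r := B)"] conjI allI impI)
    fix i assume "i < Suc r"
    then consider (less) "i < r" | (eq) "i = r" by linarith
    then have "(b(Suc r := B)) i \<subset> (b(Suc r := B)) (Suc i) \<and>
      len R ((b(Suc r := B)) (Suc i)) ((b(Suc r := B)) i) \<le> 1"
    proof cases
      case less
      then show ?thesis using b(4) by simp
    next
      case eq
      then show ?thesis using b(2) L(3,5) by simp
    qed
    then show "(b(Suc r := B)) i \<subset> (b(Suc r := B)) (Suc i)" "len R ((b(Suc r := B)) (Suc i)) ((b(Suc r := B)) i) \<le> 1"
      by blast+
  next
    show "ideal ((b(Suc r := B)) i) R" "J \<subseteq> (b(Suc r := B)) i" if "i \<le> Suc r" for i
      using b(3) that Suc.prems by (auto simp: le_Suc_eq)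
  qed (use b in auto)
qed

text \<open>\<open>B\<close> will be \<open>J\<^sup>2 : a\<close>, of which the decomposition
  \<open>J2\<close> and \<open>J \<subseteq> B\<close> are kept; the length \<open>r\<close> of
  \<open>B/J\<close> is identified with the rank at the end.\<close>

locale sally_setup = poly_cring R + noeth_local R \<mm> for R (structure) and \<mm> +
  fixes e :: nat and P0 Q J B :: "'a set" and a :: 'a and r :: nat
  assumes P0: "regular_ideal e P0" and a: "regular_mod P0 a" and Q_def: "Q = P0 <+> (a \<odot>\<^sub>s carrier R)"
    and J: "ideal J R" "Q \<subseteq> J" and Jm: "J \<subseteq> \<mm>" and B: "ideal B R" "J \<subseteq> B"
    and gen: "\<And>l. ideal_pow R J (Suc (Suc l)) \<subseteq> ideal_pow R Q l \<cdot> ideal_pow R J 2"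
    and J2: "ideal_pow R J 2 = (a \<odot>\<^sub>s B) <+> (Q \<cdot> J)" and lenB: "len R B J = enat r"
begin

lemma P0i: "ideal P0 R" by (rule regular_ideal_ideal[OF P0])
lemma ac: "a \<in> carrier R" by (rule regular_mod_carrier[OF a])
lemma aQ: "a \<in> Q" unfolding Q_def using idl_sum_upper(2)[OF P0i principal_ideal[OF ac]] elt_mult_self[OF ac] by blast
lemma Qi: "ideal Q R" unfolding Q_def by (intro add_ideals P0i principal_ideal ac)
lemma rQ: "regular_ideal (Suc e) Q" unfolding Q_def by (rule regular_ideal_Suc[OF P0 a])
lemma Qm: "Q \<subseteq> \<mm>" using J Jm by blast
lemma Qw: "ideal (ideal_pow R Q l) R" by (rule idl_pow_ideal[OF Qi])
lemma Qwc: "ideal \<cc> R \<Longrightarrow> ideal (ideal_pow R Q l \<cdot> \<cc>) R" by (intro ideal_prod_is_ideal Qw)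
lemma mprime: "primeideal \<mm> R" by (rule maximalideal_prime[OF max])

lemma mult_a_cancel:
  assumes "ideal \<cc> R" "Q \<subseteq> \<cc>" "y \<in> carrier R" "a \<otimes> y \<in> ideal_pow R Q (Suc l) \<cdot> \<cc>"
  shows "y \<in> ideal_pow R Q l \<cdot> \<cc>"
  by (rule mult_pow_prod_cancel[OF P0i regular_mod_pow[OF P0 a] Q_def assms])

lemma a_mult_pow:
  assumes "ideal \<cc> R" "y \<in> ideal_pow R Q l \<cdot> \<cc>" shows "a \<otimes> y \<in> ideal_pow R Q (Suc l) \<cdot> \<cc>"
proof -
  have "a \<in> ideal_pow R Q (Suc 0)" unfolding idl_pow_1[OF Qi] by (rule aQ)
  from pow_prod_mult_mem[OF Qi assms(1) this assms(2)] show ?thesis by (simp only: add_Suc add_0)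
qed

lemma T_cring: "cring (rees R Q)" by (rule rees_cring[OF Qi])

lemma mT_mem: "p \<in> rees_ext R Q \<mm> \<longleftrightarrow> p \<in> carrier (UP R) \<and> (\<forall>i. cf p i \<in> ideal_pow R Q i \<cdot> \<mm>)"
  by (rule rees_ext_mem[OF Qi max_ideal])

text \<open>\<open>\<mm>T\<close> is prime: compare the lowest coefficients outside \<open>\<mm>Q^i\<close>.\<close>

lemma complement_mult:
  assumes p: "p \<in> carrier (rees R Q) - rees_ext R Q \<mm>" and q: "q \<in> carrier (rees R Q) - rees_ext R Q \<mm>"
  shows "p \<otimes>\<^bsub>rees R Q\<^esub> q \<in> carrier (rees R Q) - rees_ext R Q \<mm>"
proof -
  interpret T: cring "rees R Q" by (rule T_cring)
  note Mi = Qwc[OF max_ideal]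
  have pc: "p \<in> carrier (UP R)" "q \<in> carrier (UP R)" and pT: "\<And>i. cf p i \<in> ideal_pow R Q i" "\<And>i. cf q i \<in> ideal_pow R Q i"
    using p q by (auto simp: rees_mem)
  define l where "l = (LEAST i. cf p i \<notin> ideal_pow R Q i \<cdot> \<mm>)"
  define k where "k = (LEAST i. cf q i \<notin> ideal_pow R Q i \<cdot> \<mm>)"
  have ex: "\<exists>i. cf p i \<notin> ideal_pow R Q i \<cdot> \<mm>" "\<exists>i. cf q i \<notin> ideal_pow R Q i \<cdot> \<mm>" using p q pc mT_mem by auto
  have l: "cf p l \<notin> ideal_pow R Q l \<cdot> \<mm>" and k: "cf q k \<notin> ideal_pow R Q k \<cdot> \<mm>"
    unfolding l_def k_def by (rule LeastI_ex[OF ex(1)], rule LeastI_ex[OF ex(2)])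
  have lt: "cf p i \<in> ideal_pow R Q i \<cdot> \<mm>" if "i < l" for i using not_less_Least that unfolding l_def by blast
  have kt: "cf q i \<in> ideal_pow R Q i \<cdot> \<mm>" if "i < k" for i using not_less_Least that unfolding k_def by blast
  let ?n = "l + k"
  let ?f = "\<lambda>i. cf p i \<otimes> cf q (?n - i)"
  have fc: "?f i \<in> carrier R" for i using pc by simp
  have "?f i \<in> ideal_pow R Q ?n \<cdot> \<mm>" if i: "i \<le> ?n" "i \<noteq> l" for i
  proof (cases "i < l")
    case True
    have "cf q (?n - i) \<otimes> cf p i \<in> ideal_pow R Q (?n - i + i) \<cdot> \<mm>"
      by (rule pow_prod_mult_mem[OF Qi max_ideal pT(2) lt[OF True]])
    then show ?thesis using i pc by (simp add: m_comm)
  next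
    case False
    then have "?n - i < k" using i by linarith
    from pow_prod_mult_mem[OF Qi max_ideal pT(1)[of i] kt[OF this]] show ?thesis using i by simp
  qed
  then have rest: "(\<Oplus>i\<in>{..?n} - {l}. ?f i) \<in> ideal_pow R Q ?n \<cdot> \<mm>"
    by (intro finsum_mem) (use idl_zero[OF Mi] idl_sub[OF Mi] idl_add[OF Mi] in auto)
  have "{..?n} = insert l ({..?n} - {l})" by auto
  then have "cf (p \<otimes>\<^bsub>UP R\<^esub> q) ?n = (\<Oplus>i\<in>insert l ({..?n} - {l}). ?f i)" using P.coeff_mult[OF pc, of ?n] by simp
  also have "\<dots> = ?f l \<oplus> (\<Oplus>i\<in>{..?n} - {l}. ?f i)" by (rule finsum_insert) (use fc pc in auto)
  finally have eq: "cf (p \<otimes>\<^bsub>UP R\<^esub> q) ?n = cf p l \<otimes> cf q k \<oplus> (\<Oplus>i\<in>{..?n} - {l}. ?f i)" by simp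
  have "p \<otimes>\<^bsub>UP R\<^esub> q \<notin> rees_ext R Q \<mm>"
  proof
    assume "p \<otimes>\<^bsub>UP R\<^esub> q \<in> rees_ext R Q \<mm>"
    then have "cf p l \<otimes> cf q k \<oplus> (\<Oplus>i\<in>{..?n} - {l}. ?f i) \<in> ideal_pow R Q ?n \<cdot> \<mm>" using mT_mem eq by metis
    then have "cf p l \<otimes> cf q k \<in> ideal_pow R Q (l + k) \<cdot> \<mm>" using idl_add_cancel[OF Mi _ rest] pc by simp
    then show False using regular_ideal_pow_prime[OF rQ mprime Qm pT(1)[of l] pT(2)[of k]] l k by blast
  qed
  then show ?thesis using T.m_closed[of p q] p q by simp
qed

lemma one_complement: "\<one>\<^bsub>rees R Q\<^esub> \<in> carrier (rees R Q) - rees_ext R Q \<mm>"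
proof -
  interpret T: cring "rees R Q" by (rule T_cring)
  have "\<one>\<^bsub>UP R\<^esub> \<notin> rees_ext R Q \<mm>"
  proof
    assume "\<one>\<^bsub>UP R\<^esub> \<in> rees_ext R Q \<mm>"
    then have "cf \<one>\<^bsub>UP R\<^esub> 0 \<in> ideal_pow R Q 0 \<cdot> \<mm>" using mT_mem by blast
    then show False using max_proper by (simp add: idl_pow_0 carrier_prod[OF max_ideal])
  qed
  then show ?thesis using T.one_closed by simp
qed

text \<open>Degree \<open>i\<close> of an intermediate module between \<open>J\<T>\<close>, at
  \<open>\<bb> = J\<close>, and \<open>JA[Jt]\<close>, at \<open>\<bb> = B\<close>. Degree 0 is
  always \<open>J\<close> since the Sally module starts in degree one.\<close>

definition layer :: "'a set \<Rightarrow> nat \<Rightarrow> 'a set" where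
  "layer \<bb> i = (case i of 0 \<Rightarrow> J | Suc l \<Rightarrow> (a \<odot>\<^sub>s (ideal_pow R Q l \<cdot> \<bb>)) <+> (ideal_pow R Q (Suc l) \<cdot> J))"

lemma layer_0: "layer \<bb> 0 = J"
  and layer_Suc: "layer \<bb> (Suc l) = (a \<odot>\<^sub>s (ideal_pow R Q l \<cdot> \<bb>)) <+> (ideal_pow R Q (Suc l) \<cdot> J)"
  by (simp_all add: layer_def)

lemma layer_ideal: assumes "ideal \<bb> R" shows "ideal (layer \<bb> i) R"
  by (cases i) (auto simp only: layer_0 layer_Suc intro!: J add_ideals elt_mult_ideal Qwc assms ac)

lemma layer_upper:
  assumes b: "ideal \<bb> R"
  shows "x \<in> ideal_pow R Q l \<cdot> \<bb> \<Longrightarrow> a \<otimes> x \<in> layer \<bb> (Suc l)" "ideal_pow R Q i \<cdot> J \<subseteq> layer \<bb> i"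
proof -
  have i: "ideal (a \<odot>\<^sub>s (ideal_pow R Q l \<cdot> \<bb>)) R" "ideal (ideal_pow R Q (Suc l) \<cdot> J) R" for l
    by (intro elt_mult_ideal Qwc b ac J)+
  show "a \<otimes> x \<in> layer \<bb> (Suc l)" if "x \<in> ideal_pow R Q l \<cdot> \<bb>"
    unfolding layer_Suc using idl_sum_upper(1)[OF i] elt_multI[OF that] by blast
  show "ideal_pow R Q i \<cdot> J \<subseteq> layer \<bb> i"
  proof (cases i)
    case 0
    then show ?thesis using J by (simp add: layer_0 idl_pow_0 carrier_prod)
  next
    case (Suc l)
    show ?thesis unfolding Suc layer_Suc by (rule idl_sum_upper(2)[OF i])
  qed
qed

lemma layer_mult:
  assumes b: "ideal \<bb> R" "J \<subseteq> \<bb>" and x: "x \<in> ideal_pow R Q k" and y: "y \<in> layer \<bb> i"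
  shows "x \<otimes> y \<in> layer \<bb> (k + i)"
proof (cases i)
  case 0
  then have "x \<otimes> y \<in> ideal_pow R Q k \<cdot> J" using x y by (simp add: layer_0 prod_in)
  then show ?thesis using layer_upper(2)[OF b(1), of k] 0 by auto
next
  case (Suc l)
  obtain u w where uw: "u \<in> ideal_pow R Q l \<cdot> \<bb>" "w \<in> ideal_pow R Q (Suc l) \<cdot> J" "y = a \<otimes> u \<oplus> w"
    using y unfolding Suc layer_Suc by (elim idl_sumE elt_multE) blast
  have c: "x \<in> carrier R" "u \<in> carrier R" "w \<in> carrier R"
    using uw x idl_carr[OF Qw] idl_carr[OF Qwc[OF b(1)]] idl_carr[OF Qwc[OF J(1)]] by blast+
  have "x \<otimes> y = a \<otimes> (x \<otimes> u) \<oplus> x \<otimes> w" unfolding uw(3) using c ac by algebra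
  moreover have "x \<otimes> u \<in> ideal_pow R Q (k + l) \<cdot> \<bb>" by (rule pow_prod_mult_mem[OF Qi b(1) x uw(1)])
  moreover have "x \<otimes> w \<in> ideal_pow R Q (Suc (k + l)) \<cdot> J" using pow_prod_mult_mem[OF Qi J(1) x uw(2)] by simp
  ultimately show ?thesis unfolding Suc add_Suc_right layer_Suc by (simp add: idl_sumI elt_multI del: nat_pow_Suc)
qed

lemma layer_mono: "\<bb> \<subseteq> \<bb>' \<Longrightarrow> layer \<bb> i \<subseteq> layer \<bb>' i"
  by (cases i) (simp_all only: layer_0 layer_Suc idl_sum_mono elt_mult_mono idl_prod_mono subset_refl)

text \<open>Factoring \<open>Q^l\<close> out of the layer in degree \<open>l + 1\<close> leaves
  \<open>aB + QJ = J\<^sup>2\<close>, and generation in degree one gives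
  \<open>Q^lJ\<^sup>2 = J^(l+2)\<close>.\<close>

lemma layer_top: "layer B i = ideal_pow R J (Suc i)"
proof (cases i)
  case 0
  then show ?thesis using J by (simp only: layer_0 idl_pow_1)
next
  case (Suc l)
  have "layer B (Suc l) = (ideal_pow R Q l \<cdot> (a \<odot>\<^sub>s B)) <+> (ideal_pow R Q l \<cdot> (Q \<cdot> J))"
  proof -
    have "ideal_pow R Q l \<cdot> (a \<odot>\<^sub>s B) = a \<odot>\<^sub>s (ideal_pow R Q l \<cdot> B)"
      using ideal_prod_commute[OF Qw elt_mult_ideal[OF B(1) ac]] elt_mult_prod[OF B(1) Qw ac] ideal_prod_commute[OF B(1) Qw] by simp
    then show ?thesis unfolding layer_Suc idl_pow_Suc ideal_prod_assoc[OF Qw Qi J(1)] by simp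
  qed
  also have "\<dots> = ideal_pow R Q l \<cdot> ideal_pow R J 2"
    unfolding J2 by (rule ideal_prod_distr(1)[OF Qw elt_mult_ideal[OF B(1) ac] ideal_prod_is_ideal[OF Qi J(1)], symmetric])
  also have "\<dots> = ideal_pow R J (Suc (Suc l))"
  proof
    show "ideal_pow R Q l \<cdot> ideal_pow R J 2 \<subseteq> ideal_pow R J (Suc (Suc l))"
      using idl_prod_mono[OF idl_pow_mono[OF J(2), of l] subset_refl, of "ideal_pow R J 2"] idl_pow_add[OF J(1), of l 2] by simp
  qed (rule gen)
  finally show ?thesis using Suc by simp
qed

lemma layer_bottom: "layer J i = ideal_pow R Q i \<cdot> J"
proof (cases i)
  case 0
  then show ?thesis using J by (simp add: layer_0 idl_pow_0 carrier_prod)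
next
  case (Suc l)
  have "a \<odot>\<^sub>s (ideal_pow R Q l \<cdot> J) \<subseteq> ideal_pow R Q (Suc l) \<cdot> J"
    using a_mult_pow[OF J(1)] by (auto elim!: elt_multE simp del: nat_pow_Suc)
  then show ?thesis unfolding Suc layer_Suc
    using idl_sum_comm[OF elt_mult_ideal[OF Qwc[OF J(1)] ac] Qwc[OF J(1)], of l "Suc l"]
      idl_sum_absorb[OF Qwc[OF J(1)] elt_mult_ideal[OF Qwc[OF J(1)] ac]] by (simp only:)
qed

definition level :: "'a set \<Rightarrow> (nat \<Rightarrow> 'a) set" where
  "level \<bb> = {p \<in> carrier (UP R). \<forall>i. cf p i \<in> layer \<bb> i}"

lemma level_submodule:
  assumes "ideal \<bb> R" "J \<subseteq> \<bb>" "\<bb> \<subseteq> B"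
  shows "submodule (level \<bb>) (rees R Q) (sally_base J)"
  unfolding level_def
  by (rule sally_base_graded_submodule[OF Qi J layer_ideal[OF assms(1)]])
    (use layer_mono[OF assms(3)] layer_mult[OF assms(1,2)] layer_top in auto)

lemma level_top: "level B = rees_ext R J J"
  unfolding level_def layer_top using rees_ext_self_mem[OF J(1)] by blast

lemma level_bottom: "level J = rees_ext R Q J"
  unfolding level_def layer_bottom using rees_ext_eq[OF Qi J(1)] by blast

lemma level_mono: "\<bb> \<subseteq> \<bb>' \<Longrightarrow> level \<bb> \<subseteq> level \<bb>'"
  unfolding level_def using layer_mono by blast

section \<open>One simple step of the filtration\<close>

context
  fixes \<bb> \<bb>' :: "'a set" and \<beta> :: 'a
  assumes b: "ideal \<bb> R" "J \<subseteq> \<bb>" and b': "ideal \<bb>' R" "\<bb>' \<subseteq> B"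
    and \<beta>: "\<beta> \<in> \<bb>'" "\<beta> \<notin> \<bb>" "\<bb>' = \<bb> <+> (\<beta> \<odot>\<^sub>s carrier R)" "\<And>y. y \<in> \<mm> \<Longrightarrow> y \<otimes> \<beta> \<in> \<bb>"
begin

text \<open>The class of \<open>a\<beta>t\<close> generates \<open>level \<bb>'\<close> modulo
  \<open>level \<bb>\<close>; the facts below identify this quotient with
  \<open>\<T>/\<mm>\<T>\<close>.\<close>

definition gen_elt :: "nat \<Rightarrow> 'a" where "gen_elt = monom (UP R) (a \<otimes> \<beta>) 1"

lemma \<beta>c: "\<beta> \<in> carrier R" using idl_carr[OF b'(1) \<beta>(1)] .

lemma gen_elt_carr: "gen_elt \<in> carrier (UP R)"
  unfolding gen_elt_def using ac \<beta>c by simp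

text \<open>Forward, \<open>a\<close> cancels and the colon property puts the coefficients into
  \<open>Q^l(\<bb> : \<beta>)\<close>, where \<open>\<bb> : \<beta>\<close> is proper; backward,
  \<open>\<mm>\<beta> \<subseteq> \<bb>\<close>. So the annihilator of the generator modulo
  \<open>level \<bb>\<close> is exactly \<open>\<mm>\<T>\<close>.\<close>

lemma gen_elt_mult_level:
  assumes t: "t \<in> carrier (rees R Q)"
  shows "t \<otimes>\<^bsub>UP R\<^esub> gen_elt \<in> level \<bb> \<longleftrightarrow> t \<in> rees_ext R Q \<mm>"
proof -
  have tc: "t \<in> carrier (UP R)" "\<And>i. cf t i \<in> ideal_pow R Q i" using t by (auto simp: rees_mem)
  have cfS: "cf (t \<otimes>\<^bsub>UP R\<^esub> gen_elt) (Suc l) = a \<otimes> (cf t l \<otimes> \<beta>)" for l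
    using cf_mult_monom[OF tc(1), of "a \<otimes> \<beta>" 1 l] ac \<beta>c cf_carr[OF tc(1)] unfolding gen_elt_def by (simp add: m_lcomm)
  have cf0: "cf (t \<otimes>\<^bsub>UP R\<^esub> gen_elt) 0 = \<zero>"
    using cf_mult_monom_0[OF tc(1), of "a \<otimes> \<beta>" 0] ac \<beta>c unfolding gen_elt_def by simp
  have Qb: "Q \<subseteq> \<bb>" using J b by blast
  have key: "a \<otimes> (cf t l \<otimes> \<beta>) \<in> layer \<bb> (Suc l) \<longleftrightarrow> cf t l \<in> ideal_pow R Q l \<cdot> \<mm>" for l
  proof
    let ?x = "cf t l"
    have xc: "?x \<in> carrier R" using cf_carr[OF tc(1)] .
    assume "a \<otimes> (?x \<otimes> \<beta>) \<in> layer \<bb> (Suc l)"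
    then obtain y w where yw: "y \<in> ideal_pow R Q l \<cdot> \<bb>" "w \<in> ideal_pow R Q (Suc l) \<cdot> J" "a \<otimes> (?x \<otimes> \<beta>) = a \<otimes> y \<oplus> w"
      unfolding layer_Suc by (elim idl_sumE elt_multE) blast
    have c: "y \<in> carrier R" "w \<in> carrier R" using yw idl_carr[OF Qwc[OF b(1)]] idl_carr[OF Qwc[OF J(1)]] by blast+
    have "a \<otimes> (?x \<otimes> \<beta> \<ominus> y) = (a \<otimes> y \<oplus> w) \<ominus> a \<otimes> y" unfolding yw(3)[symmetric] using c xc ac \<beta>c by algebra
    also have "\<dots> = w" using c ac by algebra
    finally have "?x \<otimes> \<beta> \<ominus> y \<in> ideal_pow R Q l \<cdot> J" using mult_a_cancel[OF J(1,2), of "?x \<otimes> \<beta> \<ominus> y" l] yw c xc \<beta>c by simp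
    also have "\<dots> \<subseteq> ideal_pow R Q l \<cdot> \<bb>" by (intro idl_prod_mono subset_refl b)
    finally have "?x \<otimes> \<beta> \<in> ideal_pow R Q l \<cdot> \<bb>" using idl_diff_cancel[OF Qwc[OF b(1)] _ yw(1)] xc \<beta>c by simp
    then have "\<beta> \<otimes> ?x \<in> ideal_pow R Q l \<cdot> \<bb>" using xc \<beta>c by (simp add: m_comm)
    then have "?x \<in> ideal_pow R Q l \<cdot> colon \<bb> \<beta>" by (rule regular_ideal_pow_colon[OF rQ b(1) Qb \<beta>c tc(2)])
    moreover have "colon \<bb> \<beta> \<subseteq> \<mm>"
      by (rule proper_ideal_sub_max[OF colon_ideal[OF b(1) \<beta>c]]) (use \<beta> \<beta>c in \<open>simp add: colon_def\<close>)
    ultimately show "?x \<in> ideal_pow R Q l \<cdot> \<mm>" using idl_prod_mono[OF subset_refl] by blast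
  next
    let ?x = "cf t l"
    assume x: "?x \<in> ideal_pow R Q l \<cdot> \<mm>"
    have "ideal_pow R Q l \<cdot> \<mm> \<subseteq> colon (ideal_pow R Q l \<cdot> \<bb>) \<beta>"
    proof (rule idl_prod_least[OF colon_ideal[OF Qwc[OF b(1)] \<beta>c]])
      fix u v assume uv: "u \<in> ideal_pow R Q l" "v \<in> \<mm>"
      have c: "u \<in> carrier R" "v \<in> carrier R" using uv idl_carr[OF Qw] idl_carr[OF max_ideal] by blast+
      have "u \<otimes> (v \<otimes> \<beta>) \<in> ideal_pow R Q l \<cdot> \<bb>" using \<beta>(4)[OF uv(2)] uv(1) by (intro prod_in)
      also have "u \<otimes> (v \<otimes> \<beta>) = \<beta> \<otimes> (u \<otimes> v)" using c \<beta>c by algebra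
      finally show "u \<otimes> v \<in> colon (ideal_pow R Q l \<cdot> \<bb>) \<beta>" using c by (simp add: colon_def)
    qed
    then have "\<beta> \<otimes> ?x \<in> ideal_pow R Q l \<cdot> \<bb>" using x by (auto simp: colon_def)
    then have "?x \<otimes> \<beta> \<in> ideal_pow R Q l \<cdot> \<bb>" using cf_carr[OF tc(1)] \<beta>c by (simp add: m_comm)
    then show "a \<otimes> (?x \<otimes> \<beta>) \<in> layer \<bb> (Suc l)" by (rule layer_upper(1)[OF b(1)])
  qed
  have "t \<otimes>\<^bsub>UP R\<^esub> gen_elt \<in> level \<bb> \<longleftrightarrow> (\<forall>l. a \<otimes> (cf t l \<otimes> \<beta>) \<in> layer \<bb> (Suc l))"
  proof
    assume "t \<otimes>\<^bsub>UP R\<^esub> gen_elt \<in> level \<bb>"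
    then show "\<forall>l. a \<otimes> (cf t l \<otimes> \<beta>) \<in> layer \<bb> (Suc l)" unfolding level_def cfS[symmetric] by blast
  next
    assume *: "\<forall>l. a \<otimes> (cf t l \<otimes> \<beta>) \<in> layer \<bb> (Suc l)"
    have "cf (t \<otimes>\<^bsub>UP R\<^esub> gen_elt) i \<in> layer \<bb> i" for i
      using * idl_zero[OF layer_ideal[OF b(1), of 0]] by (cases i) (simp_all only: cf0 cfS)
    then show "t \<otimes>\<^bsub>UP R\<^esub> gen_elt \<in> level \<bb>" unfolding level_def using tc(1) gen_elt_carr by simp
  qed
  then show ?thesis unfolding key using mT_mem tc(1) by blast
qed

lemma gen_elt_level: "gen_elt \<in> level \<bb>'"
proof -
  have "cf gen_elt i \<in> layer \<bb>' i" for i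
  proof (cases "i = 1")
    case True
    have "\<beta> \<in> ideal_pow R Q 0 \<cdot> \<bb>'" using \<beta> b' by (simp add: idl_pow_0 carrier_prod)
    from layer_upper(1)[OF b'(1) this] show ?thesis using True ac \<beta>c unfolding gen_elt_def by simp
  next
    case False
    then show ?thesis using idl_zero[OF layer_ideal[OF b'(1)]] ac \<beta>c unfolding gen_elt_def by simp
  qed
  then show ?thesis unfolding level_def using gen_elt_carr by blast
qed

text \<open>Checked on monomials: \<open>Q^l\<bb>' = Q^l\<bb> + \<beta>Q^l\<close>, and
  \<open>a\<close> times the second summand is what the multiples of \<open>a\<beta>t\<close> supply
  in degree \<open>l + 1\<close>.\<close>

lemma level_decompose:
  assumes p: "p \<in> level \<bb>'"
  obtains t q where "t \<in> carrier (rees R Q)" "q \<in> level \<bb>" "p = t \<otimes>\<^bsub>UP R\<^esub> gen_elt \<oplus>\<^bsub>UP R\<^esub> q"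
proof -
  interpret T: cring "rees R Q" by (rule T_cring)
  interpret M: module "rees R Q" "ring_module (UP R)" by (rule ring_module_rees_module[OF Qi])
  have lb: "submodule (level \<bb>) (rees R Q) (ring_module (UP R))"
    unfolding level_def by (rule graded_submodule[where N = "layer \<bb>"]) (use Qi layer_ideal[OF b(1)] layer_mult[OF b] in auto)
  let ?H = "{t \<otimes>\<^bsub>UP R\<^esub> gen_elt \<oplus>\<^bsub>UP R\<^esub> q |t q. t \<in> carrier (rees R Q) \<and> q \<in> level \<bb>}"
  have H: "submodule ?H (rees R Q) (ring_module (UP R))" "level \<bb> \<subseteq> ?H"
    using M.submodule_adjoin(1,2)[OF lb, of gen_elt] gen_elt_carr by simp_all
  have pc: "p \<in> carrier (UP R)" "\<And>i. cf p i \<in> layer \<bb>' i" using p by (auto simp: level_def)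
  have "p \<in> ?H"
  proof (rule poly_mem_of_monoms[OF pc(1)])
    show "?H \<subseteq> carrier (UP R)" "\<zero>\<^bsub>UP R\<^esub> \<in> ?H" using M.submodule_sub[OF H(1)] M.submodule_zero[OF H(1)] by simp_all
    show "x \<oplus>\<^bsub>UP R\<^esub> y \<in> ?H" if "x \<in> ?H" "y \<in> ?H" for x y using M.submoduleE(5)[OF H(1) that] by simp
    fix i
    have lev: "monom (UP R) x i \<in> level \<bb>" if "x \<in> layer \<bb> i" for x i
      using that idl_carr[OF layer_ideal[OF b(1)] that] idl_zero[OF layer_ideal[OF b(1)]] unfolding level_def by simp
    show "monom (UP R) (cf p i) i \<in> ?H"
    proof (cases i)
      case 0
      then have "cf p i \<in> layer \<bb> i" using pc(2)[of i] by (simp add: layer_0)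
      then show ?thesis using lev H(2) by blast
    next
      case (Suc l)
      obtain u w where uw: "u \<in> ideal_pow R Q l \<cdot> \<bb>'" "w \<in> ideal_pow R Q (Suc l) \<cdot> J" "cf p i = a \<otimes> u \<oplus> w"
        using pc(2)[of i] unfolding Suc layer_Suc by (elim idl_sumE elt_multE) blast
      have \<beta>A: "ideal (\<beta> \<odot>\<^sub>s carrier R) R" by (rule principal_ideal[OF \<beta>c])
      have "ideal_pow R Q l \<cdot> \<bb>' = (ideal_pow R Q l \<cdot> \<bb>) <+> (\<beta> \<odot>\<^sub>s ideal_pow R Q l)"
        unfolding \<beta>(3) ideal_prod_distr(1)[OF Qw b(1) \<beta>A]
        using ideal_prod_commute[OF Qw \<beta>A] elt_mult_carrier_prod[OF Qw \<beta>c] by simp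
      then obtain v c where vc: "v \<in> ideal_pow R Q l \<cdot> \<bb>" "c \<in> ideal_pow R Q l" "u = v \<oplus> \<beta> \<otimes> c"
        using uw(1) by (auto elim!: idl_sumE elt_multE)
      have car: "v \<in> carrier R" "c \<in> carrier R" "w \<in> carrier R"
        using vc uw idl_carr[OF Qw] idl_carr[OF Qwc[OF b(1)]] idl_carr[OF Qwc[OF J(1)]] by blast+
      define x where "x = a \<otimes> v \<oplus> w"
      have x: "x \<in> layer \<bb> i" unfolding x_def Suc layer_Suc using vc uw by (intro idl_sumI elt_multI)
      have xc: "x \<in> carrier R" using idl_carr[OF layer_ideal[OF b(1)] x] .
      have eq: "cf p i = c \<otimes> (a \<otimes> \<beta>) \<oplus> x" unfolding uw(3) vc(3) x_def using car ac \<beta>c by algebra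
      have "monom (UP R) (cf p i) i = monom (UP R) (c \<otimes> (a \<otimes> \<beta>)) (l + 1) \<oplus>\<^bsub>UP R\<^esub> monom (UP R) x i"
        unfolding eq unfolding Suc using car xc ac \<beta>c by simp
      also have "monom (UP R) (c \<otimes> (a \<otimes> \<beta>)) (l + 1) = monom (UP R) c l \<otimes>\<^bsub>UP R\<^esub> gen_elt"
        unfolding gen_elt_def using P.monom_mult[of c "a \<otimes> \<beta>" l 1] car ac \<beta>c by simp
      finally have "monom (UP R) (cf p i) i = monom (UP R) c l \<otimes>\<^bsub>UP R\<^esub> gen_elt \<oplus>\<^bsub>UP R\<^esub> monom (UP R) x i" .
      moreover have "monom (UP R) c l \<in> carrier (rees R Q)" using vc car idl_zero[OF Qw] by (simp add: rees_mem)
      ultimately show ?thesis using lev[OF x] by blast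
    qed
  qed
  then show ?thesis using that by blast
qed

end

text \<open>A saturated submodule is determined by the steps of the filtration that it meets, because each
  step has rank one.\<close>

theorem sally_rank_eq: "sally_rank R \<mm> Q J = enat r"
proof -
  interpret T: cring "rees R Q" by (rule T_cring)
  interpret M: module "rees R Q" "sally_base J" by (rule sally_base_module(2)[OF Qi J])
  define S where "S = carrier (rees R Q) - rees_ext R Q \<mm>"
  have Sc: "s \<in> carrier (rees R Q)" "s \<in> carrier (UP R)" if "s \<in> S" for s using that by (auto simp: S_def rees_mem)
  have U: "submodule (rees_ext R Q J) (rees R Q) (sally_base J)" by (rule sally_sub_submodule[OF Qi J])
  let ?L = "{Z. submodule Z (rees R Q) (sally_base J) \<and> rees_ext R Q J \<subseteq> Z \<and>
    (\<forall>s\<in>S. \<forall>x\<in>carrier (sally_base J). s \<odot>\<^bsub>sally_base J\<^esub> x \<in> Z \<longrightarrow> x \<in> Z)}"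
  have rank: "sally_rank R \<mm> Q J = chain_length ?L"
    unfolding sally_rank_def Let_def S_def[symmetric] sally_eq
    by (rule M.length_localized_quot[OF U])
      (use complement_mult one_complement in \<open>auto simp: S_def\<close>)
  obtain b where b: "b 0 = J" "b r = B" "\<forall>i\<le>r. ideal (b i) R \<and> J \<subseteq> b i"
    "\<forall>i<r. b i \<subset> b (Suc i) \<and> len R (b (Suc i)) (b i) \<le> 1" using length_filtration[OF J(1) B lenB] by blast
  have bi: "ideal (b i) R" "J \<subseteq> b i" "b i \<subseteq> B" if "i \<le> r" for i
    using b that chain_mono[of r b i r] by auto
  have "\<exists>\<beta>. i < r \<longrightarrow> \<beta> \<in> b (Suc i) \<and> \<beta> \<notin> b i" for i using b(4) by blast
  then obtain \<beta> where \<beta>: "\<And>i. i < r \<Longrightarrow> \<beta> i \<in> b (Suc i) \<and> \<beta> i \<notin> b i" by metis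
  have step: "ideal (b i) R" "J \<subseteq> b i" "ideal (b (Suc i)) R" "b (Suc i) \<subseteq> B" "\<beta> i \<in> b (Suc i)" "\<beta> i \<notin> b i"
    "b (Suc i) = b i <+> (\<beta> i \<odot>\<^sub>s carrier R)" "\<And>y. y \<in> \<mm> \<Longrightarrow> y \<otimes> \<beta> i \<in> b i" if i: "i < r" for i
    using i bi[of i] bi[of "Suc i"] \<beta>[OF i] simple_step[of "b (Suc i)" "b i" "\<beta> i"] b(4) by auto
  define g where "g i = gen_elt (\<beta> i)" for i
  have g: "g i \<in> carrier (UP R)" if "i < r" for i unfolding g_def by (rule gen_elt_carr[OF step[OF that]])
  have gl: "t \<otimes>\<^bsub>UP R\<^esub> g i \<in> level (b i) \<longleftrightarrow> t \<in> rees_ext R Q \<mm>" if "i < r" "t \<in> carrier (rees R Q)" for i t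
    unfolding g_def by (rule gen_elt_mult_level[OF step[OF that(1)] that(2)])
  have gS: "g i \<in> level (b (Suc i))" if "i < r" for i unfolding g_def by (rule gen_elt_level[OF step[OF that]])
  have dec: "\<exists>t q. t \<in> carrier (rees R Q) \<and> q \<in> level (b i) \<and> p = t \<otimes>\<^bsub>UP R\<^esub> g i \<oplus>\<^bsub>UP R\<^esub> q" if "i < r" "p \<in> level (b (Suc i))" for i p
    using level_decompose[OF step[OF that(1)] that(2)] unfolding g_def by metis
  have lev: "submodule (level (b i)) (rees R Q) (sally_base J)" if "i \<le> r" for i by (rule level_submodule[OF bi[OF that]])
  have lev_add: "x \<oplus>\<^bsub>UP R\<^esub> y \<in> level (b i)" if "i \<le> r" "x \<in> level (b i)" "y \<in> level (b i)" for i x y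
    using M.submoduleE(5)[OF lev[OF that(1)] that(2,3)] by simp
  have lev_mult: "t \<otimes>\<^bsub>UP R\<^esub> y \<in> level (b i)" if "i \<le> r" "t \<in> carrier (rees R Q)" "y \<in> level (b i)" for i t y
    using M.submoduleE(4)[OF lev[OF that(1)] that(2,3)] by simp
  have lc: "x \<in> carrier (UP R)" if "x \<in> level \<bb>" for x \<bb> using that by (simp add: level_def)
  have lm: "level (b i) \<subseteq> level (b j)" if "i \<le> j" "j \<le> r" for i j
    using level_mono[OF chain_mono[of r b i j]] b(4) that by blast
  \<comment> \<open>Saturation of each level, descending one step at a time: if \<open>s x\<close>
    falls into the lower level then \<open>s t \<in> \<mm>\<T>\<close>; as \<open>\<mm>\<T>\<close>
    is prime and \<open>s\<close> is outside it, \<open>t\<close> lies in it and \<open>x\<close>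
    drops one level.\<close>
  have S_level: "x \<in> level (b i)" if s: "s \<in> S" "i + k \<le> r" "x \<in> level (b (i + k))" "s \<otimes>\<^bsub>UP R\<^esub> x \<in> level (b i)" for s i k x
    using s(2-4)
  proof (induction k)
    case (Suc k)
    let ?j = "i + k"
    have j: "?j < r" using Suc.prems by simp
    obtain t q where tq: "t \<in> carrier (rees R Q)" "q \<in> level (b ?j)" "x = t \<otimes>\<^bsub>UP R\<^esub> g ?j \<oplus>\<^bsub>UP R\<^esub> q"
      using dec[OF j, of x] Suc.prems by auto
    have tc: "t \<in> carrier (UP R)" using tq by (simp add: rees_mem)
    note c = tc g[OF j] lc[OF tq(2)] Sc(2)[OF s(1)]
    have "s \<otimes>\<^bsub>UP R\<^esub> x \<in> level (b ?j)" using Suc.prems(3) lm[of i ?j] j by auto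
    moreover have "(\<ominus>\<^bsub>rees R Q\<^esub> s) \<in> carrier (rees R Q)" using Sc(1)[OF s(1)] by simp
    \<comment> \<open>The Rees algebra inherits the operations of the polynomial ring, but its
      negatives are described over its own carrier, so the two have to be identified.\<close>
    moreover have ms: "\<ominus>\<^bsub>rees R Q\<^esub> s = \<ominus>\<^bsub>UP R\<^esub> s"
    proof (rule P.P.minus_equality[symmetric])
      show "\<ominus>\<^bsub>rees R Q\<^esub> s \<oplus>\<^bsub>UP R\<^esub> s = \<zero>\<^bsub>UP R\<^esub>" using T.l_neg[OF Sc(1)[OF s(1)]] by simp
      show "\<ominus>\<^bsub>rees R Q\<^esub> s \<in> carrier (UP R)" using T.a_inv_closed[OF Sc(1)[OF s(1)]] by (simp add: rees_mem)
    qed (rule c(4))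
    ultimately have "s \<otimes>\<^bsub>UP R\<^esub> x \<oplus>\<^bsub>UP R\<^esub> (\<ominus>\<^bsub>UP R\<^esub> s) \<otimes>\<^bsub>UP R\<^esub> q \<in> level (b ?j)"
      using lev_mult[of ?j "\<ominus>\<^bsub>UP R\<^esub> s" q] lev_add[of ?j] tq(2) j by simp
    also have "s \<otimes>\<^bsub>UP R\<^esub> x \<oplus>\<^bsub>UP R\<^esub> (\<ominus>\<^bsub>UP R\<^esub> s) \<otimes>\<^bsub>UP R\<^esub> q = (s \<otimes>\<^bsub>UP R\<^esub> t) \<otimes>\<^bsub>UP R\<^esub> g ?j"
      unfolding tq(3) using c by algebra
    finally have "s \<otimes>\<^bsub>UP R\<^esub> t \<in> rees_ext R Q \<mm>" using gl[OF j, of "s \<otimes>\<^bsub>UP R\<^esub> t"] T.m_closed[OF Sc(1)[OF s(1)] tq(1)] by simp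
    then have "t \<in> rees_ext R Q \<mm>" using complement_mult[of s t] s(1) tq(1) unfolding S_def by auto
    then have "t \<otimes>\<^bsub>UP R\<^esub> g ?j \<in> level (b ?j)" using gl[OF j tq(1)] by simp
    then have "x \<in> level (b ?j)" unfolding tq(3) using lev_add[of ?j] tq(2) j by simp
    then show ?case using Suc.IH Suc.prems j by simp
  qed simp
  have "chain_length ?L \<le> enat r"
  proof (rule chain_length_le)
    fix n C assume C: "\<forall>i\<le>n. C i \<in> ?L" "\<forall>i<n. C i \<subset> C (Suc i)"
    \<comment> \<open>The steps of the filtration that \<open>Z\<close> meets. A strict chain of
      saturated submodules gives a strict chain of subsets of \<open>{..<r}\<close>, hence has at
      most \<open>r\<close> steps.\<close>
    define idx where "idx Z = {i. i < r \<and> \<not> Z \<inter> level (b (Suc i)) \<subseteq> level (b i)}" for Z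
    have idx_mono: "idx Y \<subseteq> idx Z" if "Y \<subseteq> Z" for Y Z using that unfolding idx_def by blast
    have det: "Z \<subseteq> Y" if YZ: "Y \<in> ?L" "Z \<in> ?L" "Y \<subseteq> Z" "idx Z \<subseteq> idx Y" for Y Z
    proof -
      have Ys: "submodule Y (rees R Q) (sally_base J)" "rees_ext R Q J \<subseteq> Y" and Zs: "submodule Z (rees R Q) (sally_base J)" using YZ by auto
      have "Z \<inter> level (b i) \<subseteq> Y" if "i \<le> r" for i
        using that
      proof (induction i)
        case 0
        then show ?case using Ys(2) level_bottom b(1) by auto
      next
        case (Suc i)
        have i: "i < r" using Suc.prems by simp
        have IH: "Z \<inter> level (b i) \<subseteq> Y" using Suc by simp
        show ?case
        proof
          fix z assume z: "z \<in> Z \<inter> level (b (Suc i))"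
          show "z \<in> Y"
          proof (cases "z \<in> level (b i)")
            case True
            then show ?thesis using IH z by blast
          next
            case False
            then have "i \<in> idx Z" unfolding idx_def using z i by blast
            then have "i \<in> idx Y" using YZ(4) by blast
            then obtain y where y: "y \<in> Y" "y \<in> level (b (Suc i))" "y \<notin> level (b i)" unfolding idx_def by blast
            obtain t q where tq: "t \<in> carrier (rees R Q)" "q \<in> level (b i)" "y = t \<otimes>\<^bsub>UP R\<^esub> g i \<oplus>\<^bsub>UP R\<^esub> q" using dec[OF i y(2)] by blast
            obtain t' q' where tq': "t' \<in> carrier (rees R Q)" "q' \<in> level (b i)" "z = t' \<otimes>\<^bsub>UP R\<^esub> g i \<oplus>\<^bsub>UP R\<^esub> q'" using dec[OF i, of z] z by blast
            have "t \<notin> rees_ext R Q \<mm>"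
            proof
              assume "t \<in> rees_ext R Q \<mm>"
              then have "t \<otimes>\<^bsub>UP R\<^esub> g i \<in> level (b i)" using gl[OF i tq(1)] by simp
              then show False using y(3) lev_add[of i] i tq by simp
            qed
            then have tS: "t \<in> S" using tq by (simp add: S_def)
            have tc: "t \<in> carrier (UP R)" "t' \<in> carrier (UP R)" using tq tq' by (simp_all add: rees_mem)
            note c = tc g[OF i] lc[OF tq(2)] lc[OF tq'(2)]
            have mt: "\<ominus>\<^bsub>rees R Q\<^esub> t' = \<ominus>\<^bsub>UP R\<^esub> t'"
            proof (rule P.P.minus_equality[symmetric])
              show "\<ominus>\<^bsub>rees R Q\<^esub> t' \<oplus>\<^bsub>UP R\<^esub> t' = \<zero>\<^bsub>UP R\<^esub>" using T.l_neg[OF tq'(1)] by simp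
              show "\<ominus>\<^bsub>rees R Q\<^esub> t' \<in> carrier (UP R)" using T.a_inv_closed[OF tq'(1)] by (simp add: rees_mem)
            qed (rule tc(2))
            have mtc: "\<ominus>\<^bsub>UP R\<^esub> t' \<in> carrier (rees R Q)" using T.a_inv_closed[OF tq'(1)] mt by simp
            \<comment> \<open>Cross-multiplication removes the generator \<open>g i\<close>, so
              \<open>w\<close> lies in \<open>Z\<close> one level down and hence in
              \<open>Y\<close>; then \<open>t z \<in> Y\<close> with \<open>t\<close> outside
              \<open>\<mm>\<T>\<close>, and saturation of \<open>Y\<close> gives
              \<open>z \<in> Y\<close>.\<close>
            define w where "w = t \<otimes>\<^bsub>UP R\<^esub> z \<oplus>\<^bsub>UP R\<^esub> (\<ominus>\<^bsub>UP R\<^esub> t') \<otimes>\<^bsub>UP R\<^esub> y"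
            have "w = t \<otimes>\<^bsub>UP R\<^esub> q' \<oplus>\<^bsub>UP R\<^esub> (\<ominus>\<^bsub>UP R\<^esub> t') \<otimes>\<^bsub>UP R\<^esub> q"
              unfolding w_def tq(3) tq'(3) using c by algebra
            moreover have "\<dots> \<in> level (b i)" using lev_add[of i] lev_mult[of i] i tq tq' mtc by simp
            ultimately have "w \<in> level (b i)" by simp
            moreover have "w \<in> Z"
            proof -
              have "t \<otimes>\<^bsub>UP R\<^esub> z \<in> Z" using M.submoduleE(4)[OF Zs tq(1), of z] z by simp
              moreover have "(\<ominus>\<^bsub>UP R\<^esub> t') \<otimes>\<^bsub>UP R\<^esub> y \<in> Z" using M.submoduleE(4)[OF Zs mtc, of y] y YZ(3) by auto
              ultimately show ?thesis using M.submoduleE(5)[OF Zs] unfolding w_def by simp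
            qed
            ultimately have wY: "w \<in> Y" using IH by blast
            have "t' \<otimes>\<^bsub>UP R\<^esub> y \<in> Y" using M.submoduleE(4)[OF Ys(1) tq'(1) y(1)] by simp
            then have "w \<oplus>\<^bsub>UP R\<^esub> t' \<otimes>\<^bsub>UP R\<^esub> y \<in> Y" using M.submoduleE(5)[OF Ys(1) wY] by simp
            also have "w \<oplus>\<^bsub>UP R\<^esub> t' \<otimes>\<^bsub>UP R\<^esub> y = t \<otimes>\<^bsub>UP R\<^esub> z"
            proof -
              have zc: "z \<in> carrier (UP R)" using z lc by blast
              show ?thesis unfolding w_def using tc lc[OF y(2)] zc by algebra
            qed
            finally have "t \<odot>\<^bsub>sally_base J\<^esub> z \<in> Y" by simp
            moreover have "z \<in> carrier (sally_base J)" using z M.submodule_carr[OF Zs] by blast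
            ultimately show "z \<in> Y" using YZ(1) tS by blast
          qed
        qed
      qed
      from this[of r] have "Z \<inter> rees_ext R J J \<subseteq> Y" using level_top b(2) by simp
      then show ?thesis using M.submodule_sub[OF Zs] by auto
    qed
    have fin: "finite (idx Z)" "card (idx Z) \<le> r" for Z
    proof -
      have "idx Z \<subseteq> {..<r}" by (auto simp: idx_def)
      then show "finite (idx Z)" "card (idx Z) \<le> r" using finite_subset card_mono[of "{..<r}"] by auto
    qed
    have "i \<le> card (idx (C i))" if "i \<le> n" for i
      using that
    proof (induction i)
      case (Suc i)
      have "C i \<in> ?L" "C (Suc i) \<in> ?L" using C(1) Suc.prems by (simp_all only: Suc_leD)
      moreover have "C i \<subset> C (Suc i)" using C Suc.prems by simp
      ultimately have "idx (C i) \<subset> idx (C (Suc i))" using idx_mono[of "C i" "C (Suc i)"] det[of "C i" "C (Suc i)"] by blast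
      then have "card (idx (C i)) < card (idx (C (Suc i)))" using fin by (intro psubset_card_mono)
      then show ?case using Suc by simp
    qed simp
    from this[of n] fin(2)[of "C n"] show "enat n \<le> enat r" by simp
  qed
  moreover have "enat r \<le> chain_length ?L"
  proof (rule chain_length_ge[where N = "\<lambda>i. level (b i)"])
    show "\<forall>i\<le>r. level (b i) \<in> ?L"
    proof (intro allI impI CollectI conjI ballI)
      fix i assume i: "i \<le> r"
      show "submodule (level (b i)) (rees R Q) (sally_base J)" by (rule lev[OF i])
      show "rees_ext R Q J \<subseteq> level (b i)" using lm[of 0 i] i b(1) level_bottom by simp
      fix s x assume s: "s \<in> S" and x: "x \<in> carrier (sally_base J)" and sx: "s \<odot>\<^bsub>sally_base J\<^esub> x \<in> level (b i)"
      have "x \<in> level (b (i + (r - i)))" using x i b(2) level_top by simp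
      then show "x \<in> level (b i)" using S_level[OF s, of i "r - i" x] sx i by simp
    qed
    show "\<forall>i<r. level (b i) \<subset> level (b (Suc i))"
    proof (intro allI impI psubsetI)
      fix i assume i: "i < r"
      show "level (b i) \<subseteq> level (b (Suc i))" using lm[of i "Suc i"] i by simp
      have "\<one>\<^bsub>UP R\<^esub> \<otimes>\<^bsub>UP R\<^esub> g i \<notin> level (b i)" using gl[OF i, of "\<one>\<^bsub>UP R\<^esub>"] one_complement by simp
      then have "g i \<notin> level (b i)" using g[OF i] by simp
      then show "level (b i) \<noteq> level (b (Suc i))" using gS[OF i] by blast
    qed
  qed
  ultimately show ?thesis unfolding rank by (rule antisym)
qed

end

section \<open>The Hilbert function\<close>

context sally_setup begin

text \<open>\<open>Q\<close> has \<open>e + 1\<close> generators, hence as many monomials of degree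
  \<open>l\<close> as the binomial says.\<close>

lemma len_Q_pow_prod:
  assumes "ideal \<cc> R" "Q \<subseteq> \<cc>" "len R (carrier R) \<cc> = enat m"
  shows "len R (ideal_pow R Q l) (ideal_pow R Q l \<cdot> \<cc>) = enat (m * ((l + e) choose e))"
  using len_regular_pow[OF rQ assms, of l] binomial_symmetric[of l "l + e"] by simp

text \<open>The lengths of \<open>Q^i/Q^(i+1)\<close> for \<open>i < l\<close> are added up by
  Pascal's rule.\<close>

lemma len_Q_pow:
  assumes "len R (carrier R) Q = enat q"
  shows "len R (carrier R) (ideal_pow R Q l) = enat (q * ((l + e) choose Suc e))"
proof (induction l)
  case 0
  then show ?case using len_0_iff[OF oneideal oneideal] by (simp add: idl_pow_0 zero_enat_def)
next
  case (Suc l)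
  have sub: "ideal_pow R Q l \<cdot> Q \<subseteq> ideal_pow R Q l" by (rule idl_prod_sub(1)[OF Qw Qi])
  have "len R (carrier R) (ideal_pow R Q l \<cdot> Q) = enat (q * ((l + e) choose Suc e)) + enat (q * ((l + e) choose e))"
    unfolding len_add[OF oneideal Qw Qwc[OF Qi] sub idl_sub[OF Qw]] Suc len_Q_pow_prod[OF Qi subset_refl assms] ..
  then show ?case unfolding idl_pow_Suc by (simp add: algebra_simps)
qed

text \<open>With \<open>l = t + 1\<close> and \<open>W = Q^l J\<close>, the length of
  \<open>R/W\<close> is known from the powers of \<open>Q\<close>, and \<open>J^(l+1)/W\<close> is
  isomorphic to \<open>Q^tB/Q^tJ\<close> by multiplication by \<open>a\<close>, of length
  \<open>r\<close> times a binomial. The length sought is the difference.\<close>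

lemma len_J_pow:
  assumes q: "len R (carrier R) Q = enat q" and c: "len R (carrier R) J = enat c"
  obtains k where "len R (carrier R) (ideal_pow R J (Suc l)) = enat k"
    "int k = int q * int ((l + Suc e) choose Suc e) - (int q - int c + int r) * int ((l + e) choose e)
      + int r * int (binom_minus2 (Suc e) l)"
proof (cases l)
  \<comment> \<open>For \<open>l = 0\<close> the formula reduces to
    \<open>q - (q - c + r) + r = c\<close>; this is where \<open>binom_minus2\<close> must be 1 at
    \<open>l = 0\<close>, also in dimension one.\<close>
  case 0
  have "ideal_pow R J (Suc l) = J" unfolding 0 by (rule idl_pow_1[OF J(1)])
  then have "len R (carrier R) (ideal_pow R J (Suc l)) = enat c" using c by metis
  then show ?thesis by (rule that) (simp add: 0 binom_minus2_def)
next
  case (Suc t)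
  let ?W = "ideal_pow R Q (Suc t) \<cdot> J" and ?X = "ideal_pow R Q t \<cdot> B" and ?Y = "ideal_pow R Q t \<cdot> J"
  note W = Qwc[OF J(1), of "Suc t"] and X = Qwc[OF B(1), of t] and Y = Qwc[OF J(1), of t]
  have Jp: "ideal (ideal_pow R J (Suc l)) R" by (rule idl_pow_ideal[OF J(1)])
  have "len R (carrier R) J = len R (carrier R) B + len R B J"
    by (rule len_add[OF oneideal B(1) J(1) B(2) idl_sub[OF B(1)]])
  then obtain s where s: "len R (carrier R) B = enat s" "c = s + r"
    unfolding c lenB by (cases "len R (carrier R) B") auto
  have "?X \<inter> colon ?W a = ?Y"
  proof
    show "?X \<inter> colon ?W a \<subseteq> ?Y"
      using mult_a_cancel[OF J(1,2), of _ t] by (auto simp: colon_def simp del: nat_pow_Suc)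
    show "?Y \<subseteq> ?X \<inter> colon ?W a"
      using a_mult_pow[OF J(1), of _ t] idl_prod_mono[OF subset_refl B(2), of "ideal_pow R Q t"] idl_carr[OF Y]
      by (auto simp: colon_def simp del: nat_pow_Suc)
  qed
  then have JW: "len R (ideal_pow R J (Suc l)) ?W = len R ?X ?Y"
    using len_mult[OF X W ac] unfolding layer_top[symmetric] Suc layer_Suc by (simp only:)
  have XQ: "?X \<subseteq> ideal_pow R Q t" by (rule idl_prod_sub(1)[OF Qw B(1)])
  have YX: "?Y \<subseteq> ?X" by (rule idl_prod_mono[OF subset_refl B(2)])
  have WQ: "?W \<subseteq> ideal_pow R Q (Suc t)" by (rule idl_prod_sub(1)[OF Qw J(1)])
  have WJ: "?W \<subseteq> ideal_pow R J (Suc l)" unfolding layer_top[symmetric] Suc by (rule layer_upper(2)[OF B(1)])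
  have QB: "Q \<subseteq> B" using J(2) B(2) by blast
  have "len R (ideal_pow R Q t) ?Y = len R (ideal_pow R Q t) ?X + len R ?X ?Y" by (rule len_add[OF Qw X Y YX XQ])
  then have XY: "len R ?X ?Y = enat (r * ((t + e) choose e))"
    unfolding len_Q_pow_prod[OF J c] len_Q_pow_prod[OF B(1) QB s(1)] s(2)
    by (cases "len R ?X ?Y") (auto simp: algebra_simps)
  have "len R (carrier R) ?W = len R (carrier R) (ideal_pow R Q (Suc t)) + len R (ideal_pow R Q (Suc t)) ?W"
    by (rule len_add[OF oneideal Qw W WQ idl_sub[OF Qw]])
  also have "\<dots> = enat (q * ((Suc t + e) choose Suc e) + c * ((Suc t + e) choose e))"
    unfolding len_Q_pow[OF q] len_Q_pow_prod[OF J c] by simp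
  finally have "enat (q * ((Suc t + e) choose Suc e) + c * ((Suc t + e) choose e)) =
    len R (carrier R) (ideal_pow R J (Suc l)) + enat (r * ((t + e) choose e))"
    unfolding len_add[OF oneideal Jp W WJ idl_sub[OF Jp]] JW XY by simp
  then obtain k where k: "len R (carrier R) (ideal_pow R J (Suc l)) = enat k"
    "q * ((Suc t + e) choose Suc e) + c * ((Suc t + e) choose e) = k + r * ((t + e) choose e)"
    by (cases "len R (carrier R) (ideal_pow R J (Suc l))") auto
  \<comment> \<open>Pascal's rule; for \<open>e = 0\<close> both binomials are 1 and the convention
    makes \<open>binom_minus2\<close> vanish at positive arguments.\<close>
  have "(Suc t + e) choose e = ((t + e) choose e) + binom_minus2 (Suc e) (Suc t)"
    by (cases e) (simp_all add: binom_minus2_def)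
  then have bm: "int (binom_minus2 (Suc e) (Suc t)) = int ((Suc t + e) choose e) - int ((t + e) choose e)" by linarith
  have ch: "int ((Suc t + Suc e) choose Suc e) = int ((Suc t + e) choose Suc e) + int ((Suc t + e) choose e)" by simp
  have ik: "int k = int q * int ((Suc t + e) choose Suc e) + int c * int ((Suc t + e) choose e) - int r * int ((t + e) choose e)"
    using arg_cong[OF k(2), of int] by (simp only: of_nat_add of_nat_mult)
  have ring: "\<And>q c r x y z :: int. q * y + c * x - r * z = q * (y + x) - (q - c + r) * x + r * (x - z)"
    by (simp add: algebra_simps)
  show ?thesis by (rule that[OF k(1)]) (unfold ik Suc ch bm, rule ring)
qed

end

text \<open>Taking first differences lowers \<open>d\<close> and kills the constant last term, so
  induction gives \<open>f i = 0\<close> for all \<open>i\<close> except the last; what is left of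
  the sum is then that coefficient.\<close>

lemma binomial_combination_unique:
  fixes f :: "nat \<Rightarrow> int"
  assumes "\<And>m. m0 \<le> m \<Longrightarrow> (\<Sum>i\<le>d. f i * int ((m + d - i) choose (d - i))) = 0" "i \<le> d"
  shows "f i = 0"
  using assms
proof (induction d arbitrary: m0 i)
  case 0
  then show ?case using "0.prems"(1)[of m0] by simp
next
  case (Suc d)
  let ?s = "\<lambda>m. \<Sum>i\<le>Suc d. f i * int ((m + Suc d - i) choose (Suc d - i))"
  have IH: "f i = 0" if i: "i \<le> d" for i
  proof (rule Suc.IH[OF _ i])
    fix m assume m: "Suc m0 \<le> m"
    then obtain m' where m': "m = Suc m'" "m0 \<le> m'" by (cases m) auto
    have "int ((Suc m' + Suc d - i) choose (Suc d - i)) - int ((m' + Suc d - i) choose (Suc d - i)) =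
      int ((m + d - i) choose (d - i))" if "i \<le> d" for i
      using that m' by (simp add: Suc_diff_le)
    then have "?s (Suc m') - ?s m' = (\<Sum>i\<le>d. f i * int ((m + d - i) choose (d - i)))"
      by (simp add: sum_subtractf[symmetric] right_diff_distrib[symmetric])
    then show "(\<Sum>i\<le>d. f i * int ((m + d - i) choose (d - i))) = 0"
      using Suc.prems(1)[of m'] Suc.prems(1)[of "Suc m'"] m' by simp
  qed
  then have "?s m0 = f (Suc d)" by simp
  then have "f (Suc d) = 0" using Suc.prems(1)[of m0] by simp
  then show ?case using IH Suc.prems(2) le_Suc_eq by blast
qed

text \<open>Uniqueness of the coefficients is what makes the description in
  \<open>hilbert_coeff\<close> denote.\<close>

lemma hilbert_coeff_eq:
  fixes A :: "('a, 'k) ring_scheme"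
  assumes dim: "krull_dim A = enat d" and h0: "\<And>i. d < i \<Longrightarrow> h i = 0"
    and h: "\<And>m. m0 \<le> m \<Longrightarrow> \<exists>k. quot_length A (ideal_pow A J (m + 1)) = enat k \<and>
      int k = (\<Sum>i\<le>d. (-1) ^ i * h i * int ((m + d - i) choose (d - i)))"
  shows "hilbert_coeff A J = h"
  unfolding hilbert_coeff_def Let_def dim the_enat.simps
proof (rule the_equality)
  show "(\<forall>i>d. h i = 0) \<and> (\<exists>m0. \<forall>m\<ge>m0. \<exists>k. quot_length A (ideal_pow A J (m + 1)) = enat k \<and>
      int k = (\<Sum>i\<le>d. (-1) ^ i * h i * int ((m + d - i) choose (d - i))))" using h0 h by blast
next
  fix g assume g: "(\<forall>i>d. g i = 0) \<and> (\<exists>m0. \<forall>m\<ge>m0. \<exists>k. quot_length A (ideal_pow A J (m + 1)) = enat k \<and>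
      int k = (\<Sum>i\<le>d. (-1) ^ i * g i * int ((m + d - i) choose (d - i))))"
  then obtain m1 where m1: "\<And>m. m1 \<le> m \<Longrightarrow> \<exists>k. quot_length A (ideal_pow A J (m + 1)) = enat k \<and>
      int k = (\<Sum>i\<le>d. (-1) ^ i * g i * int ((m + d - i) choose (d - i)))" by blast
  have "(\<Sum>i\<le>d. ((-1) ^ i * (g i - h i)) * int ((m + d - i) choose (d - i))) = 0" if m: "max m0 m1 \<le> m" for m
  proof -
    have "(\<Sum>i\<le>d. (-1) ^ i * g i * int ((m + d - i) choose (d - i))) = (\<Sum>i\<le>d. (-1) ^ i * h i * int ((m + d - i) choose (d - i)))"
      using h[of m] m1[of m] m by auto
    then show ?thesis by (simp add: left_diff_distrib right_diff_distrib sum_subtractf)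
  qed
  then have "(-1) ^ i * (g i - h i) = 0" if "i \<le> d" for i
    using binomial_combination_unique[where f = "\<lambda>i. (-1) ^ i * (g i - h i)"] that by blast
  then have "g i = h i" for i using g h0[of i] by (cases "i \<le> d") auto
  then show "g = h" by blast
qed

theorem corollary10p9:
  fixes A :: "('a, 'k) ring_scheme" and K :: "('a, 'b, 'm) module_scheme"
    and \<mm> I Q J :: "'a set" and d n :: nat
  assumes "cohen_macaulay_local A \<mm>" and "krull_dim A = enat d" and "d > 0"
    and "canonical_module A \<mm> K" and "canonical_ideal A K I"
    and "n \<ge> 1"
    and "parameter_ideal A \<mm> Q" and "sharp A \<mm> I Q"
    and "J = I <+>\<^bsub>A\<^esub> Q"
    and "goto_ring A \<mm> I Q n"
  shows "(\<forall>l :: nat.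
            quot_length A (ideal_pow A J (l + 1)) \<noteq> \<infinity> \<and>
            int (the_enat (quot_length A (ideal_pow A J (l + 1)))) =
              hilbert_coeff A J 0 * int ((l + d) choose d)
              - (hilbert_coeff A J 0 - int (the_enat (quot_length A J)) + int n)
                  * int ((l + d - 1) choose (d - 1))
              + int n * int (binom_minus2 d l)) \<and>
         (d \<ge> 2 \<longrightarrow> hilbert_coeff A J 2 = int n) \<and>
         (d \<ge> 3 \<longrightarrow> (\<forall>i. 3 \<le> i \<and> i \<le> d \<longrightarrow> hilbert_coeff A J i = 0))"
proof -
  obtain e where d: "d = Suc e" using assms(3) by (cases d) auto
  have local: "cring A" "noeth_local A \<mm>"
    using assms(1) by (auto simp: cohen_macaulay_local_def noetherian_local_def noeth_local_def noeth_local_axioms_def)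
  interpret poly_cring A by (rule poly_cring.intro[OF local(1)])
  interpret N: noeth_local A \<mm> by (rule local(2))
  have I: "ideal I A" "I \<noteq> carrier A" using assms(5) by (auto simp: canonical_ideal_def)
  have Qm: "Q \<subseteq> \<mm>" and Q: "ideal Q A"
  proof -
    obtain as where as: "set as \<subseteq> \<mm>" "Q = Idl\<^bsub>A\<^esub> (set as)"
      using assms(7) by (auto simp: parameter_ideal_def system_of_parameters_def)
    show "Q \<subseteq> \<mm>" unfolding as(2) by (rule genideal_minimal[OF N.max_ideal as(1)])
    show "ideal Q A" unfolding as(2) by (rule genideal_ideal) (use as(1) idl_sub[OF N.max_ideal] in blast)
  qed
  have J: "ideal J A" "Q \<subseteq> J" unfolding assms(9) by (intro add_ideals I(1) Q, rule idl_sum_upper(2)[OF I(1) Q])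
  have "I \<subseteq> \<mm>" using N.proper_ideal_sub_max[OF I(1)] ideal.one_imp_carrier[OF I(1)] I(2) by blast
  then have Jm: "J \<subseteq> \<mm>" unfolding assms(9) by (rule idl_sum_least[OF N.max_ideal _ Qm])
  have goto: "carrier (sally A Q J) = submod_span (rees A Q) (sally A Q J) (sally_component A Q J 1)"
    "sally_rank A \<mm> Q J = enat n" using assms(10) unfolding goto_ring_def Let_def assms(9) by blast+
  have gen: "ideal_pow A J (Suc (Suc l)) \<subseteq> ideal_prod A (ideal_pow A Q l) (ideal_pow A J 2)" for l
    by (rule sally_generated_degree_one[OF Q J goto(1)])
  \<comment> \<open>Generation in degree one, read in degree two of the Sally module.\<close>
  have "ideal_pow A J 3 \<subseteq> ideal_prod A Q (ideal_pow A J 2)"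
    using gen[of 1] idl_pow_1[OF Q] by (simp only: numeral_3_eq_3 One_nat_def)
  then obtain P a k where s: "regular_ideal e P" "regular_mod P a" "Q = P <+>\<^bsub>A\<^esub> elt_mult a (carrier A)"
    "ideal_pow A \<mm> k \<subseteq> Q" "ideal_pow A J 2 = elt_mult a (colon (ideal_pow A J 2) a) <+>\<^bsub>A\<^esub> ideal_prod A Q J"
    "J \<subseteq> colon (ideal_pow A J 2) a"
    using sharp_parameter_structure[OF assms(1) assms(2)[unfolded d] assms(4,5,8,9)] by metis
  define B where "B = colon (ideal_pow A J 2) a"
  have B: "ideal B A" "J \<subseteq> B" unfolding B_def
    using colon_ideal[OF idl_pow_ideal[OF J(1)] regular_mod_carrier[OF s(2)]] s(6) by blast+
  obtain q where q: "len A (carrier A) Q = enat q" using N.len_finite[OF s(4)] by auto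
  obtain c where c: "len A (carrier A) J = enat c" using N.len_finite[of k J] s(4) J(2) by auto
  obtain r where r: "len A B J = enat r"
    using len_mono[OF subset_refl idl_sub[OF B(1)], of J] c by (cases "len A B J") auto
  interpret sally_setup A \<mm> e P Q J B a r
    by (intro sally_setup.intro sally_setup_axioms.intro poly_cring_axioms N.noeth_local_axioms
      s(1-3) J Jm B gen s(5)[folded B_def] r)
  \<comment> \<open>The rank is \<open>r\<close> by the filtration and \<open>n\<close> by
    assumption.\<close>
  have rn: "r = n" using sally_rank_eq goto(2) by simp
  \<comment> \<open>The coefficients are read off the formula: \<open>h 0\<close> is the length
    \<open>q\<close> of \<open>A/Q\<close>, and the minus sign before \<open>q - c + n\<close> is
    the factor \<open>(-1)^1\<close> of the definition. The guard \<open>2 \<le> d\<close> matters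
    for \<open>d = 1\<close>, where the description wants zero beyond \<open>d\<close>.\<close>
  define h :: "nat \<Rightarrow> int" where "h i = (if i = 0 then int q else if i = 1 then int q - int c + int n
    else if i = 2 \<and> 2 \<le> d then int n else 0)" for i
  have quot: "quot_length A (ideal_pow A J (Suc l)) = len A (carrier A) (ideal_pow A J (Suc l))" "quot_length A J = enat c" for l
    by (rule quot_length_eq_len[OF idl_pow_ideal[OF J(1)]], rule trans[OF quot_length_eq_len[OF J(1)] c])
  have Hf: "\<exists>k. quot_length A (ideal_pow A J (l + 1)) = enat k \<and>
     int k = int q * int ((l + d) choose d) - (int q - int c + int n) * int ((l + d - 1) choose (d - 1))
      + int n * int (binom_minus2 d l)" for l
  proof -
    obtain k where k: "len A (carrier A) (ideal_pow A J (Suc l)) = enat k"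
      "int k = int q * int ((l + Suc e) choose Suc e) - (int q - int c + int r) * int ((l + e) choose e)
        + int r * int (binom_minus2 (Suc e) l)" by (rule len_J_pow[OF q c])
    have "quot_length A (ideal_pow A J (l + 1)) = enat k" using trans[OF quot(1) k(1)] by (simp only: Suc_eq_plus1)
    moreover have "int k = int q * int ((l + d) choose d) - (int q - int c + int n) * int ((l + d - 1) choose (d - 1))
      + int n * int (binom_minus2 d l)"
      using k(2) unfolding d rn by (simp only: add_Suc_right diff_Suc_1)
    ultimately show ?thesis by blast
  qed
  have hc: "hilbert_coeff A J = h"
  proof (rule hilbert_coeff_eq[OF assms(2)])
    show "h i = 0" if "d < i" for i using that d by (auto simp: h_def)
    \<comment> \<open>In dimension one the value \<open>binom_minus2 1 0 = 1\<close> departs from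
      the polynomial, so the comparison starts at 1.\<close>
    fix m :: nat assume m: "1 \<le> m"
    have "(\<Sum>i\<le>d. (-1) ^ i * h i * int ((m + d - i) choose (d - i))) = (\<Sum>i\<in>{..min d 2}. (-1) ^ i * h i * int ((m + d - i) choose (d - i)))"
      by (rule sum.mono_neutral_right) (auto simp: h_def)
    also have "\<dots> = int q * int ((m + d) choose d) - (int q - int c + int n) * int ((m + d - 1) choose (d - 1)) + int n * int (binom_minus2 d m)"
    proof (cases e)
      case 0
      then show ?thesis using m d by (simp add: h_def binom_minus2_def)
    next
      case (Suc e')
      then have "{..min d 2} = {0, 1, 2}" using d by auto
      then show ?thesis using Suc d by (simp add: h_def binom_minus2_def algebra_simps)
    qed
    finally show "\<exists>k. quot_length A (ideal_pow A J (m + 1)) = enat k \<and>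
      int k = (\<Sum>i\<le>d. (-1) ^ i * h i * int ((m + d - i) choose (d - i)))" using Hf[of m] by metis
  qed
  show ?thesis
  proof (intro conjI allI impI)
    fix l
    obtain k where k: "quot_length A (ideal_pow A J (l + 1)) = enat k"
     "int k = int q * int ((l + d) choose d) - (int q - int c + int n) * int ((l + d - 1) choose (d - 1))
      + int n * int (binom_minus2 d l)" using Hf by blast
    show "quot_length A (ideal_pow A J (l + 1)) \<noteq> \<infinity>" unfolding k(1) by simp
    show "int (the_enat (quot_length A (ideal_pow A J (l + 1)))) = hilbert_coeff A J 0 * int ((l + d) choose d)
              - (hilbert_coeff A J 0 - int (the_enat (quot_length A J)) + int n) * int ((l + d - 1) choose (d - 1))
              + int n * int (binom_minus2 d l)"
      unfolding k(1) quot(2) hc the_enat.simps k(2) by (simp add: h_def)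
  next
    show "hilbert_coeff A J 2 = int n" if "2 \<le> d" using that unfolding hc by (simp add: h_def)
    show "hilbert_coeff A J i = 0" if "3 \<le> i \<and> i \<le> d" for i using that unfolding hc by (simp add: h_def)
  qed
qed

end
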